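(* Let $\mathbf{C}$ be a stiff category. Then: \begin{itemize} \item $\widehat{\mathbf{C}}_{\mathrm{fin}}$ has universal finite joins of subunits; \item $\widehat{\mathbf{C}}_{\mathrm{dir}}$ has universal directed joins of subunits; \item $\widehat{\mathbf{C}}_{\mathrm{brd}}$ is locale-based. \end{itemize}
   Context: An object name also denotes its identity morphism, and coherence isomorphisms are suppressed, so $s \otimes X$ also denotes the map $S \otimes X \to X$. Let $\mathbf{C}$ be braided monoidal with tensor unit $I$. A subunit is a subobject $s \colon S \rightarrowtail I$ such that $s \otimes S \colon S \otimes S \to I \otimes S$ is an isomorphism; $\mathrm{ISub}(\mathbf{C})$ is the collection of subunits, ordered as subobjects (size issues are disregarded). $\mathbf{C}$ is stiff when for all objects $X$ and subunits $s,t$ the square with top $s \otimes T \otimes X \colon S \otimes T \otimes X \to T \otimes X$, left $S \otimes t \otimes X \colon S \otimes T \otimes X \to S \otimes X$, right $t \otimes X \colon T \otimes X \to X$ and bottom $s \otimes X \colon S \otimes X \to X$ is a pullback of monomorphisms. Then $\mathrm{ISub}(\mathbf{C})$ is a meet-semilattice with $s \wedge t = \lambda_I \circ (s \otimes t)$. A morphism $f \colon A \to X$ restricts to a subunit $s$ when it factors through $s \otimes X \colon S \otimes X \to X$. Broad presheaves: a subset $U$ of a poset is directed when for any $a,b \in U$ there is $c \in U$ with $a \le c \ge b$; finitely bounded when it has a finite set of maximal elements, in the sense that each element of $U$ lies below one of finitely many maximal elements of $U$. For $U \subseteq \mathrm{ISub}(\mathbf{C})$ and an object $X$, let $\langle U,X\rangle$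 be the presheaf $A \mapsto \{ f \colon A \to X \mid f \text{ restricts to some } s \in U\}$. $\widehat{\mathbf{C}}_{\mathrm{brd}}$ (respectively $\widehat{\mathbf{C}}_{\mathrm{fin}}$, $\widehat{\mathbf{C}}_{\mathrm{dir}}$) is the full subcategory of $[\mathbf{C}^{\mathrm{op}},\mathbf{Set}]$ of presheaves naturally isomorphic to some $\langle U,X\rangle$ with $U$ arbitrary (respectively finitely bounded, directed). For stiff $\mathbf{C}$ these are closed under Day convolution and contain its unit $\mathbf{C}(-,I)$, and so are braided monoidal. Universal joins: for a braided monoidal category $\mathbf{D}$, $U \subseteq \mathrm{ISub}(\mathbf{D})$ and an object $X$, $D(U,X)$ is the diagram of objects $S \otimes X$ for $s \in U$ and all morphisms $f \colon S \otimes X \to T \otimes X$ with $(t \otimes X) \circ f = s \otimes X$. $U$ is idempotent when $U = \{s \wedge t \mid s,t \in U\}$. $\mathbf{D}$ is locale-based when it is stiff, $\mathrm{ISub}(\mathbf{D})$ is a frame, and the canonical maps $S \otimes X \to (\bigvee U) \otimes X$ form a colimit of $D(U,X)$ for each idempotent $U \subseteq \mathrm{ISub}(\mathbf{D})$ and object $X$. $\mathbf{D}$ has universal finite joins of subunits when it has an initial object $0$ whose morphism $0 \to I$ is monic, with $X \otimes 0 \simeq 0$ for all $X$, and $\mathrm{ISub}(\mathbf{D})$ has finite joins such that for all subunits $s,t$ and objects $X$ the square of canonical inclusions $S \otimes T \otimes X \to S \otimes X \to (S \vee T) \otimes X$, $S \otimes T \otimes X \to T \otimes X \to (S \vee T)\otimes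 X$ is both a pullback and a pushout of monomorphisms. $\mathbf{D}$ has universal directed joins of subunits when it is stiff and has directed colimits of subunits (colimits of diagrams indexed by a directed poset all of whose arrows are inclusions $S_i \rightarrowtail S_j$ between subunits $s_i \colon S_i \rightarrowtail I$), each of whose induced arrows $\mathrm{colim}\, S_i \to I$ is again a subunit, and these colimits are preserved by each functor $X \otimes (-)$. *)

theory Defs
  imports "HOL-Library.FuncSet" "HOL-Algebra.Complete_Lattice"
begin

section \<open>Categories\<close>

record ('o, 'a) category =
  Obj :: "'o set"
  Arr :: "'a set"
  Dom :: "'a \<Rightarrow> 'o"
  Cod :: "'a \<Rightarrow> 'o"
  Ident :: "'o \<Rightarrow> 'a"
  Comp :: "'a \<Rightarrow> 'a \<Rightarrow> 'a"  (infixr \<open>\<cdot>\<index>\<close> 65)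

definition Hom :: "('o, 'a, 'm) category_scheme \<Rightarrow> 'o \<Rightarrow> 'o \<Rightarrow> 'a set" where
  "Hom C X Y = {f \<in> Arr C. Dom C f = X \<and> Cod C f = Y}"

text \<open>Composition is written in the usual order: \<open>g \<cdot> f\<close> is \<open>g\<close> after \<open>f\<close>.\<close>

locale category =
  fixes C :: "('o, 'a, 'm) category_scheme" (structure)
  assumes dom_obj: "f \<in> Arr C \<Longrightarrow> Dom C f \<in> Obj C"
    and cod_obj: "f \<in> Arr C \<Longrightarrow> Cod C f \<in> Obj C"
    and ident_hom: "X \<in> Obj C \<Longrightarrow> Ident C X \<in> Hom C X X"
    and comp_hom: "\<lbrakk>f \<in> Hom C X Y; g \<in> Hom C Y Z\<rbrakk> \<Longrightarrow> g \<cdot> f \<in> Hom C X Z"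
    and ident_left: "f \<in> Hom C X Y \<Longrightarrow> Ident C Y \<cdot> f = f"
    and ident_right: "f \<in> Hom C X Y \<Longrightarrow> f \<cdot> Ident C X = f"
    and comp_assoc: "\<lbrakk>f \<in> Hom C W X; g \<in> Hom C X Y; h \<in> Hom C Y Z\<rbrakk>
          \<Longrightarrow> h \<cdot> (g \<cdot> f) = (h \<cdot> g) \<cdot> f"

definition inverse_arrows :: "('o, 'a, 'm) category_scheme \<Rightarrow> 'a \<Rightarrow> 'a \<Rightarrow> bool" where
  "inverse_arrows C f g \<longleftrightarrow>
     f \<in> Arr C \<and> g \<in> Hom C (Cod C f) (Dom C f) \<and>
     g \<cdot>\<^bsub>C\<^esub> f = Ident C (Dom C f) \<and> f \<cdot>\<^bsub>C\<^esub> g = Ident C (Cod C f)"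

definition iso_arrow :: "('o, 'a, 'm) category_scheme \<Rightarrow> 'a \<Rightarrow> bool" where
  "iso_arrow C f \<longleftrightarrow> (\<exists>g. inverse_arrows C f g)"

definition inv_arrow :: "('o, 'a, 'm) category_scheme \<Rightarrow> 'a \<Rightarrow> 'a" where
  "inv_arrow C f = (THE g. inverse_arrows C f g)"

definition isomorphic :: "('o, 'a, 'm) category_scheme \<Rightarrow> 'o \<Rightarrow> 'o \<Rightarrow> bool" where
  "isomorphic C X Y \<longleftrightarrow> (\<exists>f \<in> Hom C X Y. iso_arrow C f)"

definition monic :: "('o, 'a, 'm) category_scheme \<Rightarrow> 'a \<Rightarrow> bool" where
  "monic C m \<longleftrightarrow> m \<in> Arr C \<and>
     (\<forall>f \<in> Arr C. \<forall>g \<in> Arr C. Dom C f = Dom C g \<and> Cod C f = Dom C m \<and> Cod C g = Dom C m \<and>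
        m \<cdot>\<^bsub>C\<^esub> f = m \<cdot>\<^bsub>C\<^esub> g \<longrightarrow> f = g)"

definition initial_object :: "('o, 'a, 'm) category_scheme \<Rightarrow> 'o \<Rightarrow> bool" where
  "initial_object C Z \<longleftrightarrow> Z \<in> Obj C \<and> (\<forall>X \<in> Obj C. \<exists>!f. f \<in> Hom C Z X)"

text \<open>In the next two definitions the square is
  \<open>p : P \<rightarrow> A\<close>, \<open>q : P \<rightarrow> B\<close>, \<open>f : A \<rightarrow> Z\<close>, \<open>g : B \<rightarrow> Z\<close>.\<close>

definition commuting_square ::
    "('o, 'a, 'm) category_scheme \<Rightarrow> 'a \<Rightarrow> 'a \<Rightarrow> 'a \<Rightarrow> 'a \<Rightarrow> bool" where
  "commuting_square C p q f g \<longleftrightarrow>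
     p \<in> Arr C \<and> q \<in> Arr C \<and> f \<in> Arr C \<and> g \<in> Arr C \<and>
     Dom C p = Dom C q \<and> Cod C p = Dom C f \<and> Cod C q = Dom C g \<and> Cod C f = Cod C g \<and>
     f \<cdot>\<^bsub>C\<^esub> p = g \<cdot>\<^bsub>C\<^esub> q"

definition pullback ::
    "('o, 'a, 'm) category_scheme \<Rightarrow> 'a \<Rightarrow> 'a \<Rightarrow> 'a \<Rightarrow> 'a \<Rightarrow> bool" where
  "pullback C p q f g \<longleftrightarrow> commuting_square C p q f g \<and>
     (\<forall>p' q'. commuting_square C p' q' f g \<longrightarrow>
        (\<exists>!h. h \<in> Hom C (Dom C p') (Dom C p) \<and> p \<cdot>\<^bsub>C\<^esub> h = p' \<and> q \<cdot>\<^bsub>C\<^esub> h = q'))"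

definition pushout ::
    "('o, 'a, 'm) category_scheme \<Rightarrow> 'a \<Rightarrow> 'a \<Rightarrow> 'a \<Rightarrow> 'a \<Rightarrow> bool" where
  "pushout C p q f g \<longleftrightarrow> commuting_square C p q f g \<and>
     (\<forall>f' g'. commuting_square C p q f' g' \<longrightarrow>
        (\<exists>!h. h \<in> Hom C (Cod C f) (Cod C f') \<and> h \<cdot>\<^bsub>C\<^esub> f = f' \<and> h \<cdot>\<^bsub>C\<^esub> g = g'))"

text \<open>A diagram is given by objects \<open>d j\<close> for \<open>j \<in> J\<close> and a set \<open>E\<close> of triples
  \<open>(i, f, j)\<close>, each standing for an arrow \<open>f : d i \<rightarrow> d j\<close> of the diagram.\<close>

definition cocone :: "('o, 'a, 'm) category_scheme \<Rightarrow> 'j set \<Rightarrow> ('j \<Rightarrow> 'o) \<Rightarrow>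
    ('j \<times> 'a \<times> 'j) set \<Rightarrow> 'o \<Rightarrow> ('j \<Rightarrow> 'a) \<Rightarrow> bool" where
  "cocone C J d E L c \<longleftrightarrow> L \<in> Obj C \<and> (\<forall>j \<in> J. c j \<in> Hom C (d j) L) \<and>
     (\<forall>(i, f, j) \<in> E. c j \<cdot>\<^bsub>C\<^esub> f = c i)"

definition colimit :: "('o, 'a, 'm) category_scheme \<Rightarrow> 'j set \<Rightarrow> ('j \<Rightarrow> 'o) \<Rightarrow>
    ('j \<times> 'a \<times> 'j) set \<Rightarrow> 'o \<Rightarrow> ('j \<Rightarrow> 'a) \<Rightarrow> bool" where
  "colimit C J d E L c \<longleftrightarrow> cocone C J d E L c \<and>
     (\<forall>M c'. cocone C J d E M c' \<longrightarrow>
        (\<exists>!u. u \<in> Hom C L M \<and> (\<forall>j \<in> J. u \<cdot>\<^bsub>C\<^esub> c j = c' j)))"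


section \<open>Braided monoidal categories\<close>

text \<open>\<open>\<odot>\<close> is the tensor product of objects, \<open>\<otimes>\<close> that of arrows.\<close>

record ('o, 'a) bmcategory = "('o, 'a) category" +
  Unit :: 'o
  TensorO :: "'o \<Rightarrow> 'o \<Rightarrow> 'o"  (infixr \<open>\<odot>\<index>\<close> 70)
  TensorA :: "'a \<Rightarrow> 'a \<Rightarrow> 'a"  (infixr \<open>\<otimes>\<index>\<close> 70)
  Assoc :: "'o \<Rightarrow> 'o \<Rightarrow> 'o \<Rightarrow> 'a"
  LUnit :: "'o \<Rightarrow> 'a"
  RUnit :: "'o \<Rightarrow> 'a"
  Braid :: "'o \<Rightarrow> 'o \<Rightarrow> 'a"

locale braided_monoidal_category = category C
  for C :: "('o, 'a, 'm) bmcategory_scheme" (structure) +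
  assumes unit_obj: "Unit C \<in> Obj C"
    and tensor_obj: "\<lbrakk>X \<in> Obj C; Y \<in> Obj C\<rbrakk> \<Longrightarrow> X \<odot> Y \<in> Obj C"
    and tensor_hom: "\<lbrakk>f \<in> Hom C X Y; g \<in> Hom C X' Y'\<rbrakk> \<Longrightarrow> f \<otimes> g \<in> Hom C (X \<odot> X') (Y \<odot> Y')"
    and tensor_ident: "\<lbrakk>X \<in> Obj C; Y \<in> Obj C\<rbrakk> \<Longrightarrow> Ident C X \<otimes> Ident C Y = Ident C (X \<odot> Y)"
    and interchange:
      "\<lbrakk>f \<in> Hom C X Y; g \<in> Hom C Y Z; f' \<in> Hom C X' Y'; g' \<in> Hom C Y' Z'\<rbrakk>
         \<Longrightarrow> (g \<cdot> f) \<otimes> (g' \<cdot> f') = (g \<otimes> g') \<cdot> (f \<otimes> f')"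
    and assoc_hom: "\<lbrakk>X \<in> Obj C; Y \<in> Obj C; Z \<in> Obj C\<rbrakk>
          \<Longrightarrow> Assoc C X Y Z \<in> Hom C ((X \<odot> Y) \<odot> Z) (X \<odot> (Y \<odot> Z))"
    and assoc_iso: "\<lbrakk>X \<in> Obj C; Y \<in> Obj C; Z \<in> Obj C\<rbrakk> \<Longrightarrow> iso_arrow C (Assoc C X Y Z)"
    and assoc_natural: "\<lbrakk>f \<in> Hom C X X'; g \<in> Hom C Y Y'; h \<in> Hom C Z Z'\<rbrakk>
          \<Longrightarrow> Assoc C X' Y' Z' \<cdot> ((f \<otimes> g) \<otimes> h) = (f \<otimes> (g \<otimes> h)) \<cdot> Assoc C X Y Z"
    and lunit_hom: "X \<in> Obj C \<Longrightarrow> LUnit C X \<in> Hom C (Unit C \<odot> X) X"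
    and lunit_iso: "X \<in> Obj C \<Longrightarrow> iso_arrow C (LUnit C X)"
    and lunit_natural: "f \<in> Hom C X Y \<Longrightarrow> LUnit C Y \<cdot> (Ident C (Unit C) \<otimes> f) = f \<cdot> LUnit C X"
    and runit_hom: "X \<in> Obj C \<Longrightarrow> RUnit C X \<in> Hom C (X \<odot> Unit C) X"
    and runit_iso: "X \<in> Obj C \<Longrightarrow> iso_arrow C (RUnit C X)"
    and runit_natural: "f \<in> Hom C X Y \<Longrightarrow> RUnit C Y \<cdot> (f \<otimes> Ident C (Unit C)) = f \<cdot> RUnit C X"
    and triangle: "\<lbrakk>X \<in> Obj C; Y \<in> Obj C\<rbrakk>
          \<Longrightarrow> (Ident C X \<otimes> LUnit C Y) \<cdot> Assoc C X (Unit C) Y = RUnit C X \<otimes> Ident C Y"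
    and pentagon: "\<lbrakk>W \<in> Obj C; X \<in> Obj C; Y \<in> Obj C; Z \<in> Obj C\<rbrakk>
          \<Longrightarrow> (Ident C W \<otimes> Assoc C X Y Z) \<cdot> Assoc C W (X \<odot> Y) Z \<cdot> (Assoc C W X Y \<otimes> Ident C Z)
            = Assoc C W X (Y \<odot> Z) \<cdot> Assoc C (W \<odot> X) Y Z"
    and braid_hom: "\<lbrakk>X \<in> Obj C; Y \<in> Obj C\<rbrakk> \<Longrightarrow> Braid C X Y \<in> Hom C (X \<odot> Y) (Y \<odot> X)"
    and braid_iso: "\<lbrakk>X \<in> Obj C; Y \<in> Obj C\<rbrakk> \<Longrightarrow> iso_arrow C (Braid C X Y)"
    and braid_natural: "\<lbrakk>f \<in> Hom C X X'; g \<in> Hom C Y Y'\<rbrakk>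
          \<Longrightarrow> Braid C X' Y' \<cdot> (f \<otimes> g) = (g \<otimes> f) \<cdot> Braid C X Y"
    and hexagon1: "\<lbrakk>X \<in> Obj C; Y \<in> Obj C; Z \<in> Obj C\<rbrakk>
          \<Longrightarrow> Assoc C Y Z X \<cdot> Braid C X (Y \<odot> Z) \<cdot> Assoc C X Y Z
            = (Ident C Y \<otimes> Braid C X Z) \<cdot> Assoc C Y X Z \<cdot> (Braid C X Y \<otimes> Ident C Z)"
    and hexagon2: "\<lbrakk>X \<in> Obj C; Y \<in> Obj C; Z \<in> Obj C\<rbrakk>
          \<Longrightarrow> inv_arrow C (Assoc C Z X Y) \<cdot> Braid C (X \<odot> Y) Z \<cdot> inv_arrow C (Assoc C X Y Z)
            = (Braid C X Z \<otimes> Ident C Y) \<cdot> inv_arrow C (Assoc C X Z Y)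
                \<cdot> (Ident C X \<otimes> Braid C Y Z)"


section \<open>Subunits\<close>

text \<open>For \<open>s : S \<rightarrow> I\<close>, \<open>act C s X\<close> is the map \<open>s \<otimes> X : S \<odot> X \<rightarrow> X\<close> with its suppressed
  left unitor made explicit.\<close>

definition act :: "('o, 'a) bmcategory \<Rightarrow> 'a \<Rightarrow> 'o \<Rightarrow> 'a" where
  "act C s X = LUnit C X \<cdot>\<^bsub>C\<^esub> (s \<otimes>\<^bsub>C\<^esub> Ident C X)"

definition subunit_arrow :: "('o, 'a) bmcategory \<Rightarrow> 'a \<Rightarrow> bool" where
  "subunit_arrow C s \<longleftrightarrow> monic C s \<and> Cod C s = Unit C \<and>
     iso_arrow C (s \<otimes>\<^bsub>C\<^esub> Ident C (Dom C s))"

definition factors_through :: "('o, 'a, 'm) category_scheme \<Rightarrow> 'a \<Rightarrow> 'a \<Rightarrow> bool" where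
  "factors_through C f m \<longleftrightarrow> (\<exists>h \<in> Hom C (Dom C f) (Dom C m). m \<cdot>\<^bsub>C\<^esub> h = f)"

text \<open>A subobject is the equivalence class of a monomorphism under mutual factorisation.\<close>

definition subobject :: "('o, 'a, 'm) category_scheme \<Rightarrow> 'a \<Rightarrow> 'a set" where
  "subobject C s = {t. monic C t \<and> Cod C t = Cod C s \<and>
     factors_through C s t \<and> factors_through C t s}"

definition rep :: "'a set \<Rightarrow> 'a" where
  "rep s = (SOME m. m \<in> s)"

definition ISub :: "('o, 'a) bmcategory \<Rightarrow> 'a set gorder" where
  "ISub C = \<lparr>carrier = {subobject C s | s. subunit_arrow C s},
             eq = (=),
             le = (\<lambda>s t. factors_through C (rep s) (rep t))\<rparr>"

definition sub_meet :: "('o, 'a) bmcategory \<Rightarrow> 'a set \<Rightarrow> 'a set \<Rightarrow> 'a set" where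
  "sub_meet C s t = subobject C (LUnit C (Unit C) \<cdot>\<^bsub>C\<^esub> (rep s \<otimes>\<^bsub>C\<^esub> rep t))"

definition sub_obj :: "('o, 'a) bmcategory \<Rightarrow> 'a set \<Rightarrow> 'o" where
  "sub_obj C s = Dom C (rep s)"

definition inclusion :: "('o, 'a) bmcategory \<Rightarrow> 'a set \<Rightarrow> 'a set \<Rightarrow> 'a" where
  "inclusion C s t = (THE h. h \<in> Hom C (sub_obj C s) (sub_obj C t) \<and> rep t \<cdot>\<^bsub>C\<^esub> h = rep s)"

definition restricts_to :: "('o, 'a) bmcategory \<Rightarrow> 'a \<Rightarrow> 'a set \<Rightarrow> bool" where
  "restricts_to C f s \<longleftrightarrow> factors_through C f (act C (rep s) (Cod C f))"

definition stiff :: "('o, 'a) bmcategory \<Rightarrow> bool" where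
  "stiff C \<longleftrightarrow> braided_monoidal_category C \<and>
     (\<forall>X \<in> Obj C. \<forall>s t. subunit_arrow C s \<and> subunit_arrow C t \<longrightarrow>
        (let top = act C s (Dom C t \<odot>\<^bsub>C\<^esub> X);
             left = Ident C (Dom C s) \<otimes>\<^bsub>C\<^esub> act C t X;
             right = act C t X;
             bottom = act C s X
         in monic C top \<and> monic C left \<and> monic C right \<and> monic C bottom \<and>
            pullback C top left right bottom))"


section \<open>Presheaves\<close>

text \<open>Presheaves on \<open>C\<close> with values in sets of elements of \<open>'v\<close>. Maps are required to be
  undefined outside their domains, so that functors and natural transformations that agree
  are equal.\<close>

record ('o, 'a, 'v) presheaf =
  at :: "'o \<Rightarrow> 'v set"
  along :: "'a \<Rightarrow> 'v \<Rightarrow> 'v"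

definition presheaf :: "('o, 'a, 'm) category_scheme \<Rightarrow> ('o, 'a, 'v) presheaf \<Rightarrow> bool" where
  "presheaf C F \<longleftrightarrow>
     (\<forall>A. A \<notin> Obj C \<longrightarrow> at F A = {}) \<and>
     (\<forall>f. f \<notin> Arr C \<longrightarrow> along F f = (\<lambda>x. undefined)) \<and>
     (\<forall>f \<in> Arr C. along F f \<in> at F (Cod C f) \<rightarrow>\<^sub>E at F (Dom C f)) \<and>
     (\<forall>A \<in> Obj C. \<forall>x \<in> at F A. along F (Ident C A) x = x) \<and>
     (\<forall>f \<in> Arr C. \<forall>g \<in> Arr C. Cod C f = Dom C g \<longrightarrow>
        (\<forall>x \<in> at F (Cod C g). along F (g \<cdot>\<^bsub>C\<^esub> f) x = along F f (along F g x)))"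

record ('o, 'a, 'v) nat_trans =
  source :: "('o, 'a, 'v) presheaf"
  target :: "('o, 'a, 'v) presheaf"
  component :: "'o \<Rightarrow> 'v \<Rightarrow> 'v"

definition nat_trans :: "('o, 'a, 'm) category_scheme \<Rightarrow> ('o, 'a, 'v) nat_trans \<Rightarrow> bool" where
  "nat_trans C \<alpha> \<longleftrightarrow> presheaf C (source \<alpha>) \<and> presheaf C (target \<alpha>) \<and>
     (\<forall>A. component \<alpha> A \<in> at (source \<alpha>) A \<rightarrow>\<^sub>E at (target \<alpha>) A) \<and>
     (\<forall>f \<in> Arr C. \<forall>x \<in> at (source \<alpha>) (Cod C f).
        component \<alpha> (Dom C f) (along (source \<alpha>) f x)
          = along (target \<alpha>) f (component \<alpha> (Cod C f) x))"

definition nat_ident :: "('o, 'a, 'v) presheaf \<Rightarrow> ('o, 'a, 'v) nat_trans" where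
  "nat_ident F = \<lparr>source = F, target = F, component = (\<lambda>A. \<lambda>x \<in> at F A. x)\<rparr>"

definition nat_comp ::
    "('o, 'a, 'v) nat_trans \<Rightarrow> ('o, 'a, 'v) nat_trans \<Rightarrow> ('o, 'a, 'v) nat_trans" where
  "nat_comp \<beta> \<alpha> = \<lparr>source = source \<alpha>, target = target \<beta>,
     component = (\<lambda>A. \<lambda>x \<in> at (source \<alpha>) A. component \<beta> A (component \<alpha> A x))\<rparr>"


section \<open>Day convolution\<close>

text \<open>The type of elements of presheaf values. It contains the arrows of \<open>C\<close>, hence all values of
  representable presheaves and of their subpresheaves, and it is closed under the formation of the
  tuples out of which coends are built. The following copy of Set thus contains, up to bijection,
  all sets of cardinality at most that of \<open>('o, 'a) elt\<close>.\<close>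

datatype ('o, 'a) elt =
    Arrow 'a
  | Tuple 'o 'o 'a "('o, 'a) elt" "('o, 'a) elt"

type_synonym ('o, 'a) psh = "('o, 'a, ('o, 'a) elt) presheaf"
type_synonym ('o, 'a) psh_map = "('o, 'a, ('o, 'a) elt) nat_trans"

definition yoneda :: "('o, 'a) bmcategory \<Rightarrow> 'o \<Rightarrow> ('o, 'a) psh" where
  "yoneda C X =
     \<lparr>at = (\<lambda>A. Arrow ` Hom C A X),
      along = (\<lambda>g. if g \<in> Arr C
         then \<lambda>x \<in> Arrow ` Hom C (Cod C g) X. case x of Arrow f \<Rightarrow> Arrow (f \<cdot>\<^bsub>C\<^esub> g)
         else (\<lambda>x. undefined))\<rparr>"

text \<open>Day convolution is the coend \<open>(F \<otimes> G)(A) = \<integral>\<^sup>B\<^sup>,\<^sup>D C(A, B \<odot> D) \<times> F(B) \<times> G(D)\<close>,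
  that is, the set of tuples \<open>(B, D, h, x, y)\<close> modulo the equivalence relation generated by
  \<open>day_step\<close>. An equivalence class is represented by a chosen element, as the class itself
  would not be of type \<open>elt\<close>.\<close>

definition day_tuples ::
    "('o, 'a) bmcategory \<Rightarrow> ('o, 'a) psh \<Rightarrow> ('o, 'a) psh \<Rightarrow> 'o \<Rightarrow> ('o, 'a) elt set" where
  "day_tuples C F G A = {Tuple B D h x y | B D h x y.
     B \<in> Obj C \<and> D \<in> Obj C \<and> h \<in> Hom C A (B \<odot>\<^bsub>C\<^esub> D) \<and> x \<in> at F B \<and> y \<in> at G D}"

inductive day_step ::
    "('o, 'a) bmcategory \<Rightarrow> ('o, 'a) psh \<Rightarrow> ('o, 'a) psh \<Rightarrow> 'o \<Rightarrow>
     ('o, 'a) elt \<Rightarrow> ('o, 'a) elt \<Rightarrow> bool"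
  for C F G A where
  "\<lbrakk>b \<in> Hom C B B'; d \<in> Hom C D D'; h \<in> Hom C A (B \<odot>\<^bsub>C\<^esub> D); x \<in> at F B'; y \<in> at G D'\<rbrakk>
     \<Longrightarrow> day_step C F G A
           (Tuple B D h (along F b x) (along G d y))
           (Tuple B' D' ((b \<otimes>\<^bsub>C\<^esub> d) \<cdot>\<^bsub>C\<^esub> h) x y)"

definition day_class ::
    "('o, 'a) bmcategory \<Rightarrow> ('o, 'a) psh \<Rightarrow> ('o, 'a) psh \<Rightarrow> 'o \<Rightarrow>
     ('o, 'a) elt \<Rightarrow> ('o, 'a) elt" where
  "day_class C F G A t = (SOME t'. equivclp (day_step C F G A) t t')"

definition day :: "('o, 'a) bmcategory \<Rightarrow> ('o, 'a) psh \<Rightarrow> ('o, 'a) psh \<Rightarrow> ('o, 'a) psh" where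
  "day C F G =
     \<lparr>at = (\<lambda>A. day_class C F G A ` day_tuples C F G A),
      along = (\<lambda>g. if g \<in> Arr C
         then \<lambda>t \<in> day_class C F G (Cod C g) ` day_tuples C F G (Cod C g).
           case t of Tuple B D h x y \<Rightarrow> day_class C F G (Dom C g) (Tuple B D (h \<cdot>\<^bsub>C\<^esub> g) x y)
         else (\<lambda>t. undefined))\<rparr>"

definition day_map ::
    "('o, 'a) bmcategory \<Rightarrow> ('o, 'a) psh_map \<Rightarrow> ('o, 'a) psh_map \<Rightarrow> ('o, 'a) psh_map" where
  "day_map C \<alpha> \<beta> =
     \<lparr>source = day C (source \<alpha>) (source \<beta>),
      target = day C (target \<alpha>) (target \<beta>),
      component = (\<lambda>A. \<lambda>t \<in> at (day C (source \<alpha>) (source \<beta>)) A.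
        case t of Tuple B D h x y \<Rightarrow>
          day_class C (target \<alpha>) (target \<beta>) A
            (Tuple B D h (component \<alpha> B x) (component \<beta> D y)))\<rparr>"

text \<open>The associator sends \<open>[B, D, h, [B1, B2, k, x, y], z]\<close> to
  \<open>[B1, B2 \<odot> D, a \<cdot> (k \<otimes> D) \<cdot> h, x, [B2, D, id, y, z]]\<close>.\<close>

definition day_assoc ::
    "('o, 'a) bmcategory \<Rightarrow> ('o, 'a) psh \<Rightarrow> ('o, 'a) psh \<Rightarrow> ('o, 'a) psh \<Rightarrow> ('o, 'a) psh_map" where
  "day_assoc C F G H =
     \<lparr>source = day C (day C F G) H,
      target = day C F (day C G H),
      component = (\<lambda>A. \<lambda>t \<in> at (day C (day C F G) H) A.
        case t of Tuple B D h (Tuple B1 B2 k x y) z \<Rightarrow>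
          day_class C F (day C G H) A
            (Tuple B1 (B2 \<odot>\<^bsub>C\<^esub> D)
               (Assoc C B1 B2 D \<cdot>\<^bsub>C\<^esub> (k \<otimes>\<^bsub>C\<^esub> Ident C D) \<cdot>\<^bsub>C\<^esub> h)
               x
               (day_class C G H (B2 \<odot>\<^bsub>C\<^esub> D) (Tuple B2 D (Ident C (B2 \<odot>\<^bsub>C\<^esub> D)) y z))))\<rparr>"

definition day_lunit :: "('o, 'a) bmcategory \<Rightarrow> ('o, 'a) psh \<Rightarrow> ('o, 'a) psh_map" where
  "day_lunit C F =
     \<lparr>source = day C (yoneda C (Unit C)) F,
      target = F,
      component = (\<lambda>A. \<lambda>t \<in> at (day C (yoneda C (Unit C)) F) A.
        case t of Tuple B D h (Arrow i) x \<Rightarrow>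
          along F (LUnit C D \<cdot>\<^bsub>C\<^esub> (i \<otimes>\<^bsub>C\<^esub> Ident C D) \<cdot>\<^bsub>C\<^esub> h) x)\<rparr>"

definition day_runit :: "('o, 'a) bmcategory \<Rightarrow> ('o, 'a) psh \<Rightarrow> ('o, 'a) psh_map" where
  "day_runit C F =
     \<lparr>source = day C F (yoneda C (Unit C)),
      target = F,
      component = (\<lambda>A. \<lambda>t \<in> at (day C F (yoneda C (Unit C))) A.
        case t of Tuple B D h x (Arrow i) \<Rightarrow>
          along F (RUnit C B \<cdot>\<^bsub>C\<^esub> (Ident C B \<otimes>\<^bsub>C\<^esub> i) \<cdot>\<^bsub>C\<^esub> h) x)\<rparr>"

definition day_braid ::
    "('o, 'a) bmcategory \<Rightarrow> ('o, 'a) psh \<Rightarrow> ('o, 'a) psh \<Rightarrow> ('o, 'a) psh_map" where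
  "day_braid C F G =
     \<lparr>source = day C F G,
      target = day C G F,
      component = (\<lambda>A. \<lambda>t \<in> at (day C F G) A.
        case t of Tuple B D h x y \<Rightarrow>
          day_class C G F A (Tuple D B (Braid C B D \<cdot>\<^bsub>C\<^esub> h) y x))\<rparr>"

definition Psh :: "('o, 'a) bmcategory \<Rightarrow> (('o, 'a) psh, ('o, 'a) psh_map) bmcategory" where
  "Psh C = \<lparr>Obj = {F. presheaf C F}, Arr = {\<alpha>. nat_trans C \<alpha>},
     Dom = source, Cod = target, Ident = nat_ident, Comp = nat_comp,
     Unit = yoneda C (Unit C), TensorO = day C, TensorA = day_map C,
     Assoc = day_assoc C, LUnit = day_lunit C, RUnit = day_runit C, Braid = day_braid C\<rparr>"


section \<open>Broad presheaves\<close>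

definition directed :: "('p, 'm) gorder_scheme \<Rightarrow> 'p set \<Rightarrow> bool" where
  "directed L U \<longleftrightarrow> (\<forall>a \<in> U. \<forall>b \<in> U. \<exists>c \<in> U. a \<sqsubseteq>\<^bsub>L\<^esub> c \<and> b \<sqsubseteq>\<^bsub>L\<^esub> c)"

definition maximal_elements :: "('p, 'm) gorder_scheme \<Rightarrow> 'p set \<Rightarrow> 'p set" where
  "maximal_elements L U = {m \<in> U. \<forall>u \<in> U. m \<sqsubseteq>\<^bsub>L\<^esub> u \<longrightarrow> u = m}"

definition finitely_bounded :: "('p, 'm) gorder_scheme \<Rightarrow> 'p set \<Rightarrow> bool" where
  "finitely_bounded L U \<longleftrightarrow> finite (maximal_elements L U) \<and>
     (\<forall>u \<in> U. \<exists>m \<in> maximal_elements L U. u \<sqsubseteq>\<^bsub>L\<^esub> m)"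

definition restricting ::
    "('o, 'a) bmcategory \<Rightarrow> 'a set set \<Rightarrow> 'o \<Rightarrow> 'o \<Rightarrow> ('o, 'a) elt set" where
  "restricting C U X A = Arrow ` {f \<in> Hom C A X. \<exists>s \<in> U. restricts_to C f s}"

definition broad :: "('o, 'a) bmcategory \<Rightarrow> 'a set set \<Rightarrow> 'o \<Rightarrow> ('o, 'a) psh" where
  "broad C U X =
     \<lparr>at = restricting C U X,
      along = (\<lambda>g. if g \<in> Arr C
         then \<lambda>x \<in> restricting C U X (Cod C g). case x of Arrow f \<Rightarrow> Arrow (f \<cdot>\<^bsub>C\<^esub> g)
         else (\<lambda>x. undefined))\<rparr>"

definition full_subcategory :: "('o, 'a) bmcategory \<Rightarrow> 'o set \<Rightarrow> ('o, 'a) bmcategory" where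
  "full_subcategory D Q = D\<lparr>Obj := Obj D \<inter> Q, Arr := {f \<in> Arr D. Dom D f \<in> Q \<and> Cod D f \<in> Q}\<rparr>"

definition broad_presheaves ::
    "('o, 'a) bmcategory \<Rightarrow> ('a set set \<Rightarrow> bool) \<Rightarrow> (('o, 'a) psh, ('o, 'a) psh_map) bmcategory" where
  "broad_presheaves C K = full_subcategory (Psh C)
     {F. \<exists>U X. U \<subseteq> carrier (ISub C) \<and> K U \<and> X \<in> Obj C \<and> isomorphic (Psh C) F (broad C U X)}"

definition Psh_brd :: "('o, 'a) bmcategory \<Rightarrow> (('o, 'a) psh, ('o, 'a) psh_map) bmcategory" where
  "Psh_brd C = broad_presheaves C (\<lambda>U. True)"

definition Psh_fin :: "('o, 'a) bmcategory \<Rightarrow> (('o, 'a) psh, ('o, 'a) psh_map) bmcategory" where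
  "Psh_fin C = broad_presheaves C (finitely_bounded (ISub C))"

definition Psh_dir :: "('o, 'a) bmcategory \<Rightarrow> (('o, 'a) psh, ('o, 'a) psh_map) bmcategory" where
  "Psh_dir C = broad_presheaves C (directed (ISub C))"


section \<open>Universal joins of subunits\<close>

definition frame :: "('p, 'm) gorder_scheme \<Rightarrow> bool" where
  "frame L \<longleftrightarrow> complete_lattice L \<and>
     (\<forall>x \<in> carrier L. \<forall>A. A \<subseteq> carrier L \<longrightarrow>
        x \<sqinter>\<^bsub>L\<^esub> (\<Squnion>\<^bsub>L\<^esub> A) = \<Squnion>\<^bsub>L\<^esub> ((\<lambda>a. x \<sqinter>\<^bsub>L\<^esub> a) ` A))"

definition D_obj :: "('o, 'a) bmcategory \<Rightarrow> 'o \<Rightarrow> 'a set \<Rightarrow> 'o" where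
  "D_obj D X s = sub_obj D s \<odot>\<^bsub>D\<^esub> X"

definition D_arr :: "('o, 'a) bmcategory \<Rightarrow> 'a set set \<Rightarrow> 'o \<Rightarrow> ('a set \<times> 'a \<times> 'a set) set" where
  "D_arr D U X = {(s, f, t) | s f t. s \<in> U \<and> t \<in> U \<and> f \<in> Hom D (D_obj D X s) (D_obj D X t) \<and>
     act D (rep t) X \<cdot>\<^bsub>D\<^esub> f = act D (rep s) X}"

definition idempotent_subset :: "('o, 'a) bmcategory \<Rightarrow> 'a set set \<Rightarrow> bool" where
  "idempotent_subset D U \<longleftrightarrow> U = {sub_meet D s t | s t. s \<in> U \<and> t \<in> U}"

definition locale_based :: "('o, 'a) bmcategory \<Rightarrow> bool" where
  "locale_based D \<longleftrightarrow> stiff D \<and> frame (ISub D) \<and>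
     (\<forall>U X. U \<subseteq> carrier (ISub D) \<and> idempotent_subset D U \<and> X \<in> Obj D \<longrightarrow>
        colimit D U (D_obj D X) (D_arr D U X)
          (sub_obj D (\<Squnion>\<^bsub>ISub D\<^esub> U) \<odot>\<^bsub>D\<^esub> X)
          (\<lambda>s. inclusion D s (\<Squnion>\<^bsub>ISub D\<^esub> U) \<otimes>\<^bsub>D\<^esub> Ident D X))"

definition universal_finite_joins :: "('o, 'a) bmcategory \<Rightarrow> bool" where
  "universal_finite_joins D \<longleftrightarrow> braided_monoidal_category D \<and>
     (\<exists>Z. initial_object D Z \<and> (\<forall>z \<in> Hom D Z (Unit D). monic D z) \<and>
        (\<forall>X \<in> Obj D. isomorphic D (X \<odot>\<^bsub>D\<^esub> Z) Z)) \<and>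
     upper_semilattice (ISub D) \<and> weak_partial_order_bottom (ISub D) \<and>
     (\<forall>s \<in> carrier (ISub D). \<forall>t \<in> carrier (ISub D). \<forall>X \<in> Obj D.
        (let p = Ident D (sub_obj D s) \<otimes>\<^bsub>D\<^esub> act D (rep t) X;
             q = act D (rep s) (sub_obj D t \<odot>\<^bsub>D\<^esub> X);
             f = inclusion D s (s \<squnion>\<^bsub>ISub D\<^esub> t) \<otimes>\<^bsub>D\<^esub> Ident D X;
             g = inclusion D t (s \<squnion>\<^bsub>ISub D\<^esub> t) \<otimes>\<^bsub>D\<^esub> Ident D X
         in monic D p \<and> monic D q \<and> monic D f \<and> monic D g \<and>
            pullback D p q f g \<and> pushout D p q f g))"

text \<open>A directed diagram of subunits: a directed poset \<open>P\<close> and subunits \<open>s i : S i \<rightarrow> I\<close>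
  such that for \<open>i \<le> j\<close> there is an inclusion \<open>S i \<rightarrow> S j\<close> over \<open>I\<close>. As \<open>s j\<close> is monic this
  inclusion is unique, so the inclusions automatically form a functor.\<close>

definition directed_subunits :: "('o, 'a) bmcategory \<Rightarrow> 'i gorder \<Rightarrow> ('i \<Rightarrow> 'a) \<Rightarrow> bool" where
  "directed_subunits D P s \<longleftrightarrow> partial_order P \<and> directed P (carrier P) \<and>
     (\<forall>i \<in> carrier P. subunit_arrow D (s i)) \<and>
     (\<forall>i \<in> carrier P. \<forall>j \<in> carrier P. i \<sqsubseteq>\<^bsub>P\<^esub> j \<longrightarrow> factors_through D (s i) (s j))"

definition inclusions ::
    "('o, 'a) bmcategory \<Rightarrow> 'i gorder \<Rightarrow> ('i \<Rightarrow> 'a) \<Rightarrow> ('i \<times> 'a \<times> 'i) set" where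
  "inclusions D P s = {(i, f, j) | i f j. i \<in> carrier P \<and> j \<in> carrier P \<and> i \<sqsubseteq>\<^bsub>P\<^esub> j \<and>
     f \<in> Hom D (Dom D (s i)) (Dom D (s j)) \<and> s j \<cdot>\<^bsub>D\<^esub> f = s i}"

text \<open>HOL cannot quantify over the type of indices inside a formula; it is therefore a parameter,
  to be kept as a type variable where the property is claimed for index posets of any size.\<close>

definition universal_directed_joins :: "'i itself \<Rightarrow> ('o, 'a) bmcategory \<Rightarrow> bool" where
  "universal_directed_joins I D \<longleftrightarrow> stiff D \<and>
     (\<forall>(P :: 'i gorder) s. directed_subunits D P s \<longrightarrow>
        (\<exists>L c. colimit D (carrier P) (\<lambda>i. Dom D (s i)) (inclusions D P s) L c) \<and>
        (\<forall>L c. colimit D (carrier P) (\<lambda>i. Dom D (s i)) (inclusions D P s) L c \<longrightarrow>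
           (\<forall>u \<in> Hom D L (Unit D). (\<forall>i \<in> carrier P. u \<cdot>\<^bsub>D\<^esub> c i = s i) \<longrightarrow> subunit_arrow D u) \<and>
           (\<forall>X \<in> Obj D.
              colimit D (carrier P) (\<lambda>i. X \<odot>\<^bsub>D\<^esub> Dom D (s i))
                {(i, Ident D X \<otimes>\<^bsub>D\<^esub> f, j) | i f j. (i, f, j) \<in> inclusions D P s}
                (X \<odot>\<^bsub>D\<^esub> L) (\<lambda>i. Ident D X \<otimes>\<^bsub>D\<^esub> c i))))"

end

theory Submission
  imports Defs
begin

text \<open>
  The idea is that everything happens inside representables, where it is a matter of which arrows
  restrict to which subunits.

  The first step is that presheaves with Day convolution form a braided monoidal category. Write
  \<open>gen x y\<close> for the class of \<open>(B, D, id, x, y)\<close>. Every element of \<open>F \<otimes> G\<close> is the restriction of some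
  \<open>gen x y\<close> along an arrow, so a natural transformation out of a tensor product is known from its values
  on these generators. All structure maps send generators to restrictions of generators along
  the corresponding structure map of \<open>C\<close>, and so each coherence law reduces to the same law in \<open>C\<close>
  (\<open>Psh_braided\<close>).

  The second step describes tensor products of broad presheaves. A presheaf isomorphic to \<open>\<langle>U, X\<rangle>\<close> is one with a natural
  bijection from its elements to the arrows into \<open>X\<close> that restrict to a member of \<open>U\<close> (\<open>embeds\<close>). The
  map \<open>\<langle>U, X\<rangle> \<otimes> \<langle>V, Y\<rangle> \<rightarrow> C(-, X \<odot> Y)\<close> sending \<open>gen x y\<close> to \<open>x \<otimes> y\<close> is injective, with the arrows that
  restrict to some \<open>u \<and> v\<close> as its image (\<open>day_embeds\<close>). This is where stiffness of \<open>C\<close> enters: it makes the actions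
  \<open>S \<odot> X \<rightarrow> X\<close> monic, and makes restriction to both \<open>s\<close> and \<open>t\<close> the same as restriction to
  \<open>s \<and> t\<close>. Closure of each category of broad presheaves under the tensor product follows, because
  finitely bounded sets and directed sets are both closed under pairwise meets.

  The third step determines the subunits of such a category. A subunit \<open>R \<rightarrow> C(-, I)\<close> is generated by
  subunits of \<open>C\<close> (\<open>subunit_generators\<close>), and therefore amounts to a down-closed set of subunits of \<open>C\<close>,
  ordered by inclusion (\<open>factors_subs\<close>, \<open>subunit_exists\<close>). Its action on \<open>F\<close> is injective, and its
  image consists of the elements of \<open>F\<close> that restrict to a member of that set (\<open>act_Cb_inj\<close>, \<open>img_iff\<close>).

  Now all claims concern subpresheaves of a fixed presheaf \<open>X\<close>. Tensoring \<open>X\<close> with subunits turns meets into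
  intersections, which gives stiffness, and joins into unions. A union of subpresheaves is
  a colimit as soon as the diagram contains enough inclusions to identify the common elements of any two
  of them: for two sets the intersection, for a directed diagram an upper bound, and for an idempotent set the meets,
  which lie in it. The joins stay in the category because finite unions of finitely bounded sets are
  finitely bounded, and directed unions of directed sets are directed.
\<close>

section \<open>Isomorphisms and monomorphisms\<close>

lemma Hom_iff: "f \<in> Hom C X Y \<longleftrightarrow> f \<in> Arr C \<and> Dom C f = X \<and> Cod C f = Y"
  by (simp add: Hom_def)

context category
begin

declare dom_obj [simp] cod_obj [simp]

lemma ident_arr [simp]:
  assumes "X \<in> Obj C"
  shows "Ident C X \<in> Arr C" "Dom C (Ident C X) = X" "Cod C (Ident C X) = X"
  using ident_hom[OF assms] by (auto simp: Hom_iff)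

lemma comp_arr [simp]:
  assumes "f \<in> Arr C" "g \<in> Arr C" "Dom C g = Cod C f"
  shows "g \<cdot> f \<in> Arr C" "Dom C (g \<cdot> f) = Dom C f" "Cod C (g \<cdot> f) = Cod C g"
  using comp_hom[of f "Dom C f" "Cod C f" g "Cod C g"] assms by (auto simp: Hom_iff)

lemma assoc_simp [simp]:
  "\<lbrakk>f \<in> Arr C; g \<in> Arr C; h \<in> Arr C; Dom C g = Cod C f; Dom C h = Cod C g\<rbrakk>
    \<Longrightarrow> (h \<cdot> g) \<cdot> f = h \<cdot> g \<cdot> f"
  using comp_assoc[of f "Dom C f" "Cod C f" g "Cod C g" h "Cod C h"] by (auto simp: Hom_iff)

lemma ident_left_simp [simp]: "\<lbrakk>f \<in> Arr C; Cod C f = Y\<rbrakk> \<Longrightarrow> Ident C Y \<cdot> f = f"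
  using ident_left[of f "Dom C f" "Cod C f"] by (auto simp: Hom_iff)

lemma ident_right_simp [simp]: "\<lbrakk>f \<in> Arr C; Dom C f = X\<rbrakk> \<Longrightarrow> f \<cdot> Ident C X = f"
  using ident_right[of f "Dom C f" "Cod C f"] by (auto simp: Hom_iff)

lemma monicD:
  assumes "monic C m" "m \<cdot> f = m \<cdot> g" "f \<in> Arr C" "g \<in> Arr C"
    "Dom C f = Dom C g" "Cod C f = Dom C m" "Cod C g = Dom C m"
  shows "f = g"
  using assms unfolding monic_def by blast

lemma monicI:
  assumes "m \<in> Arr C"
    and "\<And>f g. \<lbrakk>f \<in> Arr C; g \<in> Arr C; Dom C f = Dom C g; Cod C f = Dom C m; Cod C g = Dom C m;
      m \<cdot> f = m \<cdot> g\<rbrakk> \<Longrightarrow> f = g"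
  shows "monic C m"
  using assms unfolding monic_def by blast

lemma monic_arr: "monic C m \<Longrightarrow> m \<in> Arr C"
  by (simp add: monic_def)

lemma monic_comp:
  assumes "monic C m" "monic C n" "Dom C m = Cod C n"
  shows "monic C (m \<cdot> n)"
proof (rule monicI)
  note [simp] = monic_arr[OF assms(1)] monic_arr[OF assms(2)]
  show "m \<cdot> n \<in> Arr C" using assms by simp
  fix f g assume "f \<in> Arr C" "g \<in> Arr C" "Dom C f = Dom C g" "Cod C f = Dom C (m \<cdot> n)"
    "Cod C g = Dom C (m \<cdot> n)" "(m \<cdot> n) \<cdot> f = (m \<cdot> n) \<cdot> g"
  with assms show "f = g"
    using monicD[OF assms(1), of "n \<cdot> f" "n \<cdot> g"] monicD[OF assms(2), of f g] by auto
qed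

lemma inverse_arrows_unique:
  assumes "inverse_arrows C f g" "inverse_arrows C f h"
  shows "g = h"
proof -
  have [simp]: "f \<in> Arr C" "g \<in> Arr C" "h \<in> Arr C" "Dom C g = Cod C f" "Dom C h = Cod C f"
      "Cod C g = Dom C f" "Cod C h = Dom C f"
    using assms by (auto simp: inverse_arrows_def Hom_iff)
  have "g = g \<cdot> (f \<cdot> h)" using assms by (simp add: inverse_arrows_def)
  also have "\<dots> = (g \<cdot> f) \<cdot> h" by simp
  also have "\<dots> = h" using assms by (simp add: inverse_arrows_def del: assoc_simp)
  finally show ?thesis .
qed

lemma inv_arrow_eqI: "inverse_arrows C f g \<Longrightarrow> inv_arrow C f = g"
  unfolding inv_arrow_def using inverse_arrows_unique by blast

lemma iso_inverse: "iso_arrow C f \<Longrightarrow> inverse_arrows C f (inv_arrow C f)"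
  using inv_arrow_eqI unfolding iso_arrow_def by metis

lemma iso_arr: "iso_arrow C f \<Longrightarrow> f \<in> Arr C"
  unfolding iso_arrow_def inverse_arrows_def by blast

lemma inv_arr [simp]:
  assumes "iso_arrow C f"
  shows "inv_arrow C f \<in> Arr C" "Dom C (inv_arrow C f) = Cod C f" "Cod C (inv_arrow C f) = Dom C f"
    "inv_arrow C f \<cdot> f = Ident C (Dom C f)" "f \<cdot> inv_arrow C f = Ident C (Cod C f)"
  using iso_inverse[OF assms] by (auto simp: inverse_arrows_def Hom_iff)

lemma inv_tail [simp]:
  assumes "iso_arrow C f" "k \<in> Arr C"
  shows "Cod C k = Dom C f \<Longrightarrow> inv_arrow C f \<cdot> f \<cdot> k = k"
    "Cod C k = Cod C f \<Longrightarrow> f \<cdot> inv_arrow C f \<cdot> k = k"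
proof -
  note [simp] = assms iso_arr[OF assms(1)]
  show "inv_arrow C f \<cdot> f \<cdot> k = k" if "Cod C k = Dom C f"
    by (subst assoc_simp[symmetric]) (simp_all add: that)
  show "f \<cdot> inv_arrow C f \<cdot> k = k" if "Cod C k = Cod C f"
    by (subst assoc_simp[symmetric]) (simp_all add: that)
qed

lemma isoI:
  assumes "f \<in> Arr C" "g \<in> Arr C" "Dom C g = Cod C f" "Cod C g = Dom C f"
    "g \<cdot> f = Ident C (Dom C f)" "f \<cdot> g = Ident C (Cod C f)"
  shows "iso_arrow C f"
  using assms unfolding iso_arrow_def inverse_arrows_def Hom_iff by auto

lemma iso_inv [simp]: "iso_arrow C f \<Longrightarrow> iso_arrow C (inv_arrow C f)"
  by (rule isoI[of _ f]) (simp_all add: iso_arr)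

lemma iso_ident [simp]: "X \<in> Obj C \<Longrightarrow> iso_arrow C (Ident C X)"
  by (rule isoI[of _ "Ident C X"]) simp_all

lemma iso_comp [simp]:
  assumes "iso_arrow C f" "iso_arrow C g" "Dom C g = Cod C f"
  shows "iso_arrow C (g \<cdot> f)"
  using assms by (intro isoI[of _ "inv_arrow C f \<cdot> inv_arrow C g"]) (simp_all add: iso_arr)

lemma iso_monic: "iso_arrow C f \<Longrightarrow> monic C f"
proof (rule monicI)
  fix g h assume "iso_arrow C f" "g \<in> Arr C" "h \<in> Arr C" "Dom C g = Dom C h"
    "Cod C g = Dom C f" "Cod C h = Dom C f" "f \<cdot> g = f \<cdot> h"
  then show "g = h" using inv_tail(1)[of f g] inv_tail(1)[of f h] by metis
qed (rule iso_arr)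

lemma iso_epi:
  assumes "iso_arrow C f" "g \<cdot> f = h \<cdot> f" "g \<in> Arr C" "h \<in> Arr C"
    "Dom C g = Cod C f" "Dom C h = Cod C f"
  shows "g = h"
proof -
  note [simp] = iso_arr[OF assms(1)]
  have "g = (g \<cdot> f) \<cdot> inv_arrow C f" using assms(1,3-6) by simp
  also have "\<dots> = (h \<cdot> f) \<cdot> inv_arrow C f" by (simp only: assms(2))
  also have "\<dots> = h" using assms(1,3-6) by simp
  finally show ?thesis .
qed

lemma iso_cancel_left:
  assumes "iso_arrow C (g \<cdot> f)" "iso_arrow C g" "f \<in> Arr C" "Dom C g = Cod C f"
  shows "iso_arrow C f"
proof -
  note [simp] = iso_arr[OF assms(2)] assms(3,4)
  have "iso_arrow C (inv_arrow C g \<cdot> (g \<cdot> f))" by (rule iso_comp) (use assms(1,2) in simp_all)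
  then show ?thesis using assms(2) by simp
qed

lemma iso_cancel_right:
  assumes "iso_arrow C (g \<cdot> f)" "iso_arrow C f" "g \<in> Arr C" "Dom C g = Cod C f"
  shows "iso_arrow C g"
proof -
  note [simp] = iso_arr[OF assms(2)] assms(3,4)
  have "iso_arrow C ((g \<cdot> f) \<cdot> inv_arrow C f)" by (rule iso_comp) (use assms(1,2) in simp_all)
  then show ?thesis using assms(2) by simp
qed

text \<open>Cancelling \<open>f\<close> in \<open>f \<cdot> g \<cdot> f = f\<close> shows that its section \<open>g\<close> is also a retraction.\<close>

lemma monic_split_iso:
  assumes "monic C f" "g \<in> Arr C" "Dom C g = Cod C f" "Cod C g = Dom C f" "f \<cdot> g = Ident C (Cod C f)"
  shows "iso_arrow C f"
proof -
  note [simp] = monic_arr[OF assms(1)] assms(2-4)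
  have "f \<cdot> g \<cdot> f = (f \<cdot> g) \<cdot> f" by simp
  also have "\<dots> = f" by (subst assms(5)) simp
  finally have *: "f \<cdot> g \<cdot> f = f" .
  have "g \<cdot> f = Ident C (Dom C f)"
    by (rule monicD[OF assms(1)]) (simp_all add: *)
  then show ?thesis by (intro isoI[of f g]) (simp_all add: assms(5))
qed

end


section \<open>Coherence in braided monoidal categories\<close>

locale braided = braided_monoidal_category C
  for C :: "('o, 'a) bmcategory" (structure)
begin

declare unit_obj [simp] tensor_obj [simp]

lemma tensor_arr [simp]:
  assumes "f \<in> Arr C" "g \<in> Arr C"
  shows "f \<otimes> g \<in> Arr C" "Dom C (f \<otimes> g) = Dom C f \<odot> Dom C g" "Cod C (f \<otimes> g) = Cod C f \<odot> Cod C g"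
  using tensor_hom[of f "Dom C f" "Cod C f" g "Dom C g" "Cod C g"] assms by (auto simp: Hom_iff)

declare tensor_ident [simp]

lemma interchange_simp:
  "\<lbrakk>f \<in> Arr C; g \<in> Arr C; f' \<in> Arr C; g' \<in> Arr C; Dom C g = Cod C f; Dom C g' = Cod C f'\<rbrakk>
    \<Longrightarrow> (g \<otimes> g') \<cdot> (f \<otimes> f') = (g \<cdot> f) \<otimes> (g' \<cdot> f')"
  using interchange[of f "Dom C f" "Cod C f" g "Cod C g" f' "Dom C f'" "Cod C f'" g' "Cod C g'"]
  by (auto simp: Hom_iff)

lemma interchange_tail:
  "\<lbrakk>f \<in> Arr C; g \<in> Arr C; f' \<in> Arr C; g' \<in> Arr C; Dom C g = Cod C f; Dom C g' = Cod C f';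
     k \<in> Arr C; Cod C k = Dom C f \<odot> Dom C f'\<rbrakk>
    \<Longrightarrow> (g \<otimes> g') \<cdot> (f \<otimes> f') \<cdot> k = ((g \<cdot> f) \<otimes> (g' \<cdot> f')) \<cdot> k"
  using assoc_simp[of k "f \<otimes> f'" "g \<otimes> g'"] by (simp add: interchange_simp)

lemmas inter = interchange_simp interchange_tail

lemma assoc_arr [simp]:
  assumes "X \<in> Obj C" "Y \<in> Obj C" "Z \<in> Obj C"
  shows "Assoc C X Y Z \<in> Arr C" "Dom C (Assoc C X Y Z) = (X \<odot> Y) \<odot> Z"
    "Cod C (Assoc C X Y Z) = X \<odot> (Y \<odot> Z)"
  using assoc_hom[OF assms] by (auto simp: Hom_iff)

lemma lunit_arr [simp]:
  assumes "X \<in> Obj C"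
  shows "LUnit C X \<in> Arr C" "Dom C (LUnit C X) = Unit C \<odot> X" "Cod C (LUnit C X) = X"
  using lunit_hom[OF assms] by (auto simp: Hom_iff)

lemma runit_arr [simp]:
  assumes "X \<in> Obj C"
  shows "RUnit C X \<in> Arr C" "Dom C (RUnit C X) = X \<odot> Unit C" "Cod C (RUnit C X) = X"
  using runit_hom[OF assms] by (auto simp: Hom_iff)

lemma braid_arr [simp]:
  assumes "X \<in> Obj C" "Y \<in> Obj C"
  shows "Braid C X Y \<in> Arr C" "Dom C (Braid C X Y) = X \<odot> Y" "Cod C (Braid C X Y) = Y \<odot> X"
  using braid_hom[OF assms] by (auto simp: Hom_iff)

declare assoc_iso [simp] lunit_iso [simp] runit_iso [simp] braid_iso [simp]

lemma assoc_nat: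
  "\<lbrakk>f \<in> Arr C; g \<in> Arr C; h \<in> Arr C; X' = Cod C f; Y' = Cod C g; Z' = Cod C h\<rbrakk> \<Longrightarrow>
    Assoc C X' Y' Z' \<cdot> ((f \<otimes> g) \<otimes> h) = (f \<otimes> (g \<otimes> h)) \<cdot> Assoc C (Dom C f) (Dom C g) (Dom C h)"
  using assoc_natural[of f "Dom C f" "Cod C f" g "Dom C g" "Cod C g" h "Dom C h" "Cod C h"]
  by (simp add: Hom_iff)

lemma lunit_nat: "\<lbrakk>f \<in> Arr C; Y = Cod C f\<rbrakk> \<Longrightarrow>
    LUnit C Y \<cdot> (Ident C (Unit C) \<otimes> f) = f \<cdot> LUnit C (Dom C f)"
  using lunit_natural[of f "Dom C f" "Cod C f"] by (simp add: Hom_iff)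

lemma runit_nat: "\<lbrakk>f \<in> Arr C; Y = Cod C f\<rbrakk> \<Longrightarrow>
    RUnit C Y \<cdot> (f \<otimes> Ident C (Unit C)) = f \<cdot> RUnit C (Dom C f)"
  using runit_natural[of f "Dom C f" "Cod C f"] by (simp add: Hom_iff)

lemma braid_nat: "\<lbrakk>f \<in> Arr C; g \<in> Arr C; X' = Cod C f; Y' = Cod C g\<rbrakk> \<Longrightarrow>
    Braid C X' Y' \<cdot> (f \<otimes> g) = (g \<otimes> f) \<cdot> Braid C (Dom C f) (Dom C g)"
  using braid_natural[of f "Dom C f" "Cod C f" g "Dom C g" "Cod C g"] by (simp add: Hom_iff)

lemma iso_tensor [simp]:
  assumes "iso_arrow C f" "iso_arrow C g"
  shows "iso_arrow C (f \<otimes> g)"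
  using assms by (intro isoI[of _ "inv_arrow C f \<otimes> inv_arrow C g"]) (simp_all add: iso_arr inter)

lemma unit_tensor_faithful:
  assumes "Ident C (Unit C) \<otimes> f = Ident C (Unit C) \<otimes> g" "f \<in> Arr C" "g \<in> Arr C"
    "Dom C f = Dom C g" "Cod C f = Cod C g"
  shows "f = g"
proof (rule iso_epi)
  show "f \<cdot> LUnit C (Dom C f) = g \<cdot> LUnit C (Dom C f)"
    using assms lunit_nat[of f "Cod C f"] lunit_nat[of g "Cod C g"] by metis
qed (use assms in auto)

lemma tensor_unit_faithful:
  assumes "f \<otimes> Ident C (Unit C) = g \<otimes> Ident C (Unit C)" "f \<in> Arr C" "g \<in> Arr C"
    "Dom C f = Dom C g" "Cod C f = Cod C g"
  shows "f = g"
proof (rule iso_epi)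
  show "f \<cdot> RUnit C (Dom C f) = g \<cdot> RUnit C (Dom C f)"
    using assms runit_nat[of f "Cod C f"] runit_nat[of g "Cod C g"] by metis
qed (use assms in auto)

text \<open>Both sides agree after tensoring with \<open>I\<close> from the left: the pentagon for \<open>I, I, X, Y\<close> and the
  triangle turn either one into \<open>\<rho>\<^sub>I \<otimes> (X \<odot> Y)\<close> up to associators. This is Kelly's argument.\<close>

lemma lunit_tensor:
  assumes [simp]: "X \<in> Obj C" "Y \<in> Obj C"
  shows "LUnit C (X \<odot> Y) \<cdot> Assoc C (Unit C) X Y = LUnit C X \<otimes> Ident C Y"
proof (rule unit_tensor_faithful)
  let ?I = "Unit C" and ?i = "Ident C (Unit C)" and ?a = "Assoc C"
  let ?e = "?a ?I (?I \<odot> X) Y \<cdot> (?a ?I ?I X \<otimes> Ident C Y)"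
  have "(?i \<otimes> (LUnit C (X \<odot> Y) \<cdot> ?a ?I X Y)) \<cdot> ?e
      = (?i \<otimes> LUnit C (X \<odot> Y)) \<cdot> (?i \<otimes> ?a ?I X Y) \<cdot> ?e"
    by (simp add: inter)
  also have "\<dots> = (?i \<otimes> LUnit C (X \<odot> Y)) \<cdot> ?a ?I ?I (X \<odot> Y) \<cdot> ?a (?I \<odot> ?I) X Y"
    by (simp add: pentagon)
  also have "\<dots> = ((?i \<otimes> LUnit C (X \<odot> Y)) \<cdot> ?a ?I ?I (X \<odot> Y)) \<cdot> ?a (?I \<odot> ?I) X Y"
    by simp
  also have "\<dots> = (RUnit C ?I \<otimes> (Ident C X \<otimes> Ident C Y)) \<cdot> ?a (?I \<odot> ?I) X Y"
    by (subst triangle) simp_all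
  also have "\<dots> = ?a ?I X Y \<cdot> ((RUnit C ?I \<otimes> Ident C X) \<otimes> Ident C Y)"
    by (subst assoc_nat) simp_all
  also have "\<dots> = ?a ?I X Y \<cdot> (((?i \<otimes> LUnit C X) \<cdot> ?a ?I ?I X) \<otimes> Ident C Y)"
    by (subst triangle) simp_all
  also have "\<dots> = (?a ?I X Y \<cdot> ((?i \<otimes> LUnit C X) \<otimes> Ident C Y)) \<cdot> (?a ?I ?I X \<otimes> Ident C Y)"
    by (simp add: inter)
  also have "\<dots> = (?i \<otimes> (LUnit C X \<otimes> Ident C Y)) \<cdot> ?e"
    by (subst assoc_nat) simp_all
  finally show "?i \<otimes> (LUnit C (X \<odot> Y) \<cdot> ?a ?I X Y) = ?i \<otimes> (LUnit C X \<otimes> Ident C Y)"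
    by (rule iso_epi[rotated]) simp_all
qed simp_all

lemma lunit_lunit:
  assumes [simp]: "X \<in> Obj C"
  shows "Ident C (Unit C) \<otimes> LUnit C X = LUnit C (Unit C \<odot> X)"
  by (rule monicD[OF iso_monic, of "LUnit C X"]) (simp_all add: lunit_nat)

text \<open>Both unitors of \<open>I\<close>, tensored with \<open>I\<close>, are \<open>LUnit C (I \<odot> I)\<close> up to the associator.\<close>

lemma lunit_eq_runit: "LUnit C (Unit C) = RUnit C (Unit C)"
proof (rule tensor_unit_faithful)
  show "LUnit C (Unit C) \<otimes> Ident C (Unit C) = RUnit C (Unit C) \<otimes> Ident C (Unit C)"
    using lunit_tensor[of "Unit C" "Unit C"] triangle[of "Unit C" "Unit C"]
    by (simp add: lunit_lunit)
qed simp_all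

text \<open>The hexagon for \<open>X, I, I\<close>, followed by the unitor of \<open>I \<odot> X\<close>, is the equation tensored with \<open>I\<close>
  after composition with the braiding, which can be cancelled.\<close>

lemma lunit_braid:
  assumes [simp]: "X \<in> Obj C"
  shows "LUnit C X \<cdot> Braid C X (Unit C) = RUnit C X"
proof (rule tensor_unit_faithful)
  let ?I = "Unit C" and ?i = "Ident C (Unit C)" and ?a = "Assoc C" and ?b = "Braid C X (Unit C)"
  have "?b \<cdot> (RUnit C X \<otimes> ?i) = ?b \<cdot> (Ident C X \<otimes> LUnit C ?I) \<cdot> ?a X ?I ?I"
    by (simp add: triangle)
  also have "\<dots> = (?b \<cdot> (Ident C X \<otimes> LUnit C ?I)) \<cdot> ?a X ?I ?I" by simp
  also have "\<dots> = (LUnit C ?I \<otimes> Ident C X) \<cdot> Braid C X (?I \<odot> ?I) \<cdot> ?a X ?I ?I"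
    by (subst braid_nat) simp_all
  also have "\<dots> = LUnit C (?I \<odot> X) \<cdot> ?a ?I ?I X \<cdot> Braid C X (?I \<odot> ?I) \<cdot> ?a X ?I ?I"
    by (simp add: lunit_tensor[symmetric])
  also have "\<dots> = (LUnit C (?I \<odot> X) \<cdot> (?i \<otimes> ?b)) \<cdot> ?a ?I X ?I \<cdot> (?b \<otimes> ?i)"
    by (simp add: hexagon1)
  also have "\<dots> = ?b \<cdot> (LUnit C (X \<odot> ?I) \<cdot> ?a ?I X ?I) \<cdot> (?b \<otimes> ?i)"
    by (subst lunit_nat) simp_all
  also have "\<dots> = ?b \<cdot> ((LUnit C X \<cdot> ?b) \<otimes> ?i)"
    by (subst lunit_tensor) (simp_all add: inter)
  finally have *: "?b \<cdot> (RUnit C X \<otimes> ?i) = ?b \<cdot> ((LUnit C X \<cdot> ?b) \<otimes> ?i)" .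
  show "(LUnit C X \<cdot> ?b) \<otimes> ?i = RUnit C X \<otimes> ?i"
    by (rule monicD[OF iso_monic, OF _ *[symmetric]]) simp_all
qed simp_all

end

section \<open>Actions of arrows into the unit\<close>

context braided
begin

lemma act_arr [simp]:
  assumes "s \<in> Arr C" "Cod C s = Unit C" "X \<in> Obj C"
  shows "act C s X \<in> Arr C" "Dom C (act C s X) = Dom C s \<odot> X" "Cod C (act C s X) = X"
  using assms by (simp_all add: act_def)

lemma lunit_tensor_eq_act:
  assumes [simp]: "i \<in> Arr C" "Cod C i = Unit C" "g \<in> Arr C" and Y: "Y = Cod C g"
  shows "LUnit C Y \<cdot> (i \<otimes> g) = g \<cdot> act C i (Dom C g)"
proof -
  have "LUnit C Y \<cdot> (i \<otimes> g)
      = LUnit C (Cod C g) \<cdot> (Ident C (Unit C) \<otimes> g) \<cdot> (i \<otimes> Ident C (Dom C g))"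
    by (simp add: inter Y)
  also have "\<dots> = (LUnit C (Cod C g) \<cdot> (Ident C (Unit C) \<otimes> g)) \<cdot> (i \<otimes> Ident C (Dom C g))" by simp
  also have "\<dots> = g \<cdot> act C i (Dom C g)"
    by (subst lunit_nat) (simp_all add: act_def)
  finally show ?thesis .
qed

lemma act_tensor_hom:
  assumes [simp]: "s \<in> Arr C" "Cod C s = Unit C" "j \<in> Arr C" "g \<in> Arr C" "Cod C j = Dom C s"
    and Y: "Y = Cod C g"
  shows "act C s Y \<cdot> (j \<otimes> g) = g \<cdot> act C (s \<cdot> j) (Dom C g)"
  using lunit_tensor_eq_act[of "s \<cdot> j" g "Cod C g"] by (simp add: act_def inter Y)

lemma act_natural:
  assumes [simp]: "s \<in> Arr C" "Cod C s = Unit C" "g \<in> Arr C"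
  shows "act C s (Cod C g) \<cdot> (Ident C (Dom C s) \<otimes> g) = g \<cdot> act C s (Dom C g)"
  by (simp add: act_tensor_hom)

lemma act_comp:
  assumes [simp]: "s \<in> Arr C" "Cod C s = Unit C" "j \<in> Arr C" "Cod C j = Dom C s" "X \<in> Obj C"
  shows "act C (s \<cdot> j) X = act C s X \<cdot> (j \<otimes> Ident C X)"
  by (simp add: act_tensor_hom)

lemma act_tensor:
  assumes [simp]: "s \<in> Arr C" "Cod C s = Unit C" "X \<in> Obj C" "Y \<in> Obj C"
  shows "act C s (X \<odot> Y) \<cdot> Assoc C (Dom C s) X Y = act C s X \<otimes> Ident C Y"
proof -
  have "act C s (X \<odot> Y) \<cdot> Assoc C (Dom C s) X Y
      = LUnit C (X \<odot> Y) \<cdot> (s \<otimes> (Ident C X \<otimes> Ident C Y)) \<cdot> Assoc C (Dom C s) X Y"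
    by (simp add: act_def)
  also have "\<dots> = LUnit C (X \<odot> Y) \<cdot> Assoc C (Unit C) X Y \<cdot> ((s \<otimes> Ident C X) \<otimes> Ident C Y)"
    by (subst assoc_nat) simp_all
  also have "\<dots> = (LUnit C (X \<odot> Y) \<cdot> Assoc C (Unit C) X Y) \<cdot> ((s \<otimes> Ident C X) \<otimes> Ident C Y)"
    by simp
  also have "\<dots> = act C s X \<otimes> Ident C Y"
    by (subst lunit_tensor) (simp_all add: inter act_def)
  finally show ?thesis .
qed

text \<open>The braiding moves \<open>t\<close> in front of \<open>X\<close>: the triangle for \<open>X, I, Y\<close> produces the right unitor of \<open>X\<close>,
  which is the left unitor after the braiding.\<close>

lemma act_swap:
  assumes [simp]: "t \<in> Arr C" "Cod C t = Unit C" "X \<in> Obj C" "Y \<in> Obj C"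
  shows "(Ident C X \<otimes> act C t Y) \<cdot> Assoc C X (Dom C t) Y
    = (act C t X \<otimes> Ident C Y) \<cdot> (Braid C X (Dom C t) \<otimes> Ident C Y)"
proof -
  let ?T = "Dom C t" and ?I = "Unit C"
  have "(Ident C X \<otimes> act C t Y) \<cdot> Assoc C X ?T Y
      = (Ident C X \<otimes> LUnit C Y) \<cdot> (Ident C X \<otimes> (t \<otimes> Ident C Y)) \<cdot> Assoc C X ?T Y"
    by (simp add: act_def inter)
  also have "\<dots> = ((Ident C X \<otimes> LUnit C Y) \<cdot> Assoc C X ?I Y) \<cdot> ((Ident C X \<otimes> t) \<otimes> Ident C Y)"
    using assoc_nat[of "Ident C X" t "Ident C Y"] by simp
  also have "\<dots> = (LUnit C X \<cdot> Braid C X ?I \<cdot> (Ident C X \<otimes> t)) \<otimes> Ident C Y"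
    by (subst triangle) (simp_all add: inter lunit_braid[symmetric])
  also have "Braid C X ?I \<cdot> (Ident C X \<otimes> t) = (t \<otimes> Ident C X) \<cdot> Braid C X ?T"
    by (subst braid_nat) simp_all
  also have "(LUnit C X \<cdot> \<dots>) \<otimes> Ident C Y
      = (act C t X \<otimes> Ident C Y) \<cdot> (Braid C X ?T \<otimes> Ident C Y)"
    by (simp add: inter act_def)
  finally show ?thesis .
qed

text \<open>Acting by \<open>s \<and> t\<close> is acting by \<open>t\<close> and then by \<open>s\<close>. So the diagonal of the square in the
  definition of stiffness is the action of the meet.\<close>

lemma act_meet:
  assumes [simp]: "s \<in> Arr C" "Cod C s = Unit C" "t \<in> Arr C" "Cod C t = Unit C" "X \<in> Obj C"
  shows "act C (LUnit C (Unit C) \<cdot> (s \<otimes> t)) X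
    = act C s X \<cdot> (Ident C (Dom C s) \<otimes> act C t X) \<cdot> Assoc C (Dom C s) (Dom C t) X"
proof -
  let ?S = "Dom C s" and ?T = "Dom C t" and ?I = "Unit C"
  have "act C (LUnit C ?I \<cdot> (s \<otimes> t)) X
      = LUnit C X \<cdot> (LUnit C ?I \<otimes> Ident C X) \<cdot> ((s \<otimes> t) \<otimes> Ident C X)"
    by (simp add: act_def inter)
  also have "\<dots> = LUnit C X \<cdot> LUnit C (?I \<odot> X) \<cdot> Assoc C ?I ?I X \<cdot> ((s \<otimes> t) \<otimes> Ident C X)"
    by (simp add: lunit_tensor[symmetric])
  also have "\<dots> = LUnit C X \<cdot> LUnit C (?I \<odot> X) \<cdot> (s \<otimes> (t \<otimes> Ident C X)) \<cdot> Assoc C ?S ?T X"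
    by (subst assoc_nat) simp_all
  also have "\<dots> = LUnit C X \<cdot> (s \<otimes> act C t X) \<cdot> Assoc C ?S ?T X"
    by (simp add: lunit_lunit[symmetric] inter act_def)
  also have "\<dots> = act C s X \<cdot> (Ident C ?S \<otimes> act C t X) \<cdot> Assoc C ?S ?T X"
    by (simp add: act_def inter)
  finally show ?thesis .
qed

lemma act_unit:
  assumes [simp]: "t \<in> Arr C" "Cod C t = Unit C"
  shows "act C t (Unit C) = t \<cdot> RUnit C (Dom C t)"
  using runit_nat[of t "Unit C"] by (simp add: act_def lunit_eq_runit)


section \<open>Subunits as a partial order\<close>

lemma subunitD:
  assumes "subunit_arrow C s"
  shows "monic C s" "s \<in> Arr C" "Cod C s = Unit C" "iso_arrow C (act C s (Dom C s))"
proof -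
  show *: "monic C s" "s \<in> Arr C" "Cod C s = Unit C"
    using assms by (simp_all add: subunit_arrow_def monic_arr)
  show "iso_arrow C (act C s (Dom C s))"
    unfolding act_def using assms * by (intro iso_comp) (simp_all add: subunit_arrow_def)
qed

lemma subunitI:
  assumes "monic C s" "Cod C s = Unit C" "iso_arrow C (act C s (Dom C s))"
  shows "subunit_arrow C s"
  unfolding subunit_arrow_def
proof (intro conjI assms(1,2))
  note [simp] = monic_arr[OF assms(1)] assms(2)
  show "iso_arrow C (s \<otimes> Ident C (Dom C s))"
    by (rule iso_cancel_left[OF assms(3)[unfolded act_def]]) simp_all
qed

lemma factors_iff:
  "factors_through C f m \<longleftrightarrow> (\<exists>h. h \<in> Arr C \<and> Dom C h = Dom C f \<and> Cod C h = Dom C m \<and> f = m \<cdot> h)"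
  unfolding factors_through_def Hom_iff Bex_def by metis

lemma factorsI:
  "\<lbrakk>f = m \<cdot> h; h \<in> Arr C; m \<in> Arr C; Cod C h = Dom C m\<rbrakk> \<Longrightarrow> factors_through C f m"
  unfolding factors_iff by auto

lemma factors_refl: "f \<in> Arr C \<Longrightarrow> factors_through C f f"
  unfolding factors_iff by (intro exI[of _ "Ident C (Dom C f)"]) simp

lemma factors_trans:
  assumes "factors_through C f g" "factors_through C g h" "h \<in> Arr C"
  shows "factors_through C f h"
proof -
  obtain a where a: "a \<in> Arr C" "Dom C a = Dom C f" "Cod C a = Dom C g" "f = g \<cdot> a"
    using assms(1) unfolding factors_iff by blast
  obtain b where b: "b \<in> Arr C" "Dom C b = Dom C g" "Cod C b = Dom C h" "g = h \<cdot> b"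
    using assms(2) unfolding factors_iff by blast
  have "(h \<cdot> b) \<cdot> a = h \<cdot> (b \<cdot> a)" using a(1-3) b(1-3) assms(3) by simp
  then have "f = h \<cdot> (b \<cdot> a)" by (simp only: a(4) b(4)[symmetric])
  then show ?thesis unfolding factors_iff
    using a(1-3) b(1-3) by (intro exI[of _ "b \<cdot> a"]) (simp only: comp_arr simp_thms)
qed

lemma mutual_factor_iso:
  assumes "monic C s" "monic C t" "s = t \<cdot> j" "t = s \<cdot> k"
    "j \<in> Arr C" "k \<in> Arr C" "Dom C j = Dom C s" "Cod C j = Dom C t" "Dom C k = Dom C t" "Cod C k = Dom C s"
  shows "iso_arrow C j"
proof (rule isoI[of j k])
  note [simp] = assms(5-10) monic_arr[OF assms(1)] monic_arr[OF assms(2)]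
  have "s \<cdot> k \<cdot> j = (s \<cdot> k) \<cdot> j" by simp
  also have "\<dots> = s \<cdot> Ident C (Dom C s)" by (simp only: assms(4)[symmetric] assms(3)[symmetric]) simp
  finally have *: "s \<cdot> k \<cdot> j = s \<cdot> Ident C (Dom C s)" .
  show "k \<cdot> j = Ident C (Dom C j)"
    by (rule monicD[OF assms(1)]) (simp_all add: *)
  have "t \<cdot> j \<cdot> k = (t \<cdot> j) \<cdot> k" by simp
  also have "\<dots> = t \<cdot> Ident C (Dom C t)" by (simp only: assms(4)[symmetric] assms(3)[symmetric]) simp
  finally have *: "t \<cdot> j \<cdot> k = t \<cdot> Ident C (Dom C t)" .
  show "j \<cdot> k = Ident C (Cod C j)"
    by (rule monicD[OF assms(2)]) (simp_all add: *)
qed (use assms(5-10) in auto)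

text \<open>Being a subunit is a property of the subobject, so that it passes to chosen representatives.\<close>

lemma subunit_iso_invariant:
  assumes "subunit_arrow C t" "monic C s" "Cod C s = Unit C" "factors_through C s t" "factors_through C t s"
  shows "subunit_arrow C s"
proof (rule subunitI[OF assms(2,3)])
  note [simp] = subunitD(2,3)[OF assms(1)] monic_arr[OF assms(2)] assms(3)
  obtain j where j: "j \<in> Arr C" "Dom C j = Dom C s" "Cod C j = Dom C t" "s = t \<cdot> j"
    using assms(4) unfolding factors_iff by blast
  obtain k where k: "k \<in> Arr C" "Dom C k = Dom C t" "Cod C k = Dom C s" "t = s \<cdot> k"
    using assms(5) unfolding factors_iff by blast
  note [simp] = j(1-3)
  have iso: "iso_arrow C j"
    by (rule mutual_factor_iso[OF assms(2) subunitD(1)[OF assms(1)] j(4) k(4)]) (use j(1-3) k(1-3) in simp_all)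
  have "iso_arrow C (act C t (Dom C t) \<cdot> (j \<otimes> j))"
    by (rule iso_comp) (use iso subunitD(4)[OF assms(1)] in simp_all)
  also have "act C t (Dom C t) \<cdot> (j \<otimes> j) = j \<cdot> act C s (Dom C s)"
    by (simp add: act_tensor_hom j(4)[symmetric])
  finally show "iso_arrow C (act C s (Dom C s))"
    by (rule iso_cancel_left) (use iso in simp_all)
qed

lemma subobject_self: "monic C s \<Longrightarrow> s \<in> subobject C s"
  by (simp add: subobject_def factors_refl monic_arr)

lemma rep_subobject:
  assumes "monic C s"
  shows "monic C (rep (subobject C s))" "Cod C (rep (subobject C s)) = Cod C s"
    "factors_through C s (rep (subobject C s))" "factors_through C (rep (subobject C s)) s"
  using someI[of "\<lambda>m. m \<in> subobject C s", OF subobject_self[OF assms]]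
  by (simp_all add: rep_def subobject_def)

lemma subobject_eqI:
  assumes "monic C s" "monic C t" "Cod C s = Cod C t" "factors_through C s t" "factors_through C t s"
  shows "subobject C s = subobject C t"
proof -
  have "x \<in> subobject C s \<longleftrightarrow> x \<in> subobject C t" for x
    unfolding subobject_def mem_Collect_eq using assms factors_trans monic_arr by metis
  then show ?thesis by blast
qed

lemma carrier_ISub: "u \<in> carrier (ISub C) \<longleftrightarrow> (\<exists>s. subunit_arrow C s \<and> u = subobject C s)"
  by (auto simp: ISub_def)

lemma subobject_in_ISub: "subunit_arrow C s \<Longrightarrow> subobject C s \<in> carrier (ISub C)"
  by (auto simp: carrier_ISub)

lemma rep_ISub:
  assumes "u \<in> carrier (ISub C)"
  shows "subunit_arrow C (rep u)" "subobject C (rep u) = u"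
proof -
  obtain s where s: "subunit_arrow C s" "u = subobject C s" using assms carrier_ISub by auto
  note r = rep_subobject[OF subunitD(1)[OF s(1)]]
  show "subunit_arrow C (rep u)"
    by (rule subunit_iso_invariant[OF s(1)]) (use r s subunitD[OF s(1)] in simp_all)
  show "subobject C (rep u) = u" unfolding s(2)
    by (rule subobject_eqI) (use r subunitD[OF s(1)] in simp_all)
qed

lemma le_ISub: "u \<sqsubseteq>\<^bsub>ISub C\<^esub> v \<longleftrightarrow> factors_through C (rep u) (rep v)"
  by (simp add: ISub_def)

lemma le_subobject:
  assumes "subunit_arrow C s" "subunit_arrow C t"
  shows "subobject C s \<sqsubseteq>\<^bsub>ISub C\<^esub> subobject C t \<longleftrightarrow> factors_through C s t"
  using rep_subobject[OF subunitD(1)[OF assms(1)]] rep_subobject[OF subunitD(1)[OF assms(2)]]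
    factors_trans subunitD(2) assms monic_arr
  unfolding le_ISub by meson

lemma ISub_antisym:
  assumes "u \<in> carrier (ISub C)" "v \<in> carrier (ISub C)" "u \<sqsubseteq>\<^bsub>ISub C\<^esub> v" "v \<sqsubseteq>\<^bsub>ISub C\<^esub> u"
  shows "u = v"
proof -
  note D = subunitD[OF rep_ISub(1)[OF assms(1)]] subunitD[OF rep_ISub(1)[OF assms(2)]]
  have "subobject C (rep u) = subobject C (rep v)"
    by (rule subobject_eqI) (use D assms(3,4) le_ISub in auto)
  then show ?thesis using rep_ISub(2) assms by simp
qed

lemma eq_ISub: "eq (ISub C) = (=)"
  by (simp add: ISub_def)

lemma ISub_partial_order: "partial_order (ISub C)"
proof
  show "(.=\<^bsub>ISub C\<^esub>) = (=)" by (simp add: ISub_def)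
  fix x assume "x \<in> carrier (ISub C)"
  then show "x \<sqsubseteq>\<^bsub>ISub C\<^esub> x" unfolding le_ISub
    using rep_ISub(1) subunitD(2) factors_refl by blast
next
  fix x y z assume "x \<sqsubseteq>\<^bsub>ISub C\<^esub> y" "y \<sqsubseteq>\<^bsub>ISub C\<^esub> z" "z \<in> carrier (ISub C)"
  then show "x \<sqsubseteq>\<^bsub>ISub C\<^esub> z" unfolding le_ISub
    using rep_ISub(1) subunitD(2) factors_trans by blast
qed (simp_all add: eq_ISub, simp_all add: ISub_antisym)

lemma ISub_refl: "u \<in> carrier (ISub C) \<Longrightarrow> u \<sqsubseteq>\<^bsub>ISub C\<^esub> u"
  unfolding le_ISub using rep_ISub(1) subunitD(2) factors_refl by blast

lemma ISub_trans:
  "\<lbrakk>u \<sqsubseteq>\<^bsub>ISub C\<^esub> v; v \<sqsubseteq>\<^bsub>ISub C\<^esub> w; w \<in> carrier (ISub C)\<rbrakk> \<Longrightarrow> u \<sqsubseteq>\<^bsub>ISub C\<^esub> w"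
  unfolding le_ISub using rep_ISub(1) subunitD(2) factors_trans by blast

lemma unit_subunit: "subunit_arrow C (Ident C (Unit C))"
  by (simp add: subunit_arrow_def iso_monic)


section \<open>Restriction\<close>

abbreviation restr :: "'a \<Rightarrow> 'a \<Rightarrow> bool" where
  "restr f s \<equiv> factors_through C f (act C s (Cod C f))"

text \<open>An arrow representing the meet of the subobjects of \<open>s\<close> and \<open>t\<close>.\<close>

abbreviation meet :: "'a \<Rightarrow> 'a \<Rightarrow> 'a" where
  "meet s t \<equiv> LUnit C (Unit C) \<cdot> (s \<otimes> t)"

lemma restrE:
  assumes "restr f s" "s \<in> Arr C" "Cod C s = Unit C" "f \<in> Arr C"
  obtains h where "h \<in> Arr C" "Dom C h = Dom C f" "Cod C h = Dom C s \<odot> Cod C f" "f = act C s (Cod C f) \<cdot> h"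
  using assms unfolding factors_iff by auto

lemma restrI:
  assumes "f = act C s X \<cdot> h" "h \<in> Arr C" "Cod C h = Dom C s \<odot> X" "s \<in> Arr C" "Cod C s = Unit C" "X \<in> Obj C"
  shows "restr f s"
  using assms unfolding factors_iff by auto

lemma restr_act:
  assumes "s \<in> Arr C" "Cod C s = Unit C" "X \<in> Obj C" shows "restr (act C s X) s"
  by (rule restrI[of _ s X "Ident C (Dom C s \<odot> X)"]) (use assms in simp_all)

lemma restr_precomp:
  assumes "restr f s" "s \<in> Arr C" "Cod C s = Unit C" "f \<in> Arr C" "k \<in> Arr C" "Cod C k = Dom C f"
  shows "restr (f \<cdot> k) s"
proof -
  obtain h where h: "h \<in> Arr C" "Dom C h = Dom C f" "Cod C h = Dom C s \<odot> Cod C f" "f = act C s (Cod C f) \<cdot> h"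
    using restrE[OF assms(1-4)] .
  have "(act C s (Cod C f) \<cdot> h) \<cdot> k = act C s (Cod C f) \<cdot> h \<cdot> k" by (simp add: assms h(1-3))
  then have "f \<cdot> k = act C s (Cod C f) \<cdot> (h \<cdot> k)" by (simp only: h(4)[symmetric])
  then show ?thesis by (rule restrI) (use assms(2-) h(1-3) in simp_all)
qed

lemma restr_postcomp:
  assumes "restr f s" "s \<in> Arr C" "Cod C s = Unit C" "f \<in> Arr C" "g \<in> Arr C" "Dom C g = Cod C f"
  shows "restr (g \<cdot> f) s"
proof -
  obtain h where h: "h \<in> Arr C" "Dom C h = Dom C f" "Cod C h = Dom C s \<odot> Cod C f" "f = act C s (Cod C f) \<cdot> h"
    using restrE[OF assms(1-4)] .
  have "g \<cdot> (act C s (Cod C f) \<cdot> h) = (act C s (Cod C g) \<cdot> (Ident C (Dom C s) \<otimes> g)) \<cdot> h"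
    by (subst act_natural) (simp_all add: assms h(1-3))
  also have "\<dots> = act C s (Cod C g) \<cdot> ((Ident C (Dom C s) \<otimes> g) \<cdot> h)"
    by (simp add: assms h(1-3))
  finally have "g \<cdot> f = act C s (Cod C g) \<cdot> ((Ident C (Dom C s) \<otimes> g) \<cdot> h)"
    by (simp only: h(4)[symmetric])
  then show ?thesis by (rule restrI) (use assms(2-) h(1-3) in simp_all)
qed

lemma restr_mono:
  assumes "restr f s" "factors_through C s t" "s \<in> Arr C" "Cod C s = Unit C" "t \<in> Arr C" "Cod C t = Unit C" "f \<in> Arr C"
  shows "restr f t"
proof -
  obtain h where h: "h \<in> Arr C" "Dom C h = Dom C f" "Cod C h = Dom C s \<odot> Cod C f" "f = act C s (Cod C f) \<cdot> h"
    using restrE[OF assms(1,3,4,7)] .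
  obtain j where j: "j \<in> Arr C" "Dom C j = Dom C s" "Cod C j = Dom C t" "s = t \<cdot> j"
    using assms(2) unfolding factors_iff by blast
  have "act C s (Cod C f) = act C t (Cod C f) \<cdot> (j \<otimes> Ident C (Cod C f))"
    unfolding j(4) by (rule act_comp) (use assms j(1-3) in auto)
  then have "act C s (Cod C f) \<cdot> h = act C t (Cod C f) \<cdot> ((j \<otimes> Ident C (Cod C f)) \<cdot> h)"
    using assms(5-7) h(1-3) j(1-3) by simp
  then have "f = act C t (Cod C f) \<cdot> ((j \<otimes> Ident C (Cod C f)) \<cdot> h)"
    by (simp only: h(4)[symmetric])
  then show ?thesis by (rule restrI) (use assms(3-) h(1-3) j(1-3) in simp_all)
qed

lemma restr_tensor_left:
  assumes "restr f s" and [simp]: "s \<in> Arr C" "Cod C s = Unit C" "f \<in> Arr C" "g \<in> Arr C"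
  shows "restr (f \<otimes> g) s"
proof -
  let ?X = "Cod C f" and ?Y = "Cod C g"
  obtain h where h: "h \<in> Arr C" "Dom C h = Dom C f" "Cod C h = Dom C s \<odot> Cod C f" "f = act C s (Cod C f) \<cdot> h"
    using restrE[OF assms(1-4)] .
  note [simp] = h(1-3)
  have "act C s (?X \<odot> ?Y) \<cdot> (Assoc C (Dom C s) ?X ?Y \<cdot> (h \<otimes> g))
      = (act C s (?X \<odot> ?Y) \<cdot> Assoc C (Dom C s) ?X ?Y) \<cdot> (h \<otimes> g)" by simp
  also have "\<dots> = (act C s ?X \<cdot> h) \<otimes> g" by (subst act_tensor) (simp_all add: inter)
  also have "\<dots> = f \<otimes> g" by (simp only: h(4)[symmetric])
  finally show ?thesis by (rule restrI[OF sym]) simp_all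
qed

lemma ident_tensor_act:
  assumes [simp]: "t \<in> Arr C" "Cod C t = Unit C" "X \<in> Obj C" "Y \<in> Obj C"
  shows "Ident C X \<otimes> act C t Y = (act C t X \<otimes> Ident C Y) \<cdot> (Braid C X (Dom C t) \<otimes> Ident C Y)
    \<cdot> inv_arrow C (Assoc C X (Dom C t) Y)"
proof -
  have "Ident C X \<otimes> act C t Y = ((Ident C X \<otimes> act C t Y) \<cdot> Assoc C X (Dom C t) Y) \<cdot> inv_arrow C (Assoc C X (Dom C t) Y)"
    by simp
  also have "\<dots> = ((act C t X \<otimes> Ident C Y) \<cdot> (Braid C X (Dom C t) \<otimes> Ident C Y))
    \<cdot> inv_arrow C (Assoc C X (Dom C t) Y)"
    by (subst act_swap) simp_all
  also have "\<dots> = (act C t X \<otimes> Ident C Y) \<cdot> (Braid C X (Dom C t) \<otimes> Ident C Y)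
    \<cdot> inv_arrow C (Assoc C X (Dom C t) Y)"
    by simp
  finally show ?thesis .
qed

lemma restr_tensor_right:
  assumes "restr g s" and [simp]: "s \<in> Arr C" "Cod C s = Unit C" "f \<in> Arr C" "g \<in> Arr C"
  shows "restr (f \<otimes> g) s"
proof -
  let ?X = "Cod C f" and ?Y = "Cod C g"
  obtain h where h: "h \<in> Arr C" "Dom C h = Dom C g" "Cod C h = Dom C s \<odot> Cod C g" "g = act C s (Cod C g) \<cdot> h"
    using restrE[OF assms(1-3,5)] .
  note [simp] = h(1-3)
  have "restr (act C s ?X \<otimes> Ident C ?Y) s"
    by (rule restr_tensor_left[OF restr_act]) simp_all
  then have "restr ((act C s ?X \<otimes> Ident C ?Y) \<cdot> ((Braid C ?X (Dom C s) \<otimes> Ident C ?Y)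
    \<cdot> inv_arrow C (Assoc C ?X (Dom C s) ?Y))) s"
    by (rule restr_precomp) simp_all
  then have "restr (Ident C ?X \<otimes> act C s ?Y) s"
    by (simp only: ident_tensor_act assms cod_obj)
  then have "restr ((Ident C ?X \<otimes> act C s ?Y) \<cdot> (f \<otimes> h)) s"
    by (rule restr_precomp) simp_all
  also have "(Ident C ?X \<otimes> act C s ?Y) \<cdot> (f \<otimes> h) = f \<otimes> (act C s ?Y \<cdot> h)"
    by (simp add: inter)
  also have "\<dots> = f \<otimes> g" by (simp only: h(4)[symmetric])
  finally show ?thesis .
qed

lemma restr_unit_iff:
  assumes [simp]: "s \<in> Arr C" "Cod C s = Unit C" "f \<in> Arr C" "Cod C f = Unit C"
  shows "restr f s \<longleftrightarrow> factors_through C f s"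
proof
  assume "restr f s"
  then obtain h where h: "h \<in> Arr C" "Dom C h = Dom C f" "Cod C h = Dom C s \<odot> Unit C" "f = act C s (Unit C) \<cdot> h"
    using restrE[OF \<open>restr f s\<close> assms(1-3)] unfolding assms(4) by blast
  note [simp] = h(1-3)
  have "f = s \<cdot> (RUnit C (Dom C s) \<cdot> h)"
    by (subst h(4)) (simp add: act_unit)
  then show "factors_through C f s" by (rule factorsI) simp_all
next
  assume "factors_through C f s"
  then obtain j where j: "j \<in> Arr C" "Dom C j = Dom C f" "Cod C j = Dom C s" "f = s \<cdot> j"
    unfolding factors_iff by blast
  note [simp] = j(1-3)
  have "f = act C s (Unit C) \<cdot> inv_arrow C (RUnit C (Dom C s)) \<cdot> j"
    by (subst j(4)) (simp add: act_unit)
  then show "restr f s" by (rule restrI) simp_all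
qed

lemma restr_unit: "f \<in> Arr C \<Longrightarrow> restr f (Ident C (Unit C))"
  by (rule restrI[of f _ "Cod C f" "inv_arrow C (LUnit C (Cod C f)) \<cdot> f"]) (simp_all add: act_def)

text \<open>Tensor the isomorphism \<open>S \<odot> S \<rightarrow> S\<close> with \<open>X\<close>. In particular all arrows into \<open>S \<odot> X\<close> restrict to \<open>s\<close>.\<close>

lemma act_absorb:
  assumes "subunit_arrow C s" and [simp]: "X \<in> Obj C"
  shows "iso_arrow C (act C s (Dom C s \<odot> X))"
proof -
  note [simp] = subunitD(2-4)[OF assms(1)]
  have "iso_arrow C (act C s (Dom C s \<odot> X) \<cdot> Assoc C (Dom C s) (Dom C s) X)"
    by (subst act_tensor) simp_all
  then show ?thesis by (rule iso_cancel_right) simp_all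
qed

lemma restr_absorb:
  assumes "subunit_arrow C s" and [simp]: "X \<in> Obj C" "f \<in> Arr C" "Cod C f = Dom C s \<odot> X"
  shows "restr f s"
  by (rule restrI[of f s "Dom C s \<odot> X" "inv_arrow C (act C s (Dom C s \<odot> X)) \<cdot> f"])
    (use act_absorb[OF assms(1,2)] subunitD(2,3)[OF assms(1)] in simp_all)

end

section \<open>Restriction in a stiff category\<close>

lemma pullback_ex:
  assumes "pullback C p q f g" "commuting_square C p' q' f g"
  shows "\<exists>h. h \<in> Hom C (Dom C p') (Dom C p) \<and> p \<cdot>\<^bsub>C\<^esub> h = p' \<and> q \<cdot>\<^bsub>C\<^esub> h = q'"
  using assms unfolding pullback_def by blast

locale stiff_category = braided C for C :: "('o, 'a) bmcategory" (structure) +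
  assumes stiff_C: "stiff C"
begin

lemma stiff_square:
  assumes "subunit_arrow C s" "subunit_arrow C t" "X \<in> Obj C"
  shows "monic C (Ident C (Dom C s) \<otimes> act C t X)" "monic C (act C s X)"
    "pullback C (act C s (Dom C t \<odot> X)) (Ident C (Dom C s) \<otimes> act C t X) (act C t X) (act C s X)"
  using stiff_C assms unfolding stiff_def Let_def by blast+

text \<open>The two factorisations of \<open>f\<close> form a cone over the pullback square of stiffness, whose diagonal is the
  action of the meet by \<open>act_meet\<close>.\<close>

lemma restr_meet:
  assumes "restr f s" "restr f t" "subunit_arrow C s" "subunit_arrow C t" and [simp]: "f \<in> Arr C"
  shows "restr f (meet s t)"
proof -
  let ?X = "Cod C f" and ?S = "Dom C s" and ?T = "Dom C t"
  note [simp] = subunitD(2,3)[OF assms(3)] subunitD(2,3)[OF assms(4)]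
  obtain h where h: "h \<in> Arr C" "Dom C h = Dom C f" "Cod C h = ?S \<odot> ?X" "f = act C s ?X \<cdot> h"
    using restrE[OF assms(1)] by auto
  obtain k where k: "k \<in> Arr C" "Dom C k = Dom C f" "Cod C k = ?T \<odot> ?X" "f = act C t ?X \<cdot> k"
    using restrE[OF assms(2)] by auto
  note [simp] = h(1-3) k(1-3)
  have "commuting_square C k h (act C t ?X) (act C s ?X)"
    unfolding commuting_square_def h(4)[symmetric] k(4)[symmetric] by simp
  then obtain u where u: "u \<in> Hom C (Dom C f) (?S \<odot> ?T \<odot> ?X)" "(Ident C ?S \<otimes> act C t ?X) \<cdot> u = h"
    using pullback_ex[OF stiff_square(3)[OF assms(3,4), of ?X], of k h] by auto
  note [simp] = u(1)[unfolded Hom_iff]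
  have "act C (meet s t) ?X \<cdot> inv_arrow C (Assoc C ?S ?T ?X) \<cdot> u
      = act C s ?X \<cdot> (Ident C ?S \<otimes> act C t ?X) \<cdot> u"
    by (simp add: act_meet)
  also have "\<dots> = f" by (simp only: u(2) h(4)[symmetric])
  finally show ?thesis by (rule restrI[OF sym]) simp_all
qed

text \<open>Up to isomorphism, \<open>t\<close> may act on either factor of a tensor product.\<close>

lemma act_swap_iso:
  assumes [simp]: "t \<in> Arr C" "Cod C t = Unit C" "X \<in> Obj C" "Y \<in> Obj C"
  obtains \<sigma> where "iso_arrow C \<sigma>" "Dom C \<sigma> = Dom C t \<odot> X \<odot> Y" "Cod C \<sigma> = X \<odot> Dom C t \<odot> Y"
    "act C t (X \<odot> Y) = (Ident C X \<otimes> act C t Y) \<cdot> \<sigma>"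
proof
  let ?a = "Assoc C X (Dom C t) Y" and ?b = "Braid C X (Dom C t)" and ?c = "Assoc C (Dom C t) X Y"
  let ?\<sigma> = "?a \<cdot> (inv_arrow C ?b \<otimes> Ident C Y) \<cdot> inv_arrow C ?c"
  show "iso_arrow C ?\<sigma>" "Dom C ?\<sigma> = Dom C t \<odot> X \<odot> Y" "Cod C ?\<sigma> = X \<odot> Dom C t \<odot> Y"
    by simp_all
  have "(Ident C X \<otimes> act C t Y) \<cdot> ?\<sigma>
      = ((Ident C X \<otimes> act C t Y) \<cdot> ?a) \<cdot> (inv_arrow C ?b \<otimes> Ident C Y) \<cdot> inv_arrow C ?c"
    by simp
  also have "\<dots> = (act C t X \<otimes> Ident C Y) \<cdot> inv_arrow C ?c"
    by (subst act_swap) (simp_all add: inter)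
  also have "\<dots> = act C t (X \<odot> Y)"
    by (simp add: act_tensor[symmetric])
  finally show "act C t (X \<odot> Y) = (Ident C X \<otimes> act C t Y) \<cdot> ?\<sigma>" ..
qed

lemma meet_eq:
  assumes [simp]: "s \<in> Arr C" "Cod C s = Unit C" "t \<in> Arr C" "Cod C t = Unit C"
  shows "meet s t = s \<cdot> (RUnit C (Dom C s) \<cdot> (Ident C (Dom C s) \<otimes> t))" "meet s t = t \<cdot> act C s (Dom C t)"
proof -
  have "meet s t = act C s (Unit C) \<cdot> (Ident C (Dom C s) \<otimes> t)"
    by (simp add: act_def inter)
  then show "meet s t = s \<cdot> (RUnit C (Dom C s) \<cdot> (Ident C (Dom C s) \<otimes> t))"
    by (simp add: act_unit)
  show "meet s t = t \<cdot> act C s (Dom C t)"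
    by (rule lunit_tensor_eq_act) simp_all
qed

lemma meet_factors:
  assumes "s \<in> Arr C" "Cod C s = Unit C" "t \<in> Arr C" "Cod C t = Unit C"
  shows "factors_through C (meet s t) s" "factors_through C (meet s t) t"
  by (rule factorsI[OF meet_eq(1)]; simp add: assms) (rule factorsI[OF meet_eq(2)]; simp add: assms)

text \<open>The meet is monic because \<open>S \<otimes> t\<close> is \<open>S \<otimes> act t I\<close> up to a unitor, and \<open>act (s \<and> t)\<close> acts on
  \<open>S \<odot> T\<close> by absorbing first \<open>t\<close> and then \<open>s\<close>.\<close>

lemma meet_subunit:
  assumes "subunit_arrow C s" "subunit_arrow C t"
  shows "subunit_arrow C (meet s t)"
proof (rule subunitI)
  let ?S = "Dom C s" and ?T = "Dom C t"
  note [simp] = subunitD(2,3)[OF assms(1)] subunitD(2,3)[OF assms(2)]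
  have m3: "monic C (Ident C ?S \<otimes> inv_arrow C (RUnit C ?T))" by (rule iso_monic) simp
  have "monic C (act C s (Unit C) \<cdot> (Ident C ?S \<otimes> act C t (Unit C)) \<cdot> (Ident C ?S \<otimes> inv_arrow C (RUnit C ?T)))"
    by (intro monic_comp m3 stiff_square(1,2)[OF assms]) simp_all
  also have "(Ident C ?S \<otimes> act C t (Unit C)) \<cdot> (Ident C ?S \<otimes> inv_arrow C (RUnit C ?T))
      = Ident C ?S \<otimes> t"
    using act_unit[of t] by (simp add: inter)
  also have "act C s (Unit C) \<cdot> (Ident C ?S \<otimes> t) = meet s t"
    by (simp add: act_def inter)
  finally show "monic C (meet s t)" .
  have iso_t: "iso_arrow C (act C t (?S \<odot> ?T))"
  proof (rule iso_cancel_left)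
    have "iso_arrow C (act C t (?T \<odot> ?S) \<cdot> (Ident C ?T \<otimes> Braid C ?S ?T))"
      by (intro iso_comp act_absorb[OF assms(2)] iso_tensor) simp_all
    also have "act C t (?T \<odot> ?S) \<cdot> (Ident C ?T \<otimes> Braid C ?S ?T) = Braid C ?S ?T \<cdot> act C t (?S \<odot> ?T)"
      using act_natural[of t "Braid C ?S ?T"] by simp
    finally show "iso_arrow C (Braid C ?S ?T \<cdot> act C t (?S \<odot> ?T))" .
  qed simp_all
  have "iso_arrow C (act C (meet s t) (?S \<odot> ?T))"
    unfolding act_meet[OF subunitD(2,3)[OF assms(1)] subunitD(2,3)[OF assms(2)], of "?S \<odot> ?T", simplified]
    by (intro iso_comp act_absorb[OF assms(1)] iso_tensor iso_t) simp_all
  then show "iso_arrow C (act C (meet s t) (Dom C (meet s t)))" by simp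
  show "Cod C (meet s t) = Unit C" by simp
qed

text \<open>Factor the arrow as an action on the left factor after an action on the right one. Either is an
  action on a tensor product up to isomorphism.\<close>

lemma act_tensor_act_monic:
  assumes "subunit_arrow C s" "subunit_arrow C t" and [simp]: "X \<in> Obj C" "Y \<in> Obj C"
  shows "monic C (act C s X \<otimes> act C t Y)"
proof -
  let ?Z = "Dom C s \<odot> X"
  note [simp] = subunitD(2,3)[OF assms(1)] subunitD(2,3)[OF assms(2)]
  have a: "monic C (Assoc C (Dom C s) X Y)" by (rule iso_monic) simp
  have m1: "monic C (act C s X \<otimes> Ident C Y)"
    unfolding act_tensor[OF subunitD(2,3)[OF assms(1)] assms(3,4), symmetric]
    by (intro monic_comp stiff_square(2)[OF assms(1,1)] a) simp_all
  have m2: "monic C (Ident C ?Z \<otimes> act C t Y)"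
  proof -
    obtain \<sigma> where s: "iso_arrow C \<sigma>" "Dom C \<sigma> = Dom C t \<odot> ?Z \<odot> Y" "Cod C \<sigma> = ?Z \<odot> Dom C t \<odot> Y"
      "act C t (?Z \<odot> Y) = (Ident C ?Z \<otimes> act C t Y) \<cdot> \<sigma>"
      by (rule act_swap_iso[of t ?Z Y]) simp_all
    have "monic C (act C t (?Z \<odot> Y) \<cdot> inv_arrow C \<sigma>)"
      by (intro monic_comp stiff_square(2)[OF assms(2,2)] iso_monic[OF iso_inv[OF s(1)]]) (simp_all add: s(1-3))
    also have "act C t (?Z \<odot> Y) \<cdot> inv_arrow C \<sigma> = Ident C ?Z \<otimes> act C t Y"
      unfolding s(4) using s(1-3) by (simp add: iso_arr)
    finally show ?thesis .
  qed
  have "monic C ((act C s X \<otimes> Ident C Y) \<cdot> (Ident C ?Z \<otimes> act C t Y))"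
    by (intro monic_comp m1 m2) simp_all
  then show ?thesis by (simp add: inter)
qed

text \<open>As \<open>W \<cong> W \<odot> W\<close>, restriction to \<open>w\<close> may be imposed on both tensor factors at once.\<close>

lemma restr_tensor_factors:
  assumes "restr f w" "subunit_arrow C w" and [simp]: "f \<in> Arr C" "Cod C f = X \<odot> Y" "X \<in> Obj C" "Y \<in> Obj C"
  obtains k where "k \<in> Arr C" "Dom C k = Dom C f" "Cod C k = (Dom C w \<odot> X) \<odot> (Dom C w \<odot> Y)"
    "f = (act C w X \<otimes> act C w Y) \<cdot> k"
proof -
  let ?W = "Dom C w" and ?Z = "Dom C w \<odot> X"
  note [simp] = subunitD(2,3)[OF assms(2)]
  obtain h where h: "h \<in> Arr C" "Dom C h = Dom C f" "Cod C h = ?W \<odot> Cod C f" "f = act C w (Cod C f) \<cdot> h"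
    using restrE[OF assms(1)] by auto
  have hC: "Cod C h = ?W \<odot> X \<odot> Y" using h(3) by simp
  note [simp] = h(1,2) hC
  let ?h = "inv_arrow C (Assoc C ?W X Y) \<cdot> h"
  have f1: "f = (act C w X \<otimes> Ident C Y) \<cdot> ?h"
    by (subst h(4)) (simp add: act_tensor[symmetric])
  \<comment> \<open>The remaining factor still ends in an object that absorbs \<open>W\<close>, so \<open>w\<close> can be split off once more.\<close>
  have "restr ?h w"
    by (rule restr_postcomp[OF restr_absorb[OF assms(2), of "X \<odot> Y"]]) simp_all
  then obtain m where m: "m \<in> Arr C" "Dom C m = Dom C f" "Cod C m = ?W \<odot> ?Z \<odot> Y" "?h = act C w (?Z \<odot> Y) \<cdot> m"
    using restrE[of ?h w] by auto
  note [simp] = m(1-3)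
  obtain \<sigma> where s: "iso_arrow C \<sigma>" "Dom C \<sigma> = ?W \<odot> ?Z \<odot> Y" "Cod C \<sigma> = ?Z \<odot> ?W \<odot> Y"
      "act C w (?Z \<odot> Y) = (Ident C ?Z \<otimes> act C w Y) \<cdot> \<sigma>"
    by (rule act_swap_iso[of w ?Z Y]) simp_all
  note [simp] = s(2,3) iso_arr[OF s(1)]
  have "f = (act C w X \<otimes> Ident C Y) \<cdot> ((Ident C ?Z \<otimes> act C w Y) \<cdot> \<sigma>) \<cdot> m"
    using f1 unfolding m(4) s(4) .
  also have "\<dots> = (act C w X \<otimes> act C w Y) \<cdot> (\<sigma> \<cdot> m)"
    by (simp add: inter)
  finally show ?thesis by (rule that[rotated 3]) simp_all
qed

lemma rep_sub_meet:
  assumes "u \<in> carrier (ISub C)" "v \<in> carrier (ISub C)"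
  shows "sub_meet C u v \<in> carrier (ISub C)" "sub_meet C u v \<sqsubseteq>\<^bsub>ISub C\<^esub> u" "sub_meet C u v \<sqsubseteq>\<^bsub>ISub C\<^esub> v"
    "\<And>f. \<lbrakk>f \<in> Arr C; restr f (rep u); restr f (rep v)\<rbrakk> \<Longrightarrow> restr f (rep (sub_meet C u v))"
proof -
  let ?s = "rep u" and ?t = "rep v"
  note su = rep_ISub(1)[OF assms(1)] rep_ISub(1)[OF assms(2)]
  note [simp] = subunitD(2,3)[OF su(1)] subunitD(2,3)[OF su(2)]
  have m: "subunit_arrow C (meet ?s ?t)" using meet_subunit su by blast
  then show c: "sub_meet C u v \<in> carrier (ISub C)"
    unfolding sub_meet_def by (rule subobject_in_ISub)
  have "sub_meet C u v \<sqsubseteq>\<^bsub>ISub C\<^esub> subobject C ?s" "sub_meet C u v \<sqsubseteq>\<^bsub>ISub C\<^esub> subobject C ?t"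
    unfolding sub_meet_def le_subobject[OF m su(1)] le_subobject[OF m su(2)]
    by (simp_all add: meet_factors)
  then show "sub_meet C u v \<sqsubseteq>\<^bsub>ISub C\<^esub> u" "sub_meet C u v \<sqsubseteq>\<^bsub>ISub C\<^esub> v"
    using rep_ISub(2) assms by simp_all
  fix f assume f: "f \<in> Arr C" "restr f ?s" "restr f ?t"
  show "restr f (rep (sub_meet C u v))"
    by (rule restr_mono[OF restr_meet[OF f(2,3) su f(1)]])
      (use f(1) rep_subobject(3)[OF subunitD(1)[OF m]] subunitD(2,3)[OF rep_ISub(1)[OF c]] in \<open>simp_all add: sub_meet_def\<close>)
qed

lemma sub_meet_greatest:
  assumes "u \<in> carrier (ISub C)" "v \<in> carrier (ISub C)" "w \<in> carrier (ISub C)"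
    "w \<sqsubseteq>\<^bsub>ISub C\<^esub> u" "w \<sqsubseteq>\<^bsub>ISub C\<^esub> v"
  shows "w \<sqsubseteq>\<^bsub>ISub C\<^esub> sub_meet C u v"
proof -
  note D = subunitD(2,3)[OF rep_ISub(1)[OF assms(1)]] subunitD(2,3)[OF rep_ISub(1)[OF assms(2)]]
    subunitD(2,3)[OF rep_ISub(1)[OF assms(3)]]
    subunitD(2,3)[OF rep_ISub(1)[OF rep_sub_meet(1)[OF assms(1,2)]]]
  have "restr (rep w) (rep (sub_meet C u v))"
    by (rule rep_sub_meet(4)[OF assms(1,2)]) (use assms(4,5) D restr_unit_iff le_ISub in auto)
  then show ?thesis using D restr_unit_iff le_ISub by auto
qed

end

section \<open>Generators of the Day convolution\<close>

lemma presheafD: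
  assumes "presheaf C F"
  shows "x \<in> at F A \<Longrightarrow> A \<in> Obj C"
    "\<lbrakk>f \<in> Arr C; x \<in> at F (Cod C f)\<rbrakk> \<Longrightarrow> along F f x \<in> at F (Dom C f)"
    "x \<in> at F A \<Longrightarrow> along F (Ident C A) x = x"
    "\<lbrakk>f \<in> Arr C; g \<in> Arr C; Cod C f = Dom C g; x \<in> at F (Cod C g)\<rbrakk>
      \<Longrightarrow> along F (g \<cdot>\<^bsub>C\<^esub> f) x = along F f (along F g x)"
proof -
  show *: "x \<in> at F A \<Longrightarrow> A \<in> Obj C" for x A
    using assms unfolding presheaf_def by blast
  show "x \<in> at F A \<Longrightarrow> along F (Ident C A) x = x"
    using assms *[of x A] unfolding presheaf_def by blast
  show "\<lbrakk>f \<in> Arr C; x \<in> at F (Cod C f)\<rbrakk> \<Longrightarrow> along F f x \<in> at F (Dom C f)"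
    using assms unfolding presheaf_def by (blast dest: PiE_mem)
  show "\<lbrakk>f \<in> Arr C; g \<in> Arr C; Cod C f = Dom C g; x \<in> at F (Cod C g)\<rbrakk>
      \<Longrightarrow> along F (g \<cdot>\<^bsub>C\<^esub> f) x = along F f (along F g x)"
    using assms unfolding presheaf_def by blast
qed

lemma Hom_Psh: "\<alpha> \<in> Hom (Psh C) F G \<longleftrightarrow> nat_trans C \<alpha> \<and> source \<alpha> = F \<and> target \<alpha> = G"
  by (simp add: Psh_def Hom_def)

lemma Hom_PshD:
  assumes "\<alpha> \<in> Hom (Psh C) F G"
  shows "presheaf C F" "presheaf C G" "source \<alpha> = F" "target \<alpha> = G"
    "x \<in> at F A \<Longrightarrow> component \<alpha> A x \<in> at G A"
    "\<lbrakk>f \<in> Arr C; x \<in> at F (Cod C f)\<rbrakk>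
      \<Longrightarrow> component \<alpha> (Dom C f) (along F f x) = along G f (component \<alpha> (Cod C f) x)"
  using assms unfolding Hom_Psh nat_trans_def by (auto dest: PiE_mem)

lemma Hom_PshI:
  assumes "presheaf C F" "presheaf C G" "source \<alpha> = F" "target \<alpha> = G"
    "\<And>A. component \<alpha> A \<in> at F A \<rightarrow>\<^sub>E at G A"
    "\<And>f x. \<lbrakk>f \<in> Arr C; x \<in> at F (Cod C f)\<rbrakk>
      \<Longrightarrow> component \<alpha> (Dom C f) (along F f x) = along G f (component \<alpha> (Cod C f) x)"
  shows "\<alpha> \<in> Hom (Psh C) F G"
  unfolding Hom_Psh nat_trans_def using assms by blast

lemma Psh_ext:
  assumes "\<alpha> \<in> Hom (Psh C) F G" "\<beta> \<in> Hom (Psh C) F G"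
    "\<And>A x. x \<in> at F A \<Longrightarrow> component \<alpha> A x = component \<beta> A x"
  shows "\<alpha> = \<beta>"
proof -
  have "component \<alpha> A = component \<beta> A" for A
  proof (rule PiE_ext)
    show "component \<alpha> A \<in> at F A \<rightarrow>\<^sub>E at G A" "component \<beta> A \<in> at F A \<rightarrow>\<^sub>E at G A"
      using assms(1,2) unfolding Hom_Psh nat_trans_def by metis+
  qed (rule assms(3))
  moreover have "source \<alpha> = source \<beta>" "target \<alpha> = target \<beta>"
    using assms(1,2) unfolding Hom_Psh by auto
  ultimately show ?thesis by (intro nat_trans.equality) auto
qed

lemma Comp_Psh: "Comp (Psh C) = nat_comp"
  and Ident_Psh: "Ident (Psh C) = nat_ident"
  and Obj_Psh: "F \<in> Obj (Psh C) \<longleftrightarrow> presheaf C F"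
  and Arr_Psh: "\<alpha> \<in> Arr (Psh C) \<longleftrightarrow> nat_trans C \<alpha>"
  and Dom_Psh: "Dom (Psh C) = source"
  and Cod_Psh: "Cod (Psh C) = target"
  and Unit_Psh: "Unit (Psh C) = yoneda C (Unit C)"
  and TensorO_Psh: "TensorO (Psh C) = day C"
  and TensorA_Psh: "TensorA (Psh C) = day_map C"
  and LUnit_Psh: "LUnit (Psh C) = day_lunit C"
  and RUnit_Psh: "RUnit (Psh C) = day_runit C"
  and Assoc_Psh: "Assoc (Psh C) = day_assoc C"
  and Braid_Psh: "Braid (Psh C) = day_braid C"
  by (simp_all add: Psh_def)

lemmas Psh_sel = Comp_Psh Ident_Psh Obj_Psh Arr_Psh Dom_Psh Cod_Psh Unit_Psh TensorO_Psh TensorA_Psh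
  LUnit_Psh RUnit_Psh Assoc_Psh Braid_Psh

lemma component_comp [simp]:
  "\<lbrakk>\<alpha> \<in> Hom (Psh C) F G; x \<in> at F A\<rbrakk> \<Longrightarrow> component (nat_comp \<beta> \<alpha>) A x = component \<beta> A (component \<alpha> A x)"
  by (simp add: nat_comp_def Hom_Psh)

lemma component_ident [simp]: "x \<in> at F A \<Longrightarrow> component (nat_ident F) A x = x"
  by (simp add: nat_ident_def)

lemma nat_comp_Hom:
  assumes "\<alpha> \<in> Hom (Psh C) F G" "\<beta> \<in> Hom (Psh C) G H"
  shows "nat_comp \<beta> \<alpha> \<in> Hom (Psh C) F H"
proof (rule Hom_PshI)
  note a = Hom_PshD[OF assms(1)] and b = Hom_PshD[OF assms(2)]
  show "presheaf C F" "presheaf C H" "source (nat_comp \<beta> \<alpha>) = F" "target (nat_comp \<beta> \<alpha>) = H"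
    using a b by (auto simp: nat_comp_def)
  show "component (nat_comp \<beta> \<alpha>) A \<in> at F A \<rightarrow>\<^sub>E at H A" for A
    using a(3,5) b(5) by (auto simp: nat_comp_def)
  fix f x assume f: "f \<in> Arr C" "x \<in> at F (Cod C f)"
  note [simp] = component_comp[OF assms(1)]
  show "component (nat_comp \<beta> \<alpha>) (Dom C f) (along F f x) = along H f (component (nat_comp \<beta> \<alpha>) (Cod C f) x)"
    using f a(6)[OF f] b(6)[OF f(1) a(5)[OF f(2)]] presheafD(2)[OF a(1) f] by simp
qed

lemma nat_ident_Hom:
  assumes "presheaf C F" shows "nat_ident F \<in> Hom (Psh C) F F"
proof (rule Hom_PshI)
  fix f x assume f: "f \<in> Arr C" "x \<in> at F (Cod C f)"
  then show "component (nat_ident F) (Dom C f) (along F f x) = along F f (component (nat_ident F) (Cod C f) x)"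
    using presheafD(2)[OF assms f] by simp
qed (use assms in \<open>auto simp: nat_ident_def\<close>)

lemma category_Psh: "category (Psh C)"
proof
  show "f \<in> Arr (Psh C) \<Longrightarrow> Dom (Psh C) f \<in> Obj (Psh C)" "f \<in> Arr (Psh C) \<Longrightarrow> Cod (Psh C) f \<in> Obj (Psh C)" for f
    by (auto simp: Psh_sel nat_trans_def)
  show "X \<in> Obj (Psh C) \<Longrightarrow> Ident (Psh C) X \<in> Hom (Psh C) X X" for X
    by (simp add: Psh_sel nat_ident_Hom)
  show comp: "\<lbrakk>f \<in> Hom (Psh C) X Y; g \<in> Hom (Psh C) Y Z\<rbrakk> \<Longrightarrow> g \<cdot>\<^bsub>Psh C\<^esub> f \<in> Hom (Psh C) X Z" for f g X Y Z
    by (simp add: Psh_sel nat_comp_Hom)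
  fix f X Y assume f: "f \<in> Hom (Psh C) X Y"
  note fD = Hom_PshD[OF f]
  show "Ident (Psh C) Y \<cdot>\<^bsub>Psh C\<^esub> f = f"
    unfolding Psh_sel by (rule Psh_ext[OF nat_comp_Hom[OF f nat_ident_Hom[OF fD(2)]] f])
      (simp add: component_comp[OF f] fD)
  show "f \<cdot>\<^bsub>Psh C\<^esub> Ident (Psh C) X = f"
    unfolding Psh_sel by (rule Psh_ext[OF nat_comp_Hom[OF nat_ident_Hom[OF fD(1)] f] f])
      (simp add: component_comp[OF nat_ident_Hom[OF fD(1)]] fD)
  fix W Z g h assume g: "g \<in> Hom (Psh C) W X" and h: "h \<in> Hom (Psh C) Y Z"
  show "h \<cdot>\<^bsub>Psh C\<^esub> f \<cdot>\<^bsub>Psh C\<^esub> g = (h \<cdot>\<^bsub>Psh C\<^esub> f) \<cdot>\<^bsub>Psh C\<^esub> g"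
    unfolding Psh_sel
  proof (rule Psh_ext)
    fix A x assume x: "x \<in> at W A"
    then show "component (nat_comp h (nat_comp f g)) A x = component (nat_comp (nat_comp h f) g) A x"
      using Hom_PshD(5)[OF g x]
      by (simp add: component_comp[OF g] component_comp[OF f] component_comp[OF nat_comp_Hom[OF g f]])
  qed (rule nat_comp_Hom f g h)+
qed

lemma day_class_equiv: "equivclp (day_step C F G A) t (day_class C F G A t)"
  unfolding day_class_def by (rule someI[of _ t]) simp

lemma day_class_eq:
  assumes "day_step C F G A t t'"
  shows "day_class C F G A t = day_class C F G A t'"
proof -
  have tt: "equivclp (day_step C F G A) t t'" using assms by (rule r_into_equivclp)
  then have "equivclp (day_step C F G A) t = equivclp (day_step C F G A) t'"
    by (intro ext) (meson equivclp_sym equivclp_trans)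
  then show ?thesis by (simp add: day_class_def)
qed

text \<open>What a function sees of a chosen representative does not depend on the choice if it is constant along
  the generating steps.\<close>

lemma day_class_invariant:
  assumes "\<And>t t'. day_step C F G A t t' \<Longrightarrow> \<Phi> t = \<Phi> t'"
  shows "\<Phi> (day_class C F G A t) = \<Phi> t"
  using day_class_equiv[of C F G A t]
  by (induction rule: equivclp_induct) (auto dest: assms)

context braided
begin

text \<open>The generator \<open>gen x y\<close> is the class of \<open>(B, D, id, x, y)\<close>. Every element of a Day convolution is
  the restriction of a generator along an arrow, so a natural transformation out of a Day
  convolution is determined by what it does to generators.\<close>

definition gen :: "('o, 'a) psh \<Rightarrow> ('o, 'a) psh \<Rightarrow> 'o \<Rightarrow> 'o \<Rightarrow> ('o, 'a) elt \<Rightarrow> ('o, 'a) elt \<Rightarrow> ('o, 'a) elt" where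
  "gen F G B D x y = day_class C F G (B \<odot> D) (Tuple B D (Ident C (B \<odot> D)) x y)"

abbreviation bracket where
  "bracket F G A B D h x y \<equiv> day_class C F G A (Tuple B D h x y)"

lemma day_case_class:
  assumes resp: "\<And>B B' D D' b d h x y. \<lbrakk>b \<in> Hom C B B'; d \<in> Hom C D D'; h \<in> Hom C A (B \<odot> D); x \<in> at F B'; y \<in> at G D'\<rbrakk>
      \<Longrightarrow> \<Psi> B D h (along F b x) (along G d y) = \<Psi> B' D' ((b \<otimes> d) \<cdot> h) x y"
  shows "(case bracket F G A B D h x y of Arrow _ \<Rightarrow> undefined | Tuple B D h x y \<Rightarrow> \<Psi> B D h x y) = \<Psi> B D h x y"
proof -
  let ?\<Phi> = "case_elt (\<lambda>_. undefined) \<Psi>"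
  have "?\<Phi> t = ?\<Phi> t'" if "day_step C F G A t t'" for t t'
    using that by cases (simp add: resp)
  from day_class_invariant[where \<Phi>="?\<Phi>", OF this] show ?thesis by simp
qed

text \<open>The coend relation.\<close>

lemma bracket_slide:
  "\<lbrakk>b \<in> Hom C B B'; d \<in> Hom C D D'; h \<in> Hom C A (B \<odot> D); x \<in> at F B'; y \<in> at G D'\<rbrakk>
    \<Longrightarrow> bracket F G A B D h (along F b x) (along G d y) = bracket F G A B' D' ((b \<otimes> d) \<cdot> h) x y"
  by (rule day_class_eq) (rule day_step.intros)

lemma bracket_in_day:
  assumes "x \<in> at F B" "y \<in> at G D" "h \<in> Hom C A (B \<odot> D)" "presheaf C F" "presheaf C G"
  shows "bracket F G A B D h x y \<in> at (day C F G) A"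
proof -
  have "Tuple B D h x y \<in> day_tuples C F G A"
    using assms(1-3) presheafD(1)[OF assms(4,1)] presheafD(1)[OF assms(5,2)] by (simp add: day_tuples_def)
  then show ?thesis by (simp add: day_def)
qed

lemma dayE_bracket:
  assumes "t \<in> at (day C F G) A"
  obtains B D h x y where "x \<in> at F B" "y \<in> at G D" "h \<in> Hom C A (B \<odot> D)" "t = bracket F G A B D h x y"
  using assms unfolding day_def day_tuples_def by auto

lemma along_bracket:
  assumes "x \<in> at F B" "y \<in> at G D" "h \<in> Hom C A (B \<odot> D)" "presheaf C F" "presheaf C G"
    and g: "g \<in> Hom C A' A"
  shows "along (day C F G) g (bracket F G A B D h x y) = bracket F G A' B D (h \<cdot> g) x y"
proof -
  have [simp]: "g \<in> Arr C" "Dom C g = A'" "Cod C g = A" using g by (auto simp: Hom_iff)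
  have "along (day C F G) g (bracket F G A B D h x y)
      = (case bracket F G A B D h x y of Arrow _ \<Rightarrow> undefined | Tuple B D h x y \<Rightarrow> bracket F G A' B D (h \<cdot> g) x y)"
    using bracket_in_day[OF assms(1-5)] by (simp add: day_def)
  also have "\<dots> = bracket F G A' B D (h \<cdot> g) x y"
  proof (rule day_case_class)
    fix B B' D D' b d h x y
    assume *: "b \<in> Hom C B B'" "d \<in> Hom C D D'" "h \<in> Hom C A (B \<odot> D)" "x \<in> at F B'" "y \<in> at G D'"
    have "h \<cdot> g \<in> Hom C A' (B \<odot> D)" using * by (auto simp: Hom_iff)
    from bracket_slide[OF *(1,2) this *(4,5)]
    show "bracket F G A' B D (h \<cdot> g) (along F b x) (along G d y) = bracket F G A' B' D' (((b \<otimes> d) \<cdot> h) \<cdot> g) x y"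
      using * by (auto simp: Hom_iff)
  qed
  finally show ?thesis .
qed

lemma presheaf_day [simp]:
  assumes [simp]: "presheaf C F" "presheaf C G"
  shows "presheaf C (day C F G)"
  unfolding presheaf_def
proof (intro conjI allI impI ballI)
  fix A assume "A \<notin> Obj C"
  then have "t \<notin> at (day C F G) A" for t
    using dom_obj by (auto elim!: dayE_bracket simp: Hom_iff)
  then show "at (day C F G) A = {}" by blast
next
  fix f assume "f \<notin> Arr C" then show "along (day C F G) f = (\<lambda>x. undefined)" by (simp add: day_def)
next
  fix f assume f: "f \<in> Arr C"
  show "along (day C F G) f \<in> at (day C F G) (Cod C f) \<rightarrow>\<^sub>E at (day C F G) (Dom C f)"
  proof (rule PiE_I)
    fix t assume "t \<in> at (day C F G) (Cod C f)"
    then obtain B D h x y where t: "x \<in> at F B" "y \<in> at G D" "h \<in> Hom C (Cod C f) (B \<odot> D)"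
      "t = bracket F G (Cod C f) B D h x y" by (rule dayE_bracket)
    have *: "f \<in> Hom C (Dom C f) (Cod C f)" using f by (simp add: Hom_iff)
    show "along (day C F G) f t \<in> at (day C F G) (Dom C f)"
      unfolding t(4) along_bracket[OF t(1-3) assms *]
      by (rule bracket_in_day[OF t(1,2) comp_hom[OF * t(3)] assms])
  next
    fix t assume "t \<notin> at (day C F G) (Cod C f)"
    then show "along (day C F G) f t = undefined" using f by (simp add: day_def)
  qed
next
  fix A t assume A: "A \<in> Obj C" and "t \<in> at (day C F G) A"
  then obtain B D h x y where t: "x \<in> at F B" "y \<in> at G D" "h \<in> Hom C A (B \<odot> D)"
      "t = bracket F G A B D h x y" by (auto elim!: dayE_bracket)
  then show "along (day C F G) (Ident C A) t = t"
    unfolding t(4) by (subst along_bracket[OF t(1-3) assms ident_hom[OF A]]) (simp add: Hom_iff)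
next
  fix f g t assume fg: "f \<in> Arr C" "g \<in> Arr C" "Cod C f = Dom C g" and "t \<in> at (day C F G) (Cod C g)"
  then obtain B D h x y where t: "x \<in> at F B" "y \<in> at G D" "h \<in> Hom C (Cod C g) (B \<odot> D)"
      "t = bracket F G (Cod C g) B D h x y" by (auto elim!: dayE_bracket)
  have f: "f \<in> Hom C (Dom C f) (Dom C g)" and g: "g \<in> Hom C (Dom C g) (Cod C g)"
    using fg by (simp_all add: Hom_iff)
  show "along (day C F G) (g \<cdot> f) t = along (day C F G) f (along (day C F G) g t)"
    unfolding t(4) along_bracket[OF t(1-3) assms g] along_bracket[OF t(1-2) comp_hom[OF g t(3)] assms f]
      along_bracket[OF t(1-3) assms comp_hom[OF f g]]
    using fg t(3) by (simp add: Hom_iff)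
qed

lemma along_gen:
  assumes "x \<in> at F B" "y \<in> at G D" "h \<in> Arr C" "Cod C h = B \<odot> D" "presheaf C F" "presheaf C G"
  shows "along (day C F G) h (gen F G B D x y) = bracket F G (Dom C h) B D h x y"
proof -
  have o: "B \<in> Obj C" "D \<in> Obj C"
    using presheafD(1)[OF assms(5,1)] presheafD(1)[OF assms(6,2)] by simp_all
  then show ?thesis unfolding gen_def
    using assms(3,4) by (subst along_bracket[OF assms(1,2) _ assms(5,6)]) (auto simp: Hom_iff)
qed

lemma gen_in_day [simp]:
  assumes "x \<in> at F B" "y \<in> at G D" "presheaf C F" "presheaf C G"
  shows "gen F G B D x y \<in> at (day C F G) (B \<odot> D)"
proof -
  have o: "B \<in> Obj C" "D \<in> Obj C"
    using presheafD(1)[OF assms(3,1)] presheafD(1)[OF assms(4,2)] by simp_all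
  then show ?thesis unfolding gen_def
    by (intro bracket_in_day) (use assms in \<open>auto simp: Hom_iff\<close>)
qed

lemma dayE:
  assumes "t \<in> at (day C F G) A" "presheaf C F" "presheaf C G"
  obtains B D h x y where "x \<in> at F B" "y \<in> at G D" "h \<in> Arr C" "Dom C h = A" "Cod C h = B \<odot> D"
    "B \<in> Obj C" "D \<in> Obj C" "t = along (day C F G) h (gen F G B D x y)"
proof -
  obtain B D h x y where "x \<in> at F B" "y \<in> at G D" "h \<in> Hom C A (B \<odot> D)" "t = bracket F G A B D h x y"
    using dayE_bracket[OF assms(1)] .
  then show ?thesis using that[of x B y D h] along_gen[of x F B y G D h] assms presheafD(1)[OF assms(2)] presheafD(1)[OF assms(3)]
    by (auto simp: Hom_iff)
qed

lemma gen_slide: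
  assumes "b \<in> Arr C" "d \<in> Arr C" "x \<in> at F (Cod C b)" "y \<in> at G (Cod C d)" "presheaf C F" "presheaf C G"
  shows "gen F G (Dom C b) (Dom C d) (along F b x) (along G d y)
    = along (day C F G) (b \<otimes> d) (gen F G (Cod C b) (Cod C d) x y)"
  unfolding gen_def using assms
  by (subst bracket_slide, simp_all add: Hom_iff)
    (subst along_bracket, simp_all add: Hom_iff)

lemma gen_slide_left:
  assumes "b \<in> Arr C" "x \<in> at F (Cod C b)" "y \<in> at G D" "presheaf C F" "presheaf C G" "Dom C b = B"
  shows "gen F G B D (along F b x) y
    = along (day C F G) (b \<otimes> Ident C D) (gen F G (Cod C b) D x y)"
  using gen_slide[OF assms(1) _ assms(2) _ assms(4,5), of "Ident C D" y] assms(3,6) presheafD(1,3)[OF assms(5,3)]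
  by simp

lemma gen_slide_right:
  assumes "d \<in> Arr C" "x \<in> at F B" "y \<in> at G (Cod C d)" "presheaf C F" "presheaf C G" "Dom C d = D"
  shows "gen F G B D x (along G d y)
    = along (day C F G) (Ident C B \<otimes> d) (gen F G B (Cod C d) x y)"
  using gen_slide[OF _ assms(1) _ assms(3) assms(4,5), of "Ident C B" x] assms(2,6) presheafD(1,3)[OF assms(4,2)]
  by simp

lemma day_case:
  assumes resp: "\<And>B B' D D' b d h x y. \<lbrakk>b \<in> Hom C B B'; d \<in> Hom C D D'; h \<in> Hom C A (B \<odot> D); x \<in> at F B'; y \<in> at G D'\<rbrakk>
      \<Longrightarrow> \<Psi> B D h (along F b x) (along G d y) = \<Psi> B' D' ((b \<otimes> d) \<cdot> h) x y"
    and "x \<in> at F B" "y \<in> at G D" "h \<in> Arr C" "Cod C h = B \<odot> D" "presheaf C F" "presheaf C G" "Dom C h = A"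
  shows "(case along (day C F G) h (gen F G B D x y) of Arrow _ \<Rightarrow> undefined | Tuple B D h x y \<Rightarrow> \<Psi> B D h x y)
    = \<Psi> B D h x y"
  unfolding along_gen[OF assms(2-7)] using day_case_class[OF resp] assms(8) by simp

lemma day_ext:
  assumes "\<alpha> \<in> Hom (Psh C) (day C F G) H" "\<beta> \<in> Hom (Psh C) (day C F G) H" "presheaf C F" "presheaf C G"
    "\<And>B D x y. \<lbrakk>x \<in> at F B; y \<in> at G D; B \<in> Obj C; D \<in> Obj C\<rbrakk>
      \<Longrightarrow> component \<alpha> (B \<odot> D) (gen F G B D x y) = component \<beta> (B \<odot> D) (gen F G B D x y)"
  shows "\<alpha> = \<beta>"
proof (rule Psh_ext[OF assms(1,2)])
  fix A t assume "t \<in> at (day C F G) A"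
  then obtain B D h x y where t: "x \<in> at F B" "y \<in> at G D" "h \<in> Arr C" "Dom C h = A" "Cod C h = B \<odot> D"
    "B \<in> Obj C" "D \<in> Obj C" "t = along (day C F G) h (gen F G B D x y)" using assms(3,4) by (rule dayE)
  then show "component \<alpha> A t = component \<beta> A t"
    using Hom_PshD(6)[OF assms(1), of h "gen F G B D x y"] Hom_PshD(6)[OF assms(2), of h "gen F G B D x y"]
      assms(3-5) by simp
qed

text \<open>The universal property of the Day convolution, phrased so that it applies to components given by
  case distinction on a chosen representative.\<close>

lemma day_lift:
  assumes F: "presheaf C F" and G: "presheaf C G" and H: "presheaf C H"
    and src: "source \<alpha> = day C F G" and tgt: "target \<alpha> = H"
    and comp: "\<And>A. component \<alpha> A = (\<lambda>t \<in> at (day C F G) A.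
      case t of Arrow _ \<Rightarrow> undefined | Tuple B D h x y \<Rightarrow> \<Psi> A B D h x y)"
    and \<Psi>: "\<And>B D h x y. \<lbrakk>x \<in> at F B; y \<in> at G D; B \<in> Obj C; D \<in> Obj C; h \<in> Arr C; Cod C h = B \<odot> D\<rbrakk>
      \<Longrightarrow> \<Psi> (Dom C h) B D h x y = along H h (\<phi> B D x y)"
    and in_H: "\<And>B D x y. \<lbrakk>x \<in> at F B; y \<in> at G D; B \<in> Obj C; D \<in> Obj C\<rbrakk> \<Longrightarrow> \<phi> B D x y \<in> at H (B \<odot> D)"
    and nat: "\<And>b d x y. \<lbrakk>b \<in> Arr C; d \<in> Arr C; x \<in> at F (Cod C b); y \<in> at G (Cod C d)\<rbrakk>
      \<Longrightarrow> \<phi> (Dom C b) (Dom C d) (along F b x) (along G d y) = along H (b \<otimes> d) (\<phi> (Cod C b) (Cod C d) x y)"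
  shows "\<alpha> \<in> Hom (Psh C) (day C F G) H"
    and "\<And>B D x y. \<lbrakk>x \<in> at F B; y \<in> at G D\<rbrakk> \<Longrightarrow> component \<alpha> (B \<odot> D) (gen F G B D x y) = \<phi> B D x y"
proof -
  note FG = presheafD(1)[OF F] presheafD(1)[OF G]
  have *: "component \<alpha> (Dom C h) (along (day C F G) h (gen F G B D x y)) = along H h (\<phi> B D x y)"
    if x: "x \<in> at F B" "y \<in> at G D" "h \<in> Arr C" "Cod C h = B \<odot> D" for h B D x y
  proof -
    have m: "along (day C F G) h (gen F G B D x y) \<in> at (day C F G) (Dom C h)"
      using presheafD(2)[OF presheaf_day[OF F G] x(3)] gen_in_day[OF x(1,2) F G] x(4) by simp
    have "component \<alpha> (Dom C h) (along (day C F G) h (gen F G B D x y)) = \<Psi> (Dom C h) B D h x y"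
      unfolding comp restrict_apply'[OF m]
    proof (rule day_case)
      fix B B' D D' b d k x y
      assume a: "b \<in> Hom C B B'" "d \<in> Hom C D D'" "k \<in> Hom C (Dom C h) (B \<odot> D)" "x \<in> at F B'" "y \<in> at G D'"
      have o: "B \<in> Obj C" "B' \<in> Obj C" "D \<in> Obj C" "D' \<in> Obj C" using a by (auto simp: Hom_iff)
      have "\<Psi> (Dom C h) B D k (along F b x) (along G d y) = along H k (\<phi> B D (along F b x) (along G d y))"
        using \<Psi>[of "along F b x" B "along G d y" D k] a presheafD(2)[OF F, of b x] presheafD(2)[OF G, of d y] o
        by (auto simp: Hom_iff)
      also have "\<dots> = along H k (along H (b \<otimes> d) (\<phi> B' D' x y))"
        using nat[of b d x y] a by (auto simp: Hom_iff)
      also have "\<dots> = along H ((b \<otimes> d) \<cdot> k) (\<phi> B' D' x y)"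
        using a in_H[of x B' y D'] o by (subst presheafD(4)[OF H]) (auto simp: Hom_iff)
      also have "\<dots> = \<Psi> (Dom C h) B' D' ((b \<otimes> d) \<cdot> k) x y"
        using \<Psi>[of x B' y D' "(b \<otimes> d) \<cdot> k"] a o by (auto simp: Hom_iff)
      finally show "\<Psi> (Dom C h) B D k (along F b x) (along G d y) = \<Psi> (Dom C h) B' D' ((b \<otimes> d) \<cdot> k) x y" .
    qed (use x F G in auto)
    also have "\<dots> = along H h (\<phi> B D x y)"
      using x FG by (intro \<Psi>) auto
    finally show ?thesis .
  qed
  show "\<alpha> \<in> Hom (Psh C) (day C F G) H"
  proof (rule Hom_PshI[OF presheaf_day[OF F G] H src tgt])
    show "component \<alpha> A \<in> at (day C F G) A \<rightarrow>\<^sub>E at H A" for A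
    proof (rule PiE_I)
      fix t assume "t \<in> at (day C F G) A"
      then obtain B D h x y where t: "x \<in> at F B" "y \<in> at G D" "h \<in> Arr C" "Dom C h = A" "Cod C h = B \<odot> D"
        "B \<in> Obj C" "D \<in> Obj C" "t = along (day C F G) h (gen F G B D x y)" using F G by (rule dayE)
      then show "component \<alpha> A t \<in> at H A"
        using *[OF t(1-3,5)] presheafD(2)[OF H t(3)] in_H[OF t(1,2,6,7)] by simp
    qed (simp add: comp)
  next
    fix f t assume f: "f \<in> Arr C" and "t \<in> at (day C F G) (Cod C f)"
    then obtain B D h x y where t: "x \<in> at F B" "y \<in> at G D" "h \<in> Arr C" "Dom C h = Cod C f" "Cod C h = B \<odot> D"
        "B \<in> Obj C" "D \<in> Obj C" "t = along (day C F G) h (gen F G B D x y)" using F G by (auto elim: dayE)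
    have g: "gen F G B D x y \<in> at (day C F G) (Cod C h)" using t F G by simp
    have p: "\<phi> B D x y \<in> at H (Cod C h)" using in_H t by simp
    have "along (day C F G) f t = along (day C F G) (h \<cdot> f) (gen F G B D x y)"
      unfolding t(8) using presheafD(4)[OF presheaf_day[OF F G] f t(3) _ g] t(4) by simp
    then have "component \<alpha> (Dom C f) (along (day C F G) f t) = along H (h \<cdot> f) (\<phi> B D x y)"
      using *[OF t(1,2), of "h \<cdot> f"] f t(3-5) by simp
    also have "\<dots> = along H f (along H h (\<phi> B D x y))"
      using presheafD(4)[OF H f t(3) _ p] t(4) by simp
    also have "\<dots> = along H f (component \<alpha> (Cod C f) t)"
      unfolding t(8) t(4)[symmetric] by (subst *[OF t(1-3,5)]) simp
    finally show "component \<alpha> (Dom C f) (along (day C F G) f t) = along H f (component \<alpha> (Cod C f) t)" .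
  qed
  fix B D x y assume x: "x \<in> at F B" "y \<in> at G D"
  then have o: "B \<odot> D \<in> Obj C" using FG by simp
  have "gen F G B D x y = along (day C F G) (Ident C (B \<odot> D)) (gen F G B D x y)"
    using presheafD(3)[OF presheaf_day[OF F G] gen_in_day[OF x F G]] by simp
  then show "component \<alpha> (B \<odot> D) (gen F G B D x y) = \<phi> B D x y"
    using *[OF x, of "Ident C (B \<odot> D)"] o presheafD(3)[OF H in_H[OF x]] x FG by simp
qed

end

section \<open>Presheaves form a braided monoidal category\<close>

lemma component_nat_comp:
  "x \<in> at (source \<alpha>) A \<Longrightarrow> component (nat_comp \<beta> \<alpha>) A x = component \<beta> A (component \<alpha> A x)"
  by (simp add: nat_comp_def)

lemma source_target [simp]:
  "source (nat_ident F) = F" "target (nat_ident F) = F"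
  "source (nat_comp \<beta> \<alpha>) = source \<alpha>" "target (nat_comp \<beta> \<alpha>) = target \<beta>"
  "source (day_map C \<alpha> \<beta>) = day C (source \<alpha>) (source \<beta>)"
  "target (day_map C \<alpha> \<beta>) = day C (target \<alpha>) (target \<beta>)"
  "source (day_assoc C F G H) = day C (day C F G) H" "target (day_assoc C F G H) = day C F (day C G H)"
  "source (day_lunit C F) = day C (yoneda C (Unit C)) F" "target (day_lunit C F) = F"
  "source (day_runit C F) = day C F (yoneda C (Unit C))" "target (day_runit C F) = F"
  "source (day_braid C F G) = day C F G" "target (day_braid C F G) = day C G F"
  by (simp_all add: nat_ident_def nat_comp_def day_map_def day_assoc_def day_lunit_def day_runit_def day_braid_def)

lemma nat_trans_ident [simp]:
  fixes C :: "('o, 'a) bmcategory" and F :: "('o, 'a) psh"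
  shows "presheaf C F \<Longrightarrow> nat_trans C (nat_ident F)"
  using nat_ident_Hom[of C F] by (simp add: Hom_Psh)

lemma nat_trans_comp [simp]:
  fixes C :: "('o, 'a) bmcategory" and \<alpha> \<beta> :: "('o, 'a) psh_map"
  shows "\<lbrakk>nat_trans C \<alpha>; nat_trans C \<beta>; source \<beta> = target \<alpha>\<rbrakk> \<Longrightarrow> nat_trans C (nat_comp \<beta> \<alpha>)"
  using nat_comp_Hom[of \<alpha> C "source \<alpha>" "target \<alpha>" \<beta> "target \<beta>"] by (simp add: Hom_Psh)

lemma Psh_inverse:
  assumes "\<alpha> \<in> Hom (Psh C) F G" "\<beta> \<in> Hom (Psh C) G F" "nat_comp \<beta> \<alpha> = nat_ident F" "nat_comp \<alpha> \<beta> = nat_ident G"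
  shows "inverse_arrows (Psh C) \<alpha> \<beta>"
  using assms by (simp add: inverse_arrows_def Psh_sel Hom_Psh)

lemma Psh_isoI: "inverse_arrows (Psh C) \<alpha> \<beta> \<Longrightarrow> iso_arrow (Psh C) \<alpha>"
  by (auto simp: iso_arrow_def)

context braided
begin

sublocale psh: category "Psh C" by (rule category_Psh)

lemma nat_transD:
  fixes \<alpha> :: "('o, 'a) psh_map"
  assumes "nat_trans C \<alpha>"
  shows "presheaf C (source \<alpha>)" "presheaf C (target \<alpha>)"
    "\<lbrakk>x \<in> at (source \<alpha>) A; G = target \<alpha>\<rbrakk> \<Longrightarrow> component \<alpha> A x \<in> at G A"
    "\<lbrakk>F = source \<alpha>; f \<in> Arr C; A = Dom C f; x \<in> at F (Cod C f)\<rbrakk>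
      \<Longrightarrow> component \<alpha> A (along F f x) = along (target \<alpha>) f (component \<alpha> (Cod C f) x)"
  using Hom_PshD[of \<alpha> C "source \<alpha>" "target \<alpha>"] assms by (auto simp: Hom_Psh)

lemma along_in:
  "\<lbrakk>presheaf C F; f \<in> Arr C; A = Dom C f; x \<in> at F (Cod C f)\<rbrakk> \<Longrightarrow> along F f x \<in> at F A"
  by (simp add: presheafD)

lemma along_along:
  "\<lbrakk>presheaf C F; f \<in> Arr C; g \<in> Arr C; Cod C f = Dom C g; x \<in> at F (Cod C g)\<rbrakk>
    \<Longrightarrow> along F f (along F g x) = along F (g \<cdot> f) x"
  by (simp add: presheafD)

lemma yoneda_at: "at (yoneda C X) A = Arrow ` Hom C A X"
  by (simp add: yoneda_def)

lemma yoneda_along: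
  "\<lbrakk>g \<in> Arr C; f \<in> Arr C; Dom C f = Cod C g; Cod C f = X\<rbrakk> \<Longrightarrow> along (yoneda C X) g (Arrow f) = Arrow (f \<cdot> g)"
  by (simp add: yoneda_def Hom_iff)

lemma presheaf_yoneda [simp]:
  assumes "X \<in> Obj C" shows "presheaf C (yoneda C X)"
  unfolding presheaf_def
proof (intro conjI allI impI ballI)
  fix f assume f: "f \<in> Arr C"
  show "along (yoneda C X) f \<in> at (yoneda C X) (Cod C f) \<rightarrow>\<^sub>E at (yoneda C X) (Dom C f)"
  proof (rule PiE_I)
    fix x assume "x \<in> at (yoneda C X) (Cod C f)"
    then show "along (yoneda C X) f x \<in> at (yoneda C X) (Dom C f)"
      using f by (auto simp: yoneda_at yoneda_along Hom_iff)
  next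
    fix x assume "x \<notin> at (yoneda C X) (Cod C f)"
    then show "along (yoneda C X) f x = undefined" using f by (simp add: yoneda_def)
  qed
next
  fix A assume "A \<notin> Obj C"
  then show "at (yoneda C X) A = {}" using dom_obj by (auto simp: yoneda_at Hom_iff)
next
  fix f assume "f \<notin> Arr C" then show "along (yoneda C X) f = (\<lambda>x. undefined)" by (simp add: yoneda_def)
qed (auto simp: yoneda_at yoneda_along Hom_iff)

lemma day_map_facts:
  assumes a: "nat_trans C \<alpha>" and b: "nat_trans C \<beta>"
  shows "day_map C \<alpha> \<beta> \<in> Hom (Psh C) (day C (source \<alpha>) (source \<beta>)) (day C (target \<alpha>) (target \<beta>))"
    and "\<And>B D x y. \<lbrakk>x \<in> at (source \<alpha>) B; y \<in> at (source \<beta>) D\<rbrakk>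
      \<Longrightarrow> component (day_map C \<alpha> \<beta>) (B \<odot> D) (gen (source \<alpha>) (source \<beta>) B D x y)
        = gen (target \<alpha>) (target \<beta>) B D (component \<alpha> B x) (component \<beta> D y)"
proof -
  let ?\<Psi> = "\<lambda>A B D h x y. bracket (target \<alpha>) (target \<beta>) A B D h (component \<alpha> B x) (component \<beta> D y)"
  let ?\<phi> = "\<lambda>B D x y. gen (target \<alpha>) (target \<beta>) B D (component \<alpha> B x) (component \<beta> D y)"
  note [simp] = nat_transD[OF a] nat_transD[OF b]
  have *: "component (day_map C \<alpha> \<beta>) A = (\<lambda>t \<in> at (day C (source \<alpha>) (source \<beta>)) A.
      case t of Arrow _ \<Rightarrow> undefined | Tuple B D h x y \<Rightarrow> ?\<Psi> A B D h x y)" for A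
    by (simp add: day_map_def)
  have 1: "?\<Psi> (Dom C h) B D h x y = along (day C (target \<alpha>) (target \<beta>)) h (?\<phi> B D x y)"
    if "x \<in> at (source \<alpha>) B" "y \<in> at (source \<beta>) D" "B \<in> Obj C" "D \<in> Obj C" "h \<in> Arr C" "Cod C h = B \<odot> D"
    for B D h x y
    using that by (subst along_gen) simp_all
  have 2: "?\<phi> (Dom C b) (Dom C d) (along (source \<alpha>) b x) (along (source \<beta>) d y)
      = along (day C (target \<alpha>) (target \<beta>)) (b \<otimes> d) (?\<phi> (Cod C b) (Cod C d) x y)"
    if "b \<in> Arr C" "d \<in> Arr C" "x \<in> at (source \<alpha>) (Cod C b)" "y \<in> at (source \<beta>) (Cod C d)" for b d x y
    using that by (subst gen_slide[symmetric]) simp_all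
  note lift = day_lift[OF nat_transD(1)[OF a] nat_transD(1)[OF b] presheaf_day[OF nat_transD(2)[OF a] nat_transD(2)[OF b]] source_target(5,6) *, where \<phi>="?\<phi>"]
  show "day_map C \<alpha> \<beta> \<in> Hom (Psh C) (day C (source \<alpha>) (source \<beta>)) (day C (target \<alpha>) (target \<beta>))"
    by (rule lift(1)) (use 1 2 in simp_all)
  show "component (day_map C \<alpha> \<beta>) (B \<odot> D) (gen (source \<alpha>) (source \<beta>) B D x y) = ?\<phi> B D x y"
    if "x \<in> at (source \<alpha>) B" "y \<in> at (source \<beta>) D" for B D x y
    by (rule lift(2)) (use 1 2 that in simp_all)
qed

lemma nat_trans_day_map [simp]: "\<lbrakk>nat_trans C \<alpha>; nat_trans C \<beta>\<rbrakk> \<Longrightarrow> nat_trans C (day_map C \<alpha> \<beta>)"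
  using day_map_facts(1) by (simp add: Hom_Psh)

lemma day_map_gen:
  "\<lbrakk>nat_trans C \<alpha>; nat_trans C \<beta>; F = source \<alpha>; G = source \<beta>; x \<in> at F B; y \<in> at G D\<rbrakk>
    \<Longrightarrow> component (day_map C \<alpha> \<beta>) (B \<odot> D) (gen F G B D x y)
      = gen (target \<alpha>) (target \<beta>) B D (component \<alpha> B x) (component \<beta> D y)"
  using day_map_facts(2) by simp

lemma day_lunit_facts:
  assumes F: "presheaf C F"
  shows "day_lunit C F \<in> Hom (Psh C) (day C (yoneda C (Unit C)) F) F"
    and "\<And>B D i x. \<lbrakk>i \<in> Hom C B (Unit C); x \<in> at F D\<rbrakk>
      \<Longrightarrow> component (day_lunit C F) (B \<odot> D) (gen (yoneda C (Unit C)) F B D (Arrow i) x) = along F (act C i D) x"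
proof -
  let ?\<Psi> = "\<lambda>A B D h i x. case i of Arrow i \<Rightarrow> along F (LUnit C D \<cdot> (i \<otimes> Ident C D) \<cdot> h) x | Tuple _ _ _ _ _ \<Rightarrow> undefined"
  let ?\<phi> = "\<lambda>B D i x. case i of Arrow i \<Rightarrow> along F (act C i D) x | Tuple _ _ _ _ _ \<Rightarrow> undefined"
  have *: "component (day_lunit C F) A = (\<lambda>t \<in> at (day C (yoneda C (Unit C)) F) A.
      case t of Arrow _ \<Rightarrow> undefined | Tuple B D h x y \<Rightarrow> ?\<Psi> A B D h x y)" for A
    by (simp add: day_lunit_def)
  have 1: "?\<Psi> (Dom C h) B D h i x = along F h (?\<phi> B D i x)"
    if "i \<in> at (yoneda C (Unit C)) B" "x \<in> at F D" "B \<in> Obj C" "D \<in> Obj C" "h \<in> Arr C" "Cod C h = B \<odot> D"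
    for B D h i x
    using that F by (auto simp: yoneda_at Hom_iff along_along act_def)
  have 2: "?\<phi> (Dom C b) (Dom C d) (along (yoneda C (Unit C)) b i) (along F d x)
      = along F (b \<otimes> d) (?\<phi> (Cod C b) (Cod C d) i x)"
    if "b \<in> Arr C" "d \<in> Arr C" "i \<in> at (yoneda C (Unit C)) (Cod C b)" "x \<in> at F (Cod C d)" for b d i x
    using that F by (auto simp: yoneda_at Hom_iff yoneda_along along_along act_tensor_hom)
  have 3: "?\<phi> B D i x \<in> at F (B \<odot> D)"
    if "i \<in> at (yoneda C (Unit C)) B" "x \<in> at F D" "B \<in> Obj C" "D \<in> Obj C" for B D i x
    using that F by (auto simp: yoneda_at Hom_iff along_in)
  note lift = day_lift[OF presheaf_yoneda[OF unit_obj] F F source_target(9,10) *, where \<phi>="?\<phi>"]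
  show "day_lunit C F \<in> Hom (Psh C) (day C (yoneda C (Unit C)) F) F"
    by (rule lift(1)) (use 1 2 3 in simp_all)
  have "component (day_lunit C F) (B \<odot> D) (gen (yoneda C (Unit C)) F B D i x) = ?\<phi> B D i x"
    if "i \<in> at (yoneda C (Unit C)) B" "x \<in> at F D" for B D i x
    by (rule lift(2)) (use 1 2 3 that in simp_all)
  then show "component (day_lunit C F) (B \<odot> D) (gen (yoneda C (Unit C)) F B D (Arrow i) x) = along F (act C i D) x"
    if "i \<in> Hom C B (Unit C)" "x \<in> at F D" for B D i x using that by (simp add: yoneda_at)
qed

lemma runit_tensor_hom:
  assumes [simp]: "i \<in> Arr C" "Cod C i = Unit C" "b \<in> Arr C" "d \<in> Arr C" "Cod C d = Dom C i" and Y: "Y = Cod C b"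
  shows "RUnit C Y \<cdot> (Ident C Y \<otimes> i) \<cdot> (b \<otimes> d) = b \<cdot> RUnit C (Dom C b) \<cdot> (Ident C (Dom C b) \<otimes> (i \<cdot> d))"
proof -
  have "RUnit C Y \<cdot> (Ident C Y \<otimes> i) \<cdot> (b \<otimes> d) = (RUnit C Y \<cdot> (b \<otimes> Ident C (Unit C))) \<cdot> (Ident C (Dom C b) \<otimes> (i \<cdot> d))"
    by (simp add: inter Y)
  also have "\<dots> = b \<cdot> RUnit C (Dom C b) \<cdot> (Ident C (Dom C b) \<otimes> (i \<cdot> d))"
    unfolding Y by (subst runit_nat) simp_all
  finally show ?thesis .
qed

lemma day_runit_facts:
  assumes F: "presheaf C F"
  shows "day_runit C F \<in> Hom (Psh C) (day C F (yoneda C (Unit C))) F"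
    and "\<And>B D i x. \<lbrakk>i \<in> Hom C D (Unit C); x \<in> at F B\<rbrakk>
      \<Longrightarrow> component (day_runit C F) (B \<odot> D) (gen F (yoneda C (Unit C)) B D x (Arrow i))
        = along F (RUnit C B \<cdot> (Ident C B \<otimes> i)) x"
proof -
  let ?\<Psi> = "\<lambda>A B D h x i. case i of Arrow i \<Rightarrow> along F (RUnit C B \<cdot> (Ident C B \<otimes> i) \<cdot> h) x | Tuple _ _ _ _ _ \<Rightarrow> undefined"
  let ?\<phi> = "\<lambda>B D x i. case i of Arrow i \<Rightarrow> along F (RUnit C B \<cdot> (Ident C B \<otimes> i)) x | Tuple _ _ _ _ _ \<Rightarrow> undefined"
  have *: "component (day_runit C F) A = (\<lambda>t \<in> at (day C F (yoneda C (Unit C))) A.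
      case t of Arrow _ \<Rightarrow> undefined | Tuple B D h x y \<Rightarrow> ?\<Psi> A B D h x y)" for A
    by (simp add: day_runit_def)
  have 1: "?\<Psi> (Dom C h) B D h x i = along F h (?\<phi> B D x i)"
    if "x \<in> at F B" "i \<in> at (yoneda C (Unit C)) D" "B \<in> Obj C" "D \<in> Obj C" "h \<in> Arr C" "Cod C h = B \<odot> D"
    for B D h i x
    using that F by (auto simp: yoneda_at Hom_iff along_along)
  have 2: "?\<phi> (Dom C b) (Dom C d) (along F b x) (along (yoneda C (Unit C)) d i)
      = along F (b \<otimes> d) (?\<phi> (Cod C b) (Cod C d) x i)"
    if "b \<in> Arr C" "d \<in> Arr C" "x \<in> at F (Cod C b)" "i \<in> at (yoneda C (Unit C)) (Cod C d)" for b d i x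
    using that F by (auto simp: yoneda_at Hom_iff yoneda_along along_along runit_tensor_hom)
  have 3: "?\<phi> B D x i \<in> at F (B \<odot> D)"
    if "x \<in> at F B" "i \<in> at (yoneda C (Unit C)) D" "B \<in> Obj C" "D \<in> Obj C" for B D i x
    using that F by (auto simp: yoneda_at Hom_iff along_in)
  note lift = day_lift[OF F presheaf_yoneda[OF unit_obj] F source_target(11,12) *, where \<phi>="?\<phi>"]
  show "day_runit C F \<in> Hom (Psh C) (day C F (yoneda C (Unit C))) F"
    by (rule lift(1)) (use 1 2 3 in simp_all)
  have "component (day_runit C F) (B \<odot> D) (gen F (yoneda C (Unit C)) B D x i) = ?\<phi> B D x i"
    if "i \<in> at (yoneda C (Unit C)) D" "x \<in> at F B" for B D i x
    by (rule lift(2)) (use 1 2 3 that in simp_all)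
  then show "component (day_runit C F) (B \<odot> D) (gen F (yoneda C (Unit C)) B D x (Arrow i))
        = along F (RUnit C B \<cdot> (Ident C B \<otimes> i)) x"
    if "i \<in> Hom C D (Unit C)" "x \<in> at F B" for B D i x using that by (simp add: yoneda_at)
qed

lemma day_braid_facts:
  assumes F: "presheaf C F" and G: "presheaf C G"
  shows "day_braid C F G \<in> Hom (Psh C) (day C F G) (day C G F)"
    and "\<And>B D x y. \<lbrakk>x \<in> at F B; y \<in> at G D\<rbrakk>
      \<Longrightarrow> component (day_braid C F G) (B \<odot> D) (gen F G B D x y) = along (day C G F) (Braid C B D) (gen G F D B y x)"
proof -
  let ?\<Psi> = "\<lambda>A B D h x y. bracket G F A D B (Braid C B D \<cdot> h) y x"
  let ?\<phi> = "\<lambda>B D x y. along (day C G F) (Braid C B D) (gen G F D B y x)"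
  note [simp] = F G
  have *: "component (day_braid C F G) A = (\<lambda>t \<in> at (day C F G) A.
      case t of Arrow _ \<Rightarrow> undefined | Tuple B D h x y \<Rightarrow> ?\<Psi> A B D h x y)" for A
    by (simp add: day_braid_def)
  have 1: "?\<Psi> (Dom C h) B D h x y = along (day C G F) h (?\<phi> B D x y)"
    if "x \<in> at F B" "y \<in> at G D" "B \<in> Obj C" "D \<in> Obj C" "h \<in> Arr C" "Cod C h = B \<odot> D" for B D h x y
    using that along_gen[of y G D x F B "Braid C B D \<cdot> h"] by (simp add: along_along)
  have 2: "?\<phi> (Dom C b) (Dom C d) (along F b x) (along G d y) = along (day C G F) (b \<otimes> d) (?\<phi> (Cod C b) (Cod C d) x y)"
    if "b \<in> Arr C" "d \<in> Arr C" "x \<in> at F (Cod C b)" "y \<in> at G (Cod C d)" for b d x y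
    using that by (simp add: gen_slide along_along braid_nat)
  have 3: "?\<phi> B D x y \<in> at (day C G F) (B \<odot> D)"
    if "x \<in> at F B" "y \<in> at G D" "B \<in> Obj C" "D \<in> Obj C" for B D x y
    using that by (simp add: along_in)
  note lift = day_lift[OF F G presheaf_day[OF G F] source_target(13,14) *, where \<phi>="?\<phi>"]
  show "day_braid C F G \<in> Hom (Psh C) (day C F G) (day C G F)"
    by (rule lift(1)) (use 1 2 3 in simp_all)
  show "component (day_braid C F G) (B \<odot> D) (gen F G B D x y) = ?\<phi> B D x y"
    if "x \<in> at F B" "y \<in> at G D" for B D x y
    by (rule lift(2)) (use 1 2 3 that in simp_all)
qed

lemma assoc_nat_tail:
  assumes [simp]: "f \<in> Arr C" "g \<in> Arr C" "h \<in> Arr C" "k \<in> Arr C" "l \<in> Arr C"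
    "Cod C k = Dom C f \<odot> Dom C g" "Cod C l = Dom C h" "X' = Cod C f" "Y' = Cod C g" "Z' = Cod C h"
  shows "Assoc C X' Y' Z' \<cdot> (((f \<otimes> g) \<cdot> k) \<otimes> (h \<cdot> l))
    = (f \<otimes> (g \<otimes> h)) \<cdot> Assoc C (Dom C f) (Dom C g) (Dom C h) \<cdot> (k \<otimes> l)"
proof -
  have "Assoc C X' Y' Z' \<cdot> (((f \<otimes> g) \<cdot> k) \<otimes> (h \<cdot> l)) = (Assoc C X' Y' Z' \<cdot> ((f \<otimes> g) \<otimes> h)) \<cdot> (k \<otimes> l)"
    by (simp add: inter)
  then show ?thesis by (simp add: assoc_nat)
qed

text \<open>The first component of a representative over \<open>(F \<otimes> G) \<otimes> H\<close> is itself a chosen representative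
  \<open>(B1, B2, k, x, y)\<close>. So the map is well defined for two reasons: by \<open>resp\<close> the choice of
  the inner representative is immaterial, and by the naturality required by \<open>day_lift\<close> that of the outer one.\<close>

lemma day_assoc_facts:
  assumes F: "presheaf C F" and G: "presheaf C G" and H: "presheaf C H"
  shows "day_assoc C F G H \<in> Hom (Psh C) (day C (day C F G) H) (day C F (day C G H))"
    and "\<And>B D E x y z. \<lbrakk>x \<in> at F B; y \<in> at G D; z \<in> at H E\<rbrakk>
      \<Longrightarrow> component (day_assoc C F G H) ((B \<odot> D) \<odot> E) (gen (day C F G) H (B \<odot> D) E (gen F G B D x y) z)
        = along (day C F (day C G H)) (Assoc C B D E) (gen F (day C G H) B (D \<odot> E) x (gen G H D E y z))"
proof -
  note [simp] = F G H
  let ?K = "day C F (day C G H)"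
  let ?\<Psi> = "\<lambda>A B D h w z. case w of Arrow _ \<Rightarrow> undefined | Tuple B1 B2 k x y \<Rightarrow>
    bracket F (day C G H) A B1 (B2 \<odot> D) (Assoc C B1 B2 D \<cdot> (k \<otimes> Ident C D) \<cdot> h) x (gen G H B2 D y z)"
  let ?\<theta> = "\<lambda>D z B1 B2 k x y. along ?K (Assoc C B1 B2 D \<cdot> (k \<otimes> Ident C D))
    (gen F (day C G H) B1 (B2 \<odot> D) x (gen G H B2 D y z))"
  let ?\<phi> = "\<lambda>B D w z. case w of Arrow _ \<Rightarrow> undefined | Tuple B1 B2 k x y \<Rightarrow> ?\<theta> D z B1 B2 k x y"
  have *: "component (day_assoc C F G H) A = (\<lambda>t \<in> at (day C (day C F G) H) A.
      case t of Arrow _ \<Rightarrow> undefined | Tuple B D h x y \<Rightarrow> ?\<Psi> A B D h x y)" for A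
    by (simp only: day_assoc_def gen_def nat_trans.simps)
  have resp: "?\<theta> D z B1 B2 k (along F b x) (along G d y) = ?\<theta> D z B1' B2' ((b \<otimes> d) \<cdot> k) x y"
    if "b \<in> Hom C B1 B1'" "d \<in> Hom C B2 B2'" "k \<in> Hom C B (B1 \<odot> B2)" "x \<in> at F B1'" "y \<in> at G B2'"
      "z \<in> at H D" "D \<in> Obj C" for B B1 B2 B1' B2' b d k x y D z
  proof -
    have [simp]: "b \<in> Arr C" "Dom C b = B1" "Cod C b = B1'" "d \<in> Arr C" "Dom C d = B2" "Cod C d = B2'"
      "k \<in> Arr C" "Dom C k = B" "Cod C k = B1 \<odot> B2" "B \<in> Obj C" "B1 \<in> Obj C" "B2 \<in> Obj C" "B1' \<in> Obj C" "B2' \<in> Obj C"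
      using that(1-3) by (auto simp: Hom_iff)
    have "gen F (day C G H) B1 (B2 \<odot> D) (along F b x) (gen G H B2 D (along G d y) z)
        = along ?K (b \<otimes> (d \<otimes> Ident C D)) (gen F (day C G H) B1' (B2' \<odot> D) x (gen G H B2' D y z))"
      using that gen_slide[of b "d \<otimes> Ident C D" x F "gen G H B2' D y z" "day C G H"]
      by (simp add: gen_slide_left)
    then show ?thesis
      using that assoc_nat_tail[of b d "Ident C D" k "Ident C D" B1' B2' D] by (simp add: along_along along_in)
  qed
  have eval: "?\<phi> B D (along (day C F G) k (gen F G B1 B2 x y)) z = ?\<theta> D z B1 B2 k x y"
    if "x \<in> at F B1" "y \<in> at G B2" "k \<in> Arr C" "Dom C k = B" "Cod C k = B1 \<odot> B2" "z \<in> at H D" "D \<in> Obj C"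
    for B D B1 B2 k x y z
    by (rule day_case[where A=B]) (use that resp in simp_all)
  have 1: "?\<Psi> (Dom C h) B D h w z = along ?K h (?\<phi> B D w z)"
    if w: "w \<in> at (day C F G) B" "z \<in> at H D" "B \<in> Obj C" "D \<in> Obj C" "h \<in> Arr C" "Cod C h = B \<odot> D" for B D h w z
  proof -
    obtain B1 B2 k x y where t: "x \<in> at F B1" "y \<in> at G B2" "k \<in> Arr C" "Dom C k = B" "Cod C k = B1 \<odot> B2"
      "B1 \<in> Obj C" "B2 \<in> Obj C" "w = along (day C F G) k (gen F G B1 B2 x y)"
      using w(1) F G by (rule dayE)
    have b: "bracket F (day C G H) (Dom C h) B1 (B2 \<odot> D) (Assoc C B1 B2 D \<cdot> (k \<otimes> Ident C D) \<cdot> h) x (gen G H B2 D y z)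
        = along ?K h (?\<theta> D z B1 B2 k x y)"
      if "x \<in> at F B1" "y \<in> at G B2" "k \<in> Arr C" "Dom C k = B" "Cod C k = B1 \<odot> B2" "B1 \<in> Obj C" "B2 \<in> Obj C"
      for B1 B2 k x y
    proof -
      note [simp] = that w(2-)
      have "bracket F (day C G H) (Dom C h) B1 (B2 \<odot> D) (Assoc C B1 B2 D \<cdot> (k \<otimes> Ident C D) \<cdot> h) x (gen G H B2 D y z)
        = along ?K (Assoc C B1 B2 D \<cdot> (k \<otimes> Ident C D) \<cdot> h) (gen F (day C G H) B1 (B2 \<odot> D) x (gen G H B2 D y z))"
        by (subst along_gen) simp_all
      also have "\<dots> = along ?K h (?\<theta> D z B1 B2 k x y)" by (simp add: along_along)
      finally show ?thesis .
    qed
    have "?\<Psi> (Dom C h) B D h w z = bracket F (day C G H) (Dom C h) B1 (B2 \<odot> D) (Assoc C B1 B2 D \<cdot> (k \<otimes> Ident C D) \<cdot> h) x (gen G H B2 D y z)"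
      unfolding t(8)
    proof (rule day_case[where A=B])
      fix B' B'' D' D'' b' d h' x y
      assume a: "b' \<in> Hom C B' B''" "d \<in> Hom C D' D''" "h' \<in> Hom C B (B' \<odot> D')" "x \<in> at F B''" "y \<in> at G D''"
      have o: "b' \<in> Arr C" "Dom C b' = B'" "Cod C b' = B''" "d \<in> Arr C" "Dom C d = D'" "Cod C d = D''"
         "h' \<in> Arr C" "Dom C h' = B" "Cod C h' = B' \<odot> D'" "B' \<in> Obj C" "D' \<in> Obj C" "B'' \<in> Obj C" "D'' \<in> Obj C"
        using a(1-3) by (auto simp: Hom_iff)
      show "bracket F (day C G H) (Dom C h) B' (D' \<odot> D) (Assoc C B' D' D \<cdot> (h' \<otimes> Ident C D) \<cdot> h) (along F b' x) (gen G H D' D (along G d y) z)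
        = bracket F (day C G H) (Dom C h) B'' (D'' \<odot> D) (Assoc C B'' D'' D \<cdot> (((b' \<otimes> d) \<cdot> h') \<otimes> Ident C D) \<cdot> h) x (gen G H D'' D y z)"
        using b[of "along F b' x" B' "along G d y" D' h'] b[of x B'' y D'' "(b' \<otimes> d) \<cdot> h'"]
          resp[OF a w(2,4)] o a(4,5) by (simp add: along_in)
    qed (use t in simp_all)
    also have "\<dots> = along ?K h (?\<theta> D z B1 B2 k x y)" by (rule b) (use t in simp_all)
    also have "\<dots> = along ?K h (?\<phi> B D w z)" unfolding t(8) by (subst eval) (use t w in simp_all)
    finally show ?thesis .
  qed
  have 2: "?\<phi> (Dom C b) (Dom C d) (along (day C F G) b w) (along H d z) = along ?K (b \<otimes> d) (?\<phi> (Cod C b) (Cod C d) w z)"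
    if w: "b \<in> Arr C" "d \<in> Arr C" "w \<in> at (day C F G) (Cod C b)" "z \<in> at H (Cod C d)" for b d w z
  proof -
    obtain B1 B2 k x y where t: "x \<in> at F B1" "y \<in> at G B2" "k \<in> Arr C" "Dom C k = Cod C b" "Cod C k = B1 \<odot> B2"
      "B1 \<in> Obj C" "B2 \<in> Obj C" "w = along (day C F G) k (gen F G B1 B2 x y)"
      using w(3) F G by (rule dayE)
    have g: "gen F (day C G H) B1 (B2 \<odot> Dom C d) x (gen G H B2 (Dom C d) y (along H d z))
      = along ?K (Ident C B1 \<otimes> (Ident C B2 \<otimes> d)) (gen F (day C G H) B1 (B2 \<odot> Cod C d) x (gen G H B2 (Cod C d) y z))"
      using t w by (simp add: gen_slide_right)
    have "?\<phi> (Dom C b) (Dom C d) (along (day C F G) b w) (along H d z)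
        = ?\<theta> (Dom C d) (along H d z) B1 B2 (k \<cdot> b) x y"
      using eval[of x B1 y B2 "k \<cdot> b" "Dom C b" "along H d z" "Dom C d"] t w by (simp add: along_along along_in)
    also have "\<dots> = along ?K ((Ident C B1 \<otimes> (Ident C B2 \<otimes> d)) \<cdot> Assoc C B1 B2 (Dom C d) \<cdot> ((k \<cdot> b) \<otimes> Ident C (Dom C d)))
        (gen F (day C G H) B1 (B2 \<odot> Cod C d) x (gen G H B2 (Cod C d) y z))"
      unfolding g using t w by (simp add: along_along)
    also have "(Ident C B1 \<otimes> (Ident C B2 \<otimes> d)) \<cdot> Assoc C B1 B2 (Dom C d) \<cdot> ((k \<cdot> b) \<otimes> Ident C (Dom C d))
        = (Assoc C B1 B2 (Cod C d) \<cdot> (k \<otimes> Ident C (Cod C d))) \<cdot> (b \<otimes> d)"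
      using assoc_nat_tail[of "Ident C B1" "Ident C B2" d "k \<cdot> b" "Ident C (Dom C d)" B1 B2 "Cod C d"] t(1-7) w
      by (simp add: inter)
    also have "along ?K \<dots> (gen F (day C G H) B1 (B2 \<odot> Cod C d) x (gen G H B2 (Cod C d) y z))
        = along ?K (b \<otimes> d) (?\<theta> (Cod C d) z B1 B2 k x y)"
      using t(1-7) w by (subst along_along) simp_all
    also have "\<dots> = along ?K (b \<otimes> d) (?\<phi> (Cod C b) (Cod C d) w z)"
      unfolding t(8) by (subst eval) (use t w in simp_all)
    finally show ?thesis .
  qed
  have 3: "?\<phi> B D w z \<in> at ?K (B \<odot> D)"
    if w: "w \<in> at (day C F G) B" "z \<in> at H D" "B \<in> Obj C" "D \<in> Obj C" for B D w z
  proof -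
    obtain B1 B2 k x y where t: "x \<in> at F B1" "y \<in> at G B2" "k \<in> Arr C" "Dom C k = B" "Cod C k = B1 \<odot> B2"
      "B1 \<in> Obj C" "B2 \<in> Obj C" "w = along (day C F G) k (gen F G B1 B2 x y)"
      using w(1) F G by (rule dayE)
    show ?thesis unfolding t(8) by (subst eval) (use t w in \<open>simp_all add: along_in\<close>)
  qed
  note lift = day_lift[OF presheaf_day[OF F G] H presheaf_day[OF F presheaf_day[OF G H]] source_target(7,8) *, where \<phi>="?\<phi>"]
  show "day_assoc C F G H \<in> Hom (Psh C) (day C (day C F G) H) ?K"
    by (rule lift(1)) (use 1 2 3 in simp_all)
  have l2: "component (day_assoc C F G H) (B \<odot> D) (gen (day C F G) H B D w z) = ?\<phi> B D w z"
    if "w \<in> at (day C F G) B" "z \<in> at H D" for B D w z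
    by (rule lift(2)) (use 1 2 3 that in simp_all)
  show "component (day_assoc C F G H) ((B \<odot> D) \<odot> E) (gen (day C F G) H (B \<odot> D) E (gen F G B D x y) z)
        = along ?K (Assoc C B D E) (gen F (day C G H) B (D \<odot> E) x (gen G H D E y z))"
    if x: "x \<in> at F B" "y \<in> at G D" "z \<in> at H E" for B D E x y z
  proof -
    have o [simp]: "B \<in> Obj C" "D \<in> Obj C" "E \<in> Obj C" using x presheafD(1)[OF F] presheafD(1)[OF G] presheafD(1)[OF H] by auto
    have "gen F G B D x y = along (day C F G) (Ident C (B \<odot> D)) (gen F G B D x y)"
      using presheafD(3)[OF presheaf_day[OF F G] gen_in_day[OF x(1,2) F G]] by simp
    then have "?\<phi> (B \<odot> D) E (gen F G B D x y) z = ?\<theta> E z B D (Ident C (B \<odot> D)) x y"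
      using eval[of x B y D "Ident C (B \<odot> D)" "B \<odot> D" z E] x by simp
    then show ?thesis using l2[of "gen F G B D x y" "B \<odot> D" z E] x by simp
  qed
qed

end

context braided
begin

lemma day_eqI:
  assumes "nat_trans C \<alpha>" "nat_trans C \<beta>" "source \<alpha> = day C F G" "source \<beta> = day C F G" "target \<alpha> = target \<beta>"
    "presheaf C F" "presheaf C G"
    "\<And>B D x y. \<lbrakk>x \<in> at F B; y \<in> at G D; B \<in> Obj C; D \<in> Obj C\<rbrakk>
      \<Longrightarrow> component \<alpha> (B \<odot> D) (gen F G B D x y) = component \<beta> (B \<odot> D) (gen F G B D x y)"
  shows "\<alpha> = \<beta>"
  by (rule day_ext[of \<alpha> F G "target \<alpha>"]) (use assms in \<open>simp_all add: Hom_Psh\<close>)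

lemma day_eqI_left:
  assumes ab: "nat_trans C \<alpha>" "nat_trans C \<beta>" "source \<alpha> = day C (day C F G) H" "source \<beta> = day C (day C F G) H"
    "target \<alpha> = target \<beta>" and [simp]: "presheaf C F" "presheaf C G" "presheaf C H"
    and eq: "\<And>B D E x y z. \<lbrakk>x \<in> at F B; y \<in> at G D; z \<in> at H E; B \<in> Obj C; D \<in> Obj C; E \<in> Obj C\<rbrakk>
      \<Longrightarrow> component \<alpha> ((B \<odot> D) \<odot> E) (gen (day C F G) H (B \<odot> D) E (gen F G B D x y) z)
        = component \<beta> ((B \<odot> D) \<odot> E) (gen (day C F G) H (B \<odot> D) E (gen F G B D x y) z)"
  shows "\<alpha> = \<beta>"
proof (rule day_eqI[OF ab])
  fix A E w z assume w: "w \<in> at (day C F G) A" "z \<in> at H E" "A \<in> Obj C" "E \<in> Obj C"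
  obtain B D h x y where t: "x \<in> at F B" "y \<in> at G D" "h \<in> Arr C" "Dom C h = A" "Cod C h = B \<odot> D"
    "B \<in> Obj C" "D \<in> Obj C" "w = along (day C F G) h (gen F G B D x y)"
    using w(1) by (rule dayE) simp_all
  have g: "gen (day C F G) H A E w z = along (day C (day C F G) H) (h \<otimes> Ident C E) (gen (day C F G) H (B \<odot> D) E (gen F G B D x y) z)"
    unfolding t(8) using t(1-7) w(2-) by (simp add: gen_slide_left)
  have n: "component \<gamma> (A \<odot> E) (gen (day C F G) H A E w z)
      = along (target \<gamma>) (h \<otimes> Ident C E) (component \<gamma> ((B \<odot> D) \<odot> E) (gen (day C F G) H (B \<odot> D) E (gen F G B D x y) z))"
    if "nat_trans C \<gamma>" "source \<gamma> = day C (day C F G) H" for \<gamma>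
    unfolding g using t(1-7) w(2-) that by (subst nat_transD(4)[OF that(1)]) simp_all
  show "component \<alpha> (A \<odot> E) (gen (day C F G) H A E w z) = component \<beta> (A \<odot> E) (gen (day C F G) H A E w z)"
    using n[OF ab(1,3)] n[OF ab(2,4)] eq[OF t(1,2) w(2) t(6,7) w(4)] ab(5) by simp
qed simp_all

lemma day_eqI_right:
  assumes ab: "nat_trans C \<alpha>" "nat_trans C \<beta>" "source \<alpha> = day C F (day C G H)" "source \<beta> = day C F (day C G H)"
    "target \<alpha> = target \<beta>" and [simp]: "presheaf C F" "presheaf C G" "presheaf C H"
    and eq: "\<And>B D E x y z. \<lbrakk>x \<in> at F B; y \<in> at G D; z \<in> at H E; B \<in> Obj C; D \<in> Obj C; E \<in> Obj C\<rbrakk>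
      \<Longrightarrow> component \<alpha> (B \<odot> D \<odot> E) (gen F (day C G H) B (D \<odot> E) x (gen G H D E y z))
        = component \<beta> (B \<odot> D \<odot> E) (gen F (day C G H) B (D \<odot> E) x (gen G H D E y z))"
  shows "\<alpha> = \<beta>"
proof (rule day_eqI[OF ab])
  fix B A x w assume w: "x \<in> at F B" "w \<in> at (day C G H) A" "B \<in> Obj C" "A \<in> Obj C"
  obtain D E h y z where t: "y \<in> at G D" "z \<in> at H E" "h \<in> Arr C" "Dom C h = A" "Cod C h = D \<odot> E"
    "D \<in> Obj C" "E \<in> Obj C" "w = along (day C G H) h (gen G H D E y z)"
    using w(2) by (rule dayE) simp_all
  have g: "gen F (day C G H) B A x w = along (day C F (day C G H)) (Ident C B \<otimes> h) (gen F (day C G H) B (D \<odot> E) x (gen G H D E y z))"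
    unfolding t(8) using t(1-7) w(1,3) by (simp add: gen_slide_right)
  have n: "component \<gamma> (B \<odot> A) (gen F (day C G H) B A x w)
      = along (target \<gamma>) (Ident C B \<otimes> h) (component \<gamma> (B \<odot> D \<odot> E) (gen F (day C G H) B (D \<odot> E) x (gen G H D E y z)))"
    if "nat_trans C \<gamma>" "source \<gamma> = day C F (day C G H)" for \<gamma>
    unfolding g using t(1-7) w(1,3) that by (subst nat_transD(4)[OF that(1)]) simp_all
  show "component \<alpha> (B \<odot> A) (gen F (day C G H) B A x w) = component \<beta> (B \<odot> A) (gen F (day C G H) B A x w)"
    using n[OF ab(1,3)] n[OF ab(2,4)] eq[OF w(1) t(1,2) w(3) t(6,7)] ab(5) by simp
qed simp_all

lemma nat_trans_structure [simp]:
  assumes "presheaf C F"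
  shows "nat_trans C (day_lunit C F)" "nat_trans C (day_runit C F)"
    "presheaf C G \<Longrightarrow> nat_trans C (day_braid C F G)"
    "\<lbrakk>presheaf C G; presheaf C H\<rbrakk> \<Longrightarrow> nat_trans C (day_assoc C F G H)"
  using day_lunit_facts(1)[OF assms] day_runit_facts(1)[OF assms] day_braid_facts(1)[OF assms]
    day_assoc_facts(1)[OF assms] by (simp_all add: Hom_Psh)

lemma structure_gen:
  assumes "presheaf C F"
  shows "\<lbrakk>i \<in> Arr C; Dom C i = B; Cod C i = Unit C; x \<in> at F D\<rbrakk>
      \<Longrightarrow> component (day_lunit C F) (B \<odot> D) (gen (yoneda C (Unit C)) F B D (Arrow i) x) = along F (act C i D) x"
    "\<lbrakk>i \<in> Arr C; Dom C i = D; Cod C i = Unit C; x \<in> at F B\<rbrakk>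
      \<Longrightarrow> component (day_runit C F) (B \<odot> D) (gen F (yoneda C (Unit C)) B D x (Arrow i))
        = along F (RUnit C B \<cdot> (Ident C B \<otimes> i)) x"
    "\<lbrakk>presheaf C G; x \<in> at F B; y \<in> at G D\<rbrakk>
      \<Longrightarrow> component (day_braid C F G) (B \<odot> D) (gen F G B D x y) = along (day C G F) (Braid C B D) (gen G F D B y x)"
    "\<lbrakk>presheaf C G; presheaf C H; x \<in> at F B; y \<in> at G D; z \<in> at H E\<rbrakk>
      \<Longrightarrow> component (day_assoc C F G H) ((B \<odot> D) \<odot> E) (gen (day C F G) H (B \<odot> D) E (gen F G B D x y) z)
        = along (day C F (day C G H)) (Assoc C B D E) (gen F (day C G H) B (D \<odot> E) x (gen G H D E y z))"
  using day_lunit_facts(2)[OF assms, of i B x D] day_runit_facts(2)[OF assms, of i D x B]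
    day_braid_facts(2)[OF assms] day_assoc_facts(2)[OF assms] by (simp_all add: Hom_iff)

text \<open>The transformation induced on the coend by a natural family \<open>\<phi>\<close>, used for inverses of structure maps.\<close>

definition lift_map :: "('o, 'a) psh \<Rightarrow> ('o, 'a) psh \<Rightarrow> ('o, 'a) psh \<Rightarrow>
    ('o \<Rightarrow> 'o \<Rightarrow> ('o, 'a) elt \<Rightarrow> ('o, 'a) elt \<Rightarrow> ('o, 'a) elt) \<Rightarrow> ('o, 'a) psh_map" where
  "lift_map F G H \<phi> = \<lparr>source = day C F G, target = H,
     component = (\<lambda>A. \<lambda>t \<in> at (day C F G) A. case t of Tuple B D h x y \<Rightarrow> along H h (\<phi> B D x y))\<rparr>"

lemma lift_map:
  assumes F: "presheaf C F" and G: "presheaf C G" and H: "presheaf C H"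
    and in_H: "\<And>B D x y. \<lbrakk>x \<in> at F B; y \<in> at G D; B \<in> Obj C; D \<in> Obj C\<rbrakk> \<Longrightarrow> \<phi> B D x y \<in> at H (B \<odot> D)"
    and nat: "\<And>b d x y. \<lbrakk>b \<in> Arr C; d \<in> Arr C; x \<in> at F (Cod C b); y \<in> at G (Cod C d)\<rbrakk>
      \<Longrightarrow> \<phi> (Dom C b) (Dom C d) (along F b x) (along G d y) = along H (b \<otimes> d) (\<phi> (Cod C b) (Cod C d) x y)"
  shows "lift_map F G H \<phi> \<in> Hom (Psh C) (day C F G) H"
    and "\<And>B D x y. \<lbrakk>x \<in> at F B; y \<in> at G D\<rbrakk> \<Longrightarrow> component (lift_map F G H \<phi>) (B \<odot> D) (gen F G B D x y) = \<phi> B D x y"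
proof -
  have c: "component (lift_map F G H \<phi>) A = (\<lambda>t \<in> at (day C F G) A.
      case t of Arrow _ \<Rightarrow> undefined | Tuple B D h x y \<Rightarrow> along H h (\<phi> B D x y))"
    and s: "source (lift_map F G H \<phi>) = day C F G" "target (lift_map F G H \<phi>) = H" for A
    by (simp_all add: lift_map_def)
  note lift = day_lift[OF F G H s c, where \<phi>=\<phi>]
  show "lift_map F G H \<phi> \<in> Hom (Psh C) (day C F G) H"
    by (rule lift(1)) (use in_H nat in simp_all)
  show "component (lift_map F G H \<phi>) (B \<odot> D) (gen F G B D x y) = \<phi> B D x y"
    if "x \<in> at F B" "y \<in> at G D" for B D x y
    by (rule lift(2)) (use in_H nat that in simp_all)
qed

lemma inv_assoc_nat_tail:
  assumes [simp]: "f \<in> Arr C" "g \<in> Arr C" "h \<in> Arr C" "k \<in> Arr C" "l \<in> Arr C"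
    "Cod C k = Dom C g \<odot> Dom C h" "Cod C l = Dom C f" "X' = Cod C f" "Y' = Cod C g" "Z' = Cod C h"
  shows "inv_arrow C (Assoc C X' Y' Z') \<cdot> ((f \<cdot> l) \<otimes> ((g \<otimes> h) \<cdot> k))
    = ((f \<otimes> g) \<otimes> h) \<cdot> inv_arrow C (Assoc C (Dom C f) (Dom C g) (Dom C h)) \<cdot> (l \<otimes> k)"
proof (rule monicD[OF iso_monic[OF assoc_iso]])
  have "Assoc C X' Y' Z' \<cdot> ((f \<otimes> g) \<otimes> h) \<cdot> inv_arrow C (Assoc C (Dom C f) (Dom C g) (Dom C h)) \<cdot> (l \<otimes> k)
      = (Assoc C X' Y' Z' \<cdot> ((f \<otimes> g) \<otimes> h)) \<cdot> inv_arrow C (Assoc C (Dom C f) (Dom C g) (Dom C h)) \<cdot> (l \<otimes> k)" by simp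
  also have "\<dots> = (f \<otimes> (g \<otimes> h)) \<cdot> (l \<otimes> k)" by (subst assoc_nat) simp_all
  also have "\<dots> = Assoc C X' Y' Z' \<cdot> inv_arrow C (Assoc C X' Y' Z') \<cdot> ((f \<cdot> l) \<otimes> ((g \<otimes> h) \<cdot> k))"
    by (simp add: inter)
  finally show "Assoc C X' Y' Z' \<cdot> inv_arrow C (Assoc C X' Y' Z') \<cdot> ((f \<cdot> l) \<otimes> ((g \<otimes> h) \<cdot> k))
      = Assoc C X' Y' Z' \<cdot> ((f \<otimes> g) \<otimes> h) \<cdot> inv_arrow C (Assoc C (Dom C f) (Dom C g) (Dom C h)) \<cdot> (l \<otimes> k)" ..
qed simp_all

text \<open>The mirror image of the associator, using the inverse associator of \<open>C\<close>. Again the second component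
  of a representative is a chosen representative, and \<open>eval\<close> shows that the choice does not matter.\<close>

lemma day_assoc_inverse_exists:
  assumes F: "presheaf C F" and G: "presheaf C G" and H: "presheaf C H"
  obtains \<beta> where "\<beta> \<in> Hom (Psh C) (day C F (day C G H)) (day C (day C F G) H)"
    "\<And>B D E x y z. \<lbrakk>x \<in> at F B; y \<in> at G D; z \<in> at H E\<rbrakk>
      \<Longrightarrow> component \<beta> (B \<odot> D \<odot> E) (gen F (day C G H) B (D \<odot> E) x (gen G H D E y z))
        = along (day C (day C F G) H) (inv_arrow C (Assoc C B D E)) (gen (day C F G) H (B \<odot> D) E (gen F G B D x y) z)"
proof -
  note [simp] = F G H
  let ?K = "day C (day C F G) H"
  let ?\<theta> = "\<lambda>B x B1 B2 k y z. along ?K (inv_arrow C (Assoc C B B1 B2) \<cdot> (Ident C B \<otimes> k))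
    (gen (day C F G) H (B \<odot> B1) B2 (gen F G B B1 x y) z)"
  let ?\<phi> = "\<lambda>B D x w. case w of Arrow _ \<Rightarrow> undefined | Tuple B1 B2 k y z \<Rightarrow> ?\<theta> B x B1 B2 k y z"
  have eval: "?\<phi> B D x (along (day C G H) k (gen G H B1 B2 y z)) = ?\<theta> B x B1 B2 k y z"
    if v: "y \<in> at G B1" "z \<in> at H B2" "k \<in> Arr C" "Dom C k = D" "Cod C k = B1 \<odot> B2" "x \<in> at F B" "B \<in> Obj C"
    for B D B1 B2 k x y z
  proof (rule day_case[where A=D])
    fix B1 B1' B2 B2' b d k y z
    assume a: "b \<in> Hom C B1 B1'" "d \<in> Hom C B2 B2'" "k \<in> Hom C D (B1 \<odot> B2)" "y \<in> at G B1'" "z \<in> at H B2'"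
    have [simp]: "b \<in> Arr C" "Dom C b = B1" "Cod C b = B1'" "d \<in> Arr C" "Dom C d = B2" "Cod C d = B2'"
      "k \<in> Arr C" "Dom C k = D" "Cod C k = B1 \<odot> B2" "D \<in> Obj C" "B1 \<in> Obj C" "B2 \<in> Obj C" "B1' \<in> Obj C" "B2' \<in> Obj C"
      using a(1-3) by (auto simp: Hom_iff)
    have "gen (day C F G) H (B \<odot> B1) B2 (gen F G B B1 x (along G b y)) (along H d z)
        = along ?K ((Ident C B \<otimes> b) \<otimes> d) (gen (day C F G) H (B \<odot> B1') B2' (gen F G B B1' x y) z)"
      using a(4,5) v(6,7) gen_slide[of "Ident C B \<otimes> b" d "gen F G B B1' x y" "day C F G" z H]
      by (simp add: gen_slide_right)
    then show "?\<theta> B x B1 B2 k (along G b y) (along H d z) = ?\<theta> B x B1' B2' ((b \<otimes> d) \<cdot> k) y z"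
      using a(4,5) v(6,7) inv_assoc_nat_tail[of "Ident C B" b d k "Ident C B" B B1' B2'] by (simp add: along_along along_in)
  qed (use v in simp_all)
  have 2: "?\<phi> (Dom C b) (Dom C d) (along F b x) (along (day C G H) d w) = along ?K (b \<otimes> d) (?\<phi> (Cod C b) (Cod C d) x w)"
    if w: "b \<in> Arr C" "d \<in> Arr C" "x \<in> at F (Cod C b)" "w \<in> at (day C G H) (Cod C d)" for b d x w
  proof -
    obtain B1 B2 k y z where t: "y \<in> at G B1" "z \<in> at H B2" "k \<in> Arr C" "Dom C k = Cod C d" "Cod C k = B1 \<odot> B2"
      "B1 \<in> Obj C" "B2 \<in> Obj C" "w = along (day C G H) k (gen G H B1 B2 y z)"
      using w(4) G H by (rule dayE)
    have g: "gen (day C F G) H (Dom C b \<odot> B1) B2 (gen F G (Dom C b) B1 (along F b x) y) z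
      = along ?K ((b \<otimes> Ident C B1) \<otimes> Ident C B2) (gen (day C F G) H (Cod C b \<odot> B1) B2 (gen F G (Cod C b) B1 x y) z)"
      using t(1-7) w(1-3) by (simp add: gen_slide_left)
    have "?\<phi> (Dom C b) (Dom C d) (along F b x) (along (day C G H) d w)
        = ?\<theta> (Dom C b) (along F b x) B1 B2 (k \<cdot> d) y z"
      using eval[of y B1 z B2 "k \<cdot> d" "Dom C d" "along F b x" "Dom C b"] t w by (simp add: along_along along_in)
    also have "\<dots> = along ?K (((b \<otimes> Ident C B1) \<otimes> Ident C B2) \<cdot> inv_arrow C (Assoc C (Dom C b) B1 B2) \<cdot> (Ident C (Dom C b) \<otimes> (k \<cdot> d)))
        (gen (day C F G) H (Cod C b \<odot> B1) B2 (gen F G (Cod C b) B1 x y) z)"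
      unfolding g using t(1-7) w(1-3) by (simp add: along_along)
    also have "((b \<otimes> Ident C B1) \<otimes> Ident C B2) \<cdot> inv_arrow C (Assoc C (Dom C b) B1 B2) \<cdot> (Ident C (Dom C b) \<otimes> (k \<cdot> d))
        = (inv_arrow C (Assoc C (Cod C b) B1 B2) \<cdot> (Ident C (Cod C b) \<otimes> k)) \<cdot> (b \<otimes> d)"
      using inv_assoc_nat_tail[of b "Ident C B1" "Ident C B2" "k \<cdot> d" "Ident C (Dom C b)" "Cod C b" B1 B2] t(1-7) w(1-3)
      by (simp add: inter)
    also have "along ?K \<dots> (gen (day C F G) H (Cod C b \<odot> B1) B2 (gen F G (Cod C b) B1 x y) z)
        = along ?K (b \<otimes> d) (?\<theta> (Cod C b) x B1 B2 k y z)"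
      using t(1-7) w(1-3) by (subst along_along) simp_all
    also have "\<dots> = along ?K (b \<otimes> d) (?\<phi> (Cod C b) (Cod C d) x w)"
      unfolding t(8) by (subst eval) (use t w in simp_all)
    finally show ?thesis .
  qed
  have 3: "?\<phi> B D x w \<in> at ?K (B \<odot> D)"
    if w: "x \<in> at F B" "w \<in> at (day C G H) D" "B \<in> Obj C" "D \<in> Obj C" for B D x w
  proof -
    obtain B1 B2 k y z where t: "y \<in> at G B1" "z \<in> at H B2" "k \<in> Arr C" "Dom C k = D" "Cod C k = B1 \<odot> B2"
      "B1 \<in> Obj C" "B2 \<in> Obj C" "w = along (day C G H) k (gen G H B1 B2 y z)"
      using w(2) G H by (rule dayE)
    show ?thesis unfolding t(8) by (subst eval) (use t w in \<open>simp_all add: along_in\<close>)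
  qed
  note lift = lift_map[OF F presheaf_day[OF G H] presheaf_day[OF presheaf_day[OF F G] H], where \<phi>="?\<phi>"]
  show thesis
  proof (rule that)
    show "lift_map F (day C G H) ?K ?\<phi> \<in> Hom (Psh C) (day C F (day C G H)) ?K"
      by (rule lift(1)) (use 2 3 in simp_all)
    fix B D E x y z assume x: "x \<in> at F B" "y \<in> at G D" "z \<in> at H E"
    have o [simp]: "B \<in> Obj C" "D \<in> Obj C" "E \<in> Obj C" using x presheafD(1)[OF F] presheafD(1)[OF G] presheafD(1)[OF H] by auto
    have i: "gen G H D E y z = along (day C G H) (Ident C (D \<odot> E)) (gen G H D E y z)"
      using presheafD(3)[OF presheaf_day[OF G H] gen_in_day[OF x(2,3) G H]] by simp
    have "component (lift_map F (day C G H) ?K ?\<phi>) (B \<odot> D \<odot> E) (gen F (day C G H) B (D \<odot> E) x (gen G H D E y z))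
        = ?\<phi> B (D \<odot> E) x (gen G H D E y z)"
      by (rule lift(2)) (use x 2 3 in simp_all)
    also have "\<dots> = ?\<phi> B (D \<odot> E) x (along (day C G H) (Ident C (D \<odot> E)) (gen G H D E y z))"
      using i by simp
    also have "\<dots> = along ?K (inv_arrow C (Assoc C B D E)) (gen (day C F G) H (B \<odot> D) E (gen F G B D x y) z)"
      by (subst eval) (use x in simp_all)
    finally show "component (lift_map F (day C G H) ?K ?\<phi>) (B \<odot> D \<odot> E) (gen F (day C G H) B (D \<odot> E) x (gen G H D E y z))
        = along ?K (inv_arrow C (Assoc C B D E)) (gen (day C F G) H (B \<odot> D) E (gen F G B D x y) z)" .
  qed
qed

lemma day_assoc_iso:
  assumes F: "presheaf C F" and G: "presheaf C G" and H: "presheaf C H"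
  shows "iso_arrow (Psh C) (day_assoc C F G H)"
    "nat_trans C (inv_arrow (Psh C) (day_assoc C F G H))"
    "source (inv_arrow (Psh C) (day_assoc C F G H)) = day C F (day C G H)"
    "target (inv_arrow (Psh C) (day_assoc C F G H)) = day C (day C F G) H"
    "\<And>B D E x y z. \<lbrakk>x \<in> at F B; y \<in> at G D; z \<in> at H E\<rbrakk>
      \<Longrightarrow> component (inv_arrow (Psh C) (day_assoc C F G H)) (B \<odot> D \<odot> E) (gen F (day C G H) B (D \<odot> E) x (gen G H D E y z))
        = along (day C (day C F G) H) (inv_arrow C (Assoc C B D E)) (gen (day C F G) H (B \<odot> D) E (gen F G B D x y) z)"
proof -
  note [simp] = F G H
  obtain \<beta> where b: "\<beta> \<in> Hom (Psh C) (day C F (day C G H)) (day C (day C F G) H)"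
    "\<And>B D E x y z. \<lbrakk>x \<in> at F B; y \<in> at G D; z \<in> at H E\<rbrakk>
      \<Longrightarrow> component \<beta> (B \<odot> D \<odot> E) (gen F (day C G H) B (D \<odot> E) x (gen G H D E y z))
        = along (day C (day C F G) H) (inv_arrow C (Assoc C B D E)) (gen (day C F G) H (B \<odot> D) E (gen F G B D x y) z)"
    using day_assoc_inverse_exists[OF F G H] by blast
  have [simp]: "nat_trans C \<beta>" "source \<beta> = day C F (day C G H)" "target \<beta> = day C (day C F G) H"
    using b(1) by (auto simp: Hom_Psh)
  have "nat_comp \<beta> (day_assoc C F G H) = nat_ident (day C (day C F G) H)"
    by (rule day_eqI_left[where F=F and G=G and H=H]) (simp_all add: component_nat_comp structure_gen b(2) nat_transD along_along along_in presheafD(3))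
  moreover have "nat_comp (day_assoc C F G H) \<beta> = nat_ident (day C F (day C G H))"
    by (rule day_eqI_right[where F=F and G=G and H=H]) (simp_all add: component_nat_comp structure_gen b(2) nat_transD along_along along_in presheafD(3))
  ultimately have inv: "inverse_arrows (Psh C) (day_assoc C F G H) \<beta>"
    using Psh_inverse[OF day_assoc_facts(1)[OF F G H] b(1)] by blast
  then have e: "inv_arrow (Psh C) (day_assoc C F G H) = \<beta>" by (rule psh.inv_arrow_eqI)
  show "iso_arrow (Psh C) (day_assoc C F G H)" using inv by (rule Psh_isoI)
  show "nat_trans C (inv_arrow (Psh C) (day_assoc C F G H))"
    "source (inv_arrow (Psh C) (day_assoc C F G H)) = day C F (day C G H)"
    "target (inv_arrow (Psh C) (day_assoc C F G H)) = day C (day C F G) H"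
    "\<And>B D E x y z. \<lbrakk>x \<in> at F B; y \<in> at G D; z \<in> at H E\<rbrakk>
      \<Longrightarrow> component (inv_arrow (Psh C) (day_assoc C F G H)) (B \<odot> D \<odot> E) (gen F (day C G H) B (D \<odot> E) x (gen G H D E y z))
        = along (day C (day C F G) H) (inv_arrow C (Assoc C B D E)) (gen (day C F G) H (B \<odot> D) E (gen F G B D x y) z)"
    unfolding e by (simp_all add: b(2))
qed

lemma day_braid_iso:
  assumes F: "presheaf C F" and G: "presheaf C G"
  shows "iso_arrow (Psh C) (day_braid C F G)"
proof -
  note [simp] = F G
  let ?\<phi> = "\<lambda>D B y x. along (day C F G) (inv_arrow C (Braid C B D)) (gen F G B D x y)"
  have inv_nat: "inv_arrow C (Braid C (Cod C b) (Cod C d)) \<cdot> (d \<otimes> b) = (b \<otimes> d) \<cdot> inv_arrow C (Braid C (Dom C b) (Dom C d))"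
    if [simp]: "b \<in> Arr C" "d \<in> Arr C" for b d
  proof (rule monicD[OF iso_monic[OF braid_iso]])
    show "Braid C (Cod C b) (Cod C d) \<cdot> inv_arrow C (Braid C (Cod C b) (Cod C d)) \<cdot> (d \<otimes> b)
      = Braid C (Cod C b) (Cod C d) \<cdot> (b \<otimes> d) \<cdot> inv_arrow C (Braid C (Dom C b) (Dom C d))"
      by (subst assoc_simp[symmetric, of _ _ "Braid C (Cod C b) (Cod C d)"], simp_all del: assoc_simp)
        (simp add: braid_nat)
  qed simp_all
  have 2: "?\<phi> (Dom C d) (Dom C b) (along G d y) (along F b x) = along (day C F G) (d \<otimes> b) (?\<phi> (Cod C d) (Cod C b) y x)"
    if "b \<in> Arr C" "d \<in> Arr C" "x \<in> at F (Cod C b)" "y \<in> at G (Cod C d)" for b d x y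
    using that by (simp add: gen_slide along_along inv_nat)
  note lift = lift_map[OF G F presheaf_day[OF F G], where \<phi>="?\<phi>"]
  let ?\<beta> = "lift_map G F (day C F G) ?\<phi>"
  have b: "?\<beta> \<in> Hom (Psh C) (day C G F) (day C F G)"
    by (rule lift(1)) (use 2 in \<open>simp_all add: along_in\<close>)
  have c: "component ?\<beta> (D \<odot> B) (gen G F D B y x) = ?\<phi> D B y x" if "x \<in> at F B" "y \<in> at G D" for B D x y
    by (rule lift(2)) (use 2 that in \<open>simp_all add: along_in\<close>)
  have [simp]: "nat_trans C ?\<beta>" "source ?\<beta> = day C G F" "target ?\<beta> = day C F G"
    using b by (auto simp: Hom_Psh)
  have "nat_comp ?\<beta> (day_braid C F G) = nat_ident (day C F G)"
    by (rule day_eqI[where F=F and G=G]) (simp_all add: component_nat_comp structure_gen c nat_transD along_along along_in presheafD(3))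
  moreover have "nat_comp (day_braid C F G) ?\<beta> = nat_ident (day C G F)"
    by (rule day_eqI[where F=G and G=F]) (simp_all add: component_nat_comp structure_gen c nat_transD along_along along_in presheafD(3))
  ultimately show ?thesis
    using Psh_inverse[OF day_braid_facts(1)[OF F G] b] Psh_isoI by blast
qed

text \<open>The inverse sends \<open>x\<close> to the generator of \<open>id\<^sub>I\<close> and \<open>x\<close>, restricted along the inverse unitor of \<open>C\<close>.\<close>

lemma day_lunit_iso:
  assumes F: "presheaf C F"
  shows "iso_arrow (Psh C) (day_lunit C F)"
proof -
  note [simp] = F
  let ?Y = "yoneda C (Unit C)"
  let ?u = "\<lambda>A x. along (day C ?Y F) (inv_arrow C (LUnit C A)) (gen ?Y F (Unit C) A (Arrow (Ident C (Unit C))) x)"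
  let ?\<beta> = "\<lparr>source = F, target = day C ?Y F, component = (\<lambda>A. \<lambda>x \<in> at F A. ?u A x)\<rparr>"
  have id [simp]: "Arrow (Ident C (Unit C)) \<in> at ?Y (Unit C)" by (simp add: yoneda_at Hom_iff)
  have inv_nat: "inv_arrow C (LUnit C (Cod C f)) \<cdot> f = (Ident C (Unit C) \<otimes> f) \<cdot> inv_arrow C (LUnit C (Dom C f))"
    if [simp]: "f \<in> Arr C" for f
  proof (rule monicD[OF iso_monic[OF lunit_iso]])
    have "LUnit C (Cod C f) \<cdot> (Ident C (Unit C) \<otimes> f) \<cdot> inv_arrow C (LUnit C (Dom C f))
       = (LUnit C (Cod C f) \<cdot> (Ident C (Unit C) \<otimes> f)) \<cdot> inv_arrow C (LUnit C (Dom C f))" by simp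
    also have "\<dots> = f" by (subst lunit_nat) simp_all
    finally show "LUnit C (Cod C f) \<cdot> inv_arrow C (LUnit C (Cod C f)) \<cdot> f
      = LUnit C (Cod C f) \<cdot> (Ident C (Unit C) \<otimes> f) \<cdot> inv_arrow C (LUnit C (Dom C f))" by simp
  qed simp_all
  have b: "?\<beta> \<in> Hom (Psh C) F (day C ?Y F)"
  proof (rule Hom_PshI)
    fix A show "component ?\<beta> A \<in> at F A \<rightarrow>\<^sub>E at (day C ?Y F) A"
      using presheafD(1)[OF F] by (auto simp: along_in)
  next
    fix f x assume f: "f \<in> Arr C" "x \<in> at F (Cod C f)"
    then show "component ?\<beta> (Dom C f) (along F f x) = along (day C ?Y F) f (component ?\<beta> (Cod C f) x)"
      by (simp add: along_in gen_slide_right along_along inv_nat)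
  qed simp_all
  have [simp]: "nat_trans C ?\<beta>" using b by (auto simp: Hom_Psh)
  have "component (nat_comp ?\<beta> (day_lunit C F)) (B \<odot> D) (gen ?Y F B D i x) = gen ?Y F B D i x"
    if x: "i \<in> at ?Y B" "x \<in> at F D" and [simp]: "B \<in> Obj C" "D \<in> Obj C" for B D i x
  proof -
    obtain k where k [simp]: "i = Arrow k" "k \<in> Arr C" "Dom C k = B" "Cod C k = Unit C"
      using x(1) by (auto simp: yoneda_at Hom_iff)
    have "?u (B \<odot> D) (along F (act C k D) x)
        = along (day C ?Y F) (act C k D) (?u D x)"
      using nat_transD(4)[of ?\<beta> F "act C k D" "B \<odot> D" x] x(2) by (simp add: along_in)
    also have "\<dots> = along (day C ?Y F) (k \<otimes> Ident C D) (gen ?Y F (Unit C) D (Arrow (Ident C (Unit C))) x)"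
      using x(2) by (simp add: along_along act_def)
    also have "\<dots> = gen ?Y F B D (along ?Y k (Arrow (Ident C (Unit C)))) x"
      using x(2) by (simp add: gen_slide_left)
    finally show ?thesis using x by (simp add: component_nat_comp structure_gen along_in yoneda_along)
  qed
  then have "nat_comp ?\<beta> (day_lunit C F) = nat_ident (day C ?Y F)"
    by (intro day_eqI[where F="?Y" and G=F]) simp_all
  moreover have "nat_comp (day_lunit C F) ?\<beta> = nat_ident F"
  proof (rule Psh_ext[of _ C F F])
    fix A x assume x: "x \<in> at F A"
    have [simp]: "A \<in> Obj C" using presheafD(1)[OF F x] .
    show "component (nat_comp (day_lunit C F) ?\<beta>) A x = component (nat_ident F) A x"
      using x by (simp add: component_nat_comp nat_transD structure_gen along_along act_def presheafD(3))
  qed (simp_all add: Hom_Psh)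
  ultimately show ?thesis
    using Psh_inverse[OF day_lunit_facts(1)[OF F] b] Psh_isoI by blast
qed

end

context braided
begin

lemma runit_braid_arrow:
  assumes [simp]: "i \<in> Arr C" "Cod C i = Unit C" "B \<in> Obj C"
  shows "act C i B \<cdot> Braid C B (Dom C i) = RUnit C B \<cdot> (Ident C B \<otimes> i)"
proof -
  have "act C i B \<cdot> Braid C B (Dom C i) = LUnit C B \<cdot> (i \<otimes> Ident C B) \<cdot> Braid C B (Dom C i)"
    by (simp add: act_def)
  also have "(i \<otimes> Ident C B) \<cdot> Braid C B (Dom C i) = Braid C B (Unit C) \<cdot> (Ident C B \<otimes> i)"
    by (subst braid_nat) simp_all
  also have "LUnit C B \<cdot> Braid C B (Unit C) \<cdot> (Ident C B \<otimes> i) = RUnit C B \<cdot> (Ident C B \<otimes> i)"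
    by (simp add: lunit_braid[symmetric])
  finally show ?thesis .
qed

text \<open>As in any braided monoidal category, the right unitor is the left unitor after the braiding; here this
  is seen on generators.\<close>

lemma day_runit_iso:
  assumes F: "presheaf C F"
  shows "iso_arrow (Psh C) (day_runit C F)"
proof -
  note [simp] = F
  have "day_runit C F = nat_comp (day_lunit C F) (day_braid C F (yoneda C (Unit C)))"
    by (rule day_eqI[where F=F and G="yoneda C (Unit C)"])
      (auto simp: component_nat_comp structure_gen nat_transD along_along along_in yoneda_at Hom_iff runit_braid_arrow)
  also have "iso_arrow (Psh C) \<dots>"
    using psh.iso_comp[OF day_braid_iso[OF F presheaf_yoneda[OF unit_obj]] day_lunit_iso[OF F]] by (simp add: Psh_sel)
  finally show ?thesis .
qed

lemma triangle_act:
  assumes [simp]: "i \<in> Arr C" "Cod C i = Unit C" "B \<in> Obj C" "E \<in> Obj C"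
  shows "(Ident C B \<otimes> act C i E) \<cdot> Assoc C B (Dom C i) E = (RUnit C B \<cdot> (Ident C B \<otimes> i)) \<otimes> Ident C E"
proof -
  have "(Ident C B \<otimes> act C i E) \<cdot> Assoc C B (Dom C i) E
      = (Ident C B \<otimes> LUnit C E) \<cdot> (Ident C B \<otimes> (i \<otimes> Ident C E)) \<cdot> Assoc C B (Dom C i) E"
    by (simp add: act_def inter)
  also have "\<dots> = ((Ident C B \<otimes> LUnit C E) \<cdot> Assoc C B (Unit C) E) \<cdot> ((Ident C B \<otimes> i) \<otimes> Ident C E)"
    using assoc_nat[of "Ident C B" i "Ident C E"] by simp
  also have "\<dots> = (RUnit C B \<cdot> (Ident C B \<otimes> i)) \<otimes> Ident C E"
    by (subst triangle) (simp_all add: inter)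
  finally show ?thesis .
qed

lemmas day_eval = component_nat_comp structure_gen nat_transD along_along along_in day_map_gen
  gen_slide_left gen_slide_right

lemma day_pentagon:
  assumes W: "presheaf C W" and X: "presheaf C X" and Y: "presheaf C Y" and Z: "presheaf C Z"
  shows "nat_comp (day_map C (nat_ident W) (day_assoc C X Y Z)) (nat_comp (day_assoc C W (day C X Y) Z) (day_map C (day_assoc C W X Y) (nat_ident Z)))
    = nat_comp (day_assoc C W X (day C Y Z)) (day_assoc C (day C W X) Y Z)" (is "?l = ?r")
proof -
  note [simp] = W X Y Z
  show ?thesis
  proof (rule day_eqI_left[where F="day C W X" and G=Y and H=Z])
    fix A D E v y z
    assume v: "v \<in> at (day C W X) A" and x [simp]: "y \<in> at Y D" "z \<in> at Z E" and o [simp]: "A \<in> Obj C" "D \<in> Obj C" "E \<in> Obj C"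
    obtain B1 B2 h w x where t: "w \<in> at W B1" "x \<in> at X B2" "h \<in> Arr C" "Dom C h = A" "Cod C h = B1 \<odot> B2"
      "B1 \<in> Obj C" "B2 \<in> Obj C" "v = along (day C W X) h (gen W X B1 B2 w x)"
      using v W X by (rule dayE)
    note [simp] = t(1-7)
    let ?S = "day C (day C (day C W X) Y) Z"
    let ?g = "gen (day C (day C W X) Y) Z ((B1 \<odot> B2) \<odot> D) E (gen (day C W X) Y (B1 \<odot> B2) D (gen W X B1 B2 w x) y) z"
    have g: "gen (day C (day C W X) Y) Z (A \<odot> D) E (gen (day C W X) Y A D v y) z
        = along ?S ((h \<otimes> Ident C D) \<otimes> Ident C E) ?g"
      unfolding t(8) by (simp add: gen_slide_left)
    have "component ?l (((B1 \<odot> B2) \<odot> D) \<odot> E) ?g = component ?r (((B1 \<odot> B2) \<odot> D) \<odot> E) ?g"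
      by (simp add: day_eval pentagon)
    moreover have "component \<gamma> ((A \<odot> D) \<odot> E) (along ?S ((h \<otimes> Ident C D) \<otimes> Ident C E) ?g)
        = along (target \<gamma>) ((h \<otimes> Ident C D) \<otimes> Ident C E) (component \<gamma> (((B1 \<odot> B2) \<odot> D) \<odot> E) ?g)"
      if "nat_trans C \<gamma>" "source \<gamma> = ?S" for \<gamma>
      using that by (subst nat_transD(4)[OF that(1)]) simp_all
    ultimately show "component ?l ((A \<odot> D) \<odot> E) (gen (day C (day C W X) Y) Z (A \<odot> D) E (gen (day C W X) Y A D v y) z)
       = component ?r ((A \<odot> D) \<odot> E) (gen (day C (day C W X) Y) Z (A \<odot> D) E (gen (day C W X) Y A D v y) z)"
      unfolding g by simp
  qed simp_all
qed

text \<open>Evaluated on generators, each coherence law of the Day convolution becomes restriction along the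
  two sides of the same law in \<open>C\<close>.\<close>

theorem Psh_braided: "braided (Psh C)"
proof (intro braided.intro braided_monoidal_category.intro braided_monoidal_category_axioms.intro category_Psh)
  show "Unit (Psh C) \<in> Obj (Psh C)" by (simp add: Psh_sel)
  fix X Y assume X: "X \<in> Obj (Psh C)" and Y: "Y \<in> Obj (Psh C)"
  note XY [simp] = X[unfolded Psh_sel] Y[unfolded Psh_sel]
  show "X \<odot>\<^bsub>Psh C\<^esub> Y \<in> Obj (Psh C)" by (simp add: Psh_sel)
  show "Ident (Psh C) X \<otimes>\<^bsub>Psh C\<^esub> Ident (Psh C) Y = Ident (Psh C) (X \<odot>\<^bsub>Psh C\<^esub> Y)"
    unfolding Psh_sel by (rule day_eqI[where F=X and G=Y]) (simp_all add: day_eval)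
  show "(Ident (Psh C) X \<otimes>\<^bsub>Psh C\<^esub> LUnit (Psh C) Y) \<cdot>\<^bsub>Psh C\<^esub> Assoc (Psh C) X (Unit (Psh C)) Y
      = RUnit (Psh C) X \<otimes>\<^bsub>Psh C\<^esub> Ident (Psh C) Y"
    unfolding Psh_sel
    by (rule day_eqI_left[where F=X and G="yoneda C (Unit C)" and H=Y])
      (auto simp: day_eval yoneda_at Hom_iff triangle_act)
  show "Braid (Psh C) X Y \<in> Hom (Psh C) (X \<odot>\<^bsub>Psh C\<^esub> Y) (Y \<odot>\<^bsub>Psh C\<^esub> X)"
    unfolding Psh_sel by (rule day_braid_facts(1)) simp_all
  show "iso_arrow (Psh C) (Braid (Psh C) X Y)"
    unfolding Psh_sel by (rule day_braid_iso) simp_all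
  fix Z assume Z: "Z \<in> Obj (Psh C)"
  note [simp] = Z[unfolded Psh_sel]
  show "Assoc (Psh C) X Y Z \<in> Hom (Psh C) ((X \<odot>\<^bsub>Psh C\<^esub> Y) \<odot>\<^bsub>Psh C\<^esub> Z) (X \<odot>\<^bsub>Psh C\<^esub> Y \<odot>\<^bsub>Psh C\<^esub> Z)"
    unfolding Psh_sel by (rule day_assoc_facts(1)) simp_all
  show "iso_arrow (Psh C) (Assoc (Psh C) X Y Z)"
    unfolding Psh_sel by (rule day_assoc_iso) simp_all
  show "Assoc (Psh C) Y Z X \<cdot>\<^bsub>Psh C\<^esub> Braid (Psh C) X (Y \<odot>\<^bsub>Psh C\<^esub> Z) \<cdot>\<^bsub>Psh C\<^esub> Assoc (Psh C) X Y Z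
      = (Ident (Psh C) Y \<otimes>\<^bsub>Psh C\<^esub> Braid (Psh C) X Z) \<cdot>\<^bsub>Psh C\<^esub> Assoc (Psh C) Y X Z \<cdot>\<^bsub>Psh C\<^esub> (Braid (Psh C) X Y \<otimes>\<^bsub>Psh C\<^esub> Ident (Psh C) Z)"
    unfolding Psh_sel
    by (rule day_eqI_left[where F=X and G=Y and H=Z]) (simp_all add: day_eval hexagon1)
  note [simp] = day_assoc_iso
  show "inv_arrow (Psh C) (Assoc (Psh C) Z X Y) \<cdot>\<^bsub>Psh C\<^esub> Braid (Psh C) (X \<odot>\<^bsub>Psh C\<^esub> Y) Z \<cdot>\<^bsub>Psh C\<^esub> inv_arrow (Psh C) (Assoc (Psh C) X Y Z)
      = (Braid (Psh C) X Z \<otimes>\<^bsub>Psh C\<^esub> Ident (Psh C) Y) \<cdot>\<^bsub>Psh C\<^esub> inv_arrow (Psh C) (Assoc (Psh C) X Z Y) \<cdot>\<^bsub>Psh C\<^esub> (Ident (Psh C) X \<otimes>\<^bsub>Psh C\<^esub> Braid (Psh C) Y Z)"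
    unfolding Psh_sel
    by (rule day_eqI_right[where F=X and G=Y and H=Z]) (simp_all add: day_eval hexagon2)
  fix W assume W: "W \<in> Obj (Psh C)"
  then show "(Ident (Psh C) W \<otimes>\<^bsub>Psh C\<^esub> Assoc (Psh C) X Y Z) \<cdot>\<^bsub>Psh C\<^esub> Assoc (Psh C) W (X \<odot>\<^bsub>Psh C\<^esub> Y) Z \<cdot>\<^bsub>Psh C\<^esub> (Assoc (Psh C) W X Y \<otimes>\<^bsub>Psh C\<^esub> Ident (Psh C) Z)
      = Assoc (Psh C) W X (Y \<odot>\<^bsub>Psh C\<^esub> Z) \<cdot>\<^bsub>Psh C\<^esub> Assoc (Psh C) (W \<odot>\<^bsub>Psh C\<^esub> X) Y Z"
    unfolding Psh_sel by (intro day_pentagon) simp_all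
next
  fix X assume X: "X \<in> Obj (Psh C)"
  note [simp] = X[unfolded Psh_sel]
  show "LUnit (Psh C) X \<in> Hom (Psh C) (Unit (Psh C) \<odot>\<^bsub>Psh C\<^esub> X) X" "iso_arrow (Psh C) (LUnit (Psh C) X)"
    "RUnit (Psh C) X \<in> Hom (Psh C) (X \<odot>\<^bsub>Psh C\<^esub> Unit (Psh C)) X" "iso_arrow (Psh C) (RUnit (Psh C) X)"
    unfolding Psh_sel by (simp_all add: day_lunit_facts day_runit_facts day_lunit_iso day_runit_iso)
next
  fix f X X' assume f: "f \<in> Hom (Psh C) X X'"
  have fD: "nat_trans C f" "source f = X" "target f = X'" "presheaf C X" "presheaf C X'"
    using f Hom_PshD[OF f] by (auto simp: Hom_Psh)
  note [simp] = fD
  show "LUnit (Psh C) X' \<cdot>\<^bsub>Psh C\<^esub> (Ident (Psh C) (Unit (Psh C)) \<otimes>\<^bsub>Psh C\<^esub> f) = f \<cdot>\<^bsub>Psh C\<^esub> LUnit (Psh C) X"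
    unfolding Psh_sel by (rule day_eqI[where F="yoneda C (Unit C)" and G=X]) (auto simp: day_eval yoneda_at Hom_iff)
  show "RUnit (Psh C) X' \<cdot>\<^bsub>Psh C\<^esub> (f \<otimes>\<^bsub>Psh C\<^esub> Ident (Psh C) (Unit (Psh C))) = f \<cdot>\<^bsub>Psh C\<^esub> RUnit (Psh C) X"
    unfolding Psh_sel by (rule day_eqI[where F=X and G="yoneda C (Unit C)"]) (auto simp: day_eval yoneda_at Hom_iff)
  fix g Y Y' assume g: "g \<in> Hom (Psh C) Y Y'"
  have gD: "nat_trans C g" "source g = Y" "target g = Y'" "presheaf C Y" "presheaf C Y'"
    using g Hom_PshD[OF g] by (auto simp: Hom_Psh)
  note [simp] = gD
  show "f \<otimes>\<^bsub>Psh C\<^esub> g \<in> Hom (Psh C) (X \<odot>\<^bsub>Psh C\<^esub> Y) (X' \<odot>\<^bsub>Psh C\<^esub> Y')"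
    unfolding Psh_sel using day_map_facts(1)[OF fD(1) gD(1)] by simp
  show "Braid (Psh C) X' Y' \<cdot>\<^bsub>Psh C\<^esub> (f \<otimes>\<^bsub>Psh C\<^esub> g) = (g \<otimes>\<^bsub>Psh C\<^esub> f) \<cdot>\<^bsub>Psh C\<^esub> Braid (Psh C) X Y"
    unfolding Psh_sel by (rule day_eqI[where F=X and G=Y]) (simp_all add: day_eval)
  fix h Z Z' assume h: "h \<in> Hom (Psh C) Z Z'"
  have hD: "nat_trans C h" "source h = Z" "target h = Z'" "presheaf C Z" "presheaf C Z'"
    using h Hom_PshD[OF h] by (auto simp: Hom_Psh)
  note [simp] = hD
  show "Assoc (Psh C) X' Y' Z' \<cdot>\<^bsub>Psh C\<^esub> ((f \<otimes>\<^bsub>Psh C\<^esub> g) \<otimes>\<^bsub>Psh C\<^esub> h) = (f \<otimes>\<^bsub>Psh C\<^esub> (g \<otimes>\<^bsub>Psh C\<^esub> h)) \<cdot>\<^bsub>Psh C\<^esub> Assoc (Psh C) X Y Z"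
    unfolding Psh_sel by (rule day_eqI_left[where F=X and G=Y and H=Z]) (simp_all add: day_eval)
next
  fix f g f' g' X Y Z X' Y' Z'
  assume a: "f \<in> Hom (Psh C) X Y" "g \<in> Hom (Psh C) Y Z" "f' \<in> Hom (Psh C) X' Y'" "g' \<in> Hom (Psh C) Y' Z'"
  have [simp]: "nat_trans C f" "source f = X" "target f = Y" "presheaf C X" "presheaf C Y"
    "nat_trans C g" "source g = Y" "target g = Z" "presheaf C Z"
    "nat_trans C f'" "source f' = X'" "target f' = Y'" "presheaf C X'" "presheaf C Y'"
    "nat_trans C g'" "source g' = Y'" "target g' = Z'" "presheaf C Z'"
    using a Hom_PshD[OF a(1)] Hom_PshD[OF a(2)] Hom_PshD[OF a(3)] Hom_PshD[OF a(4)] by (auto simp: Hom_Psh)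
  show "(g \<cdot>\<^bsub>Psh C\<^esub> f) \<otimes>\<^bsub>Psh C\<^esub> (g' \<cdot>\<^bsub>Psh C\<^esub> f') = (g \<otimes>\<^bsub>Psh C\<^esub> g') \<cdot>\<^bsub>Psh C\<^esub> (f \<otimes>\<^bsub>Psh C\<^esub> f')"
    unfolding Psh_sel by (rule day_eqI[where F=X and G=X']) (simp_all add: day_eval)
qed

end


section \<open>Full subcategories\<close>

lemma full_sel [simp]:
  "Obj (full_subcategory D Q) = Obj D \<inter> Q"
  "Arr (full_subcategory D Q) = {f \<in> Arr D. Dom D f \<in> Q \<and> Cod D f \<in> Q}"
  "Dom (full_subcategory D Q) = Dom D" "Cod (full_subcategory D Q) = Cod D"
  "Ident (full_subcategory D Q) = Ident D" "Comp (full_subcategory D Q) = Comp D"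
  "Unit (full_subcategory D Q) = Unit D" "TensorO (full_subcategory D Q) = TensorO D"
  "TensorA (full_subcategory D Q) = TensorA D" "Assoc (full_subcategory D Q) = Assoc D"
  "LUnit (full_subcategory D Q) = LUnit D" "RUnit (full_subcategory D Q) = RUnit D"
  "Braid (full_subcategory D Q) = Braid D"
  by (simp_all add: full_subcategory_def)

lemma full_Hom: "f \<in> Hom (full_subcategory D Q) X Y \<longleftrightarrow> f \<in> Hom D X Y \<and> X \<in> Q \<and> Y \<in> Q"
  by (auto simp: Hom_iff)

lemma full_inverse_arrows:
  "inverse_arrows (full_subcategory D Q) f g \<longleftrightarrow> inverse_arrows D f g \<and> Dom D f \<in> Q \<and> Cod D f \<in> Q"
  by (auto simp: inverse_arrows_def Hom_iff)

lemma full_iso: "iso_arrow (full_subcategory D Q) f \<longleftrightarrow> iso_arrow D f \<and> Dom D f \<in> Q \<and> Cod D f \<in> Q"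
  by (auto simp: iso_arrow_def full_inverse_arrows)

lemma full_inv_arrow:
  "\<lbrakk>Dom D f \<in> Q; Cod D f \<in> Q\<rbrakk> \<Longrightarrow> inv_arrow (full_subcategory D Q) f = inv_arrow D f"
  by (simp add: inv_arrow_def full_inverse_arrows)

lemma full_act: "act (full_subcategory D Q) = act D"
  by (intro ext) (simp add: act_def)

lemma full_braided:
  assumes "braided D" "Unit D \<in> Q" "\<And>X Y. \<lbrakk>X \<in> Obj D; Y \<in> Obj D; X \<in> Q; Y \<in> Q\<rbrakk> \<Longrightarrow> TensorO D X Y \<in> Q"
  shows "braided (full_subcategory D Q)"
proof -
  interpret D: braided D by fact
  note [simp] = assms(2,3)
  show ?thesis
  proof (intro braided.intro braided_monoidal_category.intro category.intro braided_monoidal_category_axioms.intro)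
  qed (auto simp: full_Hom full_iso full_inv_arrow Hom_iff D.interchange_simp D.assoc_nat D.lunit_nat D.runit_nat D.braid_nat
      D.triangle D.pentagon D.hexagon1 D.hexagon2)
qed

section \<open>Broad presheaves as subpresheaves of representables\<close>

fun the_arrow :: "('o, 'a) elt \<Rightarrow> 'a" where
  "the_arrow (Arrow f) = f"

lemma Psh_bij_iso:
  assumes "\<alpha> \<in> Hom (Psh C) F G" "\<And>A. bij_betw (component \<alpha> A) (at F A) (at G A)"
  shows "iso_arrow (Psh C) \<alpha>"
proof -
  note a = Hom_PshD[OF assms(1)]
  let ?i = "\<lambda>A. inv_into (at F A) (component \<alpha> A)"
  let ?\<beta> = "\<lparr>source = G, target = F, component = (\<lambda>A. \<lambda>y \<in> at G A. ?i A y)\<rparr>"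
  have i1: "?i A (component \<alpha> A x) = x" if "x \<in> at F A" for A x
    using bij_betw_inv_into_left[OF assms(2) that] .
  have i2: "component \<alpha> A (?i A y) = y" if "y \<in> at G A" for A y
    using bij_betw_inv_into_right[OF assms(2) that] .
  have i3: "?i A y \<in> at F A" if "y \<in> at G A" for A y
    using bij_betw_apply[OF bij_betw_inv_into[OF assms(2)] that] .
  have b: "?\<beta> \<in> Hom (Psh C) G F"
  proof (rule Hom_PshI)
    show "component ?\<beta> A \<in> at G A \<rightarrow>\<^sub>E at F A" for A
      using i3 by auto
    fix f y assume f: "f \<in> Arr C" "y \<in> at G (Cod C f)"
    have "component \<alpha> (Dom C f) (along F f (?i (Cod C f) y)) = along G f y"
      using a(6)[OF f(1) i3[OF f(2)]] i2[OF f(2)] by simp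
    then have "?i (Dom C f) (along G f y) = along F f (?i (Cod C f) y)"
      using i1[OF presheafD(2)[OF a(1) f(1) i3[OF f(2)]]] by simp
    then show "component ?\<beta> (Dom C f) (along G f y) = along F f (component ?\<beta> (Cod C f) y)"
      using f presheafD(2)[OF a(2) f] by simp
  qed (simp_all add: a)
  have "nat_comp ?\<beta> \<alpha> = nat_ident F" "nat_comp \<alpha> ?\<beta> = nat_ident G"
    unfolding nat_comp_def nat_ident_def using i1 i2 i3 a(5) by (auto simp: a(3,4) restrict_def fun_eq_iff)
  then have "inverse_arrows (Psh C) \<alpha> ?\<beta>"
    by (rule Psh_inverse[OF assms(1) b])
  then show ?thesis by (rule Psh_isoI)
qed

lemma Psh_iso_bij:
  assumes "iso_arrow (Psh C) \<alpha>" "\<alpha> \<in> Hom (Psh C) F G"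
  shows "bij_betw (component \<alpha> A) (at F A) (at G A)"
proof -
  obtain \<beta> where b: "inverse_arrows (Psh C) \<alpha> \<beta>" using assms(1) by (auto simp: iso_arrow_def)
  have bh: "\<beta> \<in> Hom (Psh C) G F" and e: "nat_comp \<beta> \<alpha> = nat_ident F" "nat_comp \<alpha> \<beta> = nat_ident G"
    using b assms(2) by (auto simp: inverse_arrows_def Psh_sel Hom_Psh)
  show ?thesis
  proof (rule bij_betw_byWitness[where f'="component \<beta> A"])
    show "\<forall>x\<in>at F A. component \<beta> A (component \<alpha> A x) = x"
      using component_comp[OF assms(2), of _ A \<beta>] component_ident[of _ F A] by (simp add: e)
    show "\<forall>x\<in>at G A. component \<alpha> A (component \<beta> A x) = x"
      using component_comp[OF bh, of _ A \<alpha>] component_ident[of _ G A] by (simp add: e)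
  qed (use Hom_PshD(5)[OF assms(2)] Hom_PshD(5)[OF bh] in auto)
qed

context braided
begin

definition restricting_arrows :: "'a set set \<Rightarrow> 'o \<Rightarrow> 'o \<Rightarrow> 'a set" where
  "restricting_arrows U X A = {k \<in> Hom C A X. \<exists>s \<in> U. restr k (rep s)}"

text \<open>A family \<open>f\<close> of bijections onto the arrows into \<open>X\<close> that restrict to a member of \<open>U\<close>, natural in the
  domain: this is what it means for \<open>F\<close> to be isomorphic to \<open>\<langle>U, X\<rangle>\<close>, without naming the isomorphism.\<close>

definition embeds :: "('o, 'a) psh \<Rightarrow> 'a set set \<Rightarrow> 'o \<Rightarrow> ('o \<Rightarrow> ('o, 'a) elt \<Rightarrow> 'a) \<Rightarrow> bool" where
  "embeds F U X f \<longleftrightarrow> presheaf C F \<and> U \<subseteq> carrier (ISub C) \<and> X \<in> Obj C \<and>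
     (\<forall>A. bij_betw (f A) (at F A) (restricting_arrows U X A)) \<and>
     (\<forall>h \<in> Arr C. \<forall>x \<in> at F (Cod C h). f (Dom C h) (along F h x) = f (Cod C h) x \<cdot> h)"

lemma embedsD:
  assumes "embeds F U X f"
  shows "presheaf C F" "U \<subseteq> carrier (ISub C)" "X \<in> Obj C" "bij_betw (f A) (at F A) (restricting_arrows U X A)"
    "\<lbrakk>h \<in> Arr C; x \<in> at F (Cod C h)\<rbrakk> \<Longrightarrow> f (Dom C h) (along F h x) = f (Cod C h) x \<cdot> h"
    "x \<in> at F A \<Longrightarrow> f A x \<in> Arr C" "x \<in> at F A \<Longrightarrow> Dom C (f A x) = A" "x \<in> at F A \<Longrightarrow> Cod C (f A x) = X"
    "x \<in> at F A \<Longrightarrow> \<exists>s \<in> U. restr (f A x) (rep s)"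
    "\<lbrakk>x \<in> at F A; y \<in> at F A; f A x = f A y\<rbrakk> \<Longrightarrow> x = y"
    "\<lbrakk>k \<in> Arr C; Dom C k = A; Cod C k = X; s \<in> U; restr k (rep s)\<rbrakk> \<Longrightarrow> \<exists>x \<in> at F A. f A x = k"
proof -
  show a: "presheaf C F" "U \<subseteq> carrier (ISub C)" "X \<in> Obj C"
    "\<lbrakk>h \<in> Arr C; x \<in> at F (Cod C h)\<rbrakk> \<Longrightarrow> f (Dom C h) (along F h x) = f (Cod C h) x \<cdot> h"
    and b: "bij_betw (f A) (at F A) (restricting_arrows U X A)" for A
    using assms unfolding embeds_def by blast+
  show "x \<in> at F A \<Longrightarrow> f A x \<in> Arr C" "x \<in> at F A \<Longrightarrow> Dom C (f A x) = A" "x \<in> at F A \<Longrightarrow> Cod C (f A x) = X"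
    "x \<in> at F A \<Longrightarrow> \<exists>s \<in> U. restr (f A x) (rep s)"
    using bij_betw_apply[OF b, of x A] unfolding restricting_arrows_def Hom_iff by auto
  show "\<lbrakk>x \<in> at F A; y \<in> at F A; f A x = f A y\<rbrakk> \<Longrightarrow> x = y"
    using b[of A] unfolding bij_betw_def inj_on_def by blast
  assume k: "k \<in> Arr C" "Dom C k = A" "Cod C k = X" "s \<in> U" "restr k (rep s)"
  then have "k \<in> restricting_arrows U X A" unfolding restricting_arrows_def Hom_iff by blast
  then show "\<exists>x \<in> at F A. f A x = k" using b[of A] unfolding bij_betw_def by (metis imageE)
qed

lemma rep_arr [simp]:
  assumes "u \<in> carrier (ISub C)"
  shows "rep u \<in> Arr C" "Cod C (rep u) = Unit C"
  using subunitD[OF rep_ISub(1)[OF assms]] by auto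

lemma restricting_eq: "restricting C U X A = Arrow ` restricting_arrows U X A"
proof -
  have "{f \<in> Hom C A X. \<exists>s \<in> U. restricts_to C f s} = restricting_arrows U X A"
    unfolding restricting_arrows_def restricts_to_def by (rule refl)
  then show ?thesis by (simp add: restricting_def)
qed

lemma restricting_arrows_precomp:
  assumes "U \<subseteq> carrier (ISub C)" "k \<in> restricting_arrows U X (Cod C h)" "h \<in> Arr C"
  shows "k \<cdot> h \<in> restricting_arrows U X (Dom C h)"
proof -
  obtain s where s: "s \<in> U" "restr k (rep s)" and k: "k \<in> Arr C" "Dom C k = Cod C h" "Cod C k = X"
    using assms(2) unfolding restricting_arrows_def Hom_iff by auto
  have "restr (k \<cdot> h) (rep s)"
    by (rule restr_precomp) (use s k assms in auto)
  then show ?thesis using s k assms(3) unfolding restricting_arrows_def Hom_iff by auto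
qed

lemma broad_along:
  "\<lbrakk>h \<in> Arr C; k \<in> restricting_arrows U X (Cod C h)\<rbrakk> \<Longrightarrow> along (broad C U X) h (Arrow k) = Arrow (k \<cdot> h)"
  by (simp add: broad_def restricting_eq)

lemma presheaf_broad:
  assumes U: "U \<subseteq> carrier (ISub C)" and X: "X \<in> Obj C"
  shows "presheaf C (broad C U X)"
  unfolding presheaf_def
proof (intro conjI allI impI ballI)
  have at: "at (broad C U X) A = Arrow ` restricting_arrows U X A" for A
    by (simp add: broad_def restricting_eq)
  fix A assume "A \<notin> Obj C"
  then show "at (broad C U X) A = {}" using dom_obj by (auto simp: at restricting_arrows_def Hom_iff)
next
  fix f assume "f \<notin> Arr C" then show "along (broad C U X) f = (\<lambda>x. undefined)" by (simp add: broad_def)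
next
  fix f assume f: "f \<in> Arr C"
  show "along (broad C U X) f \<in> at (broad C U X) (Cod C f) \<rightarrow>\<^sub>E at (broad C U X) (Dom C f)"
    by (rule PiE_I) (use f restricting_arrows_precomp[OF U] in \<open>auto simp: broad_def restricting_eq\<close>)
next
  fix A x assume "A \<in> Obj C" "x \<in> at (broad C U X) A"
  then show "along (broad C U X) (Ident C A) x = x"
    by (auto simp: broad_def restricting_eq restricting_arrows_def Hom_iff)
next
  fix f g x assume fg: "f \<in> Arr C" "g \<in> Arr C" "Cod C f = Dom C g" and "x \<in> at (broad C U X) (Cod C g)"
  then obtain k where k: "k \<in> restricting_arrows U X (Cod C g)" "x = Arrow k"
    by (auto simp: broad_def restricting_eq)
  have kk: "k \<in> Arr C" "Dom C k = Cod C g" using k(1) by (auto simp: restricting_arrows_def Hom_iff)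
  have c: "k \<in> restricting_arrows U X (Cod C (g \<cdot> f))" "k \<cdot> g \<in> restricting_arrows U X (Cod C f)"
    using k(1) fg restricting_arrows_precomp[OF U k(1) fg(2)] by simp_all
  have "along (broad C U X) (g \<cdot> f) x = Arrow (k \<cdot> g \<cdot> f)"
    unfolding k(2) by (subst broad_along[OF _ c(1)]) (use fg in simp_all)
  moreover have "along (broad C U X) f (along (broad C U X) g x) = Arrow ((k \<cdot> g) \<cdot> f)"
    unfolding k(2) by (subst broad_along[OF fg(2) k(1)], subst broad_along[OF fg(1) c(2)]) simp
  ultimately show "along (broad C U X) (g \<cdot> f) x = along (broad C U X) f (along (broad C U X) g x)"
    using fg kk by simp
qed

lemma broad_embeds:
  assumes U: "U \<subseteq> carrier (ISub C)" and X: "X \<in> Obj C"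
  shows "embeds (broad C U X) U X (\<lambda>A. the_arrow)"
  unfolding embeds_def
proof (intro conjI allI ballI presheaf_broad assms)
  fix A show "bij_betw the_arrow (at (broad C U X) A) (restricting_arrows U X A)"
    by (rule bij_betw_byWitness[where f'=Arrow]) (auto simp: broad_def restricting_eq)
next
  fix h x assume h: "h \<in> Arr C" and "x \<in> at (broad C U X) (Cod C h)"
  then obtain k where k: "k \<in> restricting_arrows U X (Cod C h)" "x = Arrow k"
    by (auto simp: broad_def restricting_eq)
  show "the_arrow (along (broad C U X) h x) = the_arrow x \<cdot> h"
    unfolding k(2) by (subst broad_along[OF h k(1)]) simp
qed

lemma embeds_iso:
  assumes "iso_arrow (Psh C) \<alpha>" "\<alpha> \<in> Hom (Psh C) F G" "embeds G U X g"
  shows "embeds F U X (\<lambda>A x. g A (component \<alpha> A x))"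
  unfolding embeds_def
proof (intro conjI allI ballI)
  show "presheaf C F" "U \<subseteq> carrier (ISub C)" "X \<in> Obj C"
    using Hom_PshD(1)[OF assms(2)] embedsD(2,3)[OF assms(3)] by auto
  show "bij_betw (\<lambda>x. g A (component \<alpha> A x)) (at F A) (restricting_arrows U X A)" for A
    using bij_betw_trans[OF Psh_iso_bij[OF assms(1,2)] embedsD(4)[OF assms(3)]] by (simp add: comp_def)
  fix h x assume h: "h \<in> Arr C" "x \<in> at F (Cod C h)"
  show "g (Dom C h) (component \<alpha> (Dom C h) (along F h x)) = g (Cod C h) (component \<alpha> (Cod C h) x) \<cdot> h"
    using Hom_PshD(6)[OF assms(2) h] embedsD(5)[OF assms(3) h(1) Hom_PshD(5)[OF assms(2) h(2)]] by simp
qed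

text \<open>An isomorphism with \<open>\<langle>U, X\<rangle>\<close> is traded for a family of arrows of \<open>C\<close>, to which the results on restriction
  apply directly.\<close>

lemma isomorphic_broad_iff: "isomorphic (Psh C) F (broad C U X) \<and> U \<subseteq> carrier (ISub C) \<and> X \<in> Obj C
    \<longleftrightarrow> (\<exists>f. embeds F U X f)"
proof
  assume "isomorphic (Psh C) F (broad C U X) \<and> U \<subseteq> carrier (ISub C) \<and> X \<in> Obj C"
  then show "\<exists>f. embeds F U X f"
    unfolding isomorphic_def using embeds_iso[OF _ _ broad_embeds] by blast
next
  assume "\<exists>f. embeds F U X f"
  then obtain f where f: "embeds F U X f" by blast
  note fD = embedsD[OF f]
  let ?\<alpha> = "\<lparr>source = F, target = broad C U X, component = (\<lambda>A. \<lambda>x \<in> at F A. Arrow (f A x))\<rparr>"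
  have r: "x \<in> at F A \<Longrightarrow> f A x \<in> restricting_arrows U X A" for x A
    using bij_betw_apply[OF fD(4)] .
  have a: "?\<alpha> \<in> Hom (Psh C) F (broad C U X)"
  proof (rule Hom_PshI)
    show "component ?\<alpha> A \<in> at F A \<rightarrow>\<^sub>E at (broad C U X) A" for A
      using r by (auto simp: broad_def restricting_eq)
    fix h x assume h: "h \<in> Arr C" "x \<in> at F (Cod C h)"
    show "component ?\<alpha> (Dom C h) (along F h x) = along (broad C U X) h (component ?\<alpha> (Cod C h) x)"
      using h presheafD(2)[OF fD(1) h] fD(5)[OF h] broad_along[OF h(1) r[OF h(2)]] by simp
  qed (use fD presheaf_broad in simp_all)
  have "bij_betw (component ?\<alpha> A) (at F A) (at (broad C U X) A)" for A
  proof -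
    have "bij_betw (Arrow \<circ> f A) (at F A) (Arrow ` restricting_arrows U X A)"
      by (rule bij_betw_trans[OF fD(4)]) (simp add: bij_betw_def inj_on_def)
    then show ?thesis
      by (subst bij_betw_cong[where g="Arrow \<circ> f A"]) (simp_all add: broad_def restricting_eq)
  qed
  then have "iso_arrow (Psh C) ?\<alpha>" by (rule Psh_bij_iso[OF a])
  then show "isomorphic (Psh C) F (broad C U X) \<and> U \<subseteq> carrier (ISub C) \<and> X \<in> Obj C"
    using a fD(2,3) unfolding isomorphic_def by blast
qed

lemma yoneda_embeds:
  assumes X: "X \<in> Obj C"
  shows "embeds (yoneda C X) {subobject C (Ident C (Unit C))} X (\<lambda>A. the_arrow)"
  unfolding embeds_def
proof (intro conjI allI ballI presheaf_yoneda X)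
  let ?u = "subobject C (Ident C (Unit C))"
  have u: "?u \<in> carrier (ISub C)" by (rule subobject_in_ISub[OF unit_subunit])
  then show "{?u} \<subseteq> carrier (ISub C)" by simp
  have "restr k (rep ?u)" if "k \<in> Arr C" for k
    by (rule restr_mono[OF restr_unit]) (use that u rep_subobject(3)[OF subunitD(1)[OF unit_subunit]] in simp_all)
  then have *: "restricting_arrows {?u} X A = Hom C A X" for A
    by (auto simp: restricting_arrows_def Hom_iff)
  show "bij_betw the_arrow (at (yoneda C X) A) (restricting_arrows {?u} X A)" for A
    unfolding * by (rule bij_betw_byWitness[where f'=Arrow]) (auto simp: yoneda_at)
  fix h x assume "h \<in> Arr C" "x \<in> at (yoneda C X) (Cod C h)"
  then show "the_arrow (along (yoneda C X) h x) = the_arrow x \<cdot> h"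
    by (auto simp: yoneda_at Hom_iff yoneda_along)
qed

end


section \<open>Tensor products of broad presheaves\<close>

context stiff_category
begin

abbreviation meets :: "'a set set \<Rightarrow> 'a set set \<Rightarrow> 'a set set" where
  "meets U V \<equiv> {sub_meet C s t | s t. s \<in> U \<and> t \<in> V}"

text \<open>Every element of \<open>\<langle>U, X\<rangle> \<otimes> \<langle>V, Y\<rangle>\<close> over an arrow that restricts to \<open>w\<close> is the restriction
  of the one generator \<open>gen (w \<otimes> X) (w \<otimes> Y)\<close>, along an arrow determined by its image in \<open>C\<close>. So an
  element is determined by its image.\<close>

lemma gen_canonical:
  assumes F: "embeds F U X f" and G: "embeds G V Y g"
    and x: "x \<in> at F B" "y \<in> at G D" and h: "h \<in> Arr C" "Cod C h = B \<odot> D"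
    and s: "s \<in> U" "restr (f B x) (rep s)" "factors_through C w (rep s)"
    and t: "t \<in> V" "restr (g D y) (rep t)" "factors_through C w (rep t)"
    and w: "w \<in> Arr C" "Cod C w = Unit C"
    and p: "p \<in> at F (Dom C w \<odot> X)" "f (Dom C w \<odot> X) p = act C w X"
    and q: "q \<in> at G (Dom C w \<odot> Y)" "g (Dom C w \<odot> Y) q = act C w Y"
    and k: "k \<in> Arr C" "Dom C k = Dom C h" "Cod C k = (Dom C w \<odot> X) \<odot> (Dom C w \<odot> Y)"
      "(f B x \<otimes> g D y) \<cdot> h = (act C w X \<otimes> act C w Y) \<cdot> k"
  shows "along (day C F G) h (gen F G B D x y) = along (day C F G) k (gen F G (Dom C w \<odot> X) (Dom C w \<odot> Y) p q)"
proof -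
  note fD = embedsD[OF F] and gD = embedsD[OF G]
  have su: "subunit_arrow C (rep s)" "subunit_arrow C (rep t)"
    using rep_ISub(1) s(1) t(1) fD(2) gD(2) by blast+
  note [simp] = subunitD(2,3)[OF su(1)] subunitD(2,3)[OF su(2)] w fD(1,3) gD(1,3) fD(6-8)[OF x(1)] gD(6-8)[OF x(2)] h(1,2) k(1-3)
    presheafD(1)[OF fD(1) x(1)] presheafD(1)[OF gD(1) x(2)]
  let ?S = "Dom C (rep s)" and ?T = "Dom C (rep t)" and ?W = "Dom C w"
  obtain x0 where x0: "x0 \<in> Arr C" "Dom C x0 = B" "Cod C x0 = ?S \<odot> X" "f B x = act C (rep s) X \<cdot> x0"
    using restrE[OF s(2)] by auto
  obtain y0 where y0: "y0 \<in> Arr C" "Dom C y0 = D" "Cod C y0 = ?T \<odot> Y" "g D y = act C (rep t) Y \<cdot> y0"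
    using restrE[OF t(2)] by auto
  obtain i where i: "i \<in> Arr C" "Dom C i = ?W" "Cod C i = ?S" "w = rep s \<cdot> i"
    using s(3) unfolding factors_iff by auto
  obtain j where j: "j \<in> Arr C" "Dom C j = ?W" "Cod C j = ?T" "w = rep t \<cdot> j"
    using t(3) unfolding factors_iff by auto
  note [simp] = x0(1-3) y0(1-3) i(1-3) j(1-3)
  have "restr (act C (rep s) X) (rep s)" by (rule restr_act) simp_all
  then obtain p' where p': "p' \<in> at F (?S \<odot> X)" "f (?S \<odot> X) p' = act C (rep s) X"
    using fD(11)[of "act C (rep s) X" "?S \<odot> X" s] s(1) by auto
  have "restr (act C (rep t) Y) (rep t)" by (rule restr_act) simp_all
  then obtain q' where q': "q' \<in> at G (?T \<odot> Y)" "g (?T \<odot> Y) q' = act C (rep t) Y"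
    using gD(11)[of "act C (rep t) Y" "?T \<odot> Y" t] t(1) by auto
  have wX: "act C w X = act C (rep s) X \<cdot> (i \<otimes> Ident C X)"
    by (subst i(4)) (simp add: act_comp)
  have wY: "act C w Y = act C (rep t) Y \<cdot> (j \<otimes> Ident C Y)"
    by (subst j(4)) (simp add: act_comp)
  have ex: "x = along F x0 p'"
    by (rule fD(10)[OF x(1)]) (use fD(5)[of x0 p'] p' x0(4) in \<open>simp_all add: along_in\<close>)
  have ey: "y = along G y0 q'"
    by (rule gD(10)[OF x(2)]) (use gD(5)[of y0 q'] q' y0(4) in \<open>simp_all add: along_in\<close>)
  have ep: "p = along F (i \<otimes> Ident C X) p'"
    by (rule fD(10)[OF p(1)]) (use fD(5)[of "i \<otimes> Ident C X" p'] p' p(2) wX in \<open>simp_all add: along_in\<close>)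
  have eq: "q = along G (j \<otimes> Ident C Y) q'"
    by (rule gD(10)[OF q(1)]) (use gD(5)[of "j \<otimes> Ident C Y" q'] q' q(2) wY in \<open>simp_all add: along_in\<close>)
  have "(x0 \<otimes> y0) \<cdot> h = ((i \<otimes> Ident C X) \<otimes> (j \<otimes> Ident C Y)) \<cdot> k"
  proof (rule monicD[OF act_tensor_act_monic[OF su]])
    have "(act C (rep s) X \<otimes> act C (rep t) Y) \<cdot> (x0 \<otimes> y0) \<cdot> h = (f B x \<otimes> g D y) \<cdot> h"
      by (simp add: inter x0(4) y0(4))
    also have "\<dots> = (act C (rep s) X \<otimes> act C (rep t) Y) \<cdot> ((i \<otimes> Ident C X) \<otimes> (j \<otimes> Ident C Y)) \<cdot> k"
      unfolding k(4) wX wY by (simp add: inter)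
    finally show "(act C (rep s) X \<otimes> act C (rep t) Y) \<cdot> (x0 \<otimes> y0) \<cdot> h
      = (act C (rep s) X \<otimes> act C (rep t) Y) \<cdot> ((i \<otimes> Ident C X) \<otimes> (j \<otimes> Ident C Y)) \<cdot> k" .
  qed simp_all
  moreover have "gen F G B D x y = along (day C F G) (x0 \<otimes> y0) (gen F G (?S \<odot> X) (?T \<odot> Y) p' q')"
    unfolding ex ey using gen_slide[of x0 y0 p' F q' G] p'(1) q'(1) by simp
  moreover have "gen F G (?W \<odot> X) (?W \<odot> Y) p q
      = along (day C F G) ((i \<otimes> Ident C X) \<otimes> (j \<otimes> Ident C Y)) (gen F G (?S \<odot> X) (?T \<odot> Y) p' q')"
    unfolding ep eq using gen_slide[of "i \<otimes> Ident C X" "j \<otimes> Ident C Y" p' F q' G] p'(1) q'(1) by simp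
  ultimately show ?thesis using p'(1) q'(1) by (simp add: along_along)
qed

text \<open>The map \<open>gen x y \<mapsto> x \<otimes> y\<close>, computed on the chosen representative.\<close>

definition day_arrow :: "('o \<Rightarrow> ('o, 'a) elt \<Rightarrow> 'a) \<Rightarrow> ('o \<Rightarrow> ('o, 'a) elt \<Rightarrow> 'a) \<Rightarrow> 'o \<Rightarrow> ('o, 'a) elt \<Rightarrow> 'a" where
  "day_arrow f g A t = (case t of Tuple B D h x y \<Rightarrow> (f B x \<otimes> g D y) \<cdot> h)"

lemma day_arrow_gen:
  assumes F: "embeds F U X f" and G: "embeds G V Y g"
    and x: "x \<in> at F B" "y \<in> at G D" and h: "h \<in> Arr C" "Dom C h = A" "Cod C h = B \<odot> D"
  shows "day_arrow f g A (along (day C F G) h (gen F G B D x y)) = (f B x \<otimes> g D y) \<cdot> h"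
  unfolding day_arrow_def
proof (rule day_case[where A=A])
  note fD = embedsD[OF F] and gD = embedsD[OF G]
  fix B B' D D' b d h x y
  assume a: "b \<in> Hom C B B'" "d \<in> Hom C D D'" "h \<in> Hom C A (B \<odot> D)" "x \<in> at F B'" "y \<in> at G D'"
  have [simp]: "b \<in> Arr C" "Dom C b = B" "Cod C b = B'" "d \<in> Arr C" "Dom C d = D" "Cod C d = D'"
    "h \<in> Arr C" "Dom C h = A" "Cod C h = B \<odot> D" using a by (auto simp: Hom_iff)
  show "(f B (along F b x) \<otimes> g D (along G d y)) \<cdot> h = (f B' x \<otimes> g D' y) \<cdot> (b \<otimes> d) \<cdot> h"
    using fD(5)[of b x] gD(5)[of d y] a(4,5) fD(6-8)[OF a(4)] gD(6-8)[OF a(5)] by (simp add: inter)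
qed (use x h embedsD(1)[OF F] embedsD(1)[OF G] in simp_all)

text \<open>For injectivity, two elements with the same image in \<open>C\<close> come with four members of \<open>U\<close> and \<open>V\<close> to which that image restricts.
  It then restricts to their meet \<open>w\<close>, and \<open>gen_canonical\<close> for this \<open>w\<close> expresses both elements
  in the same way.\<close>

lemma day_embeds:
  assumes F: "embeds F U X f" and G: "embeds G V Y g"
  shows "embeds (day C F G) (meets U V) (X \<odot> Y) (day_arrow f g)"
  unfolding embeds_def
proof (intro conjI allI ballI)
  note fD = embedsD[OF F] and gD = embedsD[OF G]
  note [simp] = fD(1,3) gD(1,3)
  show "presheaf C (day C F G)" "X \<odot> Y \<in> Obj C" by simp_all
  show "meets U V \<subseteq> carrier (ISub C)" using rep_sub_meet(1) fD(2) gD(2) by blast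
  let ?\<mu> = "day_arrow f g"
  have ex: "\<exists>p \<in> at F (Dom C w \<odot> X). f (Dom C w \<odot> X) p = act C w X"
    if "s \<in> U" "factors_through C w (rep s)" "w \<in> Arr C" "Cod C w = Unit C" for s w
  proof (rule fD(11)[OF _ _ _ that(1)])
    show "restr (act C w X) (rep s)"
      using restr_mono[OF restr_act[OF that(3,4) fD(3)] that(2-4)] that fD(2) by auto
  qed (use that in simp_all)
  have ey: "\<exists>q \<in> at G (Dom C w \<odot> Y). g (Dom C w \<odot> Y) q = act C w Y"
    if "s \<in> V" "factors_through C w (rep s)" "w \<in> Arr C" "Cod C w = Unit C" for s w
  proof (rule gD(11)[OF _ _ _ that(1)])
    show "restr (act C w Y) (rep s)"
      using restr_mono[OF restr_act[OF that(3,4) gD(3)] that(2-4)] that gD(2) by auto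
  qed (use that in simp_all)
  fix A
  show "bij_betw (?\<mu> A) (at (day C F G) A) (restricting_arrows (meets U V) (X \<odot> Y) A)"
    unfolding bij_betw_def
  proof (intro conjI equalityI subsetI inj_onI)
    fix t1 t2 assume t1: "t1 \<in> at (day C F G) A" and t2: "t2 \<in> at (day C F G) A" and eq: "?\<mu> A t1 = ?\<mu> A t2"
    obtain B D h x y where x: "x \<in> at F B" "y \<in> at G D" "h \<in> Arr C" "Dom C h = A" "Cod C h = B \<odot> D"
        "B \<in> Obj C" "D \<in> Obj C" "t1 = along (day C F G) h (gen F G B D x y)" using t1 fD(1) gD(1) by (rule dayE)
    obtain B' D' h' x' y' where x': "x' \<in> at F B'" "y' \<in> at G D'" "h' \<in> Arr C" "Dom C h' = A" "Cod C h' = B' \<odot> D'"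
        "B' \<in> Obj C" "D' \<in> Obj C" "t2 = along (day C F G) h' (gen F G B' D' x' y')" using t2 fD(1) gD(1) by (rule dayE)
    let ?k = "(f B x \<otimes> g D y) \<cdot> h"
    have k': "?k = (f B' x' \<otimes> g D' y') \<cdot> h'"
      using eq unfolding x(8) x'(8) day_arrow_gen[OF F G x(1-5)] day_arrow_gen[OF F G x'(1-5)] .
    note [simp] = x(3-7) x'(3-7) fD(6-8)[OF x(1)] gD(6-8)[OF x(2)] fD(6-8)[OF x'(1)] gD(6-8)[OF x'(2)]
    obtain s t s' t' where s: "s \<in> U" "restr (f B x) (rep s)" and t: "t \<in> V" "restr (g D y) (rep t)"
      and s': "s' \<in> U" "restr (f B' x') (rep s')" and t': "t' \<in> V" "restr (g D' y') (rep t')"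
      using fD(9)[OF x(1)] gD(9)[OF x(2)] fD(9)[OF x'(1)] gD(9)[OF x'(2)] by blast
    have su: "subunit_arrow C (rep s)" "subunit_arrow C (rep t)" "subunit_arrow C (rep s')" "subunit_arrow C (rep t')"
      using s t s' t' fD(2) gD(2) rep_ISub(1) by blast+
    note [simp] = subunitD(2,3)[OF su(1)] subunitD(2,3)[OF su(2)] subunitD(2,3)[OF su(3)] subunitD(2,3)[OF su(4)]
    let ?u = "meet (rep s) (rep t)" and ?v = "meet (rep s') (rep t')"
    let ?w = "meet ?u ?v"
    have su': "subunit_arrow C ?u" "subunit_arrow C ?v" "subunit_arrow C ?w"
      by (intro meet_subunit su)+
    have fac: "factors_through C ?w (rep s)" "factors_through C ?w (rep t)" "factors_through C ?w (rep s')" "factors_through C ?w (rep t')"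
      using factors_trans[OF meet_factors(1)[of ?u ?v] meet_factors(1)[of "rep s" "rep t"]]
        factors_trans[OF meet_factors(1)[of ?u ?v] meet_factors(2)[of "rep s" "rep t"]]
        factors_trans[OF meet_factors(2)[of ?u ?v] meet_factors(1)[of "rep s'" "rep t'"]]
        factors_trans[OF meet_factors(2)[of ?u ?v] meet_factors(2)[of "rep s'" "rep t'"]] by simp_all
    have r1: "restr ?k (rep s)" "restr ?k (rep t)"
      by (rule restr_precomp[OF restr_tensor_left[OF s(2)]]; simp) (rule restr_precomp[OF restr_tensor_right[OF t(2)]]; simp)
    have r2: "restr ?k (rep s')" "restr ?k (rep t')" unfolding k'
      by (rule restr_precomp[OF restr_tensor_left[OF s'(2)]]; simp) (rule restr_precomp[OF restr_tensor_right[OF t'(2)]]; simp)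
    have kk: "?k \<in> Arr C" "Cod C ?k = X \<odot> Y" by simp_all
    have "restr ?k ?w"
      by (intro restr_meet r1 r2 su su' kk(1))
    from restr_tensor_factors[OF this su'(3) kk fD(3) gD(3)]
    obtain k where k: "k \<in> Arr C" "Dom C k = Dom C ?k" "Cod C k = (Dom C ?w \<odot> X) \<odot> (Dom C ?w \<odot> Y)"
      "?k = (act C ?w X \<otimes> act C ?w Y) \<cdot> k"
      by blast
    note w = subunitD(2,3)[OF su'(3)]
    obtain p q where p: "p \<in> at F (Dom C ?w \<odot> X)" "f (Dom C ?w \<odot> X) p = act C ?w X"
      and q: "q \<in> at G (Dom C ?w \<odot> Y)" "g (Dom C ?w \<odot> Y) q = act C ?w Y"
      using ex[OF s(1) fac(1) w] ey[OF t(1) fac(2) w] by blast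
    have kd: "Dom C k = Dom C h" "Dom C k = Dom C h'" using k(2) by simp_all
    have "t1 = along (day C F G) k (gen F G (Dom C ?w \<odot> X) (Dom C ?w \<odot> Y) p q)"
      unfolding x(8) by (rule gen_canonical[OF F G x(1,2,3,5) s fac(1) t fac(2) w p q k(1) kd(1) k(3,4)])
    moreover have "t2 = along (day C F G) k (gen F G (Dom C ?w \<odot> X) (Dom C ?w \<odot> Y) p q)"
      unfolding x'(8) by (rule gen_canonical[OF F G x'(1,2,3,5) s' fac(3) t' fac(4) w p q k(1) kd(2) k(3) k(4)[unfolded k']])
    ultimately show "t1 = t2" by simp
  next
    fix k assume "k \<in> ?\<mu> A ` at (day C F G) A"
    then obtain B D h x y where x: "x \<in> at F B" "y \<in> at G D" "h \<in> Arr C" "Dom C h = A" "Cod C h = B \<odot> D"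
        "B \<in> Obj C" "D \<in> Obj C" and k: "k = (f B x \<otimes> g D y) \<cdot> h"
      using day_arrow_gen[OF F G] by (auto elim!: dayE[OF _ fD(1) gD(1)])
    note [simp] = x(3-7) fD(6-8)[OF x(1)] gD(6-8)[OF x(2)]
    obtain s t where s: "s \<in> U" "restr (f B x) (rep s)" and t: "t \<in> V" "restr (g D y) (rep t)"
      using fD(9)[OF x(1)] gD(9)[OF x(2)] by blast
    have c: "s \<in> carrier (ISub C)" "t \<in> carrier (ISub C)" using s t fD(2) gD(2) by auto
    note [simp] = rep_arr[OF c(1)] rep_arr[OF c(2)]
    have "restr k (rep s)" "restr k (rep t)" unfolding k
      by (rule restr_precomp[OF restr_tensor_left[OF s(2)]]; simp) (rule restr_precomp[OF restr_tensor_right[OF t(2)]]; simp)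
    then have "restr k (rep (sub_meet C s t))"
      by (intro rep_sub_meet(4)[OF c]) (simp_all add: k)
    then show "k \<in> restricting_arrows (meets U V) (X \<odot> Y) A"
      using s(1) t(1) unfolding restricting_arrows_def Hom_iff k by auto
  next
    fix k assume "k \<in> restricting_arrows (meets U V) (X \<odot> Y) A"
    then obtain s t where s: "s \<in> U" and t: "t \<in> V" and kr: "restr k (rep (sub_meet C s t))"
      and k: "k \<in> Arr C" "Dom C k = A" "Cod C k = X \<odot> Y"
      unfolding restricting_arrows_def Hom_iff by blast
    have c: "s \<in> carrier (ISub C)" "t \<in> carrier (ISub C)" using s t fD(2) gD(2) by auto
    let ?w = "rep (sub_meet C s t)"
    have su: "subunit_arrow C ?w" using rep_ISub(1)[OF rep_sub_meet(1)[OF c]] .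
    note w = subunitD(2,3)[OF su]
    obtain m where m: "m \<in> Arr C" "Dom C m = Dom C k" "Cod C m = (Dom C ?w \<odot> X) \<odot> (Dom C ?w \<odot> Y)"
      "k = (act C ?w X \<otimes> act C ?w Y) \<cdot> m"
      using restr_tensor_factors[OF kr su k(1,3) fD(3) gD(3)] .
    obtain p q where p: "p \<in> at F (Dom C ?w \<odot> X)" "f (Dom C ?w \<odot> X) p = act C ?w X"
      and q: "q \<in> at G (Dom C ?w \<odot> Y)" "g (Dom C ?w \<odot> Y) q = act C ?w Y"
      using ex[OF s _ w] ey[OF t _ w] rep_sub_meet(2,3)[OF c] unfolding le_ISub by blast
    have "?\<mu> A (along (day C F G) m (gen F G (Dom C ?w \<odot> X) (Dom C ?w \<odot> Y) p q)) = k"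
      using day_arrow_gen[OF F G p(1) q(1) m(1) _ m(3), of A] m(2) k(2) p(2) q(2) m(4) by simp
    moreover have "along (day C F G) m (gen F G (Dom C ?w \<odot> X) (Dom C ?w \<odot> Y) p q) \<in> at (day C F G) A"
      using m(1-3) k(2) p(1) q(1) by (intro along_in) simp_all
    ultimately show "k \<in> ?\<mu> A ` at (day C F G) A" by (metis imageI)
  qed
next
  note fD = embedsD[OF F] and gD = embedsD[OF G]
  fix h t assume h: "h \<in> Arr C" and "t \<in> at (day C F G) (Cod C h)"
  then obtain B D k x y where x: "x \<in> at F B" "y \<in> at G D" "k \<in> Arr C" "Dom C k = Cod C h" "Cod C k = B \<odot> D"
      "B \<in> Obj C" "D \<in> Obj C" "t = along (day C F G) k (gen F G B D x y)" using fD(1) gD(1) by (auto elim: dayE)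
  note [simp] = x(3-7) fD(6-8)[OF x(1)] gD(6-8)[OF x(2)] h fD(1) gD(1)
  have e: "along (day C F G) h t = along (day C F G) (k \<cdot> h) (gen F G B D x y)"
    unfolding x(8) using x(1,2) by (simp add: along_along)
  have "day_arrow f g (Dom C h) (along (day C F G) h t) = (f B x \<otimes> g D y) \<cdot> (k \<cdot> h)"
    unfolding e by (rule day_arrow_gen[OF F G x(1,2)]) simp_all
  also have "\<dots> = day_arrow f g (Cod C h) t \<cdot> h"
    unfolding x(8) by (subst day_arrow_gen[OF F G x(1-5)]) simp
  finally show "day_arrow f g (Dom C h) (along (day C F G) h t) = day_arrow f g (Cod C h) t \<cdot> h" .
qed

end

section \<open>The action of a subpresheaf of the unit\<close>

context stiff_category
begin

definition arrow_at :: "('o, 'a) psh_map \<Rightarrow> 'o \<Rightarrow> ('o, 'a) elt \<Rightarrow> 'a" where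
  "arrow_at r A x = the_arrow (component r A x)"

lemma arrow_at:
  assumes "r \<in> Hom (Psh C) R (yoneda C X)" "x \<in> at R A"
  shows "component r A x = Arrow (arrow_at r A x)" "arrow_at r A x \<in> Arr C"
    "Dom C (arrow_at r A x) = A" "Cod C (arrow_at r A x) = X"
  using Hom_PshD(5)[OF assms] by (auto simp: yoneda_at Hom_iff arrow_at_def)

lemma arrow_at_along:
  assumes "r \<in> Hom (Psh C) R (yoneda C X)" "h \<in> Arr C" "x \<in> at R (Cod C h)"
  shows "arrow_at r (Dom C h) (along R h x) = arrow_at r (Cod C h) x \<cdot> h"
proof -
  have "along R h x \<in> at R (Dom C h)" using presheafD(2)[OF Hom_PshD(1)[OF assms(1)] assms(2,3)] .
  then have "Arrow (arrow_at r (Dom C h) (along R h x)) = along (yoneda C X) h (Arrow (arrow_at r (Cod C h) x))"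
    using Hom_PshD(6)[OF assms] by (simp only: arrow_at(1)[OF assms(1)] assms(3))
  also have "\<dots> = Arrow (arrow_at r (Cod C h) x \<cdot> h)"
    by (rule yoneda_along) (use arrow_at(2-)[OF assms(1,3)] assms(2) in simp_all)
  finally show ?thesis by simp
qed

lemma act_Psh: "act (Psh C) r F = nat_comp (day_lunit C F) (day_map C r (nat_ident F))"
  by (simp add: act_def Psh_sel)

lemma act_Psh_Hom:
  assumes "r \<in> Hom (Psh C) R (yoneda C (Unit C))" "presheaf C F"
  shows "act (Psh C) r F \<in> Hom (Psh C) (day C R F) F"
proof -
  have [simp]: "nat_trans C r" "source r = R" "target r = yoneda C (Unit C)" "presheaf C F"
    using assms by (auto simp: Hom_Psh)
  show ?thesis by (simp add: Hom_Psh act_Psh)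
qed

lemma act_Psh_gen:
  assumes r: "r \<in> Hom (Psh C) R (yoneda C (Unit C))" and F: "presheaf C F"
    and x: "x \<in> at R B" "y \<in> at F D" and h: "h \<in> Arr C" "Dom C h = A" "Cod C h = B \<odot> D"
  shows "component (act (Psh C) r F) A (along (day C R F) h (gen R F B D x y))
    = along F (act C (arrow_at r B x) D \<cdot> h) y"
proof -
  have [simp]: "nat_trans C r" "source r = R" "target r = yoneda C (Unit C)" "presheaf C F" "presheaf C R"
    using r F Hom_PshD(1)[OF r] by (auto simp: Hom_Psh)
  note rx [simp] = arrow_at(2-)[OF r x(1)]
  have [simp]: "D \<in> Obj C" using presheafD(1)[OF F x(2)] .
  have "component (act (Psh C) r F) (B \<odot> D) (gen R F B D x y)
      = component (day_lunit C F) (B \<odot> D) (gen (yoneda C (Unit C)) F B D (Arrow (arrow_at r B x)) y)"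
    using x by (simp add: act_Psh component_nat_comp day_map_gen arrow_at(1)[OF r x(1)])
  also have "\<dots> = along F (act C (arrow_at r B x) D) y"
    using x by (simp add: structure_gen)
  finally have "component (act (Psh C) r F) A (along (day C R F) h (gen R F B D x y))
      = along F h (along F (act C (arrow_at r B x) D) y)"
    using Hom_PshD(6)[OF act_Psh_Hom[OF r F], of h "gen R F B D x y"] h x by simp
  then show ?thesis using x h by (simp add: along_along)
qed

lemma embeds_postcomp_iso:
  assumes f: "embeds F U X f" and i: "iso_arrow C i" "Dom C i = X" "Cod C i = Y"
  shows "embeds F U Y (\<lambda>A x. i \<cdot> f A x)"
  unfolding embeds_def
proof (intro conjI allI ballI)
  note fD = embedsD[OF f]
  note [simp] = iso_arr[OF i(1)] i
  show "presheaf C F" "U \<subseteq> carrier (ISub C)" using fD by auto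
  show "Y \<in> Obj C" using cod_obj[OF iso_arr[OF i(1)]] i by simp
  have pc: "g \<cdot> k \<in> restricting_arrows U (Cod C g) A"
    if kg: "k \<in> restricting_arrows U (Dom C g) A" "g \<in> Arr C" for g k A
  proof -
    obtain s where s: "s \<in> U" "restr k (rep s)" and k: "k \<in> Arr C" "Dom C k = A" "Cod C k = Dom C g"
      using kg(1) unfolding restricting_arrows_def Hom_iff by blast
    have "restr (g \<cdot> k) (rep s)"
      by (rule restr_postcomp[OF s(2)]) (use k kg(2) s(1) fD(2) in auto)
    then show ?thesis using s(1) k kg(2) unfolding restricting_arrows_def Hom_iff by auto
  qed
  have "bij_betw (\<lambda>k. i \<cdot> k) (restricting_arrows U X A) (restricting_arrows U Y A)" for A
  proof (rule bij_betw_byWitness[where f'="\<lambda>k. inv_arrow C i \<cdot> k"])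
    show "(\<lambda>k. i \<cdot> k) ` restricting_arrows U X A \<subseteq> restricting_arrows U Y A"
      using pc[of _ i A] by auto
    show "(\<lambda>k. inv_arrow C i \<cdot> k) ` restricting_arrows U Y A \<subseteq> restricting_arrows U X A"
      using pc[of _ "inv_arrow C i" A] by auto
  qed (auto simp: restricting_arrows_def Hom_iff)
  from bij_betw_trans[OF fD(4) this]
  show "bij_betw (\<lambda>x. i \<cdot> f A x) (at F A) (restricting_arrows U Y A)" for A by (simp add: comp_def)
  fix h x assume h: "h \<in> Arr C" "x \<in> at F (Cod C h)"
  show "i \<cdot> f (Dom C h) (along F h x) = (i \<cdot> f (Cod C h) x) \<cdot> h"
    using fD(5)[OF h] fD(6-8)[OF h(2)] h(1) by simp
qed

lemma embeds_cong:
  assumes f: "embeds F U X f" and "\<And>A x. x \<in> at F A \<Longrightarrow> f A x = g A x"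
  shows "embeds F U X g"
  unfolding embeds_def
proof (intro conjI allI ballI)
  note fD = embedsD[OF f]
  show "presheaf C F" "U \<subseteq> carrier (ISub C)" "X \<in> Obj C" using fD by auto
  show "bij_betw (g A) (at F A) (restricting_arrows U X A)" for A
    using fD(4)[of A] bij_betw_cong[of "at F A" "f A" "g A"] assms(2) by blast
  fix h x assume h: "h \<in> Arr C" "x \<in> at F (Cod C h)"
  show "g (Dom C h) (along F h x) = g (Cod C h) x \<cdot> h"
    using fD(5)[OF h] assms(2)[OF h(2)] assms(2)[OF presheafD(2)[OF fD(1) h]] by simp
qed

text \<open>With \<open>F = \<langle>U, X\<rangle>\<close>, acting on \<open>F\<close> and then including into \<open>C(-, X)\<close> is the embedding of the tensor
  product into \<open>C(-, I \<odot> X)\<close> followed by the unitor. So the action is injective and its image is known.\<close>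

lemma act_embeds:
  assumes r: "r \<in> Hom (Psh C) R (yoneda C (Unit C))" and R: "embeds R V (Unit C) (arrow_at r)"
    and F: "embeds F U X f"
  shows "embeds (day C R F) (meets V U) X (\<lambda>A t. f A (component (act (Psh C) r F) A t))"
proof (rule embeds_cong)
  note fD = embedsD[OF F] and RD = embedsD[OF R]
  note [simp] = fD(1,3) RD(1)
  show "embeds (day C R F) (meets V U) X (\<lambda>A t. LUnit C X \<cdot> day_arrow (arrow_at r) f A t)"
    by (rule embeds_postcomp_iso[OF day_embeds[OF R F]]) simp_all
  fix A t assume "t \<in> at (day C R F) A"
  then obtain B D h x y where t: "x \<in> at R B" "y \<in> at F D" "h \<in> Arr C" "Dom C h = A" "Cod C h = B \<odot> D"
      "B \<in> Obj C" "D \<in> Obj C" "t = along (day C R F) h (gen R F B D x y)" by (rule dayE) simp_all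
  note [simp] = t(3-7) fD(6-8)[OF t(2)] RD(6-8)[OF t(1)]
  have "LUnit C X \<cdot> day_arrow (arrow_at r) f A t = LUnit C X \<cdot> (arrow_at r B x \<otimes> f D y) \<cdot> h"
    unfolding t(8) by (subst day_arrow_gen[OF R F t(1-5)]) (rule refl)
  also have "\<dots> = (LUnit C X \<cdot> (arrow_at r B x \<otimes> f D y)) \<cdot> h" by simp
  also have "\<dots> = f D y \<cdot> (act C (arrow_at r B x) D \<cdot> h)"
    by (subst lunit_tensor_eq_act) simp_all
  also have "\<dots> = f A (along F (act C (arrow_at r B x) D \<cdot> h) y)"
    using fD(5)[of "act C (arrow_at r B x) D \<cdot> h" y] t(2) by simp
  also have "\<dots> = f A (component (act (Psh C) r F) A t)"
    unfolding t(8) using act_Psh_gen[OF r fD(1) t(1-5)] by simp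
  finally show "LUnit C X \<cdot> day_arrow (arrow_at r) f A t = f A (component (act (Psh C) r F) A t)" .
qed

text \<open>By the pullback square of stiffness, an arrow that restricts to \<open>v\<close> and to \<open>u\<close> restricts to \<open>v \<and> u\<close>.\<close>

lemma restricting_meets:
  assumes "U \<subseteq> carrier (ISub C)" "V \<subseteq> carrier (ISub C)"
  shows "restricting_arrows (meets V U) X A = restricting_arrows V X A \<inter> restricting_arrows U X A"
proof (intro equalityI subsetI)
  fix k assume "k \<in> restricting_arrows (meets V U) X A"
  then obtain v u where v: "v \<in> V" "u \<in> U" "restr k (rep (sub_meet C v u))" and k: "k \<in> Hom C A X"
    unfolding restricting_arrows_def by blast
  have c: "v \<in> carrier (ISub C)" "u \<in> carrier (ISub C)" using v assms by auto
  note m = rep_sub_meet(1-3)[OF c]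
  have "restr k (rep v)" "restr k (rep u)"
    by (rule restr_mono[OF v(3)]; use m c k in \<open>simp add: le_ISub Hom_iff\<close>)+
  then show "k \<in> restricting_arrows V X A \<inter> restricting_arrows U X A"
    using v k unfolding restricting_arrows_def by blast
next
  fix k assume "k \<in> restricting_arrows V X A \<inter> restricting_arrows U X A"
  then obtain v u where v: "v \<in> V" "u \<in> U" "restr k (rep v)" "restr k (rep u)" and k: "k \<in> Hom C A X"
    unfolding restricting_arrows_def by blast
  have c: "v \<in> carrier (ISub C)" "u \<in> carrier (ISub C)" using v assms by auto
  have "restr k (rep (sub_meet C v u))"
    by (rule rep_sub_meet(4)[OF c]) (use v k in \<open>auto simp: Hom_iff\<close>)
  then show "k \<in> restricting_arrows (meets V U) X A"
    using v k unfolding restricting_arrows_def by blast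
qed

definition down :: "'a set set \<Rightarrow> 'a set set" where
  "down V = {v \<in> carrier (ISub C). \<exists>w \<in> V. v \<sqsubseteq>\<^bsub>ISub C\<^esub> w}"

lemma restricting_down:
  assumes "V \<subseteq> carrier (ISub C)"
  shows "restricting_arrows (down V) X A = restricting_arrows V X A"
proof (intro equalityI subsetI)
  fix k assume "k \<in> restricting_arrows (down V) X A"
  then obtain v w where v: "v \<in> carrier (ISub C)" "w \<in> V" "v \<sqsubseteq>\<^bsub>ISub C\<^esub> w" "restr k (rep v)" and k: "k \<in> Hom C A X"
    unfolding restricting_arrows_def down_def by blast
  have "w \<in> carrier (ISub C)" using v assms by auto
  then have "restr k (rep w)"
    by (intro restr_mono[OF v(4)]) (use v k in \<open>simp_all add: le_ISub Hom_iff\<close>)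
  then show "k \<in> restricting_arrows V X A" using v(2) k unfolding restricting_arrows_def by blast
next
  fix k assume "k \<in> restricting_arrows V X A"
  then show "k \<in> restricting_arrows (down V) X A"
    using assms ISub_refl unfolding restricting_arrows_def down_def by blast
qed

end


section \<open>Categories of broad presheaves\<close>

text \<open>The closure properties of a condition \<open>K\<close> on sets of subunits that make the presheaves
  \<open>\<langle>U, X\<rangle>\<close> with \<open>K U\<close> closed under the tensor product and contain its unit and an initial object, and that let
  every subunit among them be given by a down-closed set satisfying \<open>K\<close>: its generators are a monotone image of
  a set satisfying \<open>K\<close>.\<close>

locale broad_setting = stiff_category C
  for C :: "('o, 'a) bmcategory" (structure) +
  fixes K :: "'a set set \<Rightarrow> bool"
  assumes K_empty: "K {}"
    and K_unit: "K {subobject C (Ident C (Unit C))}"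
    and K_meets: "\<lbrakk>U \<subseteq> carrier (ISub C); V \<subseteq> carrier (ISub C); K U; K V\<rbrakk> \<Longrightarrow> K (meets U V)"
    and K_image: "\<lbrakk>U \<subseteq> carrier (ISub C); K U; g ` U \<subseteq> carrier (ISub C);
      \<And>s t. \<lbrakk>s \<in> U; t \<in> U; s \<sqsubseteq>\<^bsub>ISub C\<^esub> t\<rbrakk> \<Longrightarrow> g s \<sqsubseteq>\<^bsub>ISub C\<^esub> g t\<rbrakk> \<Longrightarrow> K (g ` U)"
    and K_down: "\<lbrakk>V \<subseteq> carrier (ISub C); K V\<rbrakk> \<Longrightarrow> K (down V)"
begin

abbreviation Cb :: "(('o, 'a) psh, ('o, 'a) psh_map) bmcategory" where
  "Cb \<equiv> broad_presheaves C K"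

lemma Obj_Cb: "F \<in> Obj Cb \<longleftrightarrow> (\<exists>U X f. K U \<and> embeds F U X f)"
proof -
  have "F \<in> Obj Cb \<longleftrightarrow> presheaf C F \<and> (\<exists>U X. K U \<and> isomorphic (Psh C) F (broad C U X) \<and> U \<subseteq> carrier (ISub C) \<and> X \<in> Obj C)"
    by (auto simp: broad_presheaves_def Psh_sel)
  then show ?thesis using isomorphic_broad_iff embedsD(1) by meson
qed

lemma Cb_sel [simp]:
  "Dom Cb = source" "Cod Cb = target" "Ident Cb = nat_ident" "Comp Cb = nat_comp"
  "Unit Cb = yoneda C (Unit C)" "TensorO Cb = day C" "TensorA Cb = day_map C" "Braid Cb = day_braid C"
  by (simp_all add: broad_presheaves_def Psh_sel)

lemma full_Psh: "Cb = full_subcategory (Psh C) (Obj Cb)"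
proof -
  define Q where "Q = {F. \<exists>U X. U \<subseteq> carrier (ISub C) \<and> K U \<and> X \<in> Obj C \<and> isomorphic (Psh C) F (broad C U X)}"
  have Cb: "Cb = full_subcategory (Psh C) Q" by (simp add: broad_presheaves_def Q_def)
  have "{f \<in> Arr (Psh C). Dom (Psh C) f \<in> Q \<and> Cod (Psh C) f \<in> Q}
      = {f \<in> Arr (Psh C). Dom (Psh C) f \<in> Obj (Psh C) \<inter> Q \<and> Cod (Psh C) f \<in> Obj (Psh C) \<inter> Q}"
    by (auto simp: Psh_sel nat_trans_def)
  moreover have "Obj (Psh C) \<inter> Q = Obj (Psh C) \<inter> (Obj (Psh C) \<inter> Q)" by blast
  ultimately have "full_subcategory (Psh C) Q = full_subcategory (Psh C) (Obj (Psh C) \<inter> Q)"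
    unfolding full_subcategory_def by simp
  then show ?thesis unfolding Cb by simp
qed

lemma Hom_Cb: "\<alpha> \<in> Hom Cb F G \<longleftrightarrow> \<alpha> \<in> Hom (Psh C) F G \<and> F \<in> Obj Cb \<and> G \<in> Obj Cb"
  by (subst full_Psh) (rule full_Hom)

lemma Arr_Cb: "\<alpha> \<in> Arr Cb \<longleftrightarrow> nat_trans C \<alpha> \<and> source \<alpha> \<in> Obj Cb \<and> target \<alpha> \<in> Obj Cb"
  using Hom_Cb[of \<alpha> "source \<alpha>" "target \<alpha>"] by (simp add: Hom_def[of Cb] Hom_Psh)

lemma iso_Cb: "iso_arrow Cb \<alpha> \<longleftrightarrow> iso_arrow (Psh C) \<alpha> \<and> source \<alpha> \<in> Obj Cb \<and> target \<alpha> \<in> Obj Cb"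
  by (subst full_Psh) (simp add: full_iso Psh_sel)

lemma act_Cb: "act Cb = act (Psh C)"
  by (simp add: broad_presheaves_def full_act)

lemma presheaf_Cb: "F \<in> Obj Cb \<Longrightarrow> presheaf C F"
  using Obj_Cb embedsD(1) by blast

lemma yoneda_Cb: "X \<in> Obj C \<Longrightarrow> yoneda C X \<in> Obj Cb"
  using Obj_Cb K_unit yoneda_embeds by blast

lemma day_Cb:
  assumes "F \<in> Obj Cb" "G \<in> Obj Cb" shows "day C F G \<in> Obj Cb"
proof -
  obtain U X f V Y g where "K U" "embeds F U X f" "K V" "embeds G V Y g"
    using assms Obj_Cb by meson
  then show ?thesis using K_meets[of U V] embedsD(2) day_embeds[of F U X f G V Y g] Obj_Cb by meson
qed

lemma Cb_braided: "braided Cb"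
  by (subst full_Psh, rule full_braided) (simp_all add: Psh_braided Psh_sel yoneda_Cb day_Cb)

sublocale cb: braided Cb by (rule Cb_braided)

text \<open>The Yoneda lemma turns elements into arrows from representables, which lie in the subcategory.\<close>

lemma monic_Cb_iff:
  assumes a: "\<alpha> \<in> Hom Cb F G"
  shows "monic Cb \<alpha> \<longleftrightarrow> (\<forall>A. inj_on (component \<alpha> A) (at F A))"
proof
  have aP: "\<alpha> \<in> Hom (Psh C) F G" and FG: "F \<in> Obj Cb" "G \<in> Obj Cb" using a Hom_Cb by auto
  note aD = Hom_PshD[OF aP]
  show "\<forall>A. inj_on (component \<alpha> A) (at F A)" if m: "monic Cb \<alpha>"
  proof (intro allI inj_onI)
    fix A x x' assume x: "x \<in> at F A" "x' \<in> at F A" "component \<alpha> A x = component \<alpha> A x'"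
    have A [simp]: "A \<in> Obj C" using presheafD(1)[OF aD(1) x(1)] .
    define y where "y = (\<lambda>x. \<lparr>source = yoneda C A, target = F,
      component = (\<lambda>B. \<lambda>k \<in> at (yoneda C A) B. along F (the_arrow k) x)\<rparr>)"
    have y: "y x \<in> Hom (Psh C) (yoneda C A) F" if "x \<in> at F A" for x
    proof (rule Hom_PshI)
      show "component (y x) B \<in> at (yoneda C A) B \<rightarrow>\<^sub>E at F B" for B
        using that aD(1) by (auto simp: y_def yoneda_at Hom_iff along_in)
      fix h k assume h: "h \<in> Arr C" "k \<in> at (yoneda C A) (Cod C h)"
      show "component (y x) (Dom C h) (along (yoneda C A) h k) = along F h (component (y x) (Cod C h) k)"
        using h that aD(1) presheafD(2)[OF presheaf_yoneda[OF A] h] by (auto simp: y_def yoneda_at Hom_iff yoneda_along along_along)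
    qed (use aD in \<open>simp_all add: y_def\<close>)
    have "nat_comp \<alpha> (y x) = nat_comp \<alpha> (y x')"
    proof (rule Psh_ext[OF nat_comp_Hom[OF y[OF x(1)] aP] nat_comp_Hom[OF y[OF x(2)] aP]])
      fix B k assume k: "k \<in> at (yoneda C A) B"
      then obtain l where l: "k = Arrow l" "l \<in> Arr C" "Dom C l = B" "Cod C l = A" by (auto simp: yoneda_at Hom_iff)
      have "component \<alpha> B (along F l x) = component \<alpha> B (along F l x')"
        using aD(6)[of l x] aD(6)[of l x'] l x by simp
      then show "component (nat_comp \<alpha> (y x)) B k = component (nat_comp \<alpha> (y x')) B k"
        using k l(1) by (simp add: component_comp[OF y[OF x(1)]] component_comp[OF y[OF x(2)]]) (simp add: y_def)
    qed
    moreover have "y x \<in> Arr Cb" "y x' \<in> Arr Cb"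
      using y[OF x(1)] y[OF x(2)] yoneda_Cb[OF A] FG by (auto simp: Arr_Cb Hom_Psh)
    ultimately have "y x = y x'"
      using cb.monicD[OF m, of "y x" "y x'"] aD(3) by (simp add: y_def)
    then have "component (y x) A (Arrow (Ident C A)) = component (y x') A (Arrow (Ident C A))" by simp
    then show "x = x'" using x presheafD(3)[OF aD(1)] by (simp add: y_def yoneda_at Hom_iff)
  qed
next
  have aP: "\<alpha> \<in> Hom (Psh C) F G" and FG: "F \<in> Obj Cb" "G \<in> Obj Cb" using a Hom_Cb by auto
  assume inj: "\<forall>A. inj_on (component \<alpha> A) (at F A)"
  show "monic Cb \<alpha>"
  proof (rule cb.monicI)
    show "\<alpha> \<in> Arr Cb" using a by (simp add: Hom_iff)
    fix f g assume f: "f \<in> Arr Cb" "g \<in> Arr Cb" "Dom Cb f = Dom Cb g" "Cod Cb f = Dom Cb \<alpha>" "Cod Cb g = Dom Cb \<alpha>"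
      "\<alpha> \<cdot>\<^bsub>Cb\<^esub> f = \<alpha> \<cdot>\<^bsub>Cb\<^esub> g"
    have h: "f \<in> Hom (Psh C) (source f) F" "g \<in> Hom (Psh C) (source f) F"
      using f Hom_PshD(3)[OF aP] by (auto simp: Arr_Cb Hom_Psh)
    show "f = g"
    proof (rule Psh_ext[OF h])
      fix A x assume x: "x \<in> at (source f) A"
      have "component (nat_comp \<alpha> f) A x = component (nat_comp \<alpha> g) A x" using f(6) by simp
      then have "component \<alpha> A (component f A x) = component \<alpha> A (component g A x)"
        using x by (simp add: component_comp[OF h(1)] component_comp[OF h(2)])
      then show "component f A x = component g A x"
        using inj Hom_PshD(5)[OF h(1) x] Hom_PshD(5)[OF h(2) x] by (meson inj_onD)
    qed
  qed
qed

end

section \<open>Subunits of a category of broad presheaves\<close>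

text \<open>Factorisation through a subpresheaf is a matter of images only.\<close>

lemma Psh_lift_injective:
  assumes p: "p \<in> Hom (Psh C) P G" and q: "q \<in> Hom (Psh C) Q G"
    and inj: "\<And>A. inj_on (component p A) (at P A)"
    and im: "\<And>A y. y \<in> at Q A \<Longrightarrow> component q A y \<in> component p A ` at P A"
  obtains h where "h \<in> Hom (Psh C) Q P" "nat_comp p h = q"
proof
  note pD = Hom_PshD[OF p] and qD = Hom_PshD[OF q]
  let ?i = "\<lambda>A y. inv_into (at P A) (component p A) (component q A y)"
  let ?h = "\<lparr>source = Q, target = P, component = (\<lambda>A. \<lambda>y \<in> at Q A. ?i A y)\<rparr>"
  have i: "?i A y \<in> at P A" "component p A (?i A y) = component q A y" if "y \<in> at Q A" for A y
    using im[OF that] by (auto intro: inv_into_into f_inv_into_f)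
  show h: "?h \<in> Hom (Psh C) Q P"
  proof (rule Hom_PshI)
    show "component ?h A \<in> at Q A \<rightarrow>\<^sub>E at P A" for A using i by auto
    fix f y assume f: "f \<in> Arr C" "y \<in> at Q (Cod C f)"
    have y': "along Q f y \<in> at Q (Dom C f)" using presheafD(2)[OF qD(1) f] .
    have iy: "along P f (?i (Cod C f) y) \<in> at P (Dom C f)" using presheafD(2)[OF pD(1) f(1) i(1)[OF f(2)]] .
    have "component p (Dom C f) (?i (Dom C f) (along Q f y)) = component p (Dom C f) (along P f (?i (Cod C f) y))"
      unfolding i(2)[OF y'] pD(6)[OF f(1) i(1)[OF f(2)]] i(2)[OF f(2)] by (rule qD(6)[OF f])
    then have "?i (Dom C f) (along Q f y) = along P f (?i (Cod C f) y)"
      using inj i(1)[OF y'] iy by (meson inj_onD)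
    then show "component ?h (Dom C f) (along Q f y) = along P f (component ?h (Cod C f) y)"
      using y' f(2) by simp
  qed (use pD qD in simp_all)
  show "nat_comp p ?h = q"
    by (rule Psh_ext[OF nat_comp_Hom[OF h p] q]) (use i in \<open>simp add: component_comp[OF h]\<close>)
qed

context broad_setting
begin

lemma subunit_Cb_Hom:
  assumes "subunit_arrow Cb r"
  shows "r \<in> Hom (Psh C) (source r) (yoneda C (Unit C))" "source r \<in> Obj Cb" "presheaf C (source r)"
    "inj_on (component r A) (at (source r) A)" "r \<in> Hom Cb (source r) (yoneda C (Unit C))"
proof -
  note D = cb.subunitD[OF assms]
  show h: "r \<in> Hom Cb (source r) (yoneda C (Unit C))" using D(2,3) by (simp add: Hom_def[of Cb])
  then show "r \<in> Hom (Psh C) (source r) (yoneda C (Unit C))" "source r \<in> Obj Cb" "presheaf C (source r)"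
    using Hom_Cb presheaf_Cb by blast+
  show "inj_on (component r A) (at (source r) A)" using monic_Cb_iff[OF h] D(1) by blast
qed

text \<open>Let \<open>r\<close> be a subunit whose domain \<open>R\<close> is \<open>\<langle>U, X\<rangle>\<close>. For \<open>s \<in> U\<close> the element \<open>s \<otimes> X\<close> of \<open>R\<close> over
  \<open>M = S \<odot> X\<close> is sent to an arrow \<open>m : M \<rightarrow> I\<close>. It is monic as \<open>r\<close> and \<open>s \<otimes> X\<close> are. That the action of
  \<open>r\<close> on \<open>R\<close> is injective makes \<open>m \<otimes> M\<close> monic. That it is surjective writes \<open>s \<otimes> X\<close> as the action of some \<open>a\<close> on some
  \<open>b\<close>; after restriction to \<open>s\<close>, which \<open>M\<close> absorbs, both \<open>a\<close> and \<open>b\<close> factor through \<open>s \<otimes> X\<close>, and this gives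
  a section of \<open>m \<otimes> M\<close>. So \<open>m\<close> is a subunit of \<open>C\<close>, and these subunits generate the image of \<open>r\<close>.\<close>

lemma generator_is_subunit:
  assumes sub: "subunit_arrow Cb r" and f: "embeds (source r) U X f"
    and s: "s \<in> U" and xs: "xs \<in> at (source r) (Dom C (rep s) \<odot> X)" "f (Dom C (rep s) \<odot> X) xs = act C (rep s) X"
  shows "subunit_arrow C (arrow_at r (Dom C (rep s) \<odot> X) xs)"
proof -
  let ?R = "source r" and ?S = "Dom C (rep s)"
  let ?M = "?S \<odot> X"
  let ?m = "arrow_at r ?M xs"
  note fD = embedsD[OF f]
  note rH = subunit_Cb_Hom(1)[OF sub]
  have su: "subunit_arrow C (rep s)" using s fD(2) rep_ISub(1) by blast
  note [simp] = subunitD(2,3)[OF su] fD(1,3) arrow_at(2-)[OF rH xs(1)]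
  have mon_s: "monic C (act C (rep s) X)" using stiff_square(2)[OF su su] by simp
  have m_along: "arrow_at r (Dom C k) (along ?R k xs) = ?m \<cdot> k" if "k \<in> Arr C" "Cod C k = ?M" for k
    using arrow_at_along[OF rH, of k xs] that xs(1) by simp
  have f_along: "f (Dom C k) (along ?R k xs) = act C (rep s) X \<cdot> k" if "k \<in> Arr C" "Cod C k = ?M" for k
    using fD(5)[of k xs] that xs by simp
  have inj_r: "x = y" if "x \<in> at ?R A" "y \<in> at ?R A" "arrow_at r A x = arrow_at r A y" for x y A
    using inj_onD[OF subunit_Cb_Hom(4)[OF sub], of A x y] arrow_at(1)[OF rH] that by metis
  have through: "\<exists>k. k \<in> Arr C \<and> Dom C k = A \<and> Cod C k = ?M \<and> x = along ?R k xs"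
    if x: "x \<in> at ?R A" "restr (f A x) (rep s)" for x A
  proof -
    note [simp] = fD(6-8)[OF x(1)]
    obtain k where k: "k \<in> Arr C" "Dom C k = A" "Cod C k = ?M" "f A x = act C (rep s) X \<cdot> k"
      using restrE[OF x(2)] by auto
    have "x = along ?R k xs"
      by (rule fD(10)[OF x(1)]) (use k xs f_along[OF k(1,3)] in \<open>simp_all add: along_in\<close>)
    then show ?thesis using k by blast
  qed
  have mon: "monic C ?m"
  proof (rule monicI)
    fix p q assume p: "p \<in> Arr C" "q \<in> Arr C" "Dom C p = Dom C q" "Cod C p = Dom C ?m" "Cod C q = Dom C ?m" "?m \<cdot> p = ?m \<cdot> q"
    have c: "Cod C p = ?M" "Cod C q = ?M" using p by simp_all
    have "along ?R p xs = along ?R q xs"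
      by (rule inj_r[where A="Dom C p"])
        (use p(1-3) c p(6) m_along[OF p(1) c(1)] m_along[OF p(2) c(2)] xs(1) in \<open>simp_all add: along_in\<close>)
    then have "act C (rep s) X \<cdot> p = act C (rep s) X \<cdot> q"
      using f_along[OF p(1) c(1)] f_along[OF p(2) c(2)] p(3) by simp
    then show "p = q" by (rule monicD[OF mon_s]) (use p(1-3) c in simp_all)
  qed simp
  have aH: "act (Psh C) r ?R \<in> Hom (Psh C) (day C ?R ?R) ?R" by (rule act_Psh_Hom[OF rH]) simp
  have "iso_arrow Cb (act Cb r ?R)" using cb.subunitD(4)[OF sub] by simp
  then have bij: "bij_betw (component (act (Psh C) r ?R) A) (at (day C ?R ?R) A) (at ?R A)" for A
    using Psh_iso_bij[OF _ aH] unfolding iso_Cb act_Cb by blast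
  let ?a = "act C ?m ?M"
  have act_xs: "component (act (Psh C) r ?R) (Dom C p) (along (day C ?R ?R) p (gen ?R ?R ?M ?M xs xs)) = along ?R (?a \<cdot> p) xs"
    if "p \<in> Arr C" "Cod C p = ?M \<odot> ?M" for p
    by (rule act_Psh_gen[OF rH fD(1) xs(1) xs(1) that(1) refl that(2)])
  \<comment> \<open>Two arrows that \<open>?a\<close> identifies restrict the generator of \<open>xs\<close> and \<open>xs\<close> to elements with the same image under the
    action, hence to the same element; its image in \<open>C(-, X \<odot> X)\<close> then identifies the two arrows.\<close>
  have mon_a: "monic C ?a"
  proof (rule monicI)
    fix p q assume p: "p \<in> Arr C" "q \<in> Arr C" "Dom C p = Dom C q" "Cod C p = Dom C ?a" "Cod C q = Dom C ?a" "?a \<cdot> p = ?a \<cdot> q"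
    have c: "Cod C p = ?M \<odot> ?M" "Cod C q = ?M \<odot> ?M" using p(4,5) by simp_all
    let ?g = "gen ?R ?R ?M ?M xs xs"
    have "along (day C ?R ?R) p ?g = along (day C ?R ?R) q ?g"
      by (rule inj_onD[OF bij_betw_imp_inj_on[OF bij[of "Dom C p"]]])
        (use act_xs[OF p(1) c(1)] act_xs[OF p(2) c(2)] p(1-3) c p(6) xs(1) in \<open>simp_all add: along_in\<close>)
    then have "(act C (rep s) X \<otimes> act C (rep s) X) \<cdot> p = (act C (rep s) X \<otimes> act C (rep s) X) \<cdot> q"
      using day_arrow_gen[OF f f xs(1) xs(1) p(1) refl c(1)] day_arrow_gen[OF f f xs(1) xs(1) p(2) refl c(2)] xs(2) p(3) by simp
    then show "p = q"
      by (rule monicD[OF act_tensor_act_monic[OF su su fD(3) fD(3)]]) (use p(1-3) c in simp_all)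
  qed simp
  \<comment> \<open>Surjectivity of the action yields \<open>a\<close> and \<open>b\<close>. Precomposition with the isomorphism \<open>?e\<close> restricts them to \<open>s\<close>.\<close>
  have "xs \<in> component (act (Psh C) r ?R) ?M ` at (day C ?R ?R) ?M"
    using bij[of ?M] xs(1) by (simp add: bij_betw_def)
  then obtain t where t: "t \<in> at (day C ?R ?R) ?M" "xs = component (act (Psh C) r ?R) ?M t" by blast
  obtain B D h a b where g: "a \<in> at ?R B" "b \<in> at ?R D" "h \<in> Arr C" "Dom C h = ?M" "Cod C h = B \<odot> D"
    "B \<in> Obj C" "D \<in> Obj C" "t = along (day C ?R ?R) h (gen ?R ?R B D a b)"
    using t(1) fD(1) fD(1) by (rule dayE)
  note [simp] = g(3-7) fD(6-8)[OF g(1)] fD(6-8)[OF g(2)] arrow_at(2-)[OF rH g(1)]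
  have xs_ab: "xs = along ?R (act C (arrow_at r B a) D \<cdot> h) b"
    unfolding t(2) g(8) by (rule act_Psh_gen[OF rH fD(1) g(1-5)])
  let ?e = "act C (rep s) ?M"
  have iso_e: "iso_arrow C ?e" by (rule act_absorb[OF su fD(3)])
  have eh: "restr (h \<cdot> ?e) (rep s)"
    by (rule restr_postcomp[OF restr_act]) simp_all
  have ehc: "h \<cdot> ?e \<in> Arr C" "Cod C (h \<cdot> ?e) = B \<odot> D" "Dom C (h \<cdot> ?e) = ?S \<odot> ?M" by simp_all
  obtain k where k: "k \<in> Arr C" "Dom C k = ?S \<odot> ?M" "Cod C k = (?S \<odot> B) \<odot> (?S \<odot> D)" "h \<cdot> ?e = (act C (rep s) B \<otimes> act C (rep s) D) \<cdot> k"
    using restr_tensor_factors[OF eh su ehc(1,2) g(6,7)] unfolding ehc(3) by blast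
  note [simp] = k(1-3)
  have ra: "along ?R (act C (rep s) B) a \<in> at ?R (?S \<odot> B)" "along ?R (act C (rep s) D) b \<in> at ?R (?S \<odot> D)"
    using g(1,2) by (simp_all add: along_in)
  have "restr (f (?S \<odot> B) (along ?R (act C (rep s) B) a)) (rep s)"
    using fD(5)[of "act C (rep s) B" a] g(1) restr_postcomp[OF restr_act[of "rep s" B], of "f B a"] by simp
  then obtain a1 where a1: "a1 \<in> Arr C" "Dom C a1 = ?S \<odot> B" "Cod C a1 = ?M" "along ?R (act C (rep s) B) a = along ?R a1 xs"
    using through[OF ra(1)] by blast
  have "restr (f (?S \<odot> D) (along ?R (act C (rep s) D) b)) (rep s)"
    using fD(5)[of "act C (rep s) D" b] g(2) restr_postcomp[OF restr_act[of "rep s" D], of "f D b"] by simp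
  then obtain b1 where b1: "b1 \<in> Arr C" "Dom C b1 = ?S \<odot> D" "Cod C b1 = ?M" "along ?R (act C (rep s) D) b = along ?R b1 xs"
    using through[OF ra(2)] by blast
  note [simp] = a1(1-3) b1(1-3)
  have ma: "arrow_at r B a \<cdot> act C (rep s) B = ?m \<cdot> a1"
    using arrow_at_along[OF rH, of "act C (rep s) B" a] g(1) m_along[of a1] a1(4) by simp
  let ?c = "?a \<cdot> (a1 \<otimes> b1) \<cdot> k"
  have "along ?R ?e xs = along ?R (act C (arrow_at r B a) D \<cdot> h \<cdot> ?e) b"
    using g(2) xs(1) by (subst xs_ab) (simp add: along_along)
  also have "h \<cdot> ?e = (act C (rep s) B \<otimes> act C (rep s) D) \<cdot> k" by (rule k(4))
  also have "act C (arrow_at r B a) D \<cdot> (act C (rep s) B \<otimes> act C (rep s) D) \<cdot> k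
      = (act C (arrow_at r B a) D \<cdot> (act C (rep s) B \<otimes> act C (rep s) D)) \<cdot> k" by simp
  also have "\<dots> = (act C (rep s) D \<cdot> act C (arrow_at r B a \<cdot> act C (rep s) B) (?S \<odot> D)) \<cdot> k"
    by (subst act_tensor_hom) simp_all
  also have "\<dots> = act C (rep s) D \<cdot> (act C (?m \<cdot> a1) (?S \<odot> D) \<cdot> k)" unfolding ma by simp
  also have "along ?R \<dots> b = along ?R (act C (?m \<cdot> a1) (?S \<odot> D) \<cdot> k) (along ?R (act C (rep s) D) b)"
    using g(2) by (subst along_along) simp_all
  also have "\<dots> = along ?R (b1 \<cdot> (act C (?m \<cdot> a1) (?S \<odot> D) \<cdot> k)) xs"
    unfolding b1(4) using xs(1) by (subst along_along) simp_all
  also have "b1 \<cdot> (act C (?m \<cdot> a1) (?S \<odot> D) \<cdot> k) = (b1 \<cdot> act C (?m \<cdot> a1) (?S \<odot> D)) \<cdot> k" by simp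
  also have "\<dots> = (?a \<cdot> (a1 \<otimes> b1)) \<cdot> k"
    by (subst act_tensor_hom) simp_all
  also have "\<dots> = ?c" by simp
  finally have e_c: "along ?R ?e xs = along ?R ?c xs" .
  have "act C (rep s) X \<cdot> ?e = act C (rep s) X \<cdot> ?c"
    using f_along[of ?e] f_along[of ?c] e_c by simp
  then have "?e = ?c" by (rule monicD[OF mon_s]) simp_all
  then have "?c \<cdot> inv_arrow C ?e = Ident C ?M" using inv_arr(5)[OF iso_e] by simp
  moreover have "?c \<cdot> inv_arrow C ?e = ?a \<cdot> ((a1 \<otimes> b1) \<cdot> k \<cdot> inv_arrow C ?e)"
    using iso_e by simp
  ultimately have sec: "?a \<cdot> ((a1 \<otimes> b1) \<cdot> k \<cdot> inv_arrow C ?e) = Ident C (Cod C ?a)" by simp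
  have "iso_arrow C ?a"
    by (rule monic_split_iso[OF mon_a _ _ _ sec]) (use iso_e in simp_all)
  then show ?thesis by (intro subunitI mon) simp_all
qed

text \<open>The generators of the previous lemma, one for each \<open>s \<in> U\<close>, form a monotone image of \<open>U\<close>.\<close>

lemma subunit_generators:
  assumes sub: "subunit_arrow Cb r"
  shows "\<exists>V. K V \<and> embeds (source r) V (Unit C) (arrow_at r)"
proof -
  let ?R = "source r"
  obtain U X f where U: "K U" and f: "embeds ?R U X f"
    using subunit_Cb_Hom(2)[OF sub] Obj_Cb by blast
  note fD = embedsD[OF f] and rH = subunit_Cb_Hom(1)[OF sub]
  let ?M = "\<lambda>s. Dom C (rep s) \<odot> X"
  have "\<exists>x. x \<in> at ?R (?M s) \<and> f (?M s) x = act C (rep s) X" if "s \<in> U" for s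
  proof -
    have c: "s \<in> carrier (ISub C)" using that fD(2) by blast
    note [simp] = rep_arr[OF c] fD(3)
    have "restr (act C (rep s) X) (rep s)" by (rule restr_act) simp_all
    then show ?thesis using fD(11)[of "act C (rep s) X" "?M s" s] that by auto
  qed
  then obtain xs where xs: "xs s \<in> at ?R (?M s)" "f (?M s) (xs s) = act C (rep s) X" if "s \<in> U" for s by metis
  let ?m = "\<lambda>s. arrow_at r (?M s) (xs s)"
  have su: "subunit_arrow C (?m s)" if "s \<in> U" for s
    using generator_is_subunit[OF sub f that xs[OF that]] .
  define V where "V = (\<lambda>s. subobject C (?m s)) ` U"
  have Vc: "V \<subseteq> carrier (ISub C)" using su subobject_in_ISub unfolding V_def by blast
  have fac: "\<exists>k. k \<in> Arr C \<and> Dom C k = A \<and> Cod C k = ?M s \<and> x = along ?R k (xs s) \<and> arrow_at r A x = ?m s \<cdot> k"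
    if x: "x \<in> at ?R A" "restr (f A x) (rep s)" "s \<in> U" for x A s
  proof -
    have c: "s \<in> carrier (ISub C)" using x(3) fD(2) by blast
    note [simp] = rep_arr[OF c] fD(1,3) fD(6-8)[OF x(1)]
    obtain k where k: "k \<in> Arr C" "Dom C k = A" "Cod C k = ?M s" "f A x = act C (rep s) X \<cdot> k"
      using restrE[OF x(2)] by auto
    have "x = along ?R k (xs s)"
      by (rule fD(10)[OF x(1)]) (use k xs[OF x(3)] fD(5)[of k "xs s"] in \<open>simp_all add: along_in\<close>)
    then show ?thesis using k(1-3) arrow_at_along[OF rH, of k "xs s"] xs(1)[OF x(3)] by auto
  qed
  have "K V" unfolding V_def
  proof (rule K_image[OF fD(2) U])
    show "(\<lambda>s. subobject C (?m s)) ` U \<subseteq> carrier (ISub C)" using Vc unfolding V_def .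
    fix s t assume st: "s \<in> U" "t \<in> U" "s \<sqsubseteq>\<^bsub>ISub C\<^esub> t"
    have c: "s \<in> carrier (ISub C)" "t \<in> carrier (ISub C)" using st fD(2) by blast+
    note [simp] = rep_arr[OF c(1)] rep_arr[OF c(2)] fD(3)
    have "restr (act C (rep s) X) (rep t)"
      using restr_mono[OF restr_act, of "rep s" X "rep t"] st(3) by (simp add: le_ISub)
    then have "restr (f (?M s) (xs s)) (rep t)" using xs(2)[OF st(1)] by simp
    then obtain k where "k \<in> Arr C" "Cod C k = ?M t" "?m s = ?m t \<cdot> k"
      using fac[OF xs(1)[OF st(1)] _ st(2)] by blast
    then show "subobject C (?m s) \<sqsubseteq>\<^bsub>ISub C\<^esub> subobject C (?m t)"
      unfolding le_subobject[OF su[OF st(1)] su[OF st(2)]]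
      using arrow_at[OF rH xs(1)[OF st(2)]] by (intro factorsI) auto
  qed
  moreover have "embeds ?R V (Unit C) (arrow_at r)"
    unfolding embeds_def
  proof (intro conjI allI ballI fD(1) Vc unit_obj)
    fix A
    have rep_fac: "factors_through C (?m s) (rep (subobject C (?m s)))" "factors_through C (rep (subobject C (?m s))) (?m s)"
        "rep (subobject C (?m s)) \<in> Arr C" "Cod C (rep (subobject C (?m s))) = Unit C" if "s \<in> U" for s
      using rep_subobject[OF subunitD(1)[OF su[OF that]]] rep_arr[OF subobject_in_ISub[OF su[OF that]]] by auto
    show "bij_betw (arrow_at r A) (at ?R A) (restricting_arrows V (Unit C) A)"
      unfolding bij_betw_def
    proof (intro conjI inj_onI equalityI subsetI)
      fix x y assume "x \<in> at ?R A" "y \<in> at ?R A" "arrow_at r A x = arrow_at r A y"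
      then show "x = y"
        using inj_onD[OF subunit_Cb_Hom(4)[OF sub], of A x y] arrow_at(1)[OF rH] by metis
    next
      fix k assume "k \<in> arrow_at r A ` at ?R A"
      then obtain x where x: "x \<in> at ?R A" "k = arrow_at r A x" by blast
      obtain s where s: "s \<in> U" "restr (f A x) (rep s)" using fD(9)[OF x(1)] by blast
      obtain l where l: "l \<in> Arr C" "Dom C l = A" "Cod C l = ?M s" "arrow_at r A x = ?m s \<cdot> l" using fac[OF x(1) s(2,1)] by blast
      note [simp] = arrow_at(2-)[OF rH x(1)] arrow_at(2-)[OF rH xs(1)[OF s(1)]]
      have "factors_through C k (?m s)" unfolding x(2) by (rule factorsI[OF l(4)]) (use l in simp_all)
      then have "factors_through C k (rep (subobject C (?m s)))"
        using factors_trans rep_fac[OF s(1)] by blast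
      then have "restr k (rep (subobject C (?m s)))"
        using rep_fac[OF s(1)] by (subst restr_unit_iff) (simp_all add: x(2))
      then show "k \<in> restricting_arrows V (Unit C) A"
        using s(1) by (auto simp: restricting_arrows_def V_def Hom_iff x(2))
    next
      fix k assume "k \<in> restricting_arrows V (Unit C) A"
      then obtain s where s: "s \<in> U" "restr k (rep (subobject C (?m s)))" and k: "k \<in> Arr C" "Dom C k = A" "Cod C k = Unit C"
        unfolding restricting_arrows_def V_def Hom_iff by blast
      note [simp] = arrow_at(2-)[OF rH xs(1)[OF s(1)]]
      have fk: "factors_through C k (rep (subobject C (?m s)))"
        using s(2) rep_fac[OF s(1)] k by (subst (asm) restr_unit_iff) simp_all
      have "factors_through C k (?m s)" by (rule factors_trans[OF fk rep_fac(2)[OF s(1)]]) simp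
      then obtain l where "l \<in> Arr C" "Dom C l = Dom C k" "Cod C l = Dom C (?m s)" and lk: "k = ?m s \<cdot> l"
        unfolding factors_iff by blast
      then have l: "l \<in> Arr C" "Dom C l = A" "Cod C l = ?M s" using k(2) by simp_all
      have "arrow_at r A (along ?R l (xs s)) = k"
        using arrow_at_along[OF rH, of l "xs s"] l xs(1)[OF s(1)] lk[symmetric] by simp
      moreover have "along ?R l (xs s) \<in> at ?R A"
        using l(1-3) xs(1)[OF s(1)] fD(1) by (intro along_in) simp_all
      ultimately show "k \<in> arrow_at r A ` at ?R A" by (metis imageI)
    qed
  qed (rule arrow_at_along[OF rH])
  ultimately show ?thesis by blast
qed

text \<open>The subunits of \<open>C\<close> that lie in the image of \<open>r\<close>. By \<open>subunit_generators\<close> they determine that image.\<close>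

definition subs :: "('o, 'a) psh_map \<Rightarrow> 'a set set" where
  "subs r = {v \<in> carrier (ISub C). rep v \<in> arrow_at r (Dom C (rep v)) ` at (source r) (Dom C (rep v))}"

lemma subs_eq_down:
  assumes e: "embeds (source r) V (Unit C) (arrow_at r)"
  shows "subs r = down V"
proof -
  note eD = embedsD[OF e]
  have "rep v \<in> arrow_at r (Dom C (rep v)) ` at (source r) (Dom C (rep v)) \<longleftrightarrow> (\<exists>w \<in> V. v \<sqsubseteq>\<^bsub>ISub C\<^esub> w)"
    if v: "v \<in> carrier (ISub C)" for v
  proof -
    have "rep v \<in> arrow_at r (Dom C (rep v)) ` at (source r) (Dom C (rep v))
        \<longleftrightarrow> rep v \<in> restricting_arrows V (Unit C) (Dom C (rep v))"
      using eD(4) by (simp add: bij_betw_def)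
    also have "\<dots> \<longleftrightarrow> (\<exists>w \<in> V. restr (rep v) (rep w))"
      using rep_arr[OF v] by (simp add: restricting_arrows_def Hom_iff)
    also have "\<dots> \<longleftrightarrow> (\<exists>w \<in> V. v \<sqsubseteq>\<^bsub>ISub C\<^esub> w)"
    proof (rule bex_cong[OF refl])
      fix w assume "w \<in> V"
      then have w: "w \<in> carrier (ISub C)" using eD(2) by blast
      show "restr (rep v) (rep w) \<longleftrightarrow> v \<sqsubseteq>\<^bsub>ISub C\<^esub> w"
        unfolding le_ISub by (rule restr_unit_iff) (use rep_arr[OF v] rep_arr[OF w] in simp_all)
    qed
    finally show ?thesis .
  qed
  then show ?thesis unfolding subs_def down_def by blast
qed

lemma down_idem:
  assumes "V \<subseteq> carrier (ISub C)" shows "down (down V) = down V"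
proof (intro equalityI subsetI)
  fix v assume "v \<in> down (down V)"
  then obtain w u where "v \<in> carrier (ISub C)" "v \<sqsubseteq>\<^bsub>ISub C\<^esub> w" "w \<sqsubseteq>\<^bsub>ISub C\<^esub> u" "u \<in> V"
    unfolding down_def by blast
  then show "v \<in> down V" using ISub_trans assms unfolding down_def by blast
next
  fix v assume "v \<in> down V"
  then show "v \<in> down (down V)" using ISub_refl unfolding down_def by blast
qed

lemma subunit_subs:
  assumes "subunit_arrow Cb r"
  shows "embeds (source r) (subs r) (Unit C) (arrow_at r)" "K (subs r)" "subs r \<subseteq> carrier (ISub C)" "down (subs r) = subs r"
proof -
  obtain V where V: "K V" "embeds (source r) V (Unit C) (arrow_at r)"
    using subunit_generators[OF assms] by blast
  note VD = embedsD[OF V(2)]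
  show "K (subs r)" unfolding subs_eq_down[OF V(2)] by (rule K_down[OF VD(2) V(1)])
  show c: "subs r \<subseteq> carrier (ISub C)" unfolding subs_def by blast
  show "down (subs r) = subs r" unfolding subs_eq_down[OF V(2)] by (rule down_idem[OF VD(2)])
  show "embeds (source r) (subs r) (Unit C) (arrow_at r)"
    using V(2) c unfolding embeds_def subs_eq_down[OF V(2)] restricting_down[OF VD(2)] by blast
qed

text \<open>The inclusion of \<open>R = \<langle>V, I\<rangle>\<close> is a subunit because \<open>R \<otimes> R\<close> and \<open>R\<close> embed into \<open>C(-, I)\<close> with the same
  image: restricting to \<open>v\<close> and \<open>v'\<close> in \<open>V\<close> is restricting to a member of \<open>V\<close>.\<close>

lemma subunit_exists:
  assumes V: "V \<subseteq> carrier (ISub C)" "down V = V" "K V"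
  obtains r where "subunit_arrow Cb r" "subs r = V"
proof
  let ?R = "broad C V (Unit C)" and ?Y = "yoneda C (Unit C)"
  let ?r = "\<lparr>source = ?R, target = ?Y, component = (\<lambda>A. \<lambda>x \<in> at ?R A. x)\<rparr>"
  note b = broad_embeds[OF V(1) unit_obj]
  note bD = embedsD[OF b]
  have R: "?R \<in> Obj Cb" using b V(3) Obj_Cb by blast
  have at: "at ?R A = Arrow ` restricting_arrows V (Unit C) A" for A by (simp add: broad_def restricting_eq)
  have sub: "restricting_arrows V (Unit C) A \<subseteq> Hom C A (Unit C)" for A unfolding restricting_arrows_def by blast
  have rH: "?r \<in> Hom (Psh C) ?R ?Y"
  proof (rule Hom_PshI)
    show "component ?r A \<in> at ?R A \<rightarrow>\<^sub>E at ?Y A" for A using sub[of A] by (auto simp: at yoneda_at)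
    fix h x assume h: "h \<in> Arr C" "x \<in> at ?R (Cod C h)"
    then obtain k where k: "k \<in> restricting_arrows V (Unit C) (Cod C h)" "x = Arrow k" by (auto simp: at)
    have kk: "k \<in> Arr C" "Dom C k = Cod C h" "Cod C k = Unit C" using k(1) by (auto simp: restricting_arrows_def Hom_iff)
    show "component ?r (Dom C h) (along ?R h x) = along ?Y h (component ?r (Cod C h) x)"
      using h presheafD(2)[OF bD(1) h] broad_along[OF h(1) k(1)] yoneda_along[OF h(1) kk] by (simp add: k(2))
  qed (use bD in simp_all)
  have rC: "?r \<in> Hom Cb ?R ?Y" using rH R yoneda_Cb[OF unit_obj] Hom_Cb by blast
  have e: "embeds ?R V (Unit C) (arrow_at ?r)"
    by (rule embeds_cong[OF b]) (simp add: arrow_at_def)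
  have inj: "\<forall>A. inj_on (component ?r A) (at ?R A)" by (simp add: inj_on_def)
  have "iso_arrow Cb (act Cb ?r (Dom Cb ?r))"
  proof -
    let ?a = "component (act (Psh C) ?r ?R)"
    have aH: "act (Psh C) ?r ?R \<in> Hom (Psh C) (day C ?R ?R) ?R" by (rule act_Psh_Hom[OF rH bD(1)])
    have "bij_betw (\<lambda>t. arrow_at ?r A (?a A t)) (at (day C ?R ?R) A) (restricting_arrows V (Unit C) A)" for A
      using embedsD(4)[OF act_embeds[OF rH e e], of A] restricting_meets[OF V(1) V(1)] by simp
    moreover have "bij_betw (arrow_at ?r A) (at ?R A) (restricting_arrows V (Unit C) A)" for A
      using embedsD(4)[OF e] .
    ultimately have "bij_betw (?a A) (at (day C ?R ?R) A) (at ?R A)" for A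
      using bij_betw_comp_iff2[of "arrow_at ?r A" "at ?R A" "restricting_arrows V (Unit C) A" "?a A" "at (day C ?R ?R) A"]
        Hom_PshD(5)[OF aH] by (simp add: comp_def image_subset_iff)
    then have "iso_arrow (Psh C) (act (Psh C) ?r ?R)" by (rule Psh_bij_iso[OF aH])
    then show ?thesis using R day_Cb[OF R R] Hom_PshD(3,4)[OF aH] by (simp add: iso_Cb act_Cb)
  qed
  moreover have "monic Cb ?r" using monic_Cb_iff[OF rC] inj by blast
  ultimately show "subunit_arrow Cb ?r" by (intro cb.subunitI) simp_all
  show "subs ?r = V" using subs_eq_down[of ?r V] e V(2) by simp
qed

lemma factors_subs:
  assumes r: "subunit_arrow Cb r" and r': "subunit_arrow Cb r'"
  shows "factors_through Cb r r' \<longleftrightarrow> subs r \<subseteq> subs r'"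
proof
  note rH = subunit_Cb_Hom[OF r] and r'H = subunit_Cb_Hom[OF r']
  show "subs r \<subseteq> subs r'" if fac: "factors_through Cb r r'"
  proof -
    obtain h where h: "h \<in> Arr Cb" "source h = source r" "target h = source r'" "r = nat_comp r' h"
      using fac unfolding cb.factors_iff Cb_sel by blast
    have hH: "h \<in> Hom (Psh C) (source r) (source r')" using h(1-3) by (simp add: Arr_Cb Hom_Psh)
    have "arrow_at r A x \<in> arrow_at r' A ` at (source r') A" if "x \<in> at (source r) A" for A x
    proof -
      have "component r A x = component r' A (component h A x)"
        using that by (subst h(4)) (simp add: component_comp[OF hH])
      then show ?thesis using Hom_PshD(5)[OF hH that] by (simp add: arrow_at_def)
    qed
    then have "arrow_at r A ` at (source r) A \<subseteq> arrow_at r' A ` at (source r') A" for A by blast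
    then show ?thesis unfolding subs_def by blast
  qed
  assume sub: "subs r \<subseteq> subs r'"
  have "restricting_arrows (subs r) (Unit C) A \<subseteq> restricting_arrows (subs r') (Unit C) A" for A
    using sub unfolding restricting_arrows_def by blast
  then have im: "arrow_at r A ` at (source r) A \<subseteq> arrow_at r' A ` at (source r') A" for A
    using embedsD(4)[OF subunit_subs(1)[OF r], of A] embedsD(4)[OF subunit_subs(1)[OF r'], of A] by (simp add: bij_betw_def)
  obtain h where h: "h \<in> Hom (Psh C) (source r) (source r')" "nat_comp r' h = r"
  proof (rule Psh_lift_injective[OF r'H(1) rH(1) r'H(4)])
    fix A y assume y: "y \<in> at (source r) A"
    then obtain z where "z \<in> at (source r') A" "arrow_at r A y = arrow_at r' A z" using im[of A] by blast
    then show "component r A y \<in> component r' A ` at (source r') A"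
      using arrow_at(1)[OF rH(1) y] arrow_at(1)[OF r'H(1)] by (metis imageI)
  qed
  then have "h \<in> Hom Cb (source r) (source r')" using Hom_Cb rH(2) r'H(2) by blast
  then show "factors_through Cb r r'" unfolding factors_through_def using h(2) by auto
qed

end

section \<open>Pullbacks, pushouts and colimits of subpresheaves\<close>

text \<open>Maps out of a presheaf covered by a family are determined on the members, and exist whenever they agree
  where the members overlap. For the empty family, \<open>L\<close> is the empty presheaf.\<close>

lemma Psh_glue:
  assumes L: "presheaf C L" and M: "presheaf C M"
    and c: "\<And>j. j \<in> J \<Longrightarrow> c j \<in> Hom (Psh C) (d j) L" and c': "\<And>j. j \<in> J \<Longrightarrow> c' j \<in> Hom (Psh C) (d j) M"
    and surj: "\<And>A z. z \<in> at L A \<Longrightarrow> \<exists>j \<in> J. z \<in> component (c j) A ` at (d j) A"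
    and compat: "\<And>i j A a b. \<lbrakk>i \<in> J; j \<in> J; a \<in> at (d i) A; b \<in> at (d j) A; component (c i) A a = component (c j) A b\<rbrakk>
      \<Longrightarrow> component (c' i) A a = component (c' j) A b"
  shows "\<exists>!u. u \<in> Hom (Psh C) L M \<and> (\<forall>j \<in> J. nat_comp u (c j) = c' j)"
proof (rule ex_ex1I)
  define g where "g = (\<lambda>A z. THE w. \<exists>j \<in> J. \<exists>a \<in> at (d j) A. component (c j) A a = z \<and> component (c' j) A a = w)"
  have g: "g A (component (c j) A a) = component (c' j) A a" if "j \<in> J" "a \<in> at (d j) A" for j a A
    unfolding g_def by (rule the_equality) (use that compat in blast)+
  let ?u = "\<lparr>source = L, target = M, component = (\<lambda>A. \<lambda>z \<in> at L A. g A z)\<rparr>"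
  have u: "?u \<in> Hom (Psh C) L M"
  proof (rule Hom_PshI[OF L M])
    show "component ?u A \<in> at L A \<rightarrow>\<^sub>E at M A" for A
    proof (rule PiE_I)
      fix z assume z: "z \<in> at L A"
      then obtain j a where "j \<in> J" "a \<in> at (d j) A" "z = component (c j) A a" using surj by blast
      then show "component ?u A z \<in> at M A" using z g Hom_PshD(5)[OF c'] by simp
    qed simp
    fix f z assume f: "f \<in> Arr C" and z: "z \<in> at L (Cod C f)"
    then obtain j a where j: "j \<in> J" "a \<in> at (d j) (Cod C f)" "z = component (c j) (Cod C f) a" using surj by blast
    have a: "along (d j) f a \<in> at (d j) (Dom C f)" using presheafD(2)[OF Hom_PshD(1)[OF c[OF j(1)]] f j(2)] .
    have "g (Dom C f) (along L f z) = along M f (g (Cod C f) z)"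
      using g[OF j(1) a] g[OF j(1,2)] Hom_PshD(6)[OF c[OF j(1)] f j(2)] Hom_PshD(6)[OF c'[OF j(1)] f j(2)] j(3) by simp
    then show "component ?u (Dom C f) (along L f z) = along M f (component ?u (Cod C f) z)"
      using z presheafD(2)[OF L f z] by simp
  qed simp_all
  have "nat_comp ?u (c j) = c' j" if j: "j \<in> J" for j
    by (rule Psh_ext[OF nat_comp_Hom[OF c[OF j] u] c'[OF j]])
      (use g[OF j] Hom_PshD(5)[OF c[OF j]] in \<open>simp add: component_comp[OF c[OF j]]\<close>)
  then show "\<exists>u. u \<in> Hom (Psh C) L M \<and> (\<forall>j \<in> J. nat_comp u (c j) = c' j)" using u by blast
next
  fix u v assume u: "u \<in> Hom (Psh C) L M \<and> (\<forall>j \<in> J. nat_comp u (c j) = c' j)"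
    and v: "v \<in> Hom (Psh C) L M \<and> (\<forall>j \<in> J. nat_comp v (c j) = c' j)"
  show "u = v"
  proof (rule Psh_ext)
    fix A z assume "z \<in> at L A"
    then obtain j a where j: "j \<in> J" "a \<in> at (d j) A" "z = component (c j) A a" using surj by blast
    have "component (nat_comp u (c j)) A a = component (nat_comp v (c j)) A a" using u v j(1) by simp
    then show "component u A z = component v A z" using j by (simp add: component_comp[OF c[OF j(1)]])
  qed (use u v in auto)
qed

context braided
begin

lemma inclusion_facts:
  assumes "u \<in> carrier (ISub C)" "v \<in> carrier (ISub C)" "u \<sqsubseteq>\<^bsub>ISub C\<^esub> v"
  shows "inclusion C u v \<in> Arr C" "Dom C (inclusion C u v) = sub_obj C u" "Cod C (inclusion C u v) = sub_obj C v"
    "rep v \<cdot> inclusion C u v = rep u"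
proof -
  note v = subunitD(1)[OF rep_ISub(1)[OF assms(2)]]
  have ex: "\<exists>h. h \<in> Hom C (sub_obj C u) (sub_obj C v) \<and> rep v \<cdot> h = rep u"
    using assms(3) unfolding le_ISub factors_through_def sub_obj_def by blast
  have "\<exists>!h. h \<in> Hom C (sub_obj C u) (sub_obj C v) \<and> rep v \<cdot> h = rep u"
  proof (rule ex_ex1I[OF ex])
    fix h k assume "h \<in> Hom C (sub_obj C u) (sub_obj C v) \<and> rep v \<cdot> h = rep u"
      "k \<in> Hom C (sub_obj C u) (sub_obj C v) \<and> rep v \<cdot> k = rep u"
    then show "h = k" using monicD[OF v, of h k] by (simp add: Hom_iff sub_obj_def)
  qed
  from theI'[OF this] show "inclusion C u v \<in> Arr C" "Dom C (inclusion C u v) = sub_obj C u"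
    "Cod C (inclusion C u v) = sub_obj C v" "rep v \<cdot> inclusion C u v = rep u"
    unfolding inclusion_def by (auto simp: Hom_iff)
qed

end

context broad_setting
begin

lemma comp_elt:
  "\<lbrakk>\<alpha> \<in> Hom Cb F G; x \<in> at F A\<rbrakk> \<Longrightarrow> component (nat_comp \<beta> \<alpha>) A x = component \<beta> A (component \<alpha> A x)"
  using component_comp[of \<alpha> C F G x A \<beta>] Hom_Cb[of \<alpha> F G] by blast

lemma Hom_CbD:
  assumes "\<alpha> \<in> Hom Cb F G"
  shows "\<alpha> \<in> Hom (Psh C) F G" "F \<in> Obj Cb" "G \<in> Obj Cb" "x \<in> at F A \<Longrightarrow> component \<alpha> A x \<in> at G A"
    "source \<alpha> = F" "target \<alpha> = G" "\<alpha> \<in> Arr Cb"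
proof -
  show h: "\<alpha> \<in> Hom (Psh C) F G" "F \<in> Obj Cb" "G \<in> Obj Cb" using assms Hom_Cb by blast+
  show "x \<in> at F A \<Longrightarrow> component \<alpha> A x \<in> at G A" "source \<alpha> = F" "target \<alpha> = G"
    using Hom_PshD(3-5)[OF h(1)] by blast+
  show "\<alpha> \<in> Arr Cb" using assms by (simp add: Hom_def[of Cb])
qed

lemma Cb_pullbackI:
  assumes p: "p \<in> Hom Cb P X" and q: "q \<in> Hom Cb P Y" and f: "f \<in> Hom Cb X Z" and g: "g \<in> Hom Cb Y Z"
    and comm: "nat_comp f p = nat_comp g q"
    and inj: "\<And>A. inj_on (component f A) (at X A)" "\<And>A. inj_on (component q A) (at P A)"
    and ex: "\<And>A a b. \<lbrakk>a \<in> at X A; b \<in> at Y A; component f A a = component g A b\<rbrakk> \<Longrightarrow> b \<in> component q A ` at P A"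
  shows "pullback Cb p q f g"
  unfolding pullback_def
proof (intro conjI allI impI)
  note pD = Hom_CbD[OF p] and qD = Hom_CbD[OF q] and fD = Hom_CbD[OF f] and gD = Hom_CbD[OF g]
  show "commuting_square Cb p q f g"
    using pD qD fD gD comm by (simp add: commuting_square_def)
  have mf: "monic Cb f" and mq: "monic Cb q" using monic_Cb_iff[OF f] monic_Cb_iff[OF q] inj by auto
  fix p' q' assume "commuting_square Cb p' q' f g"
  then have c: "p' \<in> Arr Cb" "q' \<in> Arr Cb" "source p' = source q'" "target p' = X" "target q' = Y" "nat_comp f p' = nat_comp g q'"
    using fD gD by (auto simp: commuting_square_def)
  have h': "p' \<in> Hom Cb (source p') X" "q' \<in> Hom Cb (source p') Y" using c by (auto simp: Hom_def[of Cb])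
  obtain h where h: "h \<in> Hom (Psh C) (source p') P" "nat_comp q h = q'"
  proof (rule Psh_lift_injective[OF qD(1) Hom_CbD(1)[OF h'(2)] inj(2)])
    fix A y assume y: "y \<in> at (source p') A"
    have "component (nat_comp f p') A y = component (nat_comp g q') A y" using c(6) by simp
    then show "component q' A y \<in> component q A ` at P A"
      using ex[OF Hom_CbD(4)[OF h'(1) y] Hom_CbD(4)[OF h'(2) y]] comp_elt[OF h'(1) y] comp_elt[OF h'(2) y] by simp
  qed
  have hC: "h \<in> Hom Cb (source p') P" using h(1) Hom_Cb Hom_CbD(2)[OF h'(1)] pD(2) by blast
  note hD = Hom_CbD[OF hC]
  have "nat_comp f (nat_comp p h) = nat_comp f p'"
    using cb.comp_assoc[OF hC p f] cb.comp_assoc[OF hC q g] comm h(2) c(6) by simp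
  then have ph: "nat_comp p h = p'"
    using cb.monicD[OF mf, of "nat_comp p h" p'] c fD pD hD cb.comp_arr[of h p] by simp
  show "\<exists>!h. h \<in> Hom Cb (Dom Cb p') (Dom Cb p) \<and> p \<cdot>\<^bsub>Cb\<^esub> h = p' \<and> q \<cdot>\<^bsub>Cb\<^esub> h = q'"
  proof (rule ex1I[of _ h])
    show "h \<in> Hom Cb (Dom Cb p') (Dom Cb p) \<and> p \<cdot>\<^bsub>Cb\<^esub> h = p' \<and> q \<cdot>\<^bsub>Cb\<^esub> h = q'" using hC ph h(2) pD by simp
    fix k assume k: "k \<in> Hom Cb (Dom Cb p') (Dom Cb p) \<and> p \<cdot>\<^bsub>Cb\<^esub> k = p' \<and> q \<cdot>\<^bsub>Cb\<^esub> k = q'"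
    then show "k = h"
      using cb.monicD[OF mq, of k h] h(2) hD pD qD Hom_CbD[of k "source p'" P] by simp
  qed
qed

lemma Cb_pushoutI:
  assumes p: "p \<in> Hom Cb P X" and q: "q \<in> Hom Cb P Y" and f: "f \<in> Hom Cb X Z" and g: "g \<in> Hom Cb Y Z"
    and comm: "nat_comp f p = nat_comp g q"
    and inj: "\<And>A. inj_on (component f A) (at X A)" "\<And>A. inj_on (component g A) (at Y A)"
    and surj: "\<And>A z. z \<in> at Z A \<Longrightarrow> z \<in> component f A ` at X A \<or> z \<in> component g A ` at Y A"
    and ex: "\<And>A a b. \<lbrakk>a \<in> at X A; b \<in> at Y A; component f A a = component g A b\<rbrakk>
      \<Longrightarrow> \<exists>x \<in> at P A. component p A x = a \<and> component q A x = b"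
  shows "pushout Cb p q f g"
  unfolding pushout_def
proof (intro conjI allI impI)
  note pD = Hom_CbD[OF p] and qD = Hom_CbD[OF q] and fD = Hom_CbD[OF f] and gD = Hom_CbD[OF g]
  show "commuting_square Cb p q f g"
    using pD qD fD gD comm by (simp add: commuting_square_def)
  fix f' g' assume "commuting_square Cb p q f' g'"
  then have c: "f' \<in> Arr Cb" "g' \<in> Arr Cb" "source f' = X" "source g' = Y" "target g' = target f'" "nat_comp f' p = nat_comp g' q"
    using pD qD by (auto simp: commuting_square_def)
  let ?M = "target f'"
  have h': "f' \<in> Hom Cb X ?M" "g' \<in> Hom Cb Y ?M" using c by (auto simp: Hom_def[of Cb])
  have M: "?M \<in> Obj Cb" using Hom_CbD(3)[OF h'(1)] .
  have cross: "component f' A a = component g' A b"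
    if ab: "a \<in> at X A" "b \<in> at Y A" "component f A a = component g A b" for A a b
  proof -
    obtain x where x: "x \<in> at P A" "component p A x = a" "component q A x = b" using ex[OF ab] by blast
    have "component (nat_comp f' p) A x = component (nat_comp g' q) A x" using c(6) by simp
    then show ?thesis using comp_elt[OF p x(1)] comp_elt[OF q x(1)] x(2,3) by simp
  qed
  have cross': "component g' A a = component f' A b"
    if "a \<in> at Y A" "b \<in> at X A" "component g A a = component f A b" for A a b
    using cross[OF that(2,1) that(3)[symmetric]] by (rule sym)
  have ff: "component f' A a = component f' A b"
    if "a \<in> at X A" "b \<in> at X A" "component f A a = component f A b" for A a b
    using inj_onD[OF inj(1) that(3,1,2)] by (rule arg_cong)
  have gg: "component g' A a = component g' A b"
    if "a \<in> at Y A" "b \<in> at Y A" "component g A a = component g A b" for A a b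
    using inj_onD[OF inj(2) that(3,1,2)] by (rule arg_cong)
  have bool_all: "(\<forall>j \<in> UNIV. nat_comp u (if j then f else g) = (if j then f' else g'))
      \<longleftrightarrow> nat_comp u f = f' \<and> nat_comp u g = g'" for u
    by (simp add: all_bool_eq)
  have "\<exists>!u. u \<in> Hom (Psh C) Z ?M \<and> (\<forall>j \<in> UNIV. nat_comp u (if j then f else g) = (if j then f' else g'))"
  proof (rule Psh_glue[where d="\<lambda>j. if j then X else Y"])
    show "presheaf C Z" "presheaf C ?M" using presheaf_Cb fD(3) M by auto
    show "(if j then f else g) \<in> Hom (Psh C) (if j then X else Y) Z" for j using fD(1) gD(1) by simp
    show "(if j then f' else g') \<in> Hom (Psh C) (if j then X else Y) ?M" for j using Hom_CbD(1) h' by simp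
    show "\<exists>j\<in>UNIV. z \<in> component (if j then f else g) A ` at (if j then X else Y) A" if "z \<in> at Z A" for z A
      using surj[OF that] by (auto simp: UNIV_bool)
    fix i j :: bool and A a b
    assume "a \<in> at (if i then X else Y) A" "b \<in> at (if j then X else Y) A"
      "component (if i then f else g) A a = component (if j then f else g) A b"
    then show "component (if i then f' else g') A a = component (if j then f' else g') A b"
      using ff[of a A b] gg[of a A b] cross[of a A b] cross'[of a A b] by (cases i; cases j) simp_all
  qed
  then have "\<exists>!u. u \<in> Hom (Psh C) Z ?M \<and> nat_comp u f = f' \<and> nat_comp u g = g'" by (simp only: bool_all)
  then show "\<exists>!u. u \<in> Hom Cb (Cod Cb f) (Cod Cb f') \<and> u \<cdot>\<^bsub>Cb\<^esub> f = f' \<and> u \<cdot>\<^bsub>Cb\<^esub> g = g'"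
    using fD M Hom_Cb by simp
qed

lemma Cb_colimitI:
  assumes L: "L \<in> Obj Cb" and c: "\<And>j. j \<in> J \<Longrightarrow> c j \<in> Hom Cb (d j) L"
    and E: "\<And>i f j. (i, f, j) \<in> E \<Longrightarrow> nat_comp (c j) f = c i"
    and surj: "\<And>A z. z \<in> at L A \<Longrightarrow> \<exists>j \<in> J. z \<in> component (c j) A ` at (d j) A"
    and compat: "\<And>M c' i j A a b. \<lbrakk>cocone Cb J d E M c'; i \<in> J; j \<in> J; a \<in> at (d i) A; b \<in> at (d j) A;
      component (c i) A a = component (c j) A b\<rbrakk> \<Longrightarrow> component (c' i) A a = component (c' j) A b"
  shows "colimit Cb J d E L c"
  unfolding colimit_def
proof (intro conjI allI impI)
  show "cocone Cb J d E L c" using L c E unfolding cocone_def by auto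
  fix M c' assume cc: "cocone Cb J d E M c'"
  then have M: "M \<in> Obj Cb" and c': "\<And>j. j \<in> J \<Longrightarrow> c' j \<in> Hom Cb (d j) M" unfolding cocone_def by auto
  have "\<exists>!u. u \<in> Hom (Psh C) L M \<and> (\<forall>j \<in> J. nat_comp u (c j) = c' j)"
    by (rule Psh_glue[OF presheaf_Cb[OF L] presheaf_Cb[OF M] Hom_CbD(1)[OF c] Hom_CbD(1)[OF c'] surj compat[OF cc]])
  then show "\<exists>!u. u \<in> Hom Cb L M \<and> (\<forall>j\<in>J. u \<cdot>\<^bsub>Cb\<^esub> c j = c' j)"
    using L M Hom_Cb by simp
qed


section \<open>Restriction of broad presheaves to subunits\<close>

text \<open>The subpresheaf of \<open>F\<close> that \<open>r \<otimes> F\<close> cuts out.\<close>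

definition img :: "('o, 'a) psh_map \<Rightarrow> ('o, 'a) psh \<Rightarrow> 'o \<Rightarrow> ('o, 'a) elt set" where
  "img r F A = component (act Cb r F) A ` at (day C (source r) F) A"

lemma act_Cb_Hom:
  assumes "subunit_arrow Cb r" "F \<in> Obj Cb"
  shows "act Cb r F \<in> Hom Cb (day C (source r) F) F"
  using act_Psh_Hom[OF subunit_Cb_Hom(1)[OF assms(1)] presheaf_Cb[OF assms(2)]]
    day_Cb[OF subunit_Cb_Hom(2)[OF assms(1)] assms(2)] assms(2) by (simp add: Hom_Cb act_Cb)

lemma act_Cb_embeds:
  assumes r: "subunit_arrow Cb r" and f: "embeds F U X f"
  shows "embeds (day C (source r) F) (meets (subs r) U) X (\<lambda>A t. f A (component (act Cb r F) A t))"
  unfolding act_Cb by (rule act_embeds[OF subunit_Cb_Hom(1)[OF r] subunit_subs(1)[OF r] f])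

lemma act_Cb_inj:
  assumes "subunit_arrow Cb r" "F \<in> Obj Cb"
  shows "inj_on (component (act Cb r F) A) (at (day C (source r) F) A)"
proof -
  obtain U X f where "embeds F U X f" using assms(2) Obj_Cb by blast
  then have "inj_on (\<lambda>t. f A (component (act Cb r F) A t)) (at (day C (source r) F) A)"
    using embedsD(4)[OF act_Cb_embeds[OF assms(1)]] bij_betw_imp_inj_on by blast
  then show ?thesis by (auto simp: inj_on_def)
qed

lemma act_Cb_monic: "\<lbrakk>subunit_arrow Cb r; F \<in> Obj Cb\<rbrakk> \<Longrightarrow> monic Cb (act Cb r F)"
  using monic_Cb_iff[OF act_Cb_Hom] act_Cb_inj by blast

lemma img_iff:
  assumes r: "subunit_arrow Cb r" and f: "embeds F U X f" and z: "z \<in> at F A"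
  shows "z \<in> img r F A \<longleftrightarrow> f A z \<in> restricting_arrows (subs r) X A"
proof -
  note fD = embedsD[OF f]
  have aH: "act Cb r F \<in> Hom (Psh C) (day C (source r) F) F"
    unfolding act_Cb by (rule act_Psh_Hom[OF subunit_Cb_Hom(1)[OF r] fD(1)])
  have "(\<lambda>t. f A (component (act Cb r F) A t)) ` at (day C (source r) F) A
      = restricting_arrows (subs r) X A \<inter> restricting_arrows U X A"
    using embedsD(4)[OF act_Cb_embeds[OF r f], of A]
    unfolding restricting_meets[OF fD(2) subunit_subs(3)[OF r]] by (simp add: bij_betw_def)
  then have *: "f A ` img r F A = restricting_arrows (subs r) X A \<inter> restricting_arrows U X A"
    by (simp add: img_def image_image)
  have sub: "img r F A \<subseteq> at F A" using Hom_PshD(5)[OF aH] by (auto simp: img_def)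
  have "f A z \<in> f A ` img r F A \<longleftrightarrow> z \<in> img r F A"
    by (rule inj_on_image_mem_iff[OF bij_betw_imp_inj_on[OF fD(4)] z sub])
  then show ?thesis unfolding * using bij_betw_apply[OF fD(4) z] by blast
qed

lemma img_Union:
  assumes r: "subunit_arrow Cb r" "\<And>i. i \<in> I \<Longrightarrow> subunit_arrow Cb (s i)" and eq: "subs r = (\<Union>i \<in> I. subs (s i))"
    and F: "F \<in> Obj Cb" and z: "z \<in> at F A"
  shows "z \<in> img r F A \<longleftrightarrow> (\<exists>i \<in> I. z \<in> img (s i) F A)"
proof -
  obtain U X f where f: "embeds F U X f" using F Obj_Cb by blast
  have "f A z \<in> restricting_arrows (subs r) X A \<longleftrightarrow> (\<exists>i \<in> I. f A z \<in> restricting_arrows (subs (s i)) X A)"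
    unfolding eq restricting_arrows_def by blast
  then show ?thesis using img_iff[OF r(1) f z] img_iff[OF r(2) f z] by blast
qed

text \<open>An element that restricts to \<open>u\<close> and \<open>v\<close> restricts to \<open>u \<and> v\<close>, which lies in both sets as they are
  down-closed.\<close>

lemma img_Int:
  assumes r: "subunit_arrow Cb r" "subunit_arrow Cb r1" "subunit_arrow Cb r2" and eq: "subs r = subs r1 \<inter> subs r2"
    and F: "F \<in> Obj Cb" and z: "z \<in> img r1 F A" "z \<in> img r2 F A"
  shows "z \<in> img r F A"
proof -
  obtain U X f where f: "embeds F U X f" using F Obj_Cb by blast
  have zF: "z \<in> at F A" using z(1) Hom_CbD(4)[OF act_Cb_Hom[OF r(2) F]] by (auto simp: img_def)
  note s1 = subunit_subs(3,4)[OF r(2)] and s2 = subunit_subs(3,4)[OF r(3)]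
  have "f A z \<in> restricting_arrows (meets (subs r1) (subs r2)) X A"
    unfolding restricting_meets[OF s2(1) s1(1)]
    using z img_iff[OF r(2) f zF] img_iff[OF r(3) f zF] by blast
  moreover have "meets (subs r1) (subs r2) \<subseteq> subs r"
  proof
    fix w assume "w \<in> meets (subs r1) (subs r2)"
    then obtain u v where w: "w = sub_meet C u v" "u \<in> subs r1" "v \<in> subs r2" by blast
    have c: "u \<in> carrier (ISub C)" "v \<in> carrier (ISub C)" using w s1 s2 by auto
    have "w \<in> down (subs r1)" "w \<in> down (subs r2)"
      using rep_sub_meet(1-3)[OF c] w unfolding down_def by blast+
    then show "w \<in> subs r" using s1(2) s2(2) eq by simp
  qed
  ultimately have "f A z \<in> restricting_arrows (subs r) X A" unfolding restricting_arrows_def by blast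
  then show ?thesis using img_iff[OF r(1) f zF] by blast
qed

text \<open>Elements of \<open>T \<otimes> F\<close> and their images in \<open>F\<close> embed as the same arrows of \<open>C\<close>, so they restrict to the
  same subunits.\<close>

lemma img_tensor:
  assumes r: "subunit_arrow Cb r" and t: "subunit_arrow Cb t" and F: "F \<in> Obj Cb" and u: "u \<in> at (day C (source t) F) A"
  shows "u \<in> img r (day C (source t) F) A \<longleftrightarrow> component (act Cb t F) A u \<in> img r F A"
proof -
  obtain U X f where f: "embeds F U X f" using F Obj_Cb by blast
  show ?thesis
    using img_iff[OF r act_Cb_embeds[OF t f] u] img_iff[OF r f Hom_CbD(4)[OF act_Cb_Hom[OF t F] u]] by simp
qed

text \<open>The square of actions of \<open>s\<close> and \<open>t\<close> on \<open>X\<close> is an intersection of subpresheaves of \<open>X\<close>.\<close>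

context
  fixes s t X
  assumes s: "subunit_arrow Cb s" and t: "subunit_arrow Cb t" and X: "X \<in> Obj Cb"
begin

abbreviation (input) "T \<equiv> day C (source t) X"
abbreviation (input) "top_map \<equiv> act Cb s T"
abbreviation (input) "left_map \<equiv> day_map C (nat_ident (source s)) (act Cb t X)"

lemma T_obj: "T \<in> Obj Cb" by (rule day_Cb[OF subunit_Cb_Hom(2)[OF t] X])

lemma square_Hom:
  "top_map \<in> Hom Cb (day C (source s) T) T" "left_map \<in> Hom Cb (day C (source s) T) (day C (source s) X)"
  using act_Cb_Hom[OF s T_obj] cb.tensor_hom[OF cb.ident_hom[OF subunit_Cb_Hom(2)[OF s]] act_Cb_Hom[OF t X]] by simp_all

lemma square_comm: "nat_comp (act Cb s X) left_map = nat_comp (act Cb t X) top_map"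
proof -
  note aD = Hom_CbD[OF act_Cb_Hom[OF t X]]
  show ?thesis
    using cb.act_natural[OF cb.subunitD(2,3)[OF s] aD(7)] aD(5,6) by simp
qed

lemma left_map_inj: "inj_on (component left_map A) (at (day C (source s) T) A)"
proof (rule inj_onI)
  fix x y assume xy: "x \<in> at (day C (source s) T) A" "y \<in> at (day C (source s) T) A" "component left_map A x = component left_map A y"
  have "component (nat_comp (act Cb t X) top_map) A x = component (nat_comp (act Cb t X) top_map) A y"
    unfolding square_comm[symmetric] using xy by (simp add: comp_elt[OF square_Hom(2)])
  then have "component (act Cb t X) A (component top_map A x) = component (act Cb t X) A (component top_map A y)"
    using xy by (simp add: comp_elt[OF square_Hom(1)])
  then have "component top_map A x = component top_map A y"
    using inj_onD[OF act_Cb_inj[OF t X]] Hom_CbD(4)[OF square_Hom(1)] xy by blast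
  then show "x = y" using inj_onD[OF act_Cb_inj[OF s T_obj]] xy by blast
qed

lemma square_elements:
  assumes a: "a \<in> at (day C (source s) X) A" and b: "b \<in> at T A" and eq: "component (act Cb s X) A a = component (act Cb t X) A b"
  shows "\<exists>x \<in> at (day C (source s) T) A. component left_map A x = a \<and> component top_map A x = b"
proof -
  have "component (act Cb t X) A b \<in> img s X A" using a eq[symmetric] by (simp add: img_def)
  then have "b \<in> img s T A" using img_tensor[OF s t X b] by blast
  then obtain x where x: "x \<in> at (day C (source s) T) A" "component top_map A x = b" by (auto simp: img_def)
  have "component (nat_comp (act Cb s X) left_map) A x = component (nat_comp (act Cb t X) top_map) A x"
    by (simp add: square_comm)
  then have "component (act Cb s X) A (component left_map A x) = component (act Cb s X) A a"
    using x eq by (simp add: comp_elt[OF square_Hom(1)] comp_elt[OF square_Hom(2)])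
  then have "component left_map A x = a"
    using inj_onD[OF act_Cb_inj[OF s X]] Hom_CbD(4)[OF square_Hom(2) x(1)] a by blast
  then show ?thesis using x by blast
qed

lemma stiff_square_Cb: "pullback Cb top_map left_map (act Cb t X) (act Cb s X)"
proof (rule Cb_pullbackI[OF square_Hom act_Cb_Hom[OF t X] act_Cb_Hom[OF s X]])
  show "nat_comp (act Cb t X) top_map = nat_comp (act Cb s X) left_map" by (rule square_comm[symmetric])
  show "b \<in> component left_map A ` at (day C (source s) T) A"
    if ab: "a \<in> at T A" "b \<in> at (day C (source s) X) A" "component (act Cb t X) A a = component (act Cb s X) A b" for A a b
    using square_elements[OF ab(2,1) ab(3)[symmetric]] by blast
qed (rule act_Cb_inj[OF t X] left_map_inj)+

end

lemma stiff_Cb: "stiff Cb"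
  unfolding stiff_def Let_def
proof (intro conjI ballI allI impI)
  show "braided_monoidal_category Cb" using Cb_braided by (simp add: braided_def)
  fix X s t assume X: "X \<in> Obj Cb" and st: "subunit_arrow Cb s \<and> subunit_arrow Cb t"
  then have s: "subunit_arrow Cb s" and t: "subunit_arrow Cb t" by auto
  show "monic Cb (act Cb s (Dom Cb t \<odot>\<^bsub>Cb\<^esub> X))" using act_Cb_monic[OF s T_obj[OF s t X]] by simp
  show "monic Cb (Ident Cb (Dom Cb s) \<otimes>\<^bsub>Cb\<^esub> act Cb t X)"
    using monic_Cb_iff[OF square_Hom(2)[OF s t X]] left_map_inj[OF s t X] by simp
  show "monic Cb (act Cb t X)" "monic Cb (act Cb s X)" using act_Cb_monic s t X by auto
  show "pullback Cb (act Cb s (Dom Cb t \<odot>\<^bsub>Cb\<^esub> X)) (Ident Cb (Dom Cb s) \<otimes>\<^bsub>Cb\<^esub> act Cb t X) (act Cb t X) (act Cb s X)"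
    using stiff_square_Cb[OF s t X] by simp
qed


section \<open>Subunits as down-closed sets\<close>

abbreviation S :: "('o, 'a) psh_map set \<Rightarrow> 'a set set" where
  "S u \<equiv> subs (rep u)"

lemma S_le:
  "\<lbrakk>u \<in> carrier (ISub Cb); v \<in> carrier (ISub Cb)\<rbrakk> \<Longrightarrow> u \<sqsubseteq>\<^bsub>ISub Cb\<^esub> v \<longleftrightarrow> S u \<subseteq> S v"
  unfolding cb.le_ISub using factors_subs cb.rep_ISub(1) by blast

lemma S_inj: "\<lbrakk>u \<in> carrier (ISub Cb); v \<in> carrier (ISub Cb); S u = S v\<rbrakk> \<Longrightarrow> u = v"
  by (rule cb.ISub_antisym) (simp_all add: S_le)

lemma S_facts:
  assumes "u \<in> carrier (ISub Cb)"
  shows "S u \<subseteq> carrier (ISub C)" "down (S u) = S u" "K (S u)"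
  using subunit_subs[OF cb.rep_ISub(1)[OF assms]] by auto

lemma S_subobject:
  assumes "subunit_arrow Cb r" shows "S (subobject Cb r) = subs r"
proof -
  have "subunit_arrow Cb (rep (subobject Cb r))" by (rule cb.rep_ISub(1)[OF cb.subobject_in_ISub[OF assms]])
  then show ?thesis
    using factors_subs[OF assms] factors_subs[OF _ assms] cb.rep_subobject(3,4)[OF cb.subunitD(1)[OF assms]] by blast
qed

lemma S_exists:
  assumes "V \<subseteq> carrier (ISub C)" "down V = V" "K V"
  obtains u where "u \<in> carrier (ISub Cb)" "S u = V"
  using subunit_exists[OF assms] S_subobject cb.subobject_in_ISub by metis

lemma down_Union:
  assumes "\<And>V. V \<in> \<V> \<Longrightarrow> down V = V" shows "down (\<Union>\<V>) = \<Union>\<V>"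
proof -
  have "down (\<Union>\<V>) = (\<Union>V \<in> \<V>. down V)" by (auto simp: down_def)
  then show ?thesis using assms by simp
qed

text \<open>Joins of subunits are unions of sets of subunits of \<open>C\<close>.\<close>

lemma S_least:
  assumes A: "A \<subseteq> carrier (ISub Cb)" and u: "u \<in> carrier (ISub Cb)" "S u = \<Union>(S ` A)"
  shows "least (ISub Cb) u (Upper (ISub Cb) A)"
proof (rule least_UpperI[OF _ _ A u(1)])
  show "x \<sqsubseteq>\<^bsub>ISub Cb\<^esub> u" if "x \<in> A" for x using that A u S_le[of x u] by blast
  show "u \<sqsubseteq>\<^bsub>ISub Cb\<^esub> y" if "y \<in> Upper (ISub Cb) A" for y
  proof -
    have y: "y \<in> carrier (ISub Cb)" "\<And>x. x \<in> A \<Longrightarrow> x \<sqsubseteq>\<^bsub>ISub Cb\<^esub> y" using that A by (auto simp: Upper_def)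
    then have "S x \<subseteq> S y" if "x \<in> A" for x using that A S_le by blast
    then show ?thesis using S_le[OF u(1) y(1)] u(2) by blast
  qed
qed

lemma least_exists:
  assumes A: "A \<subseteq> carrier (ISub Cb)" and K: "K (\<Union>(S ` A))"
  obtains u where "u \<in> carrier (ISub Cb)" "S u = \<Union>(S ` A)" "least (ISub Cb) u (Upper (ISub Cb) A)"
proof -
  have "\<Union>(S ` A) \<subseteq> carrier (ISub C)" using S_facts(1) A by blast
  moreover have "down (\<Union>(S ` A)) = \<Union>(S ` A)" by (rule down_Union) (use S_facts(2) A in blast)
  ultimately obtain u where "u \<in> carrier (ISub Cb)" "S u = \<Union>(S ` A)" using S_exists K by metis
  then show ?thesis using that S_least[OF A] by blast
qed

lemma S_sup:
  assumes A: "A \<subseteq> carrier (ISub Cb)" and K: "K (\<Union>(S ` A))"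
  shows "\<Squnion>\<^bsub>ISub Cb\<^esub> A \<in> carrier (ISub Cb)" "S (\<Squnion>\<^bsub>ISub Cb\<^esub> A) = \<Union>(S ` A)"
proof -
  obtain u where u: "u \<in> carrier (ISub Cb)" "S u = \<Union>(S ` A)" "least (ISub Cb) u (Upper (ISub Cb) A)"
    using least_exists[OF A K] .
  interpret po: partial_order "ISub Cb" by (rule cb.ISub_partial_order)
  have "\<Squnion>\<^bsub>ISub Cb\<^esub> A = u"
    unfolding sup_def by (rule some_equality[of _ u]) (use u(3) po.least_unique in blast)+
  then show "\<Squnion>\<^bsub>ISub Cb\<^esub> A \<in> carrier (ISub Cb)" "S (\<Squnion>\<^bsub>ISub Cb\<^esub> A) = \<Union>(S ` A)" using u by auto
qed

lemma tensor_inclusion: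
  assumes u: "u \<in> carrier (ISub Cb)" and v: "v \<in> carrier (ISub Cb)" and le: "S u \<subseteq> S v" and X: "X \<in> Obj Cb"
  defines "i \<equiv> day_map C (inclusion Cb u v) (nat_ident X)"
  shows "i \<in> Hom Cb (day C (source (rep u)) X) (day C (source (rep v)) X)"
    "nat_comp (act Cb (rep v) X) i = act Cb (rep u) X"
    "x \<in> at (day C (source (rep u)) X) A \<Longrightarrow> component (act Cb (rep v) X) A (component i A x) = component (act Cb (rep u) X) A x"
    "inj_on (component i A) (at (day C (source (rep u)) X) A)"
proof -
  have "u \<sqsubseteq>\<^bsub>ISub Cb\<^esub> v" using S_le[OF u v] le by blast
  note I = cb.inclusion_facts[OF u v this, unfolded sub_obj_def Cb_sel]
  have iH: "inclusion Cb u v \<in> Hom Cb (source (rep u)) (source (rep v))" using I by (simp add: Hom_def[of Cb])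
  show i: "i \<in> Hom Cb (day C (source (rep u)) X) (day C (source (rep v)) X)"
    using cb.tensor_hom[OF iH cb.ident_hom[OF X]] by (simp add: i_def)
  show c: "nat_comp (act Cb (rep v) X) i = act Cb (rep u) X"
    using cb.act_comp[OF cb.subunitD(2,3)[OF cb.rep_ISub(1)[OF v]] I(1) _ X] I(3,4) by (simp add: i_def)
  show e: "component (act Cb (rep v) X) A (component i A x) = component (act Cb (rep u) X) A x"
    if "x \<in> at (day C (source (rep u)) X) A" for x A
    using comp_elt[OF i that, of "act Cb (rep v) X"] c by simp
  show "inj_on (component i A) (at (day C (source (rep u)) X) A)" for A
    using act_Cb_inj[OF cb.rep_ISub(1)[OF u] X, of A] e unfolding inj_on_def by metis
qed

end

context broad_setting
begin

section \<open>Universal finite joins\<close>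

lemma empty_presheaf:
  obtains Z where "Z \<in> Obj Cb" "\<And>A. at Z A = {}"
proof
  have "embeds (broad C {} (Unit C)) {} (Unit C) (\<lambda>A. the_arrow)" by (rule broad_embeds) simp_all
  then show "broad C {} (Unit C) \<in> Obj Cb" using K_empty Obj_Cb by blast
  show "at (broad C {} (Unit C)) A = {}" for A by (simp add: broad_def restricting_def)
qed

lemma from_empty:
  assumes "Z \<in> Obj Cb" "\<And>A. at Z A = {}" "X \<in> Obj Cb"
  shows "\<exists>!f. f \<in> Hom Cb Z X"
proof -
  have "\<exists>!u. u \<in> Hom (Psh C) Z X \<and> (\<forall>j \<in> {} :: nat set. nat_comp u (nat_ident Z) = nat_ident Z)"
    by (rule Psh_glue[where d="\<lambda>_. Z"]) (use assms presheaf_Cb in auto)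
  then show ?thesis using assms(1,3) Hom_Cb by simp
qed

lemma day_empty:
  assumes "Z \<in> Obj Cb" "\<And>A. at Z A = {}" "X \<in> Obj Cb"
  shows "isomorphic Cb (day C X Z) Z"
proof -
  have e: "at (day C X Z) A = {}" for A using assms(2) by (auto elim!: dayE_bracket)
  obtain u where u: "u \<in> Hom Cb (day C X Z) Z"
    using from_empty[OF day_Cb[OF assms(3,1)] e assms(1)] by blast
  have "iso_arrow (Psh C) u"
    by (rule Psh_bij_iso[OF Hom_CbD(1)[OF u]]) (simp add: e assms(2) bij_betw_def)
  then show ?thesis using u Hom_CbD[OF u] unfolding isomorphic_def iso_Cb by auto
qed

text \<open>The initial object is the empty presheaf. The square is the intersection and the union of two subpresheaves
  of \<open>X\<close>, seen through the injective actions.\<close>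

theorem finite_joins:
  assumes K_Un: "\<And>V W. \<lbrakk>V \<subseteq> carrier (ISub C); W \<subseteq> carrier (ISub C); K V; K W\<rbrakk> \<Longrightarrow> K (V \<union> W)"
  shows "universal_finite_joins Cb"
  unfolding universal_finite_joins_def
proof (intro conjI ballI)
  show "braided_monoidal_category Cb" using Cb_braided by (simp add: braided_def)
  obtain Z where Z: "Z \<in> Obj Cb" "\<And>A. at Z A = {}" using empty_presheaf by blast
  have "initial_object Cb Z" unfolding initial_object_def using Z(1) from_empty[OF Z] by blast
  moreover have "monic Cb z" if "z \<in> Hom Cb Z (Unit Cb)" for z
    using monic_Cb_iff[OF that] Z(2) by simp
  moreover have "isomorphic Cb (X \<odot>\<^bsub>Cb\<^esub> Z) Z" if "X \<in> Obj Cb" for X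
    using day_empty[OF Z that] by simp
  ultimately show "\<exists>Z. initial_object Cb Z \<and> (\<forall>z\<in>Hom Cb Z (Unit Cb). monic Cb z) \<and> (\<forall>X\<in>Obj Cb. isomorphic Cb (X \<odot>\<^bsub>Cb\<^esub> Z) Z)"
    by blast
  interpret po: partial_order "ISub Cb" by (rule cb.ISub_partial_order)
  have K2: "K (\<Union>(S ` {x, y}))" if "x \<in> carrier (ISub Cb)" "y \<in> carrier (ISub Cb)" for x y
    using K_Un[OF S_facts(1)[OF that(1)] S_facts(1)[OF that(2)] S_facts(3)[OF that(1)] S_facts(3)[OF that(2)]] by simp
  show "upper_semilattice (ISub Cb)"
  proof
    fix x y assume xy: "x \<in> carrier (ISub Cb)" "y \<in> carrier (ISub Cb)"
    show "\<exists>s. least (ISub Cb) s (Upper (ISub Cb) {x, y})"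
      using least_exists[of "{x, y}", OF _ K2[OF xy]] xy by blast
  qed
  show "weak_partial_order_bottom (ISub Cb)"
  proof
    obtain u where u: "u \<in> carrier (ISub Cb)" "S u = {}"
      using S_exists[of "{}"] K_empty by (auto simp: down_def)
    then have "least (ISub Cb) u (carrier (ISub Cb))"
      unfolding least_def using S_le by blast
    then show "\<exists>x. least (ISub Cb) x (carrier (ISub Cb))" by blast
  qed
  fix s t X assume s: "s \<in> carrier (ISub Cb)" and t: "t \<in> carrier (ISub Cb)" and X: "X \<in> Obj Cb"
  let ?j = "s \<squnion>\<^bsub>ISub Cb\<^esub> t"
  have st: "{s, t} \<subseteq> carrier (ISub Cb)" using s t by blast
  have j: "?j \<in> carrier (ISub Cb)" "S ?j = S s \<union> S t"
    using S_sup[OF st K2[OF s t]] by (simp_all add: join_def)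
  have sj: "S s \<subseteq> S ?j" and tj: "S t \<subseteq> S ?j" using j(2) by auto
  note su = cb.rep_ISub(1)[OF s] and tu = cb.rep_ISub(1)[OF t] and ju = cb.rep_ISub(1)[OF j(1)]
  note sq = square_Hom[OF su tu X]
  note f = tensor_inclusion[OF s j(1) sj X] and g = tensor_inclusion[OF t j(1) tj X]
  let ?p = "day_map C (nat_ident (source (rep s))) (act Cb (rep t) X)" and ?q = "act Cb (rep s) (day C (source (rep t)) X)"
  let ?f = "day_map C (inclusion Cb s ?j) (nat_ident X)" and ?g = "day_map C (inclusion Cb t ?j) (nat_ident X)"
  have p_inj: "inj_on (component ?p A) (at (day C (source (rep s)) (day C (source (rep t)) X)) A)" for A
    by (rule left_map_inj[OF su tu X])
  have q_inj: "inj_on (component ?q A) (at (day C (source (rep s)) (day C (source (rep t)) X)) A)" for A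
    by (rule act_Cb_inj[OF su T_obj[OF su tu X]])
  have comm: "nat_comp ?f ?p = nat_comp ?g ?q"
  proof (rule cb.monicD[OF act_Cb_monic[OF ju X]])
    note aH = act_Cb_Hom[OF ju X]
    have "nat_comp (act Cb (rep ?j) X) (nat_comp ?f ?p) = nat_comp (act Cb (rep s) X) ?p"
      using cb.comp_assoc[OF sq(2) f(1) aH] f(2) by simp
    also have "\<dots> = nat_comp (act Cb (rep t) X) ?q" by (rule square_comm[OF su tu X])
    also have "\<dots> = nat_comp (act Cb (rep ?j) X) (nat_comp ?g ?q)"
      using cb.comp_assoc[OF sq(1) g(1) aH] g(2) by simp
    finally show "act Cb (rep ?j) X \<cdot>\<^bsub>Cb\<^esub> nat_comp ?f ?p = act Cb (rep ?j) X \<cdot>\<^bsub>Cb\<^esub> nat_comp ?g ?q" by simp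
    note fp = Hom_CbD[OF cb.comp_hom[OF sq(2) f(1), unfolded Cb_sel]]
      and gq = Hom_CbD[OF cb.comp_hom[OF sq(1) g(1), unfolded Cb_sel]]
    show "nat_comp ?f ?p \<in> Arr Cb" "nat_comp ?g ?q \<in> Arr Cb" using fp gq by auto
    show "Dom Cb (nat_comp ?f ?p) = Dom Cb (nat_comp ?g ?q)" "Cod Cb (nat_comp ?f ?p) = Dom Cb (act Cb (rep ?j) X)"
      "Cod Cb (nat_comp ?g ?q) = Dom Cb (act Cb (rep ?j) X)"
      using fp(5,6) gq(5,6) Hom_CbD(5)[OF aH] unfolding Cb_sel by simp_all
  qed
  have elements: "\<exists>x \<in> at (day C (source (rep s)) (day C (source (rep t)) X)) A. component ?p A x = a \<and> component ?q A x = b"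
    if ab: "a \<in> at (day C (source (rep s)) X) A" "b \<in> at (day C (source (rep t)) X) A" "component ?f A a = component ?g A b" for A a b
    by (rule square_elements[OF su tu X ab(1,2)]) (use f(3)[OF ab(1)] g(3)[OF ab(2)] ab(3) in simp)
  have pb: "pullback Cb ?p ?q ?f ?g"
    by (rule Cb_pullbackI[OF sq(2,1) f(1) g(1) comm f(4) q_inj]) (use elements in blast)
  have po: "pushout Cb ?p ?q ?f ?g"
  proof (rule Cb_pushoutI[OF sq(2,1) f(1) g(1) comm f(4) g(4) _ elements])
    fix A z assume z: "z \<in> at (day C (source (rep ?j)) X) A"
    let ?z = "component (act Cb (rep ?j) X) A z"
    have zX: "?z \<in> at X A" using Hom_CbD(4)[OF act_Cb_Hom[OF ju X] z] .
    have eqU: "subs (rep ?j) = (\<Union>i \<in> {s, t}. subs (rep i))" using j(2) by simp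
    have "?z \<in> img (rep ?j) X A" using z by (simp add: img_def)
    then obtain i where i: "i \<in> {s, t}" "?z \<in> img (rep i) X A"
      using img_Union[OF ju _ eqU X zX] su tu by blast
    have eq: "x = z" if "x \<in> at (day C (source (rep ?j)) X) A" "component (act Cb (rep ?j) X) A x = ?z" for x
      using inj_onD[OF act_Cb_inj[OF ju X] that(2,1) z] .
    show "z \<in> component ?f A ` at (day C (source (rep s)) X) A \<or> z \<in> component ?g A ` at (day C (source (rep t)) X) A"
    proof (cases "i = s")
      case True
      then obtain w where w: "w \<in> at (day C (source (rep s)) X) A" "?z = component (act Cb (rep s) X) A w"
        using i(2) by (auto simp: img_def)
      then have "component ?f A w = z" using eq[OF Hom_CbD(4)[OF f(1) w(1)]] f(3)[OF w(1)] by simp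
      then show ?thesis using w(1) by blast
    next
      case False
      then obtain w where w: "w \<in> at (day C (source (rep t)) X) A" "?z = component (act Cb (rep t) X) A w"
        using i by (auto simp: img_def)
      then have "component ?g A w = z" using eq[OF Hom_CbD(4)[OF g(1) w(1)]] g(3)[OF w(1)] by simp
      then show ?thesis using w(1) by blast
    qed
  qed
  have m: "monic Cb ?p" "monic Cb ?q" "monic Cb ?f" "monic Cb ?g"
    using monic_Cb_iff[OF sq(2)] monic_Cb_iff[OF sq(1)] monic_Cb_iff[OF f(1)] monic_Cb_iff[OF g(1)] p_inj q_inj f(4) g(4) by blast+
  show "let p = Ident Cb (sub_obj Cb s) \<otimes>\<^bsub>Cb\<^esub> act Cb (rep t) X;
             q = act Cb (rep s) (sub_obj Cb t \<odot>\<^bsub>Cb\<^esub> X);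
             f = inclusion Cb s ?j \<otimes>\<^bsub>Cb\<^esub> Ident Cb X;
             g = inclusion Cb t ?j \<otimes>\<^bsub>Cb\<^esub> Ident Cb X
         in monic Cb p \<and> monic Cb q \<and> monic Cb f \<and> monic Cb g \<and> pullback Cb p q f g \<and> pushout Cb p q f g"
    unfolding Let_def sub_obj_def Cb_sel using m pb po by blast
qed


section \<open>Universal directed joins\<close>

lemma subs_cover:
  assumes r: "subunit_arrow Cb r" and s: "\<And>i. i \<in> I \<Longrightarrow> subunit_arrow Cb (s i)" and eq: "subs r = (\<Union>i \<in> I. subs (s i))"
    and z: "z \<in> at (source r) A"
  obtains i a where "i \<in> I" "a \<in> at (source (s i)) A" "component (s i) A a = component r A z"
proof -
  have "arrow_at r A z \<in> restricting_arrows (subs r) (Unit C) A"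
    using bij_betw_apply[OF embedsD(4)[OF subunit_subs(1)[OF r]] z] .
  then obtain i where i: "i \<in> I" "arrow_at r A z \<in> restricting_arrows (subs (s i)) (Unit C) A"
    unfolding eq restricting_arrows_def by blast
  then obtain a where a: "a \<in> at (source (s i)) A" "arrow_at (s i) A a = arrow_at r A z"
    using embedsD(4)[OF subunit_subs(1)[OF s[OF i(1)]], of A] unfolding bij_betw_def by (metis imageE)
  have "component (s i) A a = component r A z"
    using arrow_at(1)[OF subunit_Cb_Hom(1)[OF s[OF i(1)]] a(1)] arrow_at(1)[OF subunit_Cb_Hom(1)[OF r] z] a(2) by simp
  then show ?thesis using that i(1) a(1) by blast
qed

end

lemma cocone_arrow: "\<lbrakk>cocone C J d E M c; (i, f, j) \<in> E\<rbrakk> \<Longrightarrow> c j \<cdot>\<^bsub>C\<^esub> f = c i"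
  unfolding cocone_def by blast

lemma colimit_ex:
  "\<lbrakk>colimit C J d E L c; cocone C J d E M c'\<rbrakk> \<Longrightarrow> \<exists>u. u \<in> Hom C L M \<and> (\<forall>j \<in> J. u \<cdot>\<^bsub>C\<^esub> c j = c' j)"
  unfolding colimit_def by blast

lemma colimit_eq:
  assumes "colimit C J d E L c" "cocone C J d E M c'" "u \<in> Hom C L M" "\<And>j. j \<in> J \<Longrightarrow> u \<cdot>\<^bsub>C\<^esub> c j = c' j"
    "v \<in> Hom C L M" "\<And>j. j \<in> J \<Longrightarrow> v \<cdot>\<^bsub>C\<^esub> c j = c' j"
  shows "u = v"
  using assms unfolding colimit_def by blast

lemma (in category) colimit_iso:
  assumes c: "colimit C J d E L c" and c': "colimit C J d E L' c'"
  obtains \<psi> where "\<psi> \<in> Hom C L L'" "iso_arrow C \<psi>" "\<And>j. j \<in> J \<Longrightarrow> \<psi> \<cdot> c j = c' j"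
proof -
  have cc: "cocone C J d E L c" and cc': "cocone C J d E L' c'" using c c' unfolding colimit_def by auto
  then have L: "L \<in> Obj C" "L' \<in> Obj C" and H: "\<And>j. j \<in> J \<Longrightarrow> c j \<in> Hom C (d j) L" "\<And>j. j \<in> J \<Longrightarrow> c' j \<in> Hom C (d j) L'"
    unfolding cocone_def by auto
  obtain \<psi> where p: "\<psi> \<in> Hom C L L'" "\<And>j. j \<in> J \<Longrightarrow> \<psi> \<cdot> c j = c' j" using colimit_ex[OF c cc'] by blast
  obtain \<chi> where q: "\<chi> \<in> Hom C L' L" "\<And>j. j \<in> J \<Longrightarrow> \<chi> \<cdot> c' j = c j" using colimit_ex[OF c' cc] by blast
  have "\<chi> \<cdot> \<psi> = Ident C L"
  proof (rule colimit_eq[OF c cc])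
    show "\<chi> \<cdot> \<psi> \<in> Hom C L L" "Ident C L \<in> Hom C L L" using comp_hom[OF p(1) q(1)] ident_hom[OF L(1)] by auto
    fix j assume j: "j \<in> J"
    show "(\<chi> \<cdot> \<psi>) \<cdot> c j = c j" using comp_assoc[OF H(1)[OF j] p(1) q(1)] p(2)[OF j] q(2)[OF j] by simp
    show "Ident C L \<cdot> c j = c j" using ident_left[OF H(1)[OF j]] .
  qed
  moreover have "\<psi> \<cdot> \<chi> = Ident C L'"
  proof (rule colimit_eq[OF c' cc'])
    show "\<psi> \<cdot> \<chi> \<in> Hom C L' L'" "Ident C L' \<in> Hom C L' L'" using comp_hom[OF q(1) p(1)] ident_hom[OF L(2)] by auto
    fix j assume j: "j \<in> J"
    show "(\<psi> \<cdot> \<chi>) \<cdot> c' j = c' j" using comp_assoc[OF H(2)[OF j] q(1) p(1)] p(2)[OF j] q(2)[OF j] by simp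
    show "Ident C L' \<cdot> c' j = c' j" using ident_left[OF H(2)[OF j]] .
  qed
  ultimately have "iso_arrow C \<psi>" using p(1) q(1) by (intro isoI[of \<psi> \<chi>]) (auto simp: Hom_iff)
  then show ?thesis using that p by blast
qed

context broad_setting
begin

context
  fixes P :: "'i gorder" and s :: "'i \<Rightarrow> ('o, 'a) psh_map"
  assumes ds: "directed_subunits Cb P s"
begin

lemma ds_sub: "i \<in> carrier P \<Longrightarrow> subunit_arrow Cb (s i)"
  using ds unfolding directed_subunits_def by blast

lemma ds_upper:
  assumes "i \<in> carrier P" "j \<in> carrier P"
  obtains k f g where "k \<in> carrier P" "(i, f, k) \<in> inclusions Cb P s" "(j, g, k) \<in> inclusions Cb P s"
proof -
  obtain k where k: "k \<in> carrier P" "i \<sqsubseteq>\<^bsub>P\<^esub> k" "j \<sqsubseteq>\<^bsub>P\<^esub> k"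
    using ds assms unfolding directed_subunits_def directed_def by blast
  then have "factors_through Cb (s i) (s k)" "factors_through Cb (s j) (s k)"
    using ds assms unfolding directed_subunits_def by blast+
  then show ?thesis using that k assms unfolding inclusions_def factors_through_def by blast
qed

lemma ds_inclusion:
  assumes "(i, f, j) \<in> inclusions Cb P s"
  shows "i \<in> carrier P" "j \<in> carrier P" "f \<in> Hom Cb (source (s i)) (source (s j))" "nat_comp (s j) f = s i"
  using assms unfolding inclusions_def by auto

lemma directed_subunits_colimit:
  assumes r: "subunit_arrow Cb r" and eq: "subs r = (\<Union>i \<in> carrier P. subs (s i))"
  obtains c where "colimit Cb (carrier P) (\<lambda>i. Dom Cb (s i)) (inclusions Cb P s) (source r) c"
    "\<And>i. i \<in> carrier P \<Longrightarrow> nat_comp r (c i) = s i"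
proof -
  note rH = subunit_Cb_Hom(5)[OF r] and r_mon = cb.subunitD(1)[OF r]
  have "\<exists>h. h \<in> Hom Cb (source (s i)) (source r) \<and> nat_comp r h = s i" if i: "i \<in> carrier P" for i
  proof -
    have "factors_through Cb (s i) r" using factors_subs[OF ds_sub[OF i] r] eq i by blast
    then show ?thesis unfolding factors_through_def by auto
  qed
  then obtain c where c: "\<And>i. i \<in> carrier P \<Longrightarrow> c i \<in> Hom Cb (source (s i)) (source r)"
    "\<And>i. i \<in> carrier P \<Longrightarrow> nat_comp r (c i) = s i" by metis
  have rc: "component r A (component (c i) A a) = component (s i) A a" if "i \<in> carrier P" "a \<in> at (source (s i)) A" for i A a
    using comp_elt[OF c(1)[OF that(1)] that(2), of r] c(2)[OF that(1)] by simp
  have "colimit Cb (carrier P) (\<lambda>i. Dom Cb (s i)) (inclusions Cb P s) (source r) c"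
    unfolding Cb_sel
  proof (rule Cb_colimitI[OF subunit_Cb_Hom(2)[OF r] c(1)])
    fix i f j assume E: "(i, f, j) \<in> inclusions Cb P s"
    note I = ds_inclusion[OF E]
    have "nat_comp r (nat_comp (c j) f) = nat_comp r (c i)"
      using cb.comp_assoc[OF I(3) c(1)[OF I(2)] rH] c(2)[OF I(1)] c(2)[OF I(2)] I(4) by simp
    then show "nat_comp (c j) f = c i"
      using cb.monicD[OF r_mon, of "nat_comp (c j) f" "c i"]
        Hom_CbD(5-7)[OF cb.comp_hom[OF I(3) c(1)[OF I(2)]]] Hom_CbD(5-7)[OF c(1)[OF I(1)]] by simp
  next
    fix A z assume z: "z \<in> at (source r) A"
    obtain i a where i: "i \<in> carrier P" "a \<in> at (source (s i)) A" "component (s i) A a = component r A z"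
      by (rule subs_cover[OF r _ eq z]) (use ds_sub in auto)
    have "component (c i) A a = z"
      by (rule inj_onD[OF subunit_Cb_Hom(4)[OF r] _ Hom_CbD(4)[OF c(1)[OF i(1)] i(2)] z]) (use rc[OF i(1,2)] i(3) in simp)
    then show "\<exists>j\<in>carrier P. z \<in> component (c j) A ` at (source (s j)) A" using i(1,2) by blast
  next
    fix M c' i j A a b
    assume cc: "cocone Cb (carrier P) (\<lambda>i. source (s i)) (inclusions Cb P s) M c'"
      and i: "i \<in> carrier P" and j: "j \<in> carrier P" and a: "a \<in> at (source (s i)) A" and b: "b \<in> at (source (s j)) A"
      and ab: "component (c i) A a = component (c j) A b"
    obtain k f g where k: "k \<in> carrier P" and fE: "(i, f, k) \<in> inclusions Cb P s" and gE: "(j, g, k) \<in> inclusions Cb P s"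
      using ds_upper[OF i j] .
    note f = ds_inclusion(3,4)[OF fE] and g = ds_inclusion(3,4)[OF gE]
    have "component (s k) A (component f A a) = component (s k) A (component g A b)"
      using comp_elt[OF f(1) a, of "s k"] comp_elt[OF g(1) b, of "s k"] f(2) g(2) rc[OF i a] rc[OF j b] ab by simp
    then have fg: "component f A a = component g A b"
      using inj_onD[OF subunit_Cb_Hom(4)[OF ds_sub[OF k]]] Hom_CbD(4)[OF f(1) a] Hom_CbD(4)[OF g(1) b] by blast
    have "nat_comp (c' k) f = c' i" "nat_comp (c' k) g = c' j"
      using cc fE gE unfolding cocone_def by auto
    then show "component (c' i) A a = component (c' j) A b"
      using comp_elt[OF f(1) a, of "c' k"] comp_elt[OF g(1) b, of "c' k"] fg by simp
  qed
  then show ?thesis using that c(2) by blast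
qed

text \<open>All maps in question are injective over \<open>X\<close> via the action, so that \<open>X \<otimes> L\<close> is the union of the
  \<open>X \<otimes> S\<^sub>i\<close> as soon as the sets of subunits of \<open>C\<close> in the \<open>S\<^sub>i\<close> cover those in \<open>L\<close>.\<close>

lemma directed_subunits_tensor_colimit:
  assumes u: "subunit_arrow Cb u" and eq: "subs u = (\<Union>i \<in> carrier P. subs (s i))"
    and c: "\<And>i. i \<in> carrier P \<Longrightarrow> c i \<in> Hom Cb (source (s i)) (source u)"
    and uc: "\<And>i. i \<in> carrier P \<Longrightarrow> nat_comp u (c i) = s i"
    and cE: "\<And>i f j. (i, f, j) \<in> inclusions Cb P s \<Longrightarrow> nat_comp (c j) f = c i"
    and X: "X \<in> Obj Cb"
  shows "colimit Cb (carrier P) (\<lambda>i. X \<odot>\<^bsub>Cb\<^esub> Dom Cb (s i))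
    {(i, Ident Cb X \<otimes>\<^bsub>Cb\<^esub> f, j) | i f j. (i, f, j) \<in> inclusions Cb P s}
    (X \<odot>\<^bsub>Cb\<^esub> source u) (\<lambda>i. Ident Cb X \<otimes>\<^bsub>Cb\<^esub> c i)"
  unfolding Cb_sel
proof -
  let ?L = "source u" and ?i = "nat_ident X"
  note uH = subunit_Cb_Hom(5)[OF u] and uO = subunit_Cb_Hom(2)[OF u]
  have bH: "day_braid C X F \<in> Hom Cb (day C X F) (day C F X)" if "F \<in> Obj Cb" for F
    using cb.braid_hom[OF X that] by simp
  have bbij: "bij_betw (component (day_braid C X F) A) (at (day C X F) A) (at (day C F X) A)" if "F \<in> Obj Cb" for F A
    by (rule Psh_iso_bij[OF day_braid_iso[OF presheaf_Cb[OF X] presheaf_Cb[OF that]] Hom_CbD(1)[OF bH[OF that]]])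
  define e where "e = (\<lambda>r A x. component (act Cb r X) A (component (day_braid C X (source r)) A x))"
  have e_inj: "x = y" if "subunit_arrow Cb r" "x \<in> at (day C X (source r)) A" "y \<in> at (day C X (source r)) A" "e r A x = e r A y" for r A x y
  proof -
    have rO: "source r \<in> Obj Cb" using subunit_Cb_Hom(2)[OF that(1)] .
    have "component (day_braid C X (source r)) A x = component (day_braid C X (source r)) A y"
      by (rule inj_onD[OF act_Cb_inj[OF that(1) X]]) (use that Hom_CbD(4)[OF bH[OF rO]] in \<open>simp_all add: e_def\<close>)
    then show ?thesis using inj_onD[OF bij_betw_imp_inj_on[OF bbij[OF rO]]] that(2,3) by blast
  qed
  have tH: "day_map C ?i h \<in> Hom Cb (day C X F) (day C X G)" if "h \<in> Hom Cb F G" for h F G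
    using cb.tensor_hom[OF cb.ident_hom[OF X] that] by simp
  have sO: "source (s i) \<in> Obj Cb" if "i \<in> carrier P" for i using subunit_Cb_Hom(2)[OF ds_sub[OF that]] .
  have e_c: "e u A (component (day_map C ?i (c i)) A w) = e (s i) A w"
    if i: "i \<in> carrier P" and w: "w \<in> at (day C X (source (s i))) A" for i A w
  proof -
    note cH = c[OF i]
    have "nat_comp (day_braid C X ?L) (day_map C ?i (c i)) = nat_comp (day_map C (c i) ?i) (day_braid C X (source (s i)))"
      using cb.braid_natural[OF cb.ident_hom[OF X] cH] by simp
    then have b: "component (day_braid C X ?L) A (component (day_map C ?i (c i)) A w)
        = component (day_map C (c i) ?i) A (component (day_braid C X (source (s i))) A w)"
      using comp_elt[OF tH[OF cH] w, of "day_braid C X ?L"] comp_elt[OF bH[OF sO[OF i]] w, of "day_map C (c i) ?i"] by simp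
    have cX: "day_map C (c i) ?i \<in> Hom Cb (day C (source (s i)) X) (day C ?L X)"
      using cb.tensor_hom[OF cH cb.ident_hom[OF X]] by simp
    have "nat_comp (act Cb u X) (day_map C (c i) ?i) = act Cb (s i) X"
      using cb.act_comp[OF cb.subunitD(2,3)[OF u] Hom_CbD(7)[OF cH] _ X] Hom_CbD(6)[OF cH] uc[OF i] by simp
    then show ?thesis
      unfolding e_def b using comp_elt[OF cX Hom_CbD(4)[OF bH[OF sO[OF i]] w], of "act Cb u X"] by simp
  qed
  have tens: "nat_comp (day_map C ?i g) (day_map C ?i f) = day_map C ?i (nat_comp g f)"
    if "f \<in> Hom Cb F G" "g \<in> Hom Cb G H" for f g F G H
    using cb.interchange[OF cb.ident_hom[OF X] cb.ident_hom[OF X] that] cb.ident_left[OF cb.ident_hom[OF X]] by simp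
  show "colimit Cb (carrier P) (\<lambda>i. day C X (source (s i)))
    {(i, day_map C ?i f, j) | i f j. (i, f, j) \<in> inclusions Cb P s} (day C X ?L) (\<lambda>i. day_map C ?i (c i))"
  proof (rule Cb_colimitI[OF day_Cb[OF X uO] tH[OF c]])
    fix i f' j assume "(i, f', j) \<in> {(i, day_map C ?i f, j) | i f j. (i, f, j) \<in> inclusions Cb P s}"
    then obtain f where f: "f' = day_map C ?i f" and E: "(i, f, j) \<in> inclusions Cb P s" by blast
    note I = ds_inclusion[OF E]
    show "nat_comp (day_map C ?i (c j)) f' = day_map C ?i (c i)"
      unfolding f tens[OF I(3) c[OF I(2)]] cE[OF E] ..
  next
    fix A z assume z: "z \<in> at (day C X ?L) A"
    have b: "component (day_braid C X ?L) A z \<in> at (day C ?L X) A" using Hom_CbD(4)[OF bH[OF uO] z] .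
    have ez: "e u A z \<in> at X A" unfolding e_def using Hom_CbD(4)[OF act_Cb_Hom[OF u X] b] .
    have "e u A z \<in> img u X A" using b by (simp add: e_def img_def)
    then obtain i where i: "i \<in> carrier P" "e u A z \<in> img (s i) X A"
      using img_Union[OF u ds_sub eq X ez] by blast
    then obtain t where t: "t \<in> at (day C (source (s i)) X) A" "e u A z = component (act Cb (s i) X) A t" by (auto simp: img_def)
    then obtain w where w: "w \<in> at (day C X (source (s i))) A" "t = component (day_braid C X (source (s i))) A w"
      using bbij[OF sO[OF i(1)], of A] unfolding bij_betw_def by blast
    have "component (day_map C ?i (c i)) A w = z"
      by (rule e_inj[OF u Hom_CbD(4)[OF tH[OF c[OF i(1)]] w(1)] z]) (use e_c[OF i(1) w(1)] t(2) w(2) in \<open>simp add: e_def\<close>)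
    then show "\<exists>j\<in>carrier P. z \<in> component (day_map C ?i (c j)) A ` at (day C X (source (s j))) A" using i(1) w(1) by blast
  next
    fix M c' i j A a b
    assume cc: "cocone Cb (carrier P) (\<lambda>i. day C X (source (s i))) {(i, day_map C ?i f, j) | i f j. (i, f, j) \<in> inclusions Cb P s} M c'"
      and i: "i \<in> carrier P" and j: "j \<in> carrier P" and a: "a \<in> at (day C X (source (s i))) A" and b: "b \<in> at (day C X (source (s j))) A"
      and ab: "component (day_map C ?i (c i)) A a = component (day_map C ?i (c j)) A b"
    obtain k f g where k: "k \<in> carrier P" and fE: "(i, f, k) \<in> inclusions Cb P s" and gE: "(j, g, k) \<in> inclusions Cb P s"
      using ds_upper[OF i j] .
    note f = ds_inclusion(3)[OF fE] and g = ds_inclusion(3)[OF gE]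
    let ?fa = "component (day_map C ?i f) A a" and ?gb = "component (day_map C ?i g) A b"
    have fa: "?fa \<in> at (day C X (source (s k))) A" and gb: "?gb \<in> at (day C X (source (s k))) A"
      using Hom_CbD(4)[OF tH[OF f] a] Hom_CbD(4)[OF tH[OF g] b] by auto
    have "component (day_map C ?i (c k)) A ?fa = component (day_map C ?i (c i)) A a"
      using comp_elt[OF tH[OF f] a, of "day_map C ?i (c k)"] tens[OF f c[OF k]] cE[OF fE] by simp
    moreover have "component (day_map C ?i (c k)) A ?gb = component (day_map C ?i (c j)) A b"
      using comp_elt[OF tH[OF g] b, of "day_map C ?i (c k)"] tens[OF g c[OF k]] cE[OF gE] by simp
    ultimately have "e (s k) A ?fa = e (s k) A ?gb" using e_c[OF k fa] e_c[OF k gb] ab by simp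
    then have fg: "?fa = ?gb" by (rule e_inj[OF ds_sub[OF k] fa gb])
    have "nat_comp (c' k) (day_map C ?i f) = c' i" "nat_comp (c' k) (day_map C ?i g) = c' j"
      using cocone_arrow[OF cc, of i "day_map C ?i f" k] cocone_arrow[OF cc, of j "day_map C ?i g" k] fE gE by auto
    then show "component (c' i) A a = component (c' j) A b"
      using comp_elt[OF tH[OF f] a, of "c' k"] comp_elt[OF tH[OF g] b, of "c' k"] fg by simp
  qed
qed

end

text \<open>The colimit is the subunit given by the union of all \<open>subs (s i)\<close>. Any other colimit is isomorphic to
  it over \<open>I\<close>, and so is a subunit with the same members.\<close>

theorem directed_joins:
  assumes K_Union: "\<And>\<V>. \<lbrakk>\<And>V. V \<in> \<V> \<Longrightarrow> V \<subseteq> carrier (ISub C) \<and> K V;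
      \<And>V W. \<lbrakk>V \<in> \<V>; W \<in> \<V>\<rbrakk> \<Longrightarrow> \<exists>Y \<in> \<V>. V \<subseteq> Y \<and> W \<subseteq> Y\<rbrakk> \<Longrightarrow> K (\<Union>\<V>)"
  shows "universal_directed_joins TYPE('i) Cb"
  unfolding universal_directed_joins_def
proof (intro conjI allI impI stiff_Cb)
  fix P :: "'i gorder" and s assume ds: "directed_subunits Cb P s"
  let ?V = "\<Union>i \<in> carrier P. subs (s i)" and ?E = "inclusions Cb P s" and ?d = "\<lambda>i. Dom Cb (s i)"
  note sub = ds_sub[OF ds]
  have V: "?V \<subseteq> carrier (ISub C)" "down ?V = ?V"
    using subunit_subs(3)[OF sub] down_Union[of "(\<lambda>i. subs (s i)) ` carrier P"] subunit_subs(4)[OF sub] by blast+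
  have "K ?V"
  proof (rule K_Union)
    show "V \<subseteq> carrier (ISub C) \<and> K V" if "V \<in> (\<lambda>i. subs (s i)) ` carrier P" for V
      using that subunit_subs(2,3)[OF sub] by blast
    fix V W assume "V \<in> (\<lambda>i. subs (s i)) ` carrier P" "W \<in> (\<lambda>i. subs (s i)) ` carrier P"
    then obtain i j where i: "i \<in> carrier P" "V = subs (s i)" and j: "j \<in> carrier P" "W = subs (s j)" by blast
    obtain k f g where k: "k \<in> carrier P" "(i, f, k) \<in> ?E" "(j, g, k) \<in> ?E" using ds_upper[OF ds i(1) j(1)] .
    have "factors_through Cb (s i) (s k)" "factors_through Cb (s j) (s k)"
      using ds_inclusion(3,4)[OF ds k(2)] ds_inclusion(3,4)[OF ds k(3)] unfolding factors_through_def by auto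
    then show "\<exists>Y \<in> (\<lambda>i. subs (s i)) ` carrier P. V \<subseteq> Y \<and> W \<subseteq> Y"
      using factors_subs[OF sub[OF i(1)] sub[OF k(1)]] factors_subs[OF sub[OF j(1)] sub[OF k(1)]] i(2) j(2) k(1) by blast
  qed
  then obtain r where r: "subunit_arrow Cb r" "subs r = ?V" using subunit_exists[OF V] by blast
  note rH = subunit_Cb_Hom(5)[OF r(1)]
  obtain c0 where c0: "colimit Cb (carrier P) ?d ?E (source r) c0" "\<And>i. i \<in> carrier P \<Longrightarrow> nat_comp r (c0 i) = s i"
    using directed_subunits_colimit[OF ds r] by blast
  then show "\<exists>L c. colimit Cb (carrier P) ?d ?E L c" by blast
  fix L c assume c: "colimit Cb (carrier P) ?d ?E L c"
  obtain \<psi> where p: "\<psi> \<in> Hom Cb L (source r)" "iso_arrow Cb \<psi>" "\<And>j. j \<in> carrier P \<Longrightarrow> \<psi> \<cdot>\<^bsub>Cb\<^esub> c j = c0 j"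
    using cb.colimit_iso[OF c c0(1)] by blast
  note pD = Hom_CbD[OF p(1)]
  have cc: "cocone Cb (carrier P) ?d ?E L c" using c unfolding colimit_def by blast
  then have cH: "\<And>i. i \<in> carrier P \<Longrightarrow> c i \<in> Hom Cb (source (s i)) L" and cE: "\<And>i f j. (i, f, j) \<in> ?E \<Longrightarrow> nat_comp (c j) f = c i"
    unfolding cocone_def by auto
  have sc: "cocone Cb (carrier P) ?d ?E (Unit Cb) s"
    unfolding cocone_def using cb.unit_obj subunit_Cb_Hom(5)[OF sub] ds_inclusion(4)[OF ds] by auto
  let ?u = "nat_comp r \<psi>"
  have uH: "?u \<in> Hom Cb L (Unit Cb)" using cb.comp_hom[OF p(1) rH] by simp
  have uc: "nat_comp ?u (c i) = s i" if "i \<in> carrier P" for i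
    using cb.comp_assoc[OF cH[OF that] p(1) rH] p(3)[OF that] c0(2)[OF that] by simp
  have uD: "?u \<in> Arr Cb" "source ?u = L" "target ?u = Unit Cb" using Hom_CbD[OF uH] by auto
  have mon: "monic Cb ?u"
    using cb.monic_comp[OF cb.subunitD(1)[OF r(1)] cb.iso_monic[OF p(2)]] pD(6) by simp
  have fac: "factors_through Cb ?u r" "factors_through Cb r ?u"
  proof -
    show "factors_through Cb ?u r" unfolding factors_through_def using p(1) uD by auto
    have i: "inv_arrow Cb \<psi> \<in> Hom Cb (source r) L" "nat_comp \<psi> (inv_arrow Cb \<psi>) = nat_ident (source r)"
      using cb.inv_arr[OF p(2)] pD(5,6) by (simp_all add: Hom_def[of Cb])
    have "nat_comp ?u (inv_arrow Cb \<psi>) = r"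
      using cb.comp_assoc[OF i(1) p(1) rH] i(2) cb.ident_right[OF rH] by simp
    then show "factors_through Cb r ?u" unfolding factors_through_def using i(1) uD by auto
  qed
  have u: "subunit_arrow Cb ?u"
    by (rule cb.subunit_iso_invariant[OF r(1) mon _ fac]) (use uD in simp)
  show "\<forall>v\<in>Hom Cb L (Unit Cb). (\<forall>i\<in>carrier P. v \<cdot>\<^bsub>Cb\<^esub> c i = s i) \<longrightarrow> subunit_arrow Cb v"
  proof (intro ballI impI)
    fix v assume v: "v \<in> Hom Cb L (Unit Cb)" "\<forall>i\<in>carrier P. v \<cdot>\<^bsub>Cb\<^esub> c i = s i"
    have "v = ?u" by (rule colimit_eq[OF c sc v(1) _ uH]) (use v(2) uc in auto)
    then show "subunit_arrow Cb v" using u by simp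
  qed
  have eq: "subs ?u = ?V" using factors_subs[OF u r(1)] factors_subs[OF r(1) u] fac r(2) by blast
  show "\<forall>X\<in>Obj Cb. colimit Cb (carrier P) (\<lambda>i. X \<odot>\<^bsub>Cb\<^esub> Dom Cb (s i))
    {(i, Ident Cb X \<otimes>\<^bsub>Cb\<^esub> f, j) | i f j. (i, f, j) \<in> ?E} (X \<odot>\<^bsub>Cb\<^esub> L) (\<lambda>i. Ident Cb X \<otimes>\<^bsub>Cb\<^esub> c i)"
  proof
    fix X assume X: "X \<in> Obj Cb"
    have "colimit Cb (carrier P) (\<lambda>i. X \<odot>\<^bsub>Cb\<^esub> Dom Cb (s i))
      {(i, Ident Cb X \<otimes>\<^bsub>Cb\<^esub> f, j) | i f j. (i, f, j) \<in> ?E} (X \<odot>\<^bsub>Cb\<^esub> source ?u) (\<lambda>i. Ident Cb X \<otimes>\<^bsub>Cb\<^esub> c i)"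
      by (rule directed_subunits_tensor_colimit[OF ds u eq _ uc cE X]) (use cH uD in simp_all)
    then show "colimit Cb (carrier P) (\<lambda>i. X \<odot>\<^bsub>Cb\<^esub> Dom Cb (s i))
      {(i, Ident Cb X \<otimes>\<^bsub>Cb\<^esub> f, j) | i f j. (i, f, j) \<in> ?E} (X \<odot>\<^bsub>Cb\<^esub> L) (\<lambda>i. Ident Cb X \<otimes>\<^bsub>Cb\<^esub> c i)"
      by (simp only: uD(2))
  qed
qed


section \<open>Universal joins of all sets of subunits\<close>

text \<open>The intersection is the greatest lower bound in the lattice of subunits, and so is \<open>sub_meet\<close>, as the
  category is stiff.\<close>

lemma S_inf2:
  assumes x: "x \<in> carrier (ISub Cb)" and y: "y \<in> carrier (ISub Cb)" and K: "K (S x \<inter> S y)"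
  shows "x \<sqinter>\<^bsub>ISub Cb\<^esub> y \<in> carrier (ISub Cb)" "S (x \<sqinter>\<^bsub>ISub Cb\<^esub> y) = S x \<inter> S y"
    "S (sub_meet Cb x y) = S x \<inter> S y"
proof -
  have d: "down (S x \<inter> S y) = S x \<inter> S y"
  proof (intro equalityI subsetI)
    fix v assume "v \<in> down (S x \<inter> S y)"
    then have "v \<in> down (S x)" "v \<in> down (S y)" unfolding down_def by blast+
    then show "v \<in> S x \<inter> S y" using S_facts(2)[OF x] S_facts(2)[OF y] by simp
  next
    fix v assume "v \<in> S x \<inter> S y"
    then show "v \<in> down (S x \<inter> S y)" using S_facts(1)[OF x] ISub_refl unfolding down_def by blast
  qed
  obtain u where u: "u \<in> carrier (ISub Cb)" "S u = S x \<inter> S y"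
    using S_exists[OF _ d K] S_facts(1)[OF x] by blast
  interpret po: partial_order "ISub Cb" by (rule cb.ISub_partial_order)
  have "greatest (ISub Cb) u (Lower (ISub Cb) {x, y})"
  proof (rule greatest_LowerI)
    show "u \<sqsubseteq>\<^bsub>ISub Cb\<^esub> z" if "z \<in> {x, y}" for z using that S_le[OF u(1)] u(2) x y by blast
    show "z \<sqsubseteq>\<^bsub>ISub Cb\<^esub> u" if "z \<in> Lower (ISub Cb) {x, y}" for z
    proof -
      have z: "z \<in> carrier (ISub Cb)" "z \<sqsubseteq>\<^bsub>ISub Cb\<^esub> x" "z \<sqsubseteq>\<^bsub>ISub Cb\<^esub> y" using that x y by (auto simp: Lower_def)
      then show ?thesis using S_le[OF z(1) u(1)] S_le[OF z(1) x] S_le[OF z(1) y] u(2) by blast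
    qed
  qed (use x y u in auto)
  then have "x \<sqinter>\<^bsub>ISub Cb\<^esub> y = u"
    unfolding meet_def inf_def using po.greatest_unique by (intro some_equality[of _ u]) blast+
  then show "x \<sqinter>\<^bsub>ISub Cb\<^esub> y \<in> carrier (ISub Cb)" "S (x \<sqinter>\<^bsub>ISub Cb\<^esub> y) = S x \<inter> S y" using u by auto
  interpret st: stiff_category Cb by unfold_locales (rule stiff_Cb)
  note m = st.rep_sub_meet(1-3)[OF x y]
  have "S (sub_meet Cb x y) \<subseteq> S x \<inter> S y" using m S_le[OF m(1) x] S_le[OF m(1) y] by blast
  moreover have "u \<sqsubseteq>\<^bsub>ISub Cb\<^esub> sub_meet Cb x y"
    by (rule st.sub_meet_greatest[OF x y u(1)]) (use S_le[OF u(1) x] S_le[OF u(1) y] u(2) in auto)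
  ultimately show "S (sub_meet Cb x y) = S x \<inter> S y" using S_le[OF u(1) m(1)] u(2) by blast
qed

text \<open>Subunits form the frame of down-closed sets. In the diagram of an idempotent set, an element common to
  the images of \<open>p\<close> and \<open>q\<close> comes from \<open>p \<and> q\<close>, which belongs to the diagram; so every cocone agrees on it.\<close>

theorem all_joins:
  assumes K_all: "\<And>V. V \<subseteq> carrier (ISub C) \<Longrightarrow> K V"
  shows "locale_based Cb"
  unfolding locale_based_def
proof (intro conjI allI impI stiff_Cb)
  interpret po: partial_order "ISub Cb" by (rule cb.ISub_partial_order)
  have KU: "K (\<Union>(S ` A))" if "A \<subseteq> carrier (ISub Cb)" for A
    by (rule K_all) (use that S_facts(1) in blast)
  have KI: "K (S x \<inter> S y)" if "x \<in> carrier (ISub Cb)" for x y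
    by (rule K_all) (use that S_facts(1) in blast)
  show "frame (ISub Cb)"
    unfolding frame_def
  proof (intro conjI ballI allI impI)
    show "complete_lattice (ISub Cb)"
    proof (rule po.complete_latticeI)
      fix A assume A: "A \<subseteq> carrier (ISub Cb)"
      show "\<exists>s. least (ISub Cb) s (Upper (ISub Cb) A)" by (rule least_exists[OF A KU[OF A]]) (rule exI)
      let ?V = "carrier (ISub C) \<inter> \<Inter>(S ` A)"
      have d: "down ?V = ?V"
      proof (intro equalityI subsetI)
        fix v assume v: "v \<in> down ?V"
        have "v \<in> S a" if a: "a \<in> A" for a
        proof -
          have "v \<in> down (S a)" using v a unfolding down_def by blast
          then show ?thesis unfolding S_facts(2)[OF subsetD[OF A a]] .
        qed
        moreover have "v \<in> carrier (ISub C)" using v unfolding down_def by blast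
        ultimately show "v \<in> ?V" by blast
      next
        fix v assume "v \<in> ?V"
        then show "v \<in> down ?V" using ISub_refl unfolding down_def by blast
      qed
      obtain u where u: "u \<in> carrier (ISub Cb)" "S u = ?V"
        by (rule S_exists[OF _ d K_all]) blast+
      have "greatest (ISub Cb) u (Lower (ISub Cb) A)"
      proof (rule greatest_LowerI[OF _ _ A u(1)])
        show "u \<sqsubseteq>\<^bsub>ISub Cb\<^esub> z" if z: "z \<in> A" for z
          unfolding S_le[OF u(1) subsetD[OF A z]] u(2) using z by blast
        show "z \<sqsubseteq>\<^bsub>ISub Cb\<^esub> u" if "z \<in> Lower (ISub Cb) A" for z
        proof -
          have z: "z \<in> carrier (ISub Cb)" "\<And>a. a \<in> A \<Longrightarrow> z \<sqsubseteq>\<^bsub>ISub Cb\<^esub> a" using that A by (auto simp: Lower_def)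
          have "S z \<subseteq> S a" if a: "a \<in> A" for a
            using z(2)[OF a] unfolding S_le[OF z(1) subsetD[OF A a]] .
          then show ?thesis unfolding S_le[OF z(1) u(1)] u(2) using S_facts(1)[OF z(1)] by blast
        qed
      qed
      then show "\<exists>i. greatest (ISub Cb) i (Lower (ISub Cb) A)" by blast
    qed
    fix x A assume x: "x \<in> carrier (ISub Cb)" and A: "A \<subseteq> carrier (ISub Cb)"
    let ?B = "(\<lambda>a. x \<sqinter>\<^bsub>ISub Cb\<^esub> a) ` A"
    have m: "x \<sqinter>\<^bsub>ISub Cb\<^esub> a \<in> carrier (ISub Cb)" "S (x \<sqinter>\<^bsub>ISub Cb\<^esub> a) = S x \<inter> S a" if "a \<in> carrier (ISub Cb)" for a
      using S_inf2(1,2)[OF x that KI[OF x]] by auto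
    have B: "?B \<subseteq> carrier (ISub Cb)" using m(1) A by blast
    note a = S_sup[OF A KU[OF A]] and b = S_sup[OF B KU[OF B]]
    have "S (x \<sqinter>\<^bsub>ISub Cb\<^esub> (\<Squnion>\<^bsub>ISub Cb\<^esub> A)) = S x \<inter> \<Union>(S ` A)" using m(2)[OF a(1)] a(2) by simp
    also have "\<dots> = (\<Union>a \<in> A. S x \<inter> S a)" by blast
    also have "\<dots> = (\<Union>a \<in> A. S (x \<sqinter>\<^bsub>ISub Cb\<^esub> a))" using m(2) A by (intro SUP_cong) auto
    also have "\<dots> = S (\<Squnion>\<^bsub>ISub Cb\<^esub> ?B)" using b(2) by (simp add: image_image)
    finally show "x \<sqinter>\<^bsub>ISub Cb\<^esub> (\<Squnion>\<^bsub>ISub Cb\<^esub> A) = \<Squnion>\<^bsub>ISub Cb\<^esub> ?B"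
      by (rule S_inj[OF m(1)[OF a(1)] b(1)])
  qed
  fix U X assume "U \<subseteq> carrier (ISub Cb) \<and> idempotent_subset Cb U \<and> X \<in> Obj Cb"
  then have U: "U \<subseteq> carrier (ISub Cb)" and id: "idempotent_subset Cb U" and X: "X \<in> Obj Cb" by auto
  let ?j = "\<Squnion>\<^bsub>ISub Cb\<^esub> U"
  note j = S_sup[OF U KU[OF U]]
  note ju = cb.rep_ISub(1)[OF j(1)]
  note ji = act_Cb_inj[OF ju X]
  have le: "S s \<subseteq> S ?j" if "s \<in> U" for s using that j(2) by blast
  let ?c = "\<lambda>s. day_map C (inclusion Cb s ?j) (nat_ident X)"
  have s: "s \<in> carrier (ISub Cb)" if "s \<in> U" for s using that U by blast
  have cH: "?c s \<in> Hom Cb (day C (source (rep s)) X) (day C (source (rep ?j)) X)"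
    and c_act: "nat_comp (act Cb (rep ?j) X) (?c s) = act Cb (rep s) X"
    and c_elt: "\<And>A x. x \<in> at (day C (source (rep s)) X) A \<Longrightarrow> component (act Cb (rep ?j) X) A (component (?c s) A x) = component (act Cb (rep s) X) A x"
    if "s \<in> U" for s
    using tensor_inclusion(1-3)[OF s[OF that] j(1) le[OF that] X] by auto
  have "colimit Cb U (\<lambda>s. day C (source (rep s)) X) (D_arr Cb U X) (day C (source (rep ?j)) X) ?c"
  proof (rule Cb_colimitI[OF day_Cb[OF subunit_Cb_Hom(2)[OF ju] X] cH])
    fix p f q assume "(p, f, q) \<in> D_arr Cb U X"
    then have p: "p \<in> U" and q: "q \<in> U" and f: "f \<in> Hom Cb (day C (source (rep p)) X) (day C (source (rep q)) X)"
      and fa: "nat_comp (act Cb (rep q) X) f = act Cb (rep p) X"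
      by (auto simp: D_arr_def D_obj_def sub_obj_def)
    have "nat_comp (act Cb (rep ?j) X) (nat_comp (?c q) f) = nat_comp (act Cb (rep ?j) X) (?c p)"
      using cb.comp_assoc[OF f cH[OF q] act_Cb_Hom[OF ju X]] c_act[OF q] c_act[OF p] fa by simp
    then show "nat_comp (?c q) f = ?c p"
      using cb.monicD[OF act_Cb_monic[OF ju X], of "nat_comp (?c q) f" "?c p"]
        Hom_CbD(5-7)[OF cb.comp_hom[OF f cH[OF q]]] Hom_CbD(5-7)[OF cH[OF p]] Hom_CbD(5)[OF act_Cb_Hom[OF ju X]] by simp
  next
    fix A z assume z: "z \<in> at (day C (source (rep ?j)) X) A"
    let ?z = "component (act Cb (rep ?j) X) A z"
    have "?z \<in> img (rep ?j) X A" using z by (simp add: img_def)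
    then obtain p where p: "p \<in> U" "?z \<in> img (rep p) X A"
      using img_Union[OF ju cb.rep_ISub(1)[OF s] j(2) X Hom_CbD(4)[OF act_Cb_Hom[OF ju X] z]] by blast
    then obtain w where w: "w \<in> at (day C (source (rep p)) X) A" "?z = component (act Cb (rep p) X) A w" by (auto simp: img_def)
    have "component (?c p) A w = z"
      by (rule inj_onD[OF ji _ Hom_CbD(4)[OF cH[OF p(1)] w(1)] z]) (use c_elt[OF p(1) w(1)] w(2) in simp)
    then show "\<exists>p\<in>U. z \<in> component (?c p) A ` at (day C (source (rep p)) X) A" using p(1) w(1) by blast
  next
    fix M c' p q A a b
    assume cc: "cocone Cb U (\<lambda>s. day C (source (rep s)) X) (D_arr Cb U X) M c'"
      and p: "p \<in> U" and q: "q \<in> U" and a: "a \<in> at (day C (source (rep p)) X) A" and b: "b \<in> at (day C (source (rep q)) X) A"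
      and ab: "component (?c p) A a = component (?c q) A b"
    let ?z = "component (act Cb (rep p) X) A a" and ?k = "sub_meet Cb p q"
    have zq: "?z = component (act Cb (rep q) X) A b" using c_elt[OF p a] c_elt[OF q b] ab by simp
    have k: "?k \<in> U" using id p q unfolding idempotent_subset_def by blast
    have Sk: "S ?k = S p \<inter> S q" by (rule S_inf2(3)[OF s[OF p] s[OF q] KI[OF s[OF p]]])
    have zp: "?z \<in> img (rep p) X A" using a by (simp add: img_def)
    have "?z \<in> img (rep q) X A" unfolding zq using b by (simp add: img_def)
    then have "?z \<in> img (rep ?k) X A"
      by (rule img_Int[OF cb.rep_ISub(1)[OF s[OF k]] cb.rep_ISub(1)[OF s[OF p]] cb.rep_ISub(1)[OF s[OF q]] Sk X zp])
    then obtain w where w: "w \<in> at (day C (source (rep ?k)) X) A" "?z = component (act Cb (rep ?k) X) A w" by (auto simp: img_def)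
    have glue: "component (c' m) A x = component (c' ?k) A w"
      if m: "m \<in> U" and km: "S ?k \<subseteq> S m" and x: "x \<in> at (day C (source (rep m)) X) A" "component (act Cb (rep m) X) A x = ?z" for m x
    proof -
      let ?i = "day_map C (inclusion Cb ?k m) (nat_ident X)"
      note i = tensor_inclusion[OF s[OF k] s[OF m] km X]
      have "(?k, ?i, m) \<in> D_arr Cb U X"
        using k m i(1,2) by (auto simp: D_arr_def D_obj_def sub_obj_def)
      then have "nat_comp (c' m) ?i = c' ?k" using cc unfolding cocone_def by auto
      moreover have "component ?i A w = x"
        by (rule inj_onD[OF act_Cb_inj[OF cb.rep_ISub(1)[OF s[OF m]] X] _ Hom_CbD(4)[OF i(1) w(1)] x(1)])
          (use i(3)[OF w(1)] w(2) x(2) in simp)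
      ultimately show ?thesis using comp_elt[OF i(1) w(1), of "c' m"] by simp
    qed
    have "component (c' p) A a = component (c' ?k) A w" by (rule glue[OF p _ a refl]) (use Sk in blast)
    moreover have "component (c' q) A b = component (c' ?k) A w" by (rule glue[OF q _ b zq[symmetric]]) (use Sk in blast)
    ultimately show "component (c' p) A a = component (c' q) A b" by simp
  qed
  then show "colimit Cb U (D_obj Cb X) (D_arr Cb U X) (sub_obj Cb ?j \<odot>\<^bsub>Cb\<^esub> X) (\<lambda>s. inclusion Cb s ?j \<otimes>\<^bsub>Cb\<^esub> Ident Cb X)"
    unfolding D_obj_def[abs_def] sub_obj_def[abs_def] Cb_sel .
qed

end

section \<open>Finitely bounded and directed sets of subunits\<close>

text \<open>Any finite subset that bounds \<open>U\<close> contains all maximal elements of \<open>U\<close>, and above each of its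
  members lies a maximal one: one with as many members as possible below it.\<close>

lemma finitely_bounded_iff:
  assumes po: "partial_order L" and U: "U \<subseteq> carrier L"
  shows "finitely_bounded L U \<longleftrightarrow> (\<exists>F \<subseteq> U. finite F \<and> (\<forall>u \<in> U. \<exists>m \<in> F. u \<sqsubseteq>\<^bsub>L\<^esub> m))"
proof
  assume "finitely_bounded L U"
  then show "\<exists>F \<subseteq> U. finite F \<and> (\<forall>u \<in> U. \<exists>m \<in> F. u \<sqsubseteq>\<^bsub>L\<^esub> m)"
    unfolding finitely_bounded_def by (intro exI[of _ "maximal_elements L U"]) (auto simp: maximal_elements_def)
next
  interpret partial_order L by (rule po)
  assume "\<exists>F \<subseteq> U. finite F \<and> (\<forall>u \<in> U. \<exists>m \<in> F. u \<sqsubseteq>\<^bsub>L\<^esub> m)"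
  then obtain F where F: "F \<subseteq> U" "finite F" "\<And>u. u \<in> U \<Longrightarrow> \<exists>m \<in> F. u \<sqsubseteq>\<^bsub>L\<^esub> m" by blast
  have FL: "\<And>f. f \<in> F \<Longrightarrow> f \<in> carrier L" and UL: "\<And>u. u \<in> U \<Longrightarrow> u \<in> carrier L" using F(1) U by blast+
  have anti: "x = y" if "x \<sqsubseteq>\<^bsub>L\<^esub> y" "y \<sqsubseteq>\<^bsub>L\<^esub> x" "x \<in> carrier L" "y \<in> carrier L" for x y
    using le_antisym[OF that] by (simp add: eq_is_equal)
  have "m \<in> F" if m: "m \<in> maximal_elements L U" for m
  proof -
    have mU: "m \<in> U" and mm: "\<And>u. u \<in> U \<Longrightarrow> m \<sqsubseteq>\<^bsub>L\<^esub> u \<Longrightarrow> u = m" using m by (auto simp: maximal_elements_def)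
    obtain f where f: "f \<in> F" "m \<sqsubseteq>\<^bsub>L\<^esub> f" using F(3)[OF mU] by blast
    then have "f = m" using mm F(1) by blast
    then show ?thesis using f(1) by simp
  qed
  then have "maximal_elements L U \<subseteq> F" by blast
  then have fin: "finite (maximal_elements L U)" by (rule finite_subset[OF _ F(2)])
  have "\<exists>m \<in> maximal_elements L U. u \<sqsubseteq>\<^bsub>L\<^esub> m" if u: "u \<in> U" for u
  proof -
    define B where "B = {g \<in> F. u \<sqsubseteq>\<^bsub>L\<^esub> g}"
    let ?n = "\<lambda>g. card {h \<in> F. h \<sqsubseteq>\<^bsub>L\<^esub> g}"
    have B: "finite B" "B \<noteq> {}" using F(2) F(3)[OF u] unfolding B_def by auto
    have "Max (?n ` B) \<in> ?n ` B" using B by simp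
    then obtain g where g: "g \<in> B" "?n g = Max (?n ` B)" by auto
    have gmax: "?n h \<le> ?n g" if "h \<in> B" for h using that g(2) B(1) by simp
    have gF: "g \<in> F" "u \<sqsubseteq>\<^bsub>L\<^esub> g" using g(1) by (auto simp: B_def)
    have "v = g" if v: "v \<in> U" "g \<sqsubseteq>\<^bsub>L\<^esub> v" for v
    proof -
      obtain h where h: "h \<in> F" "v \<sqsubseteq>\<^bsub>L\<^esub> h" using F(3)[OF v(1)] by blast
      have gh: "g \<sqsubseteq>\<^bsub>L\<^esub> h" by (rule le_trans[OF v(2) h(2)]) (use gF(1) h(1) v(1) FL UL in auto)
      have "u \<sqsubseteq>\<^bsub>L\<^esub> h" by (rule le_trans[OF gF(2) gh]) (use gF(1) h(1) u FL UL in auto)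
      then have "?n h \<le> ?n g" using gmax h(1) by (simp add: B_def)
      moreover have "{k \<in> F. k \<sqsubseteq>\<^bsub>L\<^esub> g} \<subseteq> {k \<in> F. k \<sqsubseteq>\<^bsub>L\<^esub> h}"
        using le_trans[OF _ gh FL FL[OF gF(1)] FL[OF h(1)]] by auto
      ultimately have "{k \<in> F. k \<sqsubseteq>\<^bsub>L\<^esub> g} = {k \<in> F. k \<sqsubseteq>\<^bsub>L\<^esub> h}" using F(2) by (intro card_seteq) auto
      then have "h \<sqsubseteq>\<^bsub>L\<^esub> g" using h(1) le_refl[OF FL[OF h(1)]] by blast
      then have "v \<sqsubseteq>\<^bsub>L\<^esub> g" by (intro le_trans[OF h(2)]) (use gF(1) h(1) v(1) FL UL in auto)
      then show "v = g" by (rule anti[OF _ v(2)]) (use v(1) gF(1) FL UL in auto)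
    qed
    then have "g \<in> maximal_elements L U" using gF(1) F(1) by (auto simp: maximal_elements_def)
    then show ?thesis using gF(2) by blast
  qed
  then show "finitely_bounded L U" unfolding finitely_bounded_def using fin by blast
qed

context stiff_category
begin

lemma sub_meet_mono:
  assumes "s \<in> carrier (ISub C)" "t \<in> carrier (ISub C)" "s' \<in> carrier (ISub C)" "t' \<in> carrier (ISub C)"
    "s \<sqsubseteq>\<^bsub>ISub C\<^esub> s'" "t \<sqsubseteq>\<^bsub>ISub C\<^esub> t'"
  shows "sub_meet C s t \<sqsubseteq>\<^bsub>ISub C\<^esub> sub_meet C s' t'"
  by (rule sub_meet_greatest[OF assms(3,4) rep_sub_meet(1)[OF assms(1,2)]])
    (use ISub_trans[OF rep_sub_meet(2)[OF assms(1,2)] assms(5,3)] ISub_trans[OF rep_sub_meet(3)[OF assms(1,2)] assms(6,4)] in auto)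

lemma broad_setting_all: "broad_setting C (\<lambda>_. True)"
  by unfold_locales auto

abbreviation (input) fb :: "'a set set \<Rightarrow> bool" where
  "fb \<equiv> finitely_bounded (ISub C)"

lemma fbI:
  "\<lbrakk>U \<subseteq> carrier (ISub C); F \<subseteq> U; finite F; \<And>u. u \<in> U \<Longrightarrow> \<exists>m \<in> F. u \<sqsubseteq>\<^bsub>ISub C\<^esub> m\<rbrakk> \<Longrightarrow> fb U"
  using finitely_bounded_iff[OF ISub_partial_order] by blast

lemma fbE:
  assumes "fb U" "U \<subseteq> carrier (ISub C)"
  obtains F where "F \<subseteq> U" "finite F" "\<And>u. u \<in> U \<Longrightarrow> \<exists>m \<in> F. u \<sqsubseteq>\<^bsub>ISub C\<^esub> m"
  using finitely_bounded_iff[OF ISub_partial_order assms(2)] assms(1) by blast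

lemma broad_setting_fin: "broad_setting C (finitely_bounded (ISub C))"
proof unfold_locales
  show "fb {}" by (rule fbI[of _ "{}"]) auto
  have u: "subobject C (Ident C (Unit C)) \<in> carrier (ISub C)" by (rule subobject_in_ISub[OF unit_subunit])
  show "fb {subobject C (Ident C (Unit C))}"
    by (rule fbI[of _ "{subobject C (Ident C (Unit C))}"]) (use u ISub_refl[OF u] in auto)
next
  fix U V assume c: "U \<subseteq> carrier (ISub C)" "V \<subseteq> carrier (ISub C)" and "fb U" "fb V"
  then obtain F G where F: "F \<subseteq> U" "finite F" "\<And>u. u \<in> U \<Longrightarrow> \<exists>m \<in> F. u \<sqsubseteq>\<^bsub>ISub C\<^esub> m"
    and G: "G \<subseteq> V" "finite G" "\<And>u. u \<in> V \<Longrightarrow> \<exists>m \<in> G. u \<sqsubseteq>\<^bsub>ISub C\<^esub> m" by (metis fbE)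
  have eq: "meets F G = (\<lambda>(s, t). sub_meet C s t) ` (F \<times> G)" by auto
  show "fb (meets U V)"
  proof (rule fbI[of _ "meets F G"])
    show "meets U V \<subseteq> carrier (ISub C)" using rep_sub_meet(1) c by blast
    show "meets F G \<subseteq> meets U V" using F(1) G(1) by blast
    show "finite (meets F G)" unfolding eq using F(2) G(2) by blast
    fix w assume "w \<in> meets U V"
    then obtain s t where w: "w = sub_meet C s t" "s \<in> U" "t \<in> V" by blast
    obtain s' t' where st: "s' \<in> F" "s \<sqsubseteq>\<^bsub>ISub C\<^esub> s'" "t' \<in> G" "t \<sqsubseteq>\<^bsub>ISub C\<^esub> t'" using F(3)[OF w(2)] G(3)[OF w(3)] by blast
    have "w \<sqsubseteq>\<^bsub>ISub C\<^esub> sub_meet C s' t'"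
      unfolding w(1) by (rule sub_meet_mono) (use st w c F(1) G(1) in auto)
    then show "\<exists>m \<in> meets F G. w \<sqsubseteq>\<^bsub>ISub C\<^esub> m" using st by blast
  qed
next
  fix U and g :: "'a set \<Rightarrow> 'a set"
  assume c: "U \<subseteq> carrier (ISub C)" and "fb U" and gc: "g ` U \<subseteq> carrier (ISub C)"
    and mono: "\<And>s t. \<lbrakk>s \<in> U; t \<in> U; s \<sqsubseteq>\<^bsub>ISub C\<^esub> t\<rbrakk> \<Longrightarrow> g s \<sqsubseteq>\<^bsub>ISub C\<^esub> g t"
  then obtain F where F: "F \<subseteq> U" "finite F" "\<And>u. u \<in> U \<Longrightarrow> \<exists>m \<in> F. u \<sqsubseteq>\<^bsub>ISub C\<^esub> m" by (metis fbE)
  show "fb (g ` U)"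
  proof (rule fbI[OF gc, of "g ` F"])
    fix w assume "w \<in> g ` U"
    then obtain u where u: "u \<in> U" "w = g u" by blast
    obtain m where m: "m \<in> F" "u \<sqsubseteq>\<^bsub>ISub C\<^esub> m" using F(3)[OF u(1)] by blast
    have "w \<sqsubseteq>\<^bsub>ISub C\<^esub> g m" unfolding u(2) by (rule mono[OF u(1) subsetD[OF F(1) m(1)] m(2)])
    then show "\<exists>m \<in> g ` F. w \<sqsubseteq>\<^bsub>ISub C\<^esub> m" using m(1) by blast
  qed (use F in auto)
next
  fix V assume c: "V \<subseteq> carrier (ISub C)" and "fb V"
  then obtain F where F: "F \<subseteq> V" "finite F" "\<And>u. u \<in> V \<Longrightarrow> \<exists>m \<in> F. u \<sqsubseteq>\<^bsub>ISub C\<^esub> m" by (metis fbE)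
  show "fb (down V)"
  proof (rule fbI[of _ F])
    show "down V \<subseteq> carrier (ISub C)" unfolding down_def by blast
    show "F \<subseteq> down V" using F(1) c ISub_refl unfolding down_def by blast
    fix v assume "v \<in> down V"
    then obtain w where w: "w \<in> V" "v \<sqsubseteq>\<^bsub>ISub C\<^esub> w" unfolding down_def by blast
    obtain m where m: "m \<in> F" "w \<sqsubseteq>\<^bsub>ISub C\<^esub> m" using F(3)[OF w(1)] by blast
    have "v \<sqsubseteq>\<^bsub>ISub C\<^esub> m" by (rule ISub_trans[OF w(2) m(2)]) (use m(1) F(1) c in blast)
    then show "\<exists>m \<in> F. v \<sqsubseteq>\<^bsub>ISub C\<^esub> m" using m(1) by blast
  qed (rule F(2))
qed

lemma finitely_bounded_Un:
  assumes "V \<subseteq> carrier (ISub C)" "W \<subseteq> carrier (ISub C)" "fb V" "fb W"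
  shows "fb (V \<union> W)"
proof -
  obtain F where F: "F \<subseteq> V" "finite F" "\<And>u. u \<in> V \<Longrightarrow> \<exists>m \<in> F. u \<sqsubseteq>\<^bsub>ISub C\<^esub> m" using fbE[OF assms(3,1)] by metis
  obtain G where G: "G \<subseteq> W" "finite G" "\<And>u. u \<in> W \<Longrightarrow> \<exists>m \<in> G. u \<sqsubseteq>\<^bsub>ISub C\<^esub> m" using fbE[OF assms(4,2)] by metis
  show ?thesis by (rule fbI[of _ "F \<union> G"]) (use assms F G in blast)+
qed

lemma broad_setting_dir: "broad_setting C (directed (ISub C))"
proof unfold_locales
  show "directed (ISub C) {}" by (simp add: directed_def)
  show "directed (ISub C) {subobject C (Ident C (Unit C))}"
    using ISub_refl[OF subobject_in_ISub[OF unit_subunit]] by (simp add: directed_def)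
next
  fix U V assume c: "U \<subseteq> carrier (ISub C)" "V \<subseteq> carrier (ISub C)" and U: "directed (ISub C) U" and V: "directed (ISub C) V"
  show "directed (ISub C) (meets U V)"
    unfolding directed_def
  proof (intro ballI)
    fix a b assume "a \<in> meets U V" "b \<in> meets U V"
    then obtain s t s' t' where st: "a = sub_meet C s t" "s \<in> U" "t \<in> V" "b = sub_meet C s' t'" "s' \<in> U" "t' \<in> V" by blast
    obtain p where p: "p \<in> U" "s \<sqsubseteq>\<^bsub>ISub C\<^esub> p" "s' \<sqsubseteq>\<^bsub>ISub C\<^esub> p" using U st(2,5) unfolding directed_def by blast
    obtain q where q: "q \<in> V" "t \<sqsubseteq>\<^bsub>ISub C\<^esub> q" "t' \<sqsubseteq>\<^bsub>ISub C\<^esub> q" using V st(3,6) unfolding directed_def by blast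
    have "a \<sqsubseteq>\<^bsub>ISub C\<^esub> sub_meet C p q" unfolding st(1) by (rule sub_meet_mono) (use c st p q in auto)
    moreover have "b \<sqsubseteq>\<^bsub>ISub C\<^esub> sub_meet C p q" unfolding st(4) by (rule sub_meet_mono) (use c st p q in auto)
    ultimately show "\<exists>c \<in> meets U V. a \<sqsubseteq>\<^bsub>ISub C\<^esub> c \<and> b \<sqsubseteq>\<^bsub>ISub C\<^esub> c" using p(1) q(1) by blast
  qed
next
  fix U and g :: "'a set \<Rightarrow> 'a set"
  assume U: "directed (ISub C) U" and mono: "\<And>s t. \<lbrakk>s \<in> U; t \<in> U; s \<sqsubseteq>\<^bsub>ISub C\<^esub> t\<rbrakk> \<Longrightarrow> g s \<sqsubseteq>\<^bsub>ISub C\<^esub> g t"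
  show "directed (ISub C) (g ` U)"
    unfolding directed_def
  proof (intro ballI)
    fix a b assume "a \<in> g ` U" "b \<in> g ` U"
    then obtain s t where st: "s \<in> U" "t \<in> U" "a = g s" "b = g t" by blast
    obtain p where p: "p \<in> U" "s \<sqsubseteq>\<^bsub>ISub C\<^esub> p" "t \<sqsubseteq>\<^bsub>ISub C\<^esub> p" using U st(1,2) unfolding directed_def by blast
    then show "\<exists>c \<in> g ` U. a \<sqsubseteq>\<^bsub>ISub C\<^esub> c \<and> b \<sqsubseteq>\<^bsub>ISub C\<^esub> c" using mono st by blast
  qed
next
  fix V assume c: "V \<subseteq> carrier (ISub C)" and V: "directed (ISub C) V"
  show "directed (ISub C) (down V)"
    unfolding directed_def
  proof (intro ballI)
    fix a b assume "a \<in> down V" "b \<in> down V"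
    then obtain s t where st: "s \<in> V" "t \<in> V" "a \<sqsubseteq>\<^bsub>ISub C\<^esub> s" "b \<sqsubseteq>\<^bsub>ISub C\<^esub> t" unfolding down_def by blast
    obtain p where p: "p \<in> V" "s \<sqsubseteq>\<^bsub>ISub C\<^esub> p" "t \<sqsubseteq>\<^bsub>ISub C\<^esub> p" using V st(1,2) unfolding directed_def by blast
    have pc: "p \<in> carrier (ISub C)" using p(1) c by blast
    have "p \<in> down V" using p(1) pc ISub_refl[OF pc] unfolding down_def by blast
    then show "\<exists>c \<in> down V. a \<sqsubseteq>\<^bsub>ISub C\<^esub> c \<and> b \<sqsubseteq>\<^bsub>ISub C\<^esub> c"
      using ISub_trans[OF st(3) p(2) pc] ISub_trans[OF st(4) p(3) pc] by blast
  qed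
qed

lemma directed_Union:
  assumes "\<And>V. V \<in> \<V> \<Longrightarrow> directed (ISub C) V" "\<And>V W. \<lbrakk>V \<in> \<V>; W \<in> \<V>\<rbrakk> \<Longrightarrow> \<exists>Y \<in> \<V>. V \<subseteq> Y \<and> W \<subseteq> Y"
  shows "directed (ISub C) (\<Union>\<V>)"
  unfolding directed_def
proof (intro ballI)
  fix a b assume "a \<in> \<Union>\<V>" "b \<in> \<Union>\<V>"
  then obtain Y where Y: "Y \<in> \<V>" "a \<in> Y" "b \<in> Y" using assms(2) by blast
  then show "\<exists>c \<in> \<Union>\<V>. a \<sqsubseteq>\<^bsub>ISub C\<^esub> c \<and> b \<sqsubseteq>\<^bsub>ISub C\<^esub> c" using assms(1)[OF Y(1)] unfolding directed_def by blast
qed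

end

theorem theorem9p10:
  fixes C :: "('o, 'a) bmcategory"
  assumes "stiff C"
  shows "universal_finite_joins (Psh_fin C) \<and>
         universal_directed_joins TYPE('i) (Psh_dir C) \<and>
         locale_based (Psh_brd C)"
proof (intro conjI)
  have "stiff_category C"
    using assms by (simp add: stiff_category_def stiff_category_axioms_def braided_def stiff_def)
  then interpret stiff_category C .
  show "universal_finite_joins (Psh_fin C)"
    unfolding Psh_fin_def by (rule broad_setting.finite_joins[OF broad_setting_fin finitely_bounded_Un])
  show "universal_directed_joins TYPE('i) (Psh_dir C)"
    unfolding Psh_dir_def by (rule broad_setting.directed_joins[OF broad_setting_dir directed_Union]) blast+
  show "locale_based (Psh_brd C)"
    unfolding Psh_brd_def by (rule broad_setting.all_joins[OF broad_setting_all]) simp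
qed

end
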